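(* Consider the distributed stochastic bilevel problem and the algorithm LoPA-LG (local gradient scheme) described in the context, and suppose that the assumptions on network connectivity, outer-level functions, inner-level functions, bounded heterogeneity and stochastic gradient estimates listed in the context hold. If the step-sizes are properly chosen, namely for a suitable $\tau\in(0,1)$ and suitable positive constants $c_\gamma,c_\lambda,c_\beta$ one takes $\gamma=c_\gamma\alpha$, $\lambda=c_\lambda\alpha$, $\beta=c_\beta\alpha$ (so $\gamma,\lambda,\beta=\mathcal O(\alpha)$) and $$\alpha=\min\Big\{u,\Big(\frac{a_0}{a_1(K+1)}\Big)^{\frac12},\Big(\frac{a_0}{a_2(K+1)}\Big)^{\frac13}\Big\}\le\frac1m$$ for a large value of $K$, where $u,a_0,a_1,a_2$ are defined in the context, then $$\frac1{K+1}\sum_{k=0}^K\mathbb E\big[\|\nabla\Phi(\bar x^k)\|^2\big]=\mathcal O\Big(\frac{\kappa^8}{(1-\rho)K}+\frac{\kappa^{\frac{16}3}(\frac b{\sqrt m})^{\frac23}}{(1-\rho)^{\frac23}K^{\frac23}}+\frac1{\sqrt K}\kappa^{\frac52}\Big(\sigma_{\rm p}+\frac1{\sqrt m}\sigma_{\rm c}\Big)\Big),$$ where $\sigma_{\rm p}=\mathcal O(\kappa^{\frac12}\sigma_{f,\theta}+\kappa^{\frac32}\sigma_{g,\theta\theta}+\kappa^{\frac52}\sigma_{g,\theta})$ and $\sigma_{\rm c}=\mathcal O(\sigma_{f,x}+\kappa\sigma_{g,x\theta})$ are the gradient sampling variances associated with the inner-level and the outer-level variables, respectively. Here $\mathcal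 O$ hides constants and parameters associated with the properties of the functions.
   Context: **Problem.** Let $\mathcal V=\{1,\dots,m\}$. For each $i\in\mathcal V$ let $f_i,g_i:\mathbb R^n\times\mathbb R^p\to\mathbb R$ with $f_i(x,\theta)=\mathbb E_{\varsigma_i\sim\mathcal D_{f_i}}[\hat f_i(x,\theta;\varsigma_i)]$ and $g_i(x,\theta)=\mathbb E_{\xi_i\sim\mathcal D_{g_i}}[\hat g_i(x,\theta;\xi_i)]$. Put $\theta_i^*(x)=\arg\min_{\theta}g_i(x,\theta)$, $\Phi_i(x)=f_i(x,\theta_i^*(x))$ and $\Phi=\frac1m\sum_{i=1}^m\Phi_i$. The problem is $\min_{x}\Phi(x)$. $\nabla_x,\nabla_\theta$ are partial gradients; $\nabla^2_{x\theta}g_i\in\mathbb R^{n\times p}$ and $\nabla^2_{\theta\theta}g_i$ are the Jacobian and Hessian. $\|\cdot\|$ is the Euclidean/spectral norm. **Network connectivity.** The undirected graph $\mathcal G=(\mathcal V,\mathcal E)$ is connected; $W=[w_{ij}]\in\mathbb R^{m\times m}$ satisfies $w_{ij}=w_{ji}>0$ iff $(i,j)\in\mathcal E$ and $w_{ij}=0$ otherwise, and $W$ is doubly stochastic. Consequently $\rho:=\|W-\frac1m1_m1_m^{\rm T}\|^2\in[0,1)$. $\mathcal N_i$ denotes the neighbors of $i$. **Outer-level functions.** With positive constants $L_{f,x},L_{f,\theta},C_{f,\theta}$, each $f_i$ satisfies: (i) $f_i$ is continuously differentiable; (ii) for any $\theta$, $\nabla_xf_i(\cdot,\theta)$ is $L_{f,x}$-Lipschitz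 in $x$, and for any $x$, $\nabla_\theta f_i(x,\cdot)$ is $L_{f,\theta}$-Lipschitz in $\theta$; (iii) $\|\nabla_\theta f_i(x,\theta_i^*(x))\|\le C_{f,\theta}$ for any $x$. **Inner-level functions.** With positive constants $\mu_g,L_{g,\theta},L_{g,x\theta},L_{g,\theta\theta},C_{g,x\theta}$, each $g_i$ satisfies: (i) for any $x$, $g_i(x,\cdot)$ is $\mu_g$-strongly convex, and $g_i$ is twice continuously differentiable; (ii) for any $x$, $\nabla_\theta g_i(x,\cdot)$ is $L_{g,\theta}$-Lipschitz in $\theta$; $\nabla^2_{x\theta}g_i(\cdot,\cdot)$ and $\nabla^2_{\theta\theta}g_i(\cdot,\cdot)$ are $L_{g,x\theta}$- and $L_{g,\theta\theta}$-Lipschitz; (iii) $\|\nabla^2_{x\theta}g_i(x,\theta)\|\le C_{g,x\theta}$ for all $x,\theta$. **Bounded heterogeneity.** With $\nabla_xf=\frac1m\sum_j\nabla_xf_j$, $\nabla_\theta f=\frac1m\sum_j\nabla_\theta f_j$, there are positive constants $b_f^2,b_g^2$ such that (i) $\sum_i\|\nabla_xf_i(x,\theta)-\nabla_xf(x,\theta)\|^2\le b_f^2$ and $\sum_i\|\nabla_\theta f_i(x,\theta)-\nabla_\theta f(x,\theta)\|^2\le b_f^2$ for all $x,\theta$; (ii) $\frac1m\sum_{i,j}\|\nabla_\theta g_i(x,\theta_j^*(x))-\nabla_\theta g_j(x,\theta_j^*(x))\|^2\le b_g^2$ for all $x$; (iii) $\frac1m\sum_{i,j}\|\nabla^2_{x\theta}g_i(x,\theta_j^*(x))-\nabla^2_{x\theta}g_j(x,\theta_j^*(x))\|^2\le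 b_g^2$ and $\frac1m\sum_{i,j}\|\nabla^2_{\theta\theta}g_i(x,\theta_j^*(x))-\nabla^2_{\theta\theta}g_j(x,\theta_j^*(x))\|^2\le b_g^2$ for all $x$. Set $$b^2=4\Big(1+\tfrac{C_{g,x\theta}^2}{\mu_g^2}\Big)b_f^2+4\Big(\tfrac{4C_{f,\theta}^2C_{g,x\theta}^2}{\mu_g^4}+\tfrac{4C_{f,\theta}^2}{\mu_g^2}+\tfrac{L_{f,x}^2}{\mu_g^2}+\tfrac{L_{f,\theta}^2C_{g,x\theta}^2}{\mu_g^4}+\tfrac{4C_{f,\theta}^2C_{g,x\theta}^2L_{g,\theta\theta}^2}{\mu_g^6}+\tfrac{4C_{f,\theta}^2L_{g,x\theta}^2}{\mu_g^4}\Big)b_g^2.$$ **Stochastic gradient estimates.** The random variables $\xi_{i,1}^k,\xi_{i,2}^k,\xi_{i,3}^k,\varsigma_{i,1}^k,\varsigma_{i,2}^k$ are mutually independent for any $k$ and independent across iterations. For all $x,\theta,k$: the estimators $\nabla_\theta\hat g_i(x,\theta;\xi_{i,1}^k)$, $\nabla^2_{\theta\theta}\hat g_i(x,\theta;\xi_{i,2}^k)$, $\nabla^2_{x\theta}\hat g_i(x,\theta;\xi_{i,3}^k)$, $\nabla_\theta\hat f_i(x,\theta;\varsigma_{i,1}^k)$, $\nabla_x\hat f_i(x,\theta;\varsigma_{i,2}^k)$ are unbiased for $\nabla_\theta g_i,\nabla^2_{\theta\theta}g_i,\nabla^2_{x\theta}g_i,\nabla_\theta f_i,\nabla_xf_i$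 at $(x,\theta)$, with variances (expected squared norm of the deviation) at most $\sigma_{g,\theta}^2,\sigma_{g,\theta\theta}^2,\sigma_{g,x\theta}^2,\sigma_{f,\theta}^2,\sigma_{f,x}^2$ respectively. **Algorithm LoPA.** Each node $i$ iterates, for $k\ge0$, with $d_i^k=\nabla_\theta\hat g_i(x_i^k,\theta_i^k;\xi_{i,1}^k)$, $h_i^k=\nabla^2_{\theta\theta}\hat g_i(x_i^k,\theta_i^k;\xi_{i,2}^k)v_i^k-\nabla_\theta\hat f_i(x_i^k,\theta_i^k;\varsigma_{i,1}^k)$, $s_i^k=\nabla_x\hat f_i(x_i^k,\theta_i^k;\varsigma_{i,2}^k)-\nabla^2_{x\theta}\hat g_i(x_i^k,\theta_i^k;\xi_{i,3}^k)v_i^k$: $$\theta_i^{k+1}=\theta_i^k-\beta d_i^k,\quad v_i^{k+1}=v_i^k-\lambda h_i^k,\quad x_i^{k+1}=(1-\tau)x_i^k+\tau\Big(\sum_{j\in\mathcal N_i}w_{ij}x_j^k-\alpha y_i^k\Big),\quad z_i^{k+1}=s_i^k+(1-\gamma)(z_i^k-s_i^k).$$ (The sum represents the $i$-th block of $(W\otimes I_n)x^k$.) LoPA-LG uses $y_i^{k+1}=z_i^{k+1}$. Initialization: $y_i^0=z_i^0$. **Notation.** $x^k=\mathrm{col}\{x_i^k\}_{i=1}^m$, $\bar x^k=\frac1m\sum_ix_i^k$, similarly for other variables. $v_i^*(x)=[\nabla^2_{\theta\theta}g_i(x,\theta_i^*(x))]^{-1}\nabla_\theta f_i(x,\theta_i^*(x))$;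 $\theta^*(\bar x)=\mathrm{col}\{\theta_i^*(\bar x)\}$, $v^*(\bar x)=\mathrm{col}\{v_i^*(\bar x)\}$, $\nabla\tilde\Phi(\bar x)=\mathrm{col}\{\nabla\Phi_i(\bar x)\}$. **Constants.** $\kappa=\max\{L_{f,x},L_{f,\theta},L_{g,\theta},L_{g,x\theta},L_{g,\theta\theta}\}/\mu_g$ is the condition number. $M=C_{f,\theta}/\mu_g$, $L_{fg,x}=2L_{f,x}^2+4M^2L_{g,x\theta}^2$, $L_{fg,\theta}=2L_{f,\theta}^2+4M^2L_{g,\theta\theta}^2$, $\omega_\theta=\frac{\mu_gL_{g,\theta}}{2(\mu_g+L_{g,\theta})}$, $P=L_{fg,x}+\frac{32C_{g,x\theta}^2L_{fg,\theta}}{\mu_g^2}$, $\varphi=P(1+\frac{4L_{g,\theta}^2}{\omega_\theta^2})$, $L_{\theta^*}=\frac{C_{g,x\theta}}{\mu_g}$, $L_v=\frac{L_{f,\theta}}{\mu_g}+\frac{C_{f,\theta}L_{g,\theta\theta}}{\mu_g^2}$, $L_{v^*}=L_v(1+L_{\theta^*})$, $L=\big(L_{f,x}+C_{g,x\theta}L_v+\frac{C_{f,\theta}L_{g,x\theta}}{\mu_g}\big)(1+L_{\theta^*})$. $u=\min\{u_1,u_2,u_3\}$ with $u_1=\frac1{2\tau L}$, $$u_2=\min\Big\{\tfrac{1-\rho}{12\varphi^{1/2}},\tfrac{(1-\rho)^{2/3}}{4\varphi^{1/3}},\tfrac{P^{1/3}(1-\rho)^{2/3}}{4\varphi^{1/3}},\tfrac{(1-\rho)^{1/2}}{3L_{fg,x}^{1/4}},\tfrac{C_{g,x\theta}^{2/3}(1-\rho)^{2/3}}{4\varphi^{1/3}\sigma_{g,x\theta}^{2/3}}\Big\},$$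 $$u_3=\min\Big\{\tfrac{\min\{1,\mu_g^2/(8\sigma_{g,x\theta}^2)\}}{96\tau L_{v^*}C_{g,x\theta}},\ \tfrac{\min\{\frac2{\mu_g+L_{g,\theta}},\frac{\mu_g+L_{g,\theta}}{2\mu_gL_{g,\theta}}\}\,\omega_\theta}{12\tau P^{1/2}L_{\theta^*}},\ \tfrac{\min\{1,2C_{g,x\theta}^2/\sigma_{g,x\theta}^2\}}{8L\tau}\Big\}.$$ With $\gamma=c_\gamma\alpha,\lambda=c_\lambda\alpha,\beta=c_\beta\alpha$ ($c_\gamma,c_\lambda,c_\beta>0$ independent of $K$ and $1-\rho$): $d_0=1$, $d_1=\frac{8C_{g,x\theta}^2\tau}{\mu_gc_\lambda}$, $d_2=\frac{P\tau}{\omega_\theta c_\beta}$, $d_3=\frac\tau{2c_\gamma}$, $\hat d_4=\frac{24\varphi\tau}{(1-\rho)^2c_\gamma}u^3$, $\hat d_5=\frac{2\varphi}{1-\rho}u$, $\vartheta=\frac{24\varphi}{(1-\rho)^2c_\gamma}$, $$\sigma_{\rm p}=\sqrt{d_1/\tau}\,(\sigma_{f,\theta}+2M\sigma_{g,\theta\theta})c_\lambda+\sqrt{d_2/\tau}\,\sigma_{g,\theta}c_\beta,\quad \sigma_{\rm c}=\sqrt{d_3/\tau}\,(\sigma_{f,x}+2M\sigma_{g,x\theta})c_\gamma,\quad \hat\sigma_{LG}=\sqrt2\,\sigma_{\rm p}+\tfrac{\sqrt2}{\sqrt m}\sigma_{\rm c},$$ $$\hat V^0=\tfrac{d_0}\tau\Phi(\bar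 x^0)+\tfrac{d_1}{\tau m}\|v^0-v^*(\bar x^0)\|^2+\tfrac{d_2}{\tau m}\|\theta^0-\theta^*(\bar x^0)\|^2+\tfrac{d_3}\tau\|\nabla\Phi(\bar x^0)-\bar z^0\|^2+\tfrac{\hat d_4}{\tau m}\|\nabla\tilde\Phi(\bar x^0)-z^0\|^2+\tfrac{\hat d_5}{\tau m}\|x^0-1_m\otimes\bar x^0\|^2,$$ $a_0=4\hat V^0$, $a_1=4\hat\sigma_{LG}^2$, $a_2=\frac{4\vartheta}mb^2$.
   Formalization: Two assumptions are added, as the claim fails without them: ∇_x f_i is also Lipschitz in θ and ∇_θ f_i in x, and Φ is normalized to be nonnegative. "Large K" means K beyond a threshold depending on m, ρ, μ_g, noise; the hidden constant may depend on the size of the initial data. *)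

theory Defs
  imports "HOL-Probability.Probability"
begin

text \<open>Matrices are bounded linear maps, so that \<open>norm\<close> on them is the spectral norm.\<close>

definition grad :: "('a::real_inner \<Rightarrow> real) \<Rightarrow> 'a \<Rightarrow> 'a" where
  "grad F x = (THE D. GDERIV F x :> D)"

definition jac :: "('a::real_normed_vector \<Rightarrow> 'b::real_normed_vector) \<Rightarrow> 'a \<Rightarrow> 'a \<Rightarrow>\<^sub>L 'b" where
  "jac F x = (THE D. (F has_derivative blinfun_apply D) (at x))"

definition grad_x :: "('x::real_inner \<Rightarrow> 'y \<Rightarrow> real) \<Rightarrow> 'x \<Rightarrow> 'y \<Rightarrow> 'x" where
  "grad_x F x \<theta> = grad (\<lambda>x'. F x' \<theta>) x"

definition grad_t :: "('x \<Rightarrow> 'y::real_inner \<Rightarrow> real) \<Rightarrow> 'x \<Rightarrow> 'y \<Rightarrow> 'y" where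
  "grad_t F x \<theta> = grad (\<lambda>\<theta>'. F x \<theta>') \<theta>"

text \<open>For \<open>x \<in> \<real>\<^sup>n\<close>, \<open>\<theta> \<in> \<real>\<^sup>p\<close> the mixed derivative is an \<open>n \<times> p\<close> matrix: the Jacobian in \<open>\<theta>\<close> of
  the partial gradient in \<open>x\<close>.\<close>

definition hess_xt :: "('x::real_inner \<Rightarrow> 'y::real_normed_vector \<Rightarrow> real) \<Rightarrow> 'x \<Rightarrow> 'y \<Rightarrow> 'y \<Rightarrow>\<^sub>L 'x" where
  "hess_xt F x \<theta> = jac (\<lambda>\<theta>'. grad_x F x \<theta>') \<theta>"

definition hess_tt :: "('x \<Rightarrow> 'y::real_inner \<Rightarrow> real) \<Rightarrow> 'x \<Rightarrow> 'y \<Rightarrow> 'y \<Rightarrow>\<^sub>L 'y" where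
  "hess_tt F x \<theta> = jac (\<lambda>\<theta>'. grad_t F x \<theta>') \<theta>"

definition C1 :: "('a::real_normed_vector \<Rightarrow> 'b::real_normed_vector) \<Rightarrow> bool" where
  "C1 F \<longleftrightarrow> (\<exists>F' :: 'a \<Rightarrow> 'a \<Rightarrow>\<^sub>L 'b.
     (\<forall>z. (F has_derivative blinfun_apply (F' z)) (at z)) \<and> continuous_on UNIV F')"

definition C2 :: "('a::real_normed_vector \<Rightarrow> real) \<Rightarrow> bool" where
  "C2 F \<longleftrightarrow> (\<exists>F' :: 'a \<Rightarrow> 'a \<Rightarrow>\<^sub>L real.
     (\<forall>z. (F has_derivative blinfun_apply (F' z)) (at z)) \<and> C1 F')"

definition strongly_convex :: "real \<Rightarrow> ('a::real_normed_vector \<Rightarrow> real) \<Rightarrow> bool" where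
  "strongly_convex \<mu> h \<longleftrightarrow> convex_on UNIV (\<lambda>\<theta>. h \<theta> - \<mu> / 2 * (norm \<theta>)\<^sup>2)"

text \<open>Needed for Bochner integrals of matrix-valued estimators.\<close>

instance blinfun :: (euclidean_space, euclidean_space) second_countable_topology
proof
  have "\<exists>F. finite F \<and> cball (0 :: 'a \<Rightarrow>\<^sub>L 'b) (real n) \<subseteq> (\<Union>x\<in>F. ball x (1 / real (Suc n)))" for n
  proof -
    have "compact (cball (0 :: 'a \<Rightarrow>\<^sub>L 'b) (real n))"
      by simp
    then show ?thesis
      unfolding compact_eq_totally_bounded by (metis of_nat_0_less_iff zero_less_Suc zero_less_divide_1_iff)
  qed
  then obtain F where F: "\<And>n. finite (F n)"
    "\<And>n. cball (0 :: 'a \<Rightarrow>\<^sub>L 'b) (real n) \<subseteq> (\<Union>x\<in>F n. ball x (1 / real (Suc n)))"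
    by metis
  define D where "D = (\<Union>n. F n)"
  define B where "B = (\<lambda>(x, k). ball x (1 / real (Suc k))) ` (D \<times> (UNIV :: nat set))"
  have "countable D"
    unfolding D_def using F(1) by (simp add: countable_finite)
  then have "countable B"
    unfolding B_def by simp
  moreover have "topological_basis B"
  proof (rule topological_basisI)
    show "open B'" if "B' \<in> B" for B'
      using that unfolding B_def by auto
  next
    fix U and z :: "'a \<Rightarrow>\<^sub>L 'b"
    assume "open U" "z \<in> U"
    then obtain e where e: "e > 0" "ball z e \<subseteq> U"
      by (meson open_contains_ball)
    obtain k where k: "1 / real (Suc k) < e / 2"
      using e(1) by (metis half_gt_zero nat_approx_posE)
    obtain N :: nat where N: "norm z \<le> real N"
      using real_arch_simple by blast
    define n where "n = max N k"
    have "z \<in> cball 0 (real n)"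
      using N by (simp add: n_def)
    then obtain x where x: "x \<in> F n" "dist x z < 1 / real (Suc n)"
      using F(2)[of n] by (meson UN_iff mem_ball subsetD)
    have "1 / real (Suc n) \<le> 1 / real (Suc k)"
      by (simp add: n_def frac_le)
    with x have xz: "dist x z < 1 / real (Suc k)"
      by linarith
    have "ball x (1 / real (Suc k)) \<subseteq> ball z e"
    proof
      fix w assume "w \<in> ball x (1 / real (Suc k))"
      then have "dist x w < 1 / real (Suc k)" by simp
      moreover have "dist z w \<le> dist x z + dist x w"
        by (metis dist_commute dist_triangle)
      ultimately show "w \<in> ball z e"
        using xz k by simp
    qed
    moreover have "ball x (1 / real (Suc k)) \<in> B"
      unfolding B_def D_def using x(1) by auto
    ultimately show "\<exists>B'\<in>B. z \<in> B' \<and> B' \<subseteq> U"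
      using e(2) xz by (metis mem_ball subset_trans)
  qed
  ultimately show "\<exists>B :: ('a \<Rightarrow>\<^sub>L 'b) set set. countable B \<and> open = generate_topology B"
    using topological_basis_imp_subbasis by blast
qed

record ('x, 'y, 's) bilevel =
  nodes :: nat
  fhat :: "nat \<Rightarrow> 'x \<Rightarrow> 'y \<Rightarrow> 's \<Rightarrow> real"
  ghat :: "nat \<Rightarrow> 'x \<Rightarrow> 'y \<Rightarrow> 's \<Rightarrow> real"
  law_f :: "nat \<Rightarrow> 's measure"
  law_g :: "nat \<Rightarrow> 's measure"

abbreviation V :: "('x, 'y, 's) bilevel \<Rightarrow> nat set" where
  "V P \<equiv> {1..nodes P}"

definition node_avg :: "nat \<Rightarrow> (nat \<Rightarrow> 'a::real_vector) \<Rightarrow> 'a" where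
  "node_avg m h = (1 / real m) *\<^sub>R (\<Sum>i=1..m. h i)"

definition f :: "('x, 'y, 's) bilevel \<Rightarrow> nat \<Rightarrow> 'x \<Rightarrow> 'y \<Rightarrow> real" where
  "f P i x \<theta> = (\<integral>s. fhat P i x \<theta> s \<partial>law_f P i)"

definition g :: "('x, 'y, 's) bilevel \<Rightarrow> nat \<Rightarrow> 'x \<Rightarrow> 'y \<Rightarrow> real" where
  "g P i x \<theta> = (\<integral>s. ghat P i x \<theta> s \<partial>law_g P i)"

definition theta_star :: "('x, 'y, 's) bilevel \<Rightarrow> nat \<Rightarrow> 'x \<Rightarrow> 'y" where
  "theta_star P i x = arg_min (g P i x) (\<lambda>_. True)"

definition v_star :: "('x, 'y::real_inner, 's) bilevel \<Rightarrow> nat \<Rightarrow> 'x \<Rightarrow> 'y" where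
  "v_star P i x = inv (blinfun_apply (hess_tt (g P i) x (theta_star P i x)))
                    (grad_t (f P i) x (theta_star P i x))"

definition Phi_i :: "('x, 'y, 's) bilevel \<Rightarrow> nat \<Rightarrow> 'x \<Rightarrow> real" where
  "Phi_i P i x = f P i x (theta_star P i x)"

definition Phi :: "('x, 'y, 's) bilevel \<Rightarrow> 'x \<Rightarrow> real" where
  "Phi P x = node_avg (nodes P) (\<lambda>i. Phi_i P i x)"

definition well_formed :: "('x, 'y, 's) bilevel \<Rightarrow> bool" where
  "well_formed P \<longleftrightarrow> nodes P \<ge> 1 \<and>
     (\<forall>i\<in>V P. prob_space (law_f P i) \<and> prob_space (law_g P i) \<and>
        (\<forall>x \<theta>. integrable (law_f P i) (fhat P i x \<theta>) \<and> integrable (law_g P i) (ghat P i x \<theta>)))"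

definition spectral_norm :: "nat \<Rightarrow> (nat \<Rightarrow> nat \<Rightarrow> real) \<Rightarrow> real" where
  "spectral_norm m A =
     (SUP u \<in> {u. L2_set u {1..m} \<le> 1}. L2_set (\<lambda>i. \<Sum>j=1..m. A i j * u j) {1..m})"

definition rho :: "nat \<Rightarrow> (nat \<Rightarrow> nat \<Rightarrow> real) \<Rightarrow> real" where
  "rho m W = (spectral_norm m (\<lambda>i j. W i j - 1 / real m))\<^sup>2"

text \<open>A self-loop \<open>(i, i)\<close> belongs to the edge set exactly when \<open>W i i > 0\<close>, so that the sum over
  the neighbours of \<open>i\<close> is the \<open>i\<close>-th block of \<open>(W \<otimes> I) x\<close>.\<close>

definition network :: "nat \<Rightarrow> (nat \<times> nat) set \<Rightarrow> (nat \<Rightarrow> nat \<Rightarrow> real) \<Rightarrow> bool" where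
  "network m E W \<longleftrightarrow>
     E \<subseteq> {1..m} \<times> {1..m} \<and> sym E \<and> (\<forall>i\<in>{1..m}. \<forall>j\<in>{1..m}. (i, j) \<in> E\<^sup>*) \<and>
     (\<forall>i\<in>{1..m}. \<forall>j\<in>{1..m}. W i j = W j i \<and> (W i j > 0 \<longleftrightarrow> (i, j) \<in> E) \<and>
        ((i, j) \<notin> E \<longrightarrow> W i j = 0)) \<and>
     (\<forall>i\<in>{1..m}. (\<Sum>j=1..m. W i j) = 1) \<and> (\<forall>j\<in>{1..m}. (\<Sum>i=1..m. W i j) = 1)"

record fun_consts =
  L_fx :: real
  L_ft :: real
  C_ft :: real
  L_gt :: real
  L_gxt :: real
  L_gtt :: real
  C_gxt :: real

definition positive_consts :: "fun_consts \<Rightarrow> bool" where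
  "positive_consts c \<longleftrightarrow> L_fx c > 0 \<and> L_ft c > 0 \<and> C_ft c > 0 \<and> L_gt c > 0 \<and> L_gxt c > 0 \<and>
     L_gtt c > 0 \<and> C_gxt c > 0"

definition outer_assumption ::
  "('x::euclidean_space, 'y::euclidean_space, 's) bilevel \<Rightarrow> fun_consts \<Rightarrow> bool" where
  "outer_assumption P c \<longleftrightarrow> (\<forall>i\<in>V P.
     C1 (\<lambda>(x, \<theta>). f P i x \<theta>) \<and>
     (\<forall>\<theta>. (L_fx c)-lipschitz_on UNIV (\<lambda>x. grad_x (f P i) x \<theta>)) \<and>
     (\<forall>x. (L_ft c)-lipschitz_on UNIV (\<lambda>\<theta>. grad_t (f P i) x \<theta>)) \<and>
     (\<forall>x. norm (grad_t (f P i) x (theta_star P i x)) \<le> C_ft c))"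

text \<open>Lipschitz continuity of the outer partial gradients in the respective other block. Without it
  \<open>Phi\<close> need not have a Lipschitz gradient: the cross term of \<open>x * \<theta> * ln (1 / (x\<^sup>2 + \<theta>\<^sup>2))\<close> is
  unbounded near the origin although both diagonal blocks are bounded.\<close>

definition cross_lipschitz ::
  "('x::euclidean_space, 'y::euclidean_space, 's) bilevel \<Rightarrow> real \<Rightarrow> bool" where
  "cross_lipschitz P Lc \<longleftrightarrow> (\<forall>i\<in>V P.
     (\<forall>x. Lc-lipschitz_on UNIV (\<lambda>\<theta>. grad_x (f P i) x \<theta>)) \<and>
     (\<forall>\<theta>. Lc-lipschitz_on UNIV (\<lambda>x. grad_t (f P i) x \<theta>)))"

definition inner_assumption ::
  "('x::euclidean_space, 'y::euclidean_space, 's) bilevel \<Rightarrow> fun_consts \<Rightarrow> real \<Rightarrow> bool" where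
  "inner_assumption P c \<mu> \<longleftrightarrow> (\<forall>i\<in>V P.
     (\<forall>x. strongly_convex \<mu> (g P i x)) \<and> C2 (\<lambda>(x, \<theta>). g P i x \<theta>) \<and>
     (\<forall>x. (L_gt c)-lipschitz_on UNIV (\<lambda>\<theta>. grad_t (g P i) x \<theta>)) \<and>
     (L_gxt c)-lipschitz_on UNIV (\<lambda>(x, \<theta>). hess_xt (g P i) x \<theta>) \<and>
     (L_gtt c)-lipschitz_on UNIV (\<lambda>(x, \<theta>). hess_tt (g P i) x \<theta>) \<and>
     (\<forall>x \<theta>. norm (hess_xt (g P i) x \<theta>) \<le> C_gxt c))"

definition heterogeneity ::
  "('x::euclidean_space, 'y::euclidean_space, 's) bilevel \<Rightarrow> real \<Rightarrow> real \<Rightarrow> bool" where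
  "heterogeneity P bf bg \<longleftrightarrow>
     (\<forall>x \<theta>. (\<Sum>i\<in>V P. (norm (grad_x (f P i) x \<theta> -
                node_avg (nodes P) (\<lambda>j. grad_x (f P j) x \<theta>)))\<^sup>2) \<le> bf\<^sup>2 \<and>
            (\<Sum>i\<in>V P. (norm (grad_t (f P i) x \<theta> -
                node_avg (nodes P) (\<lambda>j. grad_t (f P j) x \<theta>)))\<^sup>2) \<le> bf\<^sup>2) \<and>
     (\<forall>x. 1 / real (nodes P) * (\<Sum>i\<in>V P. \<Sum>j\<in>V P.
            (norm (grad_t (g P i) x (theta_star P j x) - grad_t (g P j) x (theta_star P j x)))\<^sup>2)
          \<le> bg\<^sup>2 \<and>
          1 / real (nodes P) * (\<Sum>i\<in>V P. \<Sum>j\<in>V P.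
            (norm (hess_xt (g P i) x (theta_star P j x) - hess_xt (g P j) x (theta_star P j x)))\<^sup>2)
          \<le> bg\<^sup>2 \<and>
          1 / real (nodes P) * (\<Sum>i\<in>V P. \<Sum>j\<in>V P.
            (norm (hess_tt (g P i) x (theta_star P j x) - hess_tt (g P j) x (theta_star P j x)))\<^sup>2)
          \<le> bg\<^sup>2)"

record noise =
  s_fx :: real
  s_ft :: real
  s_gt :: real
  s_gtt :: real
  s_gxt :: real

text \<open>\<open>s_gxt\<close> is a divisor in the step-size bound below. It only bounds a standard deviation from
  above, so it can always be taken positive.\<close>

definition noise_levels :: "noise \<Rightarrow> bool" where
  "noise_levels n \<longleftrightarrow> s_fx n \<ge> 0 \<and> s_ft n \<ge> 0 \<and> s_gt n \<ge> 0 \<and> s_gtt n \<ge> 0 \<and> s_gxt n > 0"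

datatype draw = Xi1 | Xi2 | Xi3 | Sig1 | Sig2

definition law :: "('x, 'y, 's) bilevel \<Rightarrow> nat \<Rightarrow> draw \<Rightarrow> 's measure" where
  "law P i d = (if d = Sig1 \<or> d = Sig2 then law_f P i else law_g P i)"

definition estimator ::
  "'w measure \<Rightarrow> ('w \<Rightarrow> 'a::{banach, second_countable_topology}) \<Rightarrow> 'a \<Rightarrow> real \<Rightarrow> bool" where
  "estimator M X a \<sigma> \<longleftrightarrow> integrable M X \<and> (\<integral>\<omega>. X \<omega> \<partial>M) = a \<and>
     (\<integral>\<^sup>+\<omega>. ennreal ((norm (X \<omega> - a))\<^sup>2) \<partial>M) \<le> ennreal (\<sigma>\<^sup>2)"

abbreviation fsample :: "('x, 'y, 's) bilevel \<Rightarrow> nat \<Rightarrow> 's \<Rightarrow> 'x \<Rightarrow> 'y \<Rightarrow> real" where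
  "fsample P i s \<equiv> (\<lambda>x \<theta>. fhat P i x \<theta> s)"

abbreviation gsample :: "('x, 'y, 's) bilevel \<Rightarrow> nat \<Rightarrow> 's \<Rightarrow> 'x \<Rightarrow> 'y \<Rightarrow> real" where
  "gsample P i s \<equiv> (\<lambda>x \<theta>. ghat P i x \<theta> s)"

definition measurable_estimators ::
  "('x::euclidean_space, 'y::euclidean_space, 's) bilevel \<Rightarrow> bool" where
  "measurable_estimators P \<longleftrightarrow> (\<forall>i\<in>V P.
     (\<lambda>(x, \<theta>, s). grad_t (gsample P i s) x \<theta>) \<in> borel_measurable (borel \<Otimes>\<^sub>M borel \<Otimes>\<^sub>M law_g P i) \<and>
     (\<lambda>(x, \<theta>, s). hess_tt (gsample P i s) x \<theta>) \<in> borel_measurable (borel \<Otimes>\<^sub>M borel \<Otimes>\<^sub>M law_g P i) \<and>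
     (\<lambda>(x, \<theta>, s). hess_xt (gsample P i s) x \<theta>) \<in> borel_measurable (borel \<Otimes>\<^sub>M borel \<Otimes>\<^sub>M law_g P i) \<and>
     (\<lambda>(x, \<theta>, s). grad_t (fsample P i s) x \<theta>) \<in> borel_measurable (borel \<Otimes>\<^sub>M borel \<Otimes>\<^sub>M law_f P i) \<and>
     (\<lambda>(x, \<theta>, s). grad_x (fsample P i s) x \<theta>) \<in> borel_measurable (borel \<Otimes>\<^sub>M borel \<Otimes>\<^sub>M law_f P i))"

text \<open>\<open>\<zeta> i d k\<close> is the sample of kind \<open>d\<close> drawn by node \<open>i\<close> at iteration \<open>k\<close>.\<close>

definition sampling ::
  "('x::euclidean_space, 'y::euclidean_space, 's) bilevel \<Rightarrow> noise \<Rightarrow> 'w measure \<Rightarrow>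
     (nat \<Rightarrow> draw \<Rightarrow> nat \<Rightarrow> 'w \<Rightarrow> 's) \<Rightarrow> bool" where
  "sampling P n M \<zeta> \<longleftrightarrow> prob_space M \<and> measurable_estimators P \<and>
     prob_space.indep_vars M (\<lambda>(i, d, k). law P i d) (\<lambda>(i, d, k). \<zeta> i d k)
       (V P \<times> UNIV \<times> UNIV) \<and>
     (\<forall>i\<in>V P. \<forall>k. (\<forall>d. distr M (law P i d) (\<zeta> i d k) = law P i d) \<and>
       (\<forall>x \<theta>.
         estimator M (\<lambda>\<omega>. grad_t (gsample P i (\<zeta> i Xi1 k \<omega>)) x \<theta>) (grad_t (g P i) x \<theta>) (s_gt n) \<and>
         estimator M (\<lambda>\<omega>. hess_tt (gsample P i (\<zeta> i Xi2 k \<omega>)) x \<theta>) (hess_tt (g P i) x \<theta>) (s_gtt n) \<and>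
         estimator M (\<lambda>\<omega>. hess_xt (gsample P i (\<zeta> i Xi3 k \<omega>)) x \<theta>) (hess_xt (g P i) x \<theta>) (s_gxt n) \<and>
         estimator M (\<lambda>\<omega>. grad_t (fsample P i (\<zeta> i Sig1 k \<omega>)) x \<theta>) (grad_t (f P i) x \<theta>) (s_ft n) \<and>
         estimator M (\<lambda>\<omega>. grad_x (fsample P i (\<zeta> i Sig2 k \<omega>)) x \<theta>) (grad_x (f P i) x \<theta>) (s_fx n)))"

record steps =
  tau :: real
  c_gamma :: real
  c_lambda :: real
  c_beta :: real

definition lopa_lg ::
  "('x::euclidean_space, 'y::euclidean_space, 's) bilevel \<Rightarrow> (nat \<times> nat) set \<Rightarrow>
     (nat \<Rightarrow> nat \<Rightarrow> real) \<Rightarrow> 'w measure \<Rightarrow> (nat \<Rightarrow> draw \<Rightarrow> nat \<Rightarrow> 'w \<Rightarrow> 's) \<Rightarrow> steps \<Rightarrow> real \<Rightarrow>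
     (nat \<Rightarrow> 'x) \<Rightarrow> (nat \<Rightarrow> 'y) \<Rightarrow> (nat \<Rightarrow> 'y) \<Rightarrow> (nat \<Rightarrow> 'x) \<Rightarrow>
     (nat \<Rightarrow> nat \<Rightarrow> 'w \<Rightarrow> 'x) \<Rightarrow> (nat \<Rightarrow> nat \<Rightarrow> 'w \<Rightarrow> 'y) \<Rightarrow> (nat \<Rightarrow> nat \<Rightarrow> 'w \<Rightarrow> 'y) \<Rightarrow>
     (nat \<Rightarrow> nat \<Rightarrow> 'w \<Rightarrow> 'x) \<Rightarrow> (nat \<Rightarrow> nat \<Rightarrow> 'w \<Rightarrow> 'x) \<Rightarrow> bool" where
  "lopa_lg P E W M \<zeta> st \<alpha> x0 \<theta>0 v0 z0 x \<theta> v y z \<longleftrightarrow>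
     (\<forall>i\<in>V P. \<forall>\<omega>\<in>space M.
        x i 0 \<omega> = x0 i \<and> \<theta> i 0 \<omega> = \<theta>0 i \<and> v i 0 \<omega> = v0 i \<and> z i 0 \<omega> = z0 i \<and> y i 0 \<omega> = z i 0 \<omega> \<and>
        (\<forall>k.
          (let \<beta> = c_beta st * \<alpha>; lam = c_lambda st * \<alpha>; \<gamma> = c_gamma st * \<alpha>;
               d = grad_t (gsample P i (\<zeta> i Xi1 k \<omega>)) (x i k \<omega>) (\<theta> i k \<omega>);
               h = hess_tt (gsample P i (\<zeta> i Xi2 k \<omega>)) (x i k \<omega>) (\<theta> i k \<omega>) (v i k \<omega>) -
                   grad_t (fsample P i (\<zeta> i Sig1 k \<omega>)) (x i k \<omega>) (\<theta> i k \<omega>);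
               s = grad_x (fsample P i (\<zeta> i Sig2 k \<omega>)) (x i k \<omega>) (\<theta> i k \<omega>) -
                   hess_xt (gsample P i (\<zeta> i Xi3 k \<omega>)) (x i k \<omega>) (\<theta> i k \<omega>) (v i k \<omega>)
           in
             \<theta> i (Suc k) \<omega> = \<theta> i k \<omega> - \<beta> *\<^sub>R d \<and>
             v i (Suc k) \<omega> = v i k \<omega> - lam *\<^sub>R h \<and>
             x i (Suc k) \<omega> = (1 - tau st) *\<^sub>R x i k \<omega> +
               tau st *\<^sub>R ((\<Sum>j | (i, j) \<in> E. W i j *\<^sub>R x j k \<omega>) - \<alpha> *\<^sub>R y i k \<omega>) \<and>
             z i (Suc k) \<omega> = s + (1 - \<gamma>) *\<^sub>R (z i k \<omega> - s) \<and>
             y i (Suc k) \<omega> = z i (Suc k) \<omega>)))"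

definition kappa :: "fun_consts \<Rightarrow> real \<Rightarrow> real" where
  "kappa c \<mu> = Max {L_fx c, L_ft c, L_gt c, L_gxt c, L_gtt c} / \<mu>"

definition b2 :: "fun_consts \<Rightarrow> real \<Rightarrow> real \<Rightarrow> real \<Rightarrow> real" where
  "b2 c \<mu> bf bg =
     4 * (1 + (C_gxt c)\<^sup>2 / \<mu>\<^sup>2) * bf\<^sup>2 +
     4 * (4 * (C_ft c)\<^sup>2 * (C_gxt c)\<^sup>2 / \<mu> ^ 4 + 4 * (C_ft c)\<^sup>2 / \<mu>\<^sup>2 + (L_fx c)\<^sup>2 / \<mu>\<^sup>2 +
          (L_ft c)\<^sup>2 * (C_gxt c)\<^sup>2 / \<mu> ^ 4 +
          4 * (C_ft c)\<^sup>2 * (C_gxt c)\<^sup>2 * (L_gtt c)\<^sup>2 / \<mu> ^ 6 +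
          4 * (C_ft c)\<^sup>2 * (L_gxt c)\<^sup>2 / \<mu> ^ 4) * bg\<^sup>2"

definition MM :: "fun_consts \<Rightarrow> real \<Rightarrow> real" where
  "MM c \<mu> = C_ft c / \<mu>"

definition L_fgx :: "fun_consts \<Rightarrow> real \<Rightarrow> real" where
  "L_fgx c \<mu> = 2 * (L_fx c)\<^sup>2 + 4 * (MM c \<mu>)\<^sup>2 * (L_gxt c)\<^sup>2"

definition L_fgt :: "fun_consts \<Rightarrow> real \<Rightarrow> real" where
  "L_fgt c \<mu> = 2 * (L_ft c)\<^sup>2 + 4 * (MM c \<mu>)\<^sup>2 * (L_gtt c)\<^sup>2"

definition omega_t :: "fun_consts \<Rightarrow> real \<Rightarrow> real" where
  "omega_t c \<mu> = \<mu> * L_gt c / (2 * (\<mu> + L_gt c))"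

definition PP :: "fun_consts \<Rightarrow> real \<Rightarrow> real" where
  "PP c \<mu> = L_fgx c \<mu> + 32 * (C_gxt c)\<^sup>2 * L_fgt c \<mu> / \<mu>\<^sup>2"

definition phi :: "fun_consts \<Rightarrow> real \<Rightarrow> real" where
  "phi c \<mu> = PP c \<mu> * (1 + 4 * (L_gt c)\<^sup>2 / (omega_t c \<mu>)\<^sup>2)"

definition L_tstar :: "fun_consts \<Rightarrow> real \<Rightarrow> real" where
  "L_tstar c \<mu> = C_gxt c / \<mu>"

definition L_v :: "fun_consts \<Rightarrow> real \<Rightarrow> real" where
  "L_v c \<mu> = L_ft c / \<mu> + C_ft c * L_gtt c / \<mu>\<^sup>2"

definition L_vstar :: "fun_consts \<Rightarrow> real \<Rightarrow> real" where
  "L_vstar c \<mu> = L_v c \<mu> * (1 + L_tstar c \<mu>)"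

definition LL :: "fun_consts \<Rightarrow> real \<Rightarrow> real" where
  "LL c \<mu> = (L_fx c + C_gxt c * L_v c \<mu> + C_ft c * L_gxt c / \<mu>) * (1 + L_tstar c \<mu>)"

definition u1 :: "fun_consts \<Rightarrow> real \<Rightarrow> steps \<Rightarrow> real" where
  "u1 c \<mu> st = 1 / (2 * tau st * LL c \<mu>)"

definition u2 :: "fun_consts \<Rightarrow> real \<Rightarrow> noise \<Rightarrow> real \<Rightarrow> real" where
  "u2 c \<mu> n \<rho> = Min {
     (1 - \<rho>) / (12 * phi c \<mu> powr (1/2)),
     (1 - \<rho>) powr (2/3) / (4 * phi c \<mu> powr (1/3)),
     PP c \<mu> powr (1/3) * (1 - \<rho>) powr (2/3) / (4 * phi c \<mu> powr (1/3)),
     (1 - \<rho>) powr (1/2) / (3 * L_fgx c \<mu> powr (1/4)),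
     C_gxt c powr (2/3) * (1 - \<rho>) powr (2/3) / (4 * phi c \<mu> powr (1/3) * s_gxt n powr (2/3))}"

definition u3 :: "fun_consts \<Rightarrow> real \<Rightarrow> noise \<Rightarrow> steps \<Rightarrow> real" where
  "u3 c \<mu> n st = Min {
     min 1 (\<mu>\<^sup>2 / (8 * (s_gxt n)\<^sup>2)) / (96 * tau st * L_vstar c \<mu> * C_gxt c),
     min (2 / (\<mu> + L_gt c)) ((\<mu> + L_gt c) / (2 * \<mu> * L_gt c)) * omega_t c \<mu> /
       (12 * tau st * PP c \<mu> powr (1/2) * L_tstar c \<mu>),
     min 1 (2 * (C_gxt c)\<^sup>2 / (s_gxt n)\<^sup>2) / (8 * LL c \<mu> * tau st)}"

definition uu :: "fun_consts \<Rightarrow> real \<Rightarrow> noise \<Rightarrow> steps \<Rightarrow> real \<Rightarrow> real" where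
  "uu c \<mu> n st \<rho> = Min {u1 c \<mu> st, u2 c \<mu> n \<rho>, u3 c \<mu> n st}"

definition d0 :: real where
  "d0 = 1"

definition d1 :: "fun_consts \<Rightarrow> real \<Rightarrow> steps \<Rightarrow> real" where
  "d1 c \<mu> st = 8 * (C_gxt c)\<^sup>2 * tau st / (\<mu> * c_lambda st)"

definition d2 :: "fun_consts \<Rightarrow> real \<Rightarrow> steps \<Rightarrow> real" where
  "d2 c \<mu> st = PP c \<mu> * tau st / (omega_t c \<mu> * c_beta st)"

definition d3 :: "steps \<Rightarrow> real" where
  "d3 st = tau st / (2 * c_gamma st)"

definition d4_hat :: "fun_consts \<Rightarrow> real \<Rightarrow> noise \<Rightarrow> steps \<Rightarrow> real \<Rightarrow> real" where
  "d4_hat c \<mu> n st \<rho> =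
     24 * phi c \<mu> * tau st / ((1 - \<rho>)\<^sup>2 * c_gamma st) * (uu c \<mu> n st \<rho>) ^ 3"

definition d5_hat :: "fun_consts \<Rightarrow> real \<Rightarrow> noise \<Rightarrow> steps \<Rightarrow> real \<Rightarrow> real" where
  "d5_hat c \<mu> n st \<rho> = 2 * phi c \<mu> / (1 - \<rho>) * uu c \<mu> n st \<rho>"

definition vartheta :: "fun_consts \<Rightarrow> real \<Rightarrow> steps \<Rightarrow> real \<Rightarrow> real" where
  "vartheta c \<mu> st \<rho> = 24 * phi c \<mu> / ((1 - \<rho>)\<^sup>2 * c_gamma st)"

definition sigma_p :: "fun_consts \<Rightarrow> real \<Rightarrow> noise \<Rightarrow> steps \<Rightarrow> real" where
  "sigma_p c \<mu> n st =
     sqrt (d1 c \<mu> st / tau st) * (s_ft n + 2 * MM c \<mu> * s_gtt n) * c_lambda st +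
     sqrt (d2 c \<mu> st / tau st) * s_gt n * c_beta st"

definition sigma_c :: "fun_consts \<Rightarrow> real \<Rightarrow> noise \<Rightarrow> steps \<Rightarrow> real" where
  "sigma_c c \<mu> n st = sqrt (d3 st / tau st) * (s_fx n + 2 * MM c \<mu> * s_gxt n) * c_gamma st"

definition sigma_LG_hat :: "fun_consts \<Rightarrow> real \<Rightarrow> noise \<Rightarrow> steps \<Rightarrow> nat \<Rightarrow> real" where
  "sigma_LG_hat c \<mu> n st m =
     sqrt 2 * sigma_p c \<mu> n st + sqrt 2 / sqrt (real m) * sigma_c c \<mu> n st"

text \<open>\<open>Phi P xb\<close> is not offset by the infimum of \<open>Phi P\<close>. The formula is a Lyapunov value for
  objectives normalized to be nonnegative.\<close>

definition V0_hat ::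
  "('x::euclidean_space, 'y::euclidean_space, 's) bilevel \<Rightarrow> fun_consts \<Rightarrow> real \<Rightarrow> noise \<Rightarrow> steps \<Rightarrow>
     real \<Rightarrow> (nat \<Rightarrow> 'x) \<Rightarrow> (nat \<Rightarrow> 'y) \<Rightarrow> (nat \<Rightarrow> 'y) \<Rightarrow> (nat \<Rightarrow> 'x) \<Rightarrow> real" where
  "V0_hat P c \<mu> n st \<rho> x0 \<theta>0 v0 z0 =
     (let m = real (nodes P); t = tau st; xb = node_avg (nodes P) x0 in
        d0 / t * Phi P xb +
        d1 c \<mu> st / (t * m) * (\<Sum>i\<in>V P. (norm (v0 i - v_star P i xb))\<^sup>2) +
        d2 c \<mu> st / (t * m) * (\<Sum>i\<in>V P. (norm (\<theta>0 i - theta_star P i xb))\<^sup>2) +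
        d3 st / t * (norm (grad (Phi P) xb - node_avg (nodes P) z0))\<^sup>2 +
        d4_hat c \<mu> n st \<rho> / (t * m) * (\<Sum>i\<in>V P. (norm (grad (Phi_i P i) xb - z0 i))\<^sup>2) +
        d5_hat c \<mu> n st \<rho> / (t * m) * (\<Sum>i\<in>V P. (norm (x0 i - xb))\<^sup>2))"

definition step_size :: "real \<Rightarrow> real \<Rightarrow> real \<Rightarrow> real \<Rightarrow> nat \<Rightarrow> real" where
  "step_size u a0 a1 a2 K =
     Min {u, (a0 / (a1 * (real K + 1))) powr (1/2), (a0 / (a2 * (real K + 1))) powr (1/3)}"

definition alpha ::
  "('x::euclidean_space, 'y::euclidean_space, 's) bilevel \<Rightarrow> fun_consts \<Rightarrow> real \<Rightarrow> noise \<Rightarrow> steps \<Rightarrow>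
     real \<Rightarrow> real \<Rightarrow> real \<Rightarrow> (nat \<Rightarrow> 'x) \<Rightarrow> (nat \<Rightarrow> 'y) \<Rightarrow> (nat \<Rightarrow> 'y) \<Rightarrow> (nat \<Rightarrow> 'x) \<Rightarrow> nat \<Rightarrow> real" where
  "alpha P c \<mu> n st \<rho> bf bg x0 \<theta>0 v0 z0 K =
     step_size (uu c \<mu> n st \<rho>)
       (4 * V0_hat P c \<mu> n st \<rho> x0 \<theta>0 v0 z0)
       (4 * (sigma_LG_hat c \<mu> n st (nodes P))\<^sup>2)
       (4 * vartheta c \<mu> st \<rho> / real (nodes P) * b2 c \<mu> bf bg)
       K"

text \<open>Size of the initial data in units of a constant \<open>B\<close>. Every initialization satisfies this for
  some \<open>B\<close>. The powers of \<open>\<kappa>\<close> are the natural scales: \<open>v_star\<close> and the gradients of the \<open>Phi_i\<close> are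
  of order \<open>\<kappa>\<close>, and the consensus error enters the initial Lyapunov value with a factor of order
  \<open>\<kappa> ^ 7\<close>, as opposed to \<open>\<kappa> ^ 5\<close> for the error in \<open>\<theta>\<close>.\<close>

definition init_bound ::
  "('x::euclidean_space, 'y::euclidean_space, 's) bilevel \<Rightarrow> real \<Rightarrow> real \<Rightarrow>
     (nat \<Rightarrow> 'x) \<Rightarrow> (nat \<Rightarrow> 'y) \<Rightarrow> (nat \<Rightarrow> 'y) \<Rightarrow> (nat \<Rightarrow> 'x) \<Rightarrow> bool" where
  "init_bound P \<kappa> B x0 \<theta>0 v0 z0 \<longleftrightarrow>
     (let m = nodes P; xb = node_avg m x0 in
        Phi P xb \<le> B \<and>
        node_avg m (\<lambda>i. (norm (\<theta>0 i - theta_star P i xb))\<^sup>2) \<le> B \<and>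
        node_avg m (\<lambda>i. (norm (v0 i - v_star P i xb))\<^sup>2) \<le> B * \<kappa>\<^sup>2 \<and>
        node_avg m (\<lambda>i. (norm (grad (Phi_i P i) xb - z0 i))\<^sup>2) \<le> B * \<kappa>\<^sup>2 \<and>
        \<kappa>\<^sup>2 * node_avg m (\<lambda>i. (norm (x0 i - xb))\<^sup>2) \<le> B)"

end

theory Submission
  imports Defs
begin

text \<open>
  The rate is a Lyapunov argument along the averaged iterate \<open>xb\<close>. Five mean squared errors are
  followed: the distances of \<open>\<theta>\<close> and \<open>v\<close> to their targets at \<open>xb\<close>, of the averaged estimate
  \<open>zb\<close> to the gradient of \<open>Phi P\<close>, of each \<open>z\<close> to the gradient of its own \<open>Phi_i\<close>, and of each \<open>x\<close>
  to \<open>xb\<close>. Each of them contracts in one step: \<open>\<theta>\<close> and \<open>v\<close> by strong convexity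
  (\<open>contractive_step\<close>), \<open>x\<close> by the spectral gap of the network (\<open>consensus_step\<close>), \<open>z\<close> because it is
  a moving average (\<open>tracking_step\<close>). The perturbations are multiples of the other errors, the
  displacement of \<open>xb\<close>, whose square is \<open>\<tau>\<^sup>2 * \<alpha>\<^sup>2\<close> times that of \<open>zb\<close>, and sampling noise. Smoothness of \<open>Phi P\<close>
  makes one step lower the objective by \<open>\<tau> * \<alpha> / 2\<close> times the squared gradient plus
  \<open>\<tau> * \<alpha> / 4\<close> times the square of \<open>zb\<close>, up to \<open>\<tau> * \<alpha> / 2\<close> times the error of \<open>zb\<close>
  (\<open>recursion_Phi\<close>). In \<open>lyapunov_step\<close> the errors are weighted such that all cross terms cancel,
  and the gain in the square of \<open>zb\<close> pays for the displacement as soon as \<open>\<tau>\<close> is a small multiple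
  of \<open>1 / (A * q ^ 4)\<close>. There remains a decrease by \<open>\<alpha> / 2\<close> times the squared gradient, up to
  \<open>\<alpha>\<^sup>2\<close> times the sampling variances and \<open>\<alpha> ^ 3\<close> times the heterogeneity. The telescoped sum
  is bounded by \<open>V / (\<alpha> * K) + \<alpha> * variance + \<alpha>\<^sup>2 * heterogeneity\<close> (\<open>lyap_telescope\<close>), and the
  rule for \<open>\<alpha>\<close> balances these three terms (\<open>step_size_balance\<close>).

  The recursions rest on three facts. The gradient of \<open>Phi_i\<close> is the hypergradient and is Lipschitz
  (\<open>value_GDERIV\<close>, \<open>hgrad_lip\<close>). The samples of an iteration are independent of everything before it, so that
  noise is orthogonal to the past and enters only through its variance (\<open>fresh_noise\<close>), and the noise of the
  averaged estimate has a variance smaller by a factor \<open>m\<close> because the nodes sample independently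
  (\<open>noise_S_avg\<close>). The local gradients differ by at most the heterogeneity constants
  (\<open>hypergradient_heterogeneity\<close>), which is what keeps the \<open>x\<close> apart.

  Every constant of the functions is at most \<open>A\<close>, and bounds are powers of \<open>q = A / \<mu>\<close>. This \<open>q\<close> is at
  most \<open>D * \<kappa>\<close>, where \<open>D\<close> is the ratio of \<open>A\<close> to the smallest of these constants and does not involve \<open>\<mu>\<close>;
  powers of \<open>D\<close> therefore go into the constant of the rate. In the same way the weights of the Lyapunov
  function, the variances and the heterogeneity are compared with the constants in the rule
  for \<open>\<alpha>\<close>, up to powers of \<open>D\<close> (\<open>lyap_0_le\<close>, \<open>noise_floor_le\<close>, \<open>het_term_le\<close>). For large \<open>K\<close> the variance
  argument of the minimum, which is of order \<open>1 / sqrt K\<close>, falls below any threshold fixed by \<open>m\<close>, \<open>\<rho>\<close>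
  and the noise levels, so that all smallness conditions on \<open>\<alpha>\<close> hold (\<open>small_step_exists\<close>) and the last two
  terms of the rate remain.
\<close>

section \<open>Gradients, Jacobians and symmetry of the second derivative\<close>

lemma grad_eqI:
  assumes "GDERIV F x :> D" shows "grad F x = D"
proof -
  have "D' = D" if "GDERIV F x :> D'" for D'
  proof -
    have "(\<lambda>h. inner h D') = (\<lambda>h. inner h D)"
      using has_derivative_unique that assms unfolding gderiv_def by blast
    then have "inner (D' - D) D' = inner (D' - D) D" by metis
    then have "inner (D' - D) (D' - D) = 0" by (simp add: inner_diff_right)
    then show ?thesis by simp
  qed
  then show ?thesis unfolding grad_def using assms by blast
qed

lemma jac_eqI:
  assumes "(F has_derivative D) (at x)" shows "blinfun_apply (jac F x) = D"
proof -
  have bl: "bounded_linear D" using assms by (rule has_derivative_bounded_linear)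
  have "jac F x = Blinfun D"
    unfolding jac_def
  proof (rule the_equality)
    show "(F has_derivative blinfun_apply (Blinfun D)) (at x)"
      using assms bl by (simp add: bounded_linear_Blinfun_apply)
    show "D' = Blinfun D" if "(F has_derivative blinfun_apply D') (at x)" for D'
      using has_derivative_unique[OF that assms] bl
      by (metis bounded_linear_Blinfun_apply blinfun_apply_inject)
  qed
  then show ?thesis using bl by (simp add: bounded_linear_Blinfun_apply)
qed

text \<open>The vector that represents a functional. It turns the derivatives in \<open>C1\<close> and \<open>C2\<close>, which are
  functionals, into gradients.\<close>

definition riesz :: "('a::euclidean_space \<Rightarrow>\<^sub>L real) \<Rightarrow> 'a" where
  "riesz D = (\<Sum>b\<in>Basis. blinfun_apply D b *\<^sub>R b)"

lemma inner_riesz: "inner h (riesz D) = blinfun_apply D h"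
proof -
  have "blinfun_apply D h = blinfun_apply D (\<Sum>b\<in>Basis. inner h b *\<^sub>R b)"
    by (simp add: euclidean_representation)
  also have "\<dots> = (\<Sum>b\<in>Basis. inner h b * blinfun_apply D b)"
    by (simp add: blinfun.sum_right blinfun.scaleR_right)
  finally show ?thesis
    by (simp add: riesz_def inner_sum_right mult.commute)
qed

lemma bounded_linear_riesz: "bounded_linear riesz"
  unfolding riesz_def
  by (intro bounded_linear_sum bounded_linear_scaleR_const blinfun.bounded_linear_left)

lemma C1_gradient:
  fixes F :: "'a::euclidean_space \<Rightarrow> real"
  assumes "C1 F"
  obtains N where "\<And>z. GDERIV F z :> N z" "continuous_on UNIV N"
proof -
  obtain F' where F': "\<And>z. (F has_derivative blinfun_apply (F' z)) (at z)" "continuous_on UNIV F'"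
    using assms unfolding C1_def by blast
  show ?thesis
  proof
    show "GDERIV F z :> riesz (F' z)" for z
      using F'(1) by (simp add: gderiv_def inner_riesz)
    show "continuous_on UNIV (\<lambda>z. riesz (F' z))"
      by (rule bounded_linear.continuous_on[OF bounded_linear_riesz F'(2)])
  qed
qed

lemma C2_gradient:
  fixes F :: "'a::euclidean_space \<Rightarrow> real"
  assumes "C2 F"
  obtains N N' where "\<And>z. GDERIV F z :> N z" "\<And>z. (N has_derivative N' z) (at z)"
proof -
  obtain F' where F': "\<And>z. (F has_derivative blinfun_apply (F' z)) (at z)" "C1 F'"
    using assms unfolding C2_def by blast
  then obtain F'' where F'': "\<And>z. (F' has_derivative blinfun_apply (F'' z)) (at z)"
    unfolding C1_def by blast
  show ?thesis
  proof
    show "GDERIV F z :> riesz (F' z)" for z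
      using F'(1) by (simp add: gderiv_def inner_riesz)
    show "((\<lambda>z. riesz (F' z)) has_derivative (\<lambda>h. riesz (F'' z h))) (at z)" for z
      by (rule bounded_linear.has_derivative[OF bounded_linear_riesz F''])
  qed
qed

lemma GDERIV_line:
  assumes "GDERIV F (a + s *\<^sub>R u) :> D"
  shows "((\<lambda>s. F (a + s *\<^sub>R u)) has_real_derivative inner u D) (at s)"
proof -
  have "((\<lambda>s. a + s *\<^sub>R u) has_derivative (\<lambda>h. h *\<^sub>R u)) (at s)"
    by (auto intro!: derivative_eq_intros)
  from has_derivative_compose[OF this assms[unfolded gderiv_def]]
  show ?thesis by (simp add: has_field_derivative_def mult.commute mult_commute_abs)
qed

text \<open>Schwarz's theorem. No continuity of \<open>H\<close> is at hand, so it is proved through the second difference of \<open>F\<close> over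
  the parallelogram with sides \<open>t * a\<close> and \<open>t * b\<close>: the mean value theorem along \<open>a\<close> and
  differentiability of \<open>N\<close> at \<open>z\<close> show that it is \<open>t\<^sup>2 * inner a (H b)\<close> up to a small multiple of \<open>t\<^sup>2\<close>,
  and it is symmetric in \<open>a\<close> and \<open>b\<close>.\<close>

lemma gradient_derivative_symmetric:
  fixes F :: "'a::real_inner \<Rightarrow> real"
  assumes grd: "\<And>z. GDERIV F z :> N z" and der: "(N has_derivative H) (at z)"
  shows "inner u (H w) = inner w (H u)"
proof -
  have lin: "linear H" using der has_derivative_linear by blast
  have est: "\<exists>d>0. \<forall>t a b. 0 < t \<longrightarrow> t * (norm a + norm b) < d \<longrightarrow>
      \<bar>F (z + t *\<^sub>R a + t *\<^sub>R b) - F (z + t *\<^sub>R a) - F (z + t *\<^sub>R b) + F z - t\<^sup>2 * inner a (H b)\<bar>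
       \<le> 2 * e * t\<^sup>2 * norm a * (norm a + norm b)" if "e > 0" for e
  proof -
    obtain d where d: "d > 0" "\<And>y. norm (y - z) < d \<Longrightarrow> norm (N y - N z - H (y - z)) \<le> e * norm (y - z)"
      using der \<open>e > 0\<close> unfolding has_derivative_at_alt by blast
    have "\<bar>F (z + t *\<^sub>R a + t *\<^sub>R b) - F (z + t *\<^sub>R a) - F (z + t *\<^sub>R b) + F z - t\<^sup>2 * inner a (H b)\<bar>
       \<le> 2 * e * t\<^sup>2 * norm a * (norm a + norm b)"
      if t: "0 < t" "t * (norm a + norm b) < d" for t a b
    proof -
      \<comment> \<open>The second difference is \<open>p t - p 0\<close>.\<close>
      define p where "p s = F (z + t *\<^sub>R b + s *\<^sub>R a) - F (z + s *\<^sub>R a)" for s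
      have dp: "(p has_real_derivative inner a (N (z + t *\<^sub>R b + s *\<^sub>R a)) - inner a (N (z + s *\<^sub>R a))) (at s)" for s
        unfolding p_def by (intro DERIV_diff GDERIV_line grd)
      then obtain x where x: "0 < x" "x < t"
        "p t - p 0 = (t - 0) * (inner a (N (z + t *\<^sub>R b + x *\<^sub>R a)) - inner a (N (z + x *\<^sub>R a)))"
        using MVT2[OF t(1), of p "\<lambda>s. inner a (N (z + t *\<^sub>R b + s *\<^sub>R a)) - inner a (N (z + s *\<^sub>R a))"] dp
        by auto
      let ?y = "z + t *\<^sub>R b + x *\<^sub>R a" and ?y' = "z + x *\<^sub>R a"
      have n1: "norm (t *\<^sub>R b + x *\<^sub>R a) \<le> t * (norm a + norm b)"
        using norm_triangle_ineq[of "t *\<^sub>R b" "x *\<^sub>R a"] x(1,2) t mult_right_mono[of x t "norm a"]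
        by (simp add: algebra_simps)
      have n2: "norm (x *\<^sub>R a) \<le> t * (norm a + norm b)"
      proof -
        have "x * norm a \<le> t * norm a" using x(1,2) by (simp add: mult_right_mono)
        moreover have "0 \<le> t * norm b" using t by simp
        ultimately have "x * norm a \<le> t * (norm a + norm b)" by (unfold distrib_left) linarith
        then show ?thesis using x(1,2) by simp
      qed
      have e1: "norm (N ?y - N z - H (t *\<^sub>R b + x *\<^sub>R a)) \<le> e * (t * (norm a + norm b))"
      proof -
        have eq: "?y - z = t *\<^sub>R b + x *\<^sub>R a" by simp
        have "norm (N ?y - N z - H (?y - z)) \<le> e * norm (?y - z)"
          by (rule d(2)) (unfold eq, use n1 t in linarith)
        also have "\<dots> \<le> e * (t * (norm a + norm b))"
          unfolding eq using n1 \<open>e > 0\<close> by (intro mult_left_mono) auto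
        finally show ?thesis unfolding eq .
      qed
      have e2: "norm (N ?y' - N z - H (x *\<^sub>R a)) \<le> e * (t * (norm a + norm b))"
      proof -
        have eq: "?y' - z = x *\<^sub>R a" by simp
        have "norm (N ?y' - N z - H (?y' - z)) \<le> e * norm (?y' - z)"
          by (rule d(2)) (unfold eq, use n2 t in linarith)
        also have "\<dots> \<le> e * (t * (norm a + norm b))"
          unfolding eq using n2 \<open>e > 0\<close> by (intro mult_left_mono) auto
        finally show ?thesis unfolding eq .
      qed
      have "N ?y - N ?y' - t *\<^sub>R H b = (N ?y - N z - H (t *\<^sub>R b + x *\<^sub>R a)) - (N ?y' - N z - H (x *\<^sub>R a))"
        by (simp add: linear_add[OF lin] linear_scale[OF lin])
      then have "norm (N ?y - N ?y' - t *\<^sub>R H b) \<le> norm (N ?y - N z - H (t *\<^sub>R b + x *\<^sub>R a)) + norm (N ?y' - N z - H (x *\<^sub>R a))"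
        by (metis norm_triangle_ineq4)
      also have "\<dots> \<le> 2 * e * (t * (norm a + norm b))"
        using e1 e2 by linarith
      finally have "norm (N ?y - N ?y' - t *\<^sub>R H b) \<le> 2 * e * (t * (norm a + norm b))" .
      then have "\<bar>inner a (N ?y - N ?y' - t *\<^sub>R H b)\<bar> \<le> norm a * (2 * e * (t * (norm a + norm b)))"
        using Cauchy_Schwarz_ineq2[of a "N ?y - N ?y' - t *\<^sub>R H b"]
        by (meson mult_left_mono norm_ge_zero order_trans)
      moreover have "p t - p 0 - t\<^sup>2 * inner a (H b) = t * inner a (N ?y - N ?y' - t *\<^sub>R H b)"
        using x(3) by (simp add: inner_diff_right power2_eq_square algebra_simps)
      ultimately have "\<bar>p t - p 0 - t\<^sup>2 * inner a (H b)\<bar> \<le> t * (norm a * (2 * e * (t * (norm a + norm b))))"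
        using t by (simp add: abs_mult)
      then show ?thesis
        unfolding p_def by (simp add: power2_eq_square algebra_simps)
    qed
    with d(1) show ?thesis by blast
  qed
  have *: "\<bar>inner u (H w) - inner w (H u)\<bar> \<le> e * (2 * (norm u + norm w)\<^sup>2)" if epos: "e > 0" for e
  proof -
    obtain d where d: "d > 0" "\<And>t a b. 0 < t \<Longrightarrow> t * (norm a + norm b) < d \<Longrightarrow>
      \<bar>F (z + t *\<^sub>R a + t *\<^sub>R b) - F (z + t *\<^sub>R a) - F (z + t *\<^sub>R b) + F z - t\<^sup>2 * inner a (H b)\<bar>
       \<le> 2 * e * t\<^sup>2 * norm a * (norm a + norm b)"
      using est[OF epos] by blast
    define t where "t = d / (2 * (norm u + norm w + 1))"
    have pos: "norm u + norm w + 1 > 0" by (simp add: add_nonneg_pos)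
    then have t: "t > 0" using d(1) by (simp add: t_def)
    have "t * (norm u + norm w) \<le> t * (norm u + norm w + 1)" using t by simp
    also have "\<dots> = d / 2" using pos by (simp add: t_def field_simps)
    finally have tl: "t * (norm u + norm w) < d" using d(1) by simp
    define S where "S = F (z + t *\<^sub>R u + t *\<^sub>R w) - F (z + t *\<^sub>R u) - F (z + t *\<^sub>R w) + F z"
    have "\<bar>S - t\<^sup>2 * inner u (H w)\<bar> \<le> 2 * e * t\<^sup>2 * norm u * (norm u + norm w)"
      using d(2)[OF t tl] by (simp add: S_def)
    moreover have "\<bar>S - t\<^sup>2 * inner w (H u)\<bar> \<le> 2 * e * t\<^sup>2 * norm w * (norm u + norm w)"
      using d(2)[of t w u] t tl by (simp add: S_def algebra_simps)
    ultimately have "\<bar>t\<^sup>2 * inner u (H w) - t\<^sup>2 * inner w (H u)\<bar>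
      \<le> 2 * e * t\<^sup>2 * norm u * (norm u + norm w) + 2 * e * t\<^sup>2 * norm w * (norm u + norm w)"
      by linarith
    also have "\<dots> = t\<^sup>2 * (e * (2 * (norm u + norm w)\<^sup>2))"
      by (simp add: power2_eq_square algebra_simps)
    finally have "t\<^sup>2 * \<bar>inner u (H w) - inner w (H u)\<bar> \<le> t\<^sup>2 * (e * (2 * (norm u + norm w)\<^sup>2))"
      by (simp add: right_diff_distrib[symmetric] abs_mult del: mult_le_cancel_left)
    then show ?thesis using t by simp
  qed
  have *: "\<bar>inner u (H w) - inner w (H u)\<bar> \<le> 0 + e" if "e > 0" for e
  proof -
    define c where "c = 2 * (norm u + norm w)\<^sup>2"
    have c: "c \<ge> 0" by (simp add: c_def)
    have "\<bar>inner u (H w) - inner w (H u)\<bar> \<le> e / (c + 1) * c"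
      unfolding c_def[symmetric] using that c by (intro *[folded c_def]) (simp add: add_nonneg_pos)
    also have "\<dots> \<le> e" using c that by (simp add: field_simps)
    finally show ?thesis by simp
  qed
  have "\<bar>inner u (H w) - inner w (H u)\<bar> \<le> 0"
    using field_le_epsilon[OF *] .
  then show ?thesis by simp
qed

lemma convex_gradient_inequality:
  assumes cvx: "convex_on UNIV h" and D: "GDERIV h a :> D"
  shows "h a + inner (b - a) D \<le> h b"
proof -
  define p where "p s = h (a + s *\<^sub>R (b - a))" for s
  have "(p has_real_derivative inner (b - a) D) (at 0)"
    unfolding p_def by (rule GDERIV_line) (simp add: D)
  then have "((\<lambda>s. (p (0 + s) - p 0) / s) \<longlongrightarrow> inner (b - a) D) (at 0)"
    by (simp add: DERIV_def)
  then have lim: "((\<lambda>s. (p s - p 0) / s) \<longlongrightarrow> inner (b - a) D) (at_right 0)"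
    by (simp add: filterlim_at_split)
  have "\<forall>\<^sub>F s in at_right 0. (p s - p 0) / s \<le> h b - h a"
    unfolding eventually_at_right_field
  proof (intro exI[of _ 1] conjI allI impI)
    fix s :: real assume s: "0 < s" "s < 1"
    have "a + s *\<^sub>R (b - a) = (1 - s) *\<^sub>R a + s *\<^sub>R b"
      by (simp add: algebra_simps)
    then have "p s \<le> (1 - s) * h a + s * h b"
      using convex_onD[OF cvx, of s a b] s by (simp add: p_def)
    then show "(p s - p 0) / s \<le> h b - h a"
      using s by (simp add: p_def field_simps)
  qed simp
  then have "inner (b - a) D \<le> h b - h a"
    by (rule tendsto_upperbound[OF lim]) simp
  then show ?thesis by simp
qed

lemma strongly_convex_gradient_inequality:
  fixes h :: "'a::real_inner \<Rightarrow> real"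
  assumes "strongly_convex \<mu> h" and D: "GDERIV h a :> D"
  shows "h a + inner (b - a) D + \<mu> / 2 * (norm (b - a))\<^sup>2 \<le> h b"
proof -
  have "GDERIV (\<lambda>\<theta>. h \<theta> - \<mu> / 2 * (norm \<theta>)\<^sup>2) a :> D - \<mu> *\<^sub>R a"
    using D unfolding gderiv_def power2_norm_eq_inner
    by (auto intro!: derivative_eq_intros simp: inner_diff_right inner_commute)
  with assms(1)[unfolded strongly_convex_def]
  have "h a - \<mu> / 2 * (norm a)\<^sup>2 + inner (b - a) (D - \<mu> *\<^sub>R a) \<le> h b - \<mu> / 2 * (norm b)\<^sup>2"
    by (rule convex_gradient_inequality)
  moreover
  have "(norm (b - a))\<^sup>2 = (norm b)\<^sup>2 - (norm a)\<^sup>2 - 2 * inner (b - a) a"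
    by (simp add: power2_norm_eq_inner inner_diff_left inner_diff_right inner_commute)
  then have "\<mu> / 2 * (norm (b - a))\<^sup>2 = \<mu> / 2 * ((norm b)\<^sup>2 - (norm a)\<^sup>2 - 2 * inner (b - a) a)"
    by (simp only:)
  then have "\<mu> / 2 * (norm (b - a))\<^sup>2 = \<mu> / 2 * (norm b)\<^sup>2 - \<mu> / 2 * (norm a)\<^sup>2 - \<mu> * inner (b - a) a"
    by (simp only: right_diff_distrib)
  ultimately show ?thesis
    unfolding inner_diff_right inner_scaleR_right by linarith
qed

text \<open>The growth inequality at \<open>0\<close> confines the search to a ball of radius \<open>2 * norm (D 0) / \<mu>\<close>, which is
  compact.\<close>

lemma strongly_convex_attains_min:
  fixes h :: "'a::euclidean_space \<Rightarrow> real"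
  assumes "strongly_convex \<mu> h" "\<mu> > 0" and D: "\<And>a. GDERIV h a :> D a"
  shows "h (arg_min h (\<lambda>_. True)) \<le> h b"
proof -
  define r where "r = 2 * norm (D 0) / \<mu>"
  have r0: "r \<ge> 0" using assms(2) by (simp add: r_def)
  have cont: "continuous_on UNIV h"
    using D has_derivative_continuous unfolding gderiv_def
    by (blast intro: continuous_at_imp_continuous_on)
  have "\<exists>t\<in>cball 0 r. \<forall>y\<in>cball 0 r. h t \<le> h y"
    using r0 by (intro continuous_attains_inf continuous_on_subset[OF cont]) auto
  then obtain t where t: "t \<in> cball 0 r" "\<And>y. y \<in> cball 0 r \<Longrightarrow> h t \<le> h y"
    by blast
  have "h t \<le> h y" for y
  proof (cases "y \<in> cball 0 r")
    case False
    then have y: "r < norm y" by simp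
    have "norm y * norm (D 0) \<le> \<mu> / 2 * (norm y)\<^sup>2"
    proof -
      have "norm (D 0) \<le> \<mu> / 2 * norm y"
        using y[unfolded r_def pos_divide_less_eq[OF assms(2)]] by (simp add: mult.commute)
      then have "norm y * norm (D 0) \<le> norm y * (\<mu> / 2 * norm y)"
        by (rule mult_left_mono) (rule norm_ge_zero)
      also have "\<dots> = \<mu> / 2 * (norm y)\<^sup>2"
        unfolding power2_eq_square by (rule mult.left_commute)
      finally show ?thesis .
    qed
    moreover have "- inner y (D 0) \<le> norm y * norm (D 0)"
      using Cauchy_Schwarz_ineq2[of y "D 0"] by linarith
    ultimately have "h 0 \<le> h y"
      using strongly_convex_gradient_inequality[OF assms(1) D, of 0 y] by simp
    then show ?thesis using t(2)[of 0] r0 by simp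
  qed (use t in auto)
  then have "is_arg_min h (\<lambda>_. True) t"
    by (simp add: is_arg_min_linorder)
  then have "is_arg_min h (\<lambda>_. True) (arg_min h (\<lambda>_. True))"
    unfolding arg_min_def by (rule someI)
  then show ?thesis by (simp add: is_arg_min_linorder)
qed

lemma GDERIV_partial:
  fixes F :: "'x::real_inner \<Rightarrow> 'y::real_inner \<Rightarrow> real"
  assumes "GDERIV (\<lambda>(x, \<theta>). F x \<theta>) (x, \<theta>) :> N"
  shows "GDERIV (\<lambda>x. F x \<theta>) x :> fst N" "GDERIV (\<lambda>\<theta>. F x \<theta>) \<theta> :> snd N"
proof -
  have "((\<lambda>x. (x, \<theta>)) has_derivative (\<lambda>h. (h, 0))) (at x)"
    by (auto intro!: derivative_eq_intros)
  from has_derivative_compose[OF this assms[unfolded gderiv_def]]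
  show "GDERIV (\<lambda>x. F x \<theta>) x :> fst N" by (simp add: gderiv_def inner_prod_def)
  have "((\<lambda>\<theta>. (x, \<theta>)) has_derivative (\<lambda>h. (0, h))) (at \<theta>)"
    by (auto intro!: derivative_eq_intros)
  from has_derivative_compose[OF this assms[unfolded gderiv_def]]
  show "GDERIV (\<lambda>\<theta>. F x \<theta>) \<theta> :> snd N" by (simp add: gderiv_def inner_prod_def)
qed

section \<open>The hypergradient of one node\<close>

lemma has_derivative_directional:
  assumes D: "(h has_derivative D) (at a)" and e: "e > 0"
  obtains t where "t > (0::real)" "norm (h (a + t *\<^sub>R v) - h a - t *\<^sub>R D v) \<le> e * t"
proof -
  have lin: "linear D" using D by (rule has_derivative_linear)
  define c where "c = norm v + 1"
  have c: "c > 0" "norm v \<le> c" by (simp_all add: c_def add_nonneg_pos)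
  have ec: "e / c > 0" using e c(1) by simp
  obtain d where d: "d > 0" "\<And>y. norm (y - a) < d \<Longrightarrow> norm (h y - h a - D (y - a)) \<le> e / c * norm (y - a)"
    using D ec unfolding has_derivative_at_alt by blast
  define t where "t = d / (2 * c)"
  have t: "t > 0" using d(1) c(1) by (simp add: t_def)
  have le: "t * norm v \<le> t * c" using t c(2) by simp
  have tc: "t * c = d / 2" using c(1) by (simp add: t_def)
  have "norm (h (a + t *\<^sub>R v) - h a - D (a + t *\<^sub>R v - a)) \<le> e / c * norm (a + t *\<^sub>R v - a)"
    by (rule d(2)) (use le tc t d(1) in simp)
  also have "\<dots> = e / c * (t * norm v)" using t by simp
  also have "\<dots> \<le> e / c * (t * c)" by (rule mult_left_mono[OF le]) (use ec in simp)
  also have "\<dots> = e * t" using c(1) by simp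
  finally show ?thesis
    using that[OF t] by (simp add: linear_scale[OF lin])
qed

lemma le_epsilon_mult:
  fixes a b c :: real
  assumes "\<And>e. e > 0 \<Longrightarrow> a \<le> b + e * c" and "c \<ge> 0"
  shows "a \<le> b"
proof (rule field_le_epsilon)
  fix e :: real assume e: "e > 0"
  have "a \<le> b + e / (c + 1) * c" using assms e by (intro assms(1)) simp
  also have "e / (c + 1) * c \<le> e" using assms(2) e by (simp add: field_simps)
  finally show "a \<le> b + e" by simp
qed

text \<open>Together with \<open>has_derivative_lipschitz_bound\<close> this transfers strong monotonicity and the Lipschitz bound of
  \<open>grad_t\<close> to the Hessian.\<close>

lemma has_derivative_strongly_monotone:
  assumes D: "(h has_derivative D) (at a)"
    and mono: "\<And>x y. inner (h x - h y) (x - y) \<ge> \<mu> * (norm (x - y))\<^sup>2"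
  shows "inner (D v) v \<ge> \<mu> * (norm v)\<^sup>2"
proof (rule le_epsilon_mult)
  fix e :: real assume "e > 0"
  then obtain t where t: "t > 0" "norm (h (a + t *\<^sub>R v) - h a - t *\<^sub>R D v) \<le> e * t"
    using has_derivative_directional[OF D] by blast
  define r where "r = h (a + t *\<^sub>R v) - h a - t *\<^sub>R D v"
  have "\<mu> * (norm (t *\<^sub>R v))\<^sup>2 \<le> inner (h (a + t *\<^sub>R v) - h a) (t *\<^sub>R v)"
    using mono[of "a + t *\<^sub>R v" a] by simp
  also have "h (a + t *\<^sub>R v) - h a = t *\<^sub>R D v + r" by (simp add: r_def)
  also have "inner (t *\<^sub>R D v + r) (t *\<^sub>R v) = t * (t * inner (D v) v + inner r v)"
    by (simp add: inner_add_left algebra_simps)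
  also have "inner r v \<le> (e * t) * norm v"
    using Cauchy_Schwarz_ineq2[of r v] t(2) by (simp add: r_def) (meson abs_le_D1 mult_right_mono norm_ge_zero order_trans)
  finally have "t * (t * (\<mu> * (norm v)\<^sup>2)) \<le> t * (t * (inner (D v) v + e * norm v))"
    using t(1) by (simp add: power_mult_distrib power2_eq_square algebra_simps)
  then show "\<mu> * (norm v)\<^sup>2 \<le> inner (D v) v + e * norm v"
    using t(1) by simp
qed simp

lemma has_derivative_lipschitz_bound:
  assumes D: "(h has_derivative D) (at a)"
    and lip: "\<And>x y. norm (h x - h y) \<le> L * norm (x - y)"
  shows "norm (D v) \<le> L * norm v"
proof (rule le_epsilon_mult)
  fix e :: real assume "e > 0"
  then obtain t where t: "t > 0" "norm (h (a + t *\<^sub>R v) - h a - t *\<^sub>R D v) \<le> e * t"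
    using has_derivative_directional[OF D] by blast
  have "norm (t *\<^sub>R D v) \<le> norm (h (a + t *\<^sub>R v) - h a) + norm (h (a + t *\<^sub>R v) - h a - t *\<^sub>R D v)"
    by (metis norm_triangle_sub norm_minus_commute)
  also have "\<dots> \<le> L * norm (t *\<^sub>R v) + e * t"
    using lip[of "a + t *\<^sub>R v" a] t(2) by simp
  finally have "t * norm (D v) \<le> t * (L * norm v + e * 1)"
    using t(1) by (simp add: algebra_simps)
  then show "norm (D v) \<le> L * norm v + e * 1" using t(1) by simp
qed simp

text \<open>A single \<open>A \<ge> 1\<close> replaces all Lipschitz and derivative bounds. \<open>Mv\<close> is kept apart from it: it bounds \<open>v_star\<close>, and its exact
  value enters the sampling variances.\<close>

locale bilevel_node =
  fixes F G :: "'x::euclidean_space \<Rightarrow> 'y::euclidean_space \<Rightarrow> real" and \<mu> A Mv :: real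
  assumes mu: "0 < \<mu>" "\<mu> \<le> A" "1 \<le> A"
    and F_C1: "C1 (\<lambda>(x, \<theta>). F x \<theta>)"
    and G_C2: "C2 (\<lambda>(x, \<theta>). G x \<theta>)"
    and G_convex: "\<And>x. strongly_convex \<mu> (G x)"
    and Fx_lip: "\<And>x \<theta> x' \<theta>'. norm (grad_x F x \<theta> - grad_x F x' \<theta>') \<le> A * (norm (x - x') + norm (\<theta> - \<theta>'))"
    and Ft_lip: "\<And>x \<theta> x' \<theta>'. norm (grad_t F x \<theta> - grad_t F x' \<theta>') \<le> A * (norm (x - x') + norm (\<theta> - \<theta>'))"
    and Gt_lip: "\<And>x \<theta> \<theta>'. norm (grad_t G x \<theta> - grad_t G x \<theta>') \<le> A * norm (\<theta> - \<theta>')"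
    and Gxt_lip: "\<And>x \<theta> x' \<theta>'. norm (hess_xt G x \<theta> - hess_xt G x' \<theta>') \<le> A * (norm (x - x') + norm (\<theta> - \<theta>'))"
    and Gtt_lip: "\<And>x \<theta> x' \<theta>'. norm (hess_tt G x \<theta> - hess_tt G x' \<theta>') \<le> A * (norm (x - x') + norm (\<theta> - \<theta>'))"
    and Gxt_bound: "\<And>x \<theta>. norm (hess_xt G x \<theta>) \<le> A"
    and Ft_bound: "\<And>x. norm (grad_t F x (arg_min (G x) (\<lambda>_. True))) \<le> \<mu> * Mv"
    and Mv_le: "\<mu> * Mv \<le> A"
begin

text \<open>\<open>dG\<close> and \<open>ddG\<close> are the gradient of \<open>G\<close> on the product space and its derivative. \<open>Gtx x \<theta>\<close>
  is the derivative of \<open>grad_t G\<close> in \<open>x\<close>, the transpose of \<open>hess_xt\<close>.\<close>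

definition "tst x = arg_min (G x) (\<lambda>_. True)"
definition "vst x = inv (blinfun_apply (hess_tt G x (tst x))) (grad_t F x (tst x))"
definition "hgrad x = grad_x F x (tst x) - blinfun_apply (hess_xt G x (tst x)) (vst x)"
definition "q = A / \<mu>"
definition "dG z = (grad_x G (fst z) (snd z), grad_t G (fst z) (snd z))"
definition "ddG z = frechet_derivative dG (at z)"
definition "Gtx x \<theta> h = snd (ddG (x, \<theta>) (h, 0))"

lemma q_ge1: "1 \<le> q" using mu by (simp add: q_def)
lemma A_pos: "0 < A" using mu by linarith
lemma mu_q: "\<mu> * q = A" using mu by (simp add: q_def)

lemma F_GDERIV: "GDERIV (\<lambda>(x, \<theta>). F x \<theta>) (x, \<theta>) :> (grad_x F x \<theta>, grad_t F x \<theta>)"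
proof -
  obtain N where N: "\<And>z. GDERIV (\<lambda>(x, \<theta>). F x \<theta>) z :> N z"
    using C1_gradient[OF F_C1] by metis
  have "grad_x F x \<theta> = fst (N (x, \<theta>))" "grad_t F x \<theta> = snd (N (x, \<theta>))"
    unfolding grad_x_def grad_t_def using GDERIV_partial[OF N] by (auto intro!: grad_eqI)
  then show ?thesis using N[of "(x, \<theta>)"] by simp
qed

lemma G_GDERIV: "GDERIV (\<lambda>(x, \<theta>). G x \<theta>) z :> dG z"
  and dG_derivative: "(dG has_derivative ddG z) (at z)"
proof -
  obtain N N' where N: "\<And>z. GDERIV (\<lambda>(x, \<theta>). G x \<theta>) z :> N z" "\<And>z. (N has_derivative N' z) (at z)"
    using C2_gradient[OF G_C2] by metis
  have "dG z = N z" for z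
  proof -
    obtain x \<theta> where z: "z = (x, \<theta>)" by fastforce
    have "grad_x G x \<theta> = fst (N z)" "grad_t G x \<theta> = snd (N z)"
      unfolding grad_x_def grad_t_def z using GDERIV_partial[OF N(1)] by (auto intro!: grad_eqI)
    then show ?thesis by (simp add: dG_def z)
  qed
  then have eq: "dG = N" by auto
  show "GDERIV (\<lambda>(x, \<theta>). G x \<theta>) z :> dG z" using N(1) eq by simp
  show "(dG has_derivative ddG z) (at z)"
    unfolding ddG_def eq using N(2) frechet_derivative_works differentiable_def by blast
qed

lemma G_t_GDERIV: "GDERIV (G x) \<theta> :> grad_t G x \<theta>"
  using GDERIV_partial(2)[OF G_GDERIV[of "(x, \<theta>)"]] by (simp add: dG_def)

lemma ddG_linear: "linear (ddG z)"
  using dG_derivative by (rule has_derivative_linear)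

lemma ddG_symmetric: "inner u (ddG z w) = inner w (ddG z u)"
  using gradient_derivative_symmetric[OF G_GDERIV dG_derivative] .

lemma dG_derivative_theta:
  "((\<lambda>\<theta>. dG (x, \<theta>)) has_derivative (\<lambda>k. ddG (x, \<theta>) (0, k))) (at \<theta>)"
proof -
  have "((\<lambda>\<theta>. (x, \<theta>)) has_derivative (\<lambda>h. (0, h))) (at \<theta>)"
    by (auto intro!: derivative_eq_intros)
  from has_derivative_compose[OF this dG_derivative] show ?thesis .
qed

lemma hess_xt_apply: "blinfun_apply (hess_xt G x \<theta>) k = fst (ddG (x, \<theta>) (0, k))"
proof -
  have "((\<lambda>\<theta>. grad_x G x \<theta>) has_derivative (\<lambda>k. fst (ddG (x, \<theta>) (0, k)))) (at \<theta>)"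
    using has_derivative_fst[OF dG_derivative_theta] by (simp add: dG_def)
  then show ?thesis unfolding hess_xt_def by (simp add: jac_eqI)
qed

lemma Gt_derivative: "((\<lambda>\<theta>. grad_t G x \<theta>) has_derivative blinfun_apply (hess_tt G x \<theta>)) (at \<theta>)"
  and hess_tt_apply: "blinfun_apply (hess_tt G x \<theta>) k = snd (ddG (x, \<theta>) (0, k))"
proof -
  have d: "((\<lambda>\<theta>. grad_t G x \<theta>) has_derivative (\<lambda>k. snd (ddG (x, \<theta>) (0, k)))) (at \<theta>)"
    using has_derivative_snd[OF dG_derivative_theta] by (simp add: dG_def)
  then have eq: "blinfun_apply (hess_tt G x \<theta>) = (\<lambda>k. snd (ddG (x, \<theta>) (0, k)))"
    unfolding hess_tt_def by (rule jac_eqI)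
  show "blinfun_apply (hess_tt G x \<theta>) k = snd (ddG (x, \<theta>) (0, k))" using eq by simp
  show "((\<lambda>\<theta>. grad_t G x \<theta>) has_derivative blinfun_apply (hess_tt G x \<theta>)) (at \<theta>)"
    unfolding eq using d .
qed

lemma Gtx_adjoint: "inner (Gtx x \<theta> h) k = inner h (blinfun_apply (hess_xt G x \<theta>) k)"
proof -
  have "inner (Gtx x \<theta> h) k = inner (ddG (x, \<theta>) (h, 0)) (0, k)"
    by (simp add: Gtx_def inner_prod_def)
  also have "\<dots> = inner (h, 0) (ddG (x, \<theta>) (0, k))"
    by (metis ddG_symmetric inner_commute)
  finally show ?thesis by (simp add: hess_xt_apply inner_prod_def)
qed

lemma Gtx_bound: "norm (Gtx x \<theta> h) \<le> A * norm h"
proof -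
  let ?k = "Gtx x \<theta> h"
  have "norm ?k * norm ?k = inner h (blinfun_apply (hess_xt G x \<theta>) ?k)"
    by (metis Gtx_adjoint power2_eq_square power2_norm_eq_inner)
  also have "\<dots> \<le> norm h * norm (blinfun_apply (hess_xt G x \<theta>) ?k)"
    by (rule norm_cauchy_schwarz)
  also have "\<dots> \<le> norm h * (A * norm ?k)"
    by (intro mult_left_mono order_trans[OF norm_blinfun] mult_right_mono Gxt_bound) auto
  finally have "norm ?k * norm ?k \<le> (A * norm h) * norm ?k" by (simp add: mult_ac)
  then show ?thesis
    by (metis A_pos less_eq_real_def mult_nonneg_nonneg mult_right_le_imp_le norm_ge_zero)
qed

text \<open>The bound on \<open>hess_xt\<close> controls the derivative of \<open>grad_t G\<close> in \<open>x\<close> only because that derivative is its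
  transpose.\<close>

lemma Gt_lip_x: "norm (grad_t G x \<theta> - grad_t G x' \<theta>) \<le> A * norm (x - x')"
proof -
  have d: "((\<lambda>x. grad_t G x \<theta>) has_derivative Gtx x \<theta>) (at x within UNIV)" for x
  proof -
    have "((\<lambda>x. (x, \<theta>)) has_derivative (\<lambda>h. (h, 0))) (at x)"
      by (auto intro!: derivative_eq_intros)
    from has_derivative_snd[OF has_derivative_compose[OF this dG_derivative]]
    show ?thesis by (simp add: dG_def Gtx_def[abs_def])
  qed
  show ?thesis
    by (rule differentiable_bound[OF convex_UNIV d]) (auto intro: onorm_le Gtx_bound)
qed

lemma Gt_monotone: "inner (grad_t G x a - grad_t G x b) (a - b) \<ge> \<mu> * (norm (a - b))\<^sup>2"
  using strongly_convex_gradient_inequality[OF G_convex G_t_GDERIV, of x a b]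
    strongly_convex_gradient_inequality[OF G_convex G_t_GDERIV, of x b a]
  by (simp add: inner_diff_left inner_diff_right norm_minus_commute inner_commute)

lemma tst_min: "G x (tst x) \<le> G x \<theta>"
  unfolding tst_def using strongly_convex_attains_min[OF G_convex mu(1) G_t_GDERIV] .

lemma Gt_tst: "grad_t G x (tst x) = 0"
proof -
  have "(\<lambda>h. inner h (grad_t G x (tst x))) = (\<lambda>v. 0)"
    by (rule differential_zero_maxmin[OF UNIV_I open_UNIV G_t_GDERIV[unfolded gderiv_def]])
      (use tst_min in blast)
  then show ?thesis by (metis inner_eq_zero_iff)
qed

lemma strongly_monotone_norm:
  assumes "inner d e \<ge> \<mu> * (norm e)\<^sup>2" shows "\<mu> * norm e \<le> norm d"
proof (cases "e = 0")
  case False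
  have "norm e * (\<mu> * norm e) \<le> norm e * norm d"
    using assms norm_cauchy_schwarz[of d e] by (simp add: power2_eq_square mult_ac)
  then show ?thesis using False by simp
qed simp

lemma Gt_inverse_lip: "\<mu> * norm (a - b) \<le> norm (grad_t G x a - grad_t G x b)"
  using Gt_monotone by (rule strongly_monotone_norm)

text \<open>At the minimizer of \<open>G x\<close> the gradient of \<open>G x'\<close> is at most \<open>A * norm (x - x')\<close>, and a strongly monotone gradient
  of that size is near its zero.\<close>

lemma tst_lip: "norm (tst x - tst x') \<le> q * norm (x - x')"
proof -
  have "\<mu> * norm (tst x - tst x') \<le> norm (grad_t G x (tst x) - grad_t G x (tst x'))"
    by (rule Gt_inverse_lip)
  also have "\<dots> = norm (grad_t G x' (tst x') - grad_t G x (tst x'))"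
    by (simp add: Gt_tst norm_minus_commute)
  also have "\<dots> \<le> A * norm (x' - x)" by (rule Gt_lip_x)
  finally show ?thesis using mu by (simp add: q_def field_simps norm_minus_commute)
qed

lemma Gtt_coercive: "inner (blinfun_apply (hess_tt G x \<theta>) v) v \<ge> \<mu> * (norm v)\<^sup>2"
  using has_derivative_strongly_monotone[OF Gt_derivative Gt_monotone] .

lemma Gtt_bound: "norm (blinfun_apply (hess_tt G x \<theta>) v) \<le> A * norm v"
  using has_derivative_lipschitz_bound[OF Gt_derivative Gt_lip] .

lemma Gtt_lower: "\<mu> * norm v \<le> norm (blinfun_apply (hess_tt G x \<theta>) v)"
  using Gtt_coercive by (rule strongly_monotone_norm)

lemma Gtt_bij: "bij (blinfun_apply (hess_tt G x \<theta>))"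
proof -
  have lin: "linear (blinfun_apply (hess_tt G x \<theta>))" by (simp add: blinfun.bounded_linear_right bounded_linear.linear)
  have "inj (blinfun_apply (hess_tt G x \<theta>))"
    unfolding linear_injective_0[OF lin]
  proof (intro allI impI)
    fix v assume "blinfun_apply (hess_tt G x \<theta>) v = 0"
    then show "v = 0" using Gtt_lower[of v x \<theta>] mu by (simp add: mult_le_0_iff)
  qed
  then show ?thesis using lin linear_injective_imp_surjective by (auto simp: bij_def)
qed

lemma Gtt_symmetric:
  "inner u (blinfun_apply (hess_tt G x \<theta>) w) = inner w (blinfun_apply (hess_tt G x \<theta>) u)"
  using ddG_symmetric[of "(0, u)" "(x, \<theta>)" "(0, w)"] by (simp add: inner_prod_def hess_tt_apply)

lemma Gtt_vst: "blinfun_apply (hess_tt G x (tst x)) (vst x) = grad_t F x (tst x)"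
  unfolding vst_def by (rule surj_f_inv_f[OF bij_is_surj[OF Gtt_bij]])

lemma vst_bound: "norm (vst x) \<le> Mv"
proof -
  have "\<mu> * norm (vst x) \<le> \<mu> * Mv"
    using Gtt_lower[of "vst x" x "tst x"] Ft_bound[of x, folded tst_def] unfolding Gtt_vst by linarith
  then show ?thesis using mu by simp
qed

lemma Mv_q: "Mv \<le> q" using Mv_le mu by (simp add: q_def field_simps)

text \<open>The residual of the linear system for \<open>v\<close> at \<open>(x, \<theta>)\<close>, with the exact solution at \<open>x'\<close> inserted. It
  is the perturbation in \<open>v_step\<close> and, at \<open>\<theta> = tst x\<close>, gives the Lipschitz bound of
  \<open>vst\<close>.\<close>

lemma residual_bound:
  "norm (blinfun_apply (hess_tt G x \<theta>) (vst x') - grad_t F x \<theta>) \<le> 2 * A * q * (norm (x - x') + norm (\<theta> - tst x'))"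
proof -
  let ?d = "norm (x - x') + norm (\<theta> - tst x')"
  have eq: "blinfun_apply (hess_tt G x \<theta>) (vst x') - grad_t F x \<theta> =
     blinfun_apply (hess_tt G x \<theta> - hess_tt G x' (tst x')) (vst x') + (grad_t F x' (tst x') - grad_t F x \<theta>)"
    by (simp add: Gtt_vst blinfun.diff_left)
  have "norm (blinfun_apply (hess_tt G x \<theta> - hess_tt G x' (tst x')) (vst x')) \<le> (A * ?d) * q"
    by (rule order_trans[OF norm_blinfun])
      (intro mult_mono Gtt_lip order_trans[OF vst_bound Mv_q], use A_pos in auto)
  moreover have "norm (grad_t F x' (tst x') - grad_t F x \<theta>) \<le> A * ?d * q"
  proof -
    have "norm (grad_t F x' (tst x') - grad_t F x \<theta>) \<le> A * ?d"
      using Ft_lip[of x \<theta> x' "tst x'"] by (simp add: norm_minus_commute)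
    also have "\<dots> \<le> A * ?d * q" using mult_left_mono[OF q_ge1, of "A * ?d"] A_pos by simp
    finally show ?thesis .
  qed
  ultimately show ?thesis unfolding eq
    by (intro order_trans[OF norm_triangle_ineq]) (simp add: algebra_simps)
qed

lemma vst_lip: "norm (vst x - vst x') \<le> 4 * q ^ 3 * norm (x - x')"
proof -
  have "\<mu> * norm (vst x - vst x') \<le> norm (blinfun_apply (hess_tt G x (tst x)) (vst x - vst x'))"
    by (rule Gtt_lower)
  also have "\<dots> = norm (blinfun_apply (hess_tt G x (tst x)) (vst x') - grad_t F x (tst x))"
    by (simp add: blinfun.diff_right Gtt_vst norm_minus_commute)
  also have "\<dots> \<le> 2 * A * q * (norm (x - x') + norm (tst x - tst x'))"
    by (rule residual_bound)
  also have "\<dots> \<le> 2 * A * q * (q * norm (x - x') + q * norm (x - x'))"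
    using A_pos q_ge1 tst_lip[of x x'] mult_right_mono[OF q_ge1, of "norm (x - x')"]
    by (intro mult_left_mono) auto
  also have "\<dots> = (\<mu> * q) * (4 * q\<^sup>2 * norm (x - x'))"
    unfolding mu_q by (simp add: power2_eq_square)
  also have "\<dots> = \<mu> * (4 * q ^ 3 * norm (x - x'))"
    by (simp add: power2_eq_square power3_eq_cube)
  finally show ?thesis using mu by simp
qed

text \<open>The systematic error of the update direction of \<open>z\<close> as an estimate of the hypergradient.\<close>

lemma bias_bound:
  "norm (grad_x F x \<theta> - blinfun_apply (hess_xt G x \<theta>) v - hgrad x')
     \<le> 2 * A * q * (norm (x - x') + norm (\<theta> - tst x')) + A * norm (v - vst x')"
proof -
  let ?d = "norm (x - x') + norm (\<theta> - tst x')"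
  have eq: "grad_x F x \<theta> - blinfun_apply (hess_xt G x \<theta>) v - hgrad x' =
     (grad_x F x \<theta> - grad_x F x' (tst x')) - (blinfun_apply (hess_xt G x \<theta> - hess_xt G x' (tst x')) (vst x')
        + blinfun_apply (hess_xt G x \<theta>) (v - vst x'))"
    by (simp add: hgrad_def blinfun.diff_left blinfun.diff_right)
  have a: "norm (grad_x F x \<theta> - grad_x F x' (tst x')) \<le> A * ?d * q"
  proof -
    have "norm (grad_x F x \<theta> - grad_x F x' (tst x')) \<le> A * ?d" by (rule Fx_lip)
    also have "\<dots> \<le> A * ?d * q" using mult_left_mono[OF q_ge1, of "A * ?d"] A_pos by simp
    finally show ?thesis .
  qed
  have b: "norm (blinfun_apply (hess_xt G x \<theta> - hess_xt G x' (tst x')) (vst x')) \<le> A * ?d * q"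
    by (rule order_trans[OF norm_blinfun])
      (intro mult_mono Gxt_lip order_trans[OF vst_bound Mv_q], use A_pos in auto)
  have c: "norm (blinfun_apply (hess_xt G x \<theta>) (v - vst x')) \<le> A * norm (v - vst x')"
    by (rule order_trans[OF norm_blinfun]) (intro mult_right_mono Gxt_bound, auto)
  show ?thesis unfolding eq
    using norm_triangle_ineq4[of "grad_x F x \<theta> - grad_x F x' (tst x')"
        "blinfun_apply (hess_xt G x \<theta> - hess_xt G x' (tst x')) (vst x') + blinfun_apply (hess_xt G x \<theta>) (v - vst x')"]
      norm_triangle_ineq[of "blinfun_apply (hess_xt G x \<theta> - hess_xt G x' (tst x')) (vst x')"
        "blinfun_apply (hess_xt G x \<theta>) (v - vst x')"] a b c
    by (simp add: algebra_simps)
qed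

lemma hgrad_lip: "norm (hgrad x - hgrad x') \<le> 8 * A * q ^ 3 * norm (x - x')"
proof -
  have "norm (hgrad x - hgrad x') \<le> 2 * A * q * (norm (x - x') + norm (tst x - tst x')) + A * norm (vst x - vst x')"
    using bias_bound[of x "tst x" "vst x" x'] by (simp add: hgrad_def)
  also have "\<dots> \<le> 2 * A * q * (q * norm (x - x') + q * norm (x - x')) + A * (4 * q ^ 3 * norm (x - x'))"
    using A_pos q_ge1 tst_lip[of x x'] vst_lip[of x x'] mult_right_mono[OF q_ge1, of "norm (x - x')"]
    by (intro add_mono mult_left_mono) auto
  also have "\<dots> = 4 * A * norm (x - x') * q\<^sup>2 * 1 + 4 * A * q ^ 3 * norm (x - x')"
    by (simp add: power2_eq_square)
  also have "\<dots> \<le> 4 * A * norm (x - x') * q\<^sup>2 * q + 4 * A * q ^ 3 * norm (x - x')"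
    using A_pos q_ge1 by (intro add_right_mono mult_left_mono) auto
  also have "\<dots> = 8 * A * q ^ 3 * norm (x - x')"
    by (simp add: power2_eq_square power3_eq_cube)
  finally show ?thesis .
qed

text \<open>The implicit function theorem for \<open>grad_t G x (tst x) = 0\<close>. As \<open>tst\<close> is already known to be Lipschitz, the first order
  expansion of \<open>dG\<close> at \<open>(x, tst x)\<close>, solved with the invertible Hessian, is all that is needed.\<close>

lemma tst_derivative:
  "(tst has_derivative (\<lambda>h. - inv (blinfun_apply (hess_tt G x (tst x))) (Gtx x (tst x) h))) (at x)"
proof -
  let ?H = "blinfun_apply (hess_tt G x (tst x))" and ?z = "(x, tst x)"
  have linH: "linear ?H" by (simp add: blinfun.bounded_linear_right bounded_linear.linear)
  have linI: "linear (inv ?H)" by (rule inj_linear_imp_inv_linear[OF linH bij_is_inj[OF Gtt_bij]])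
  have linG: "linear (Gtx x (tst x))"
    unfolding Gtx_def[abs_def]
    by (intro linear_compose[unfolded comp_def, OF _ linear_snd] linear_compose[unfolded comp_def, OF _ ddG_linear])
       (simp add: linear_iff)
  have bl: "bounded_linear (\<lambda>h. - inv ?H (Gtx x (tst x) h))"
    unfolding linear_conv_bounded_linear[symmetric]
    using linear_compose_neg[OF linear_compose[OF linG linI]] by (simp add: comp_def)
  have "\<exists>d>0. \<forall>y. norm (y - x) < d \<longrightarrow>
      norm (tst y - tst x - - inv ?H (Gtx x (tst x) (y - x))) \<le> e * norm (y - x)" if e: "e > 0" for e
  proof -
    define e' where "e' = e * \<mu> / (1 + q)"
    have e': "e' > 0" using e mu q_ge1 by (simp add: e'_def)
    obtain d where d: "d > 0" "\<And>w. norm (w - ?z) < d \<Longrightarrow> norm (dG w - dG ?z - ddG ?z (w - ?z)) \<le> e' * norm (w - ?z)"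
      using dG_derivative[of ?z] e' unfolding has_derivative_at_alt by blast
    show ?thesis
    proof (intro exI[of _ "d / (1 + q)"] conjI allI impI)
      show "d / (1 + q) > 0" using d(1) q_ge1 by simp
      fix y assume y: "norm (y - x) < d / (1 + q)"
      let ?w = "(y, tst y)"
      define r where "r = tst y - tst x + inv ?H (Gtx x (tst x) (y - x))"
      have nw: "norm (?w - ?z) \<le> (1 + q) * norm (y - x)"
        using norm_Pair_le[of "y - x" "tst y - tst x"] tst_lip[of y x] by (simp add: algebra_simps)
      also have "\<dots> < d" using y q_ge1 by (simp add: field_simps)
      finally have small: "norm (?w - ?z) < d" .
      have "ddG ?z (?w - ?z) = ddG ?z ((y - x, 0) + (0, tst y - tst x))" by simp
      also have "\<dots> = ddG ?z (y - x, 0) + ddG ?z (0, tst y - tst x)" by (rule linear_add[OF ddG_linear])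
      finally have s: "snd (ddG ?z (?w - ?z)) = Gtx x (tst x) (y - x) + ?H (tst y - tst x)"
        by (simp add: Gtx_def hess_tt_apply)
      have Hr: "?H r = Gtx x (tst x) (y - x) + ?H (tst y - tst x)"
        unfolding r_def linear_add[OF linH] by (simp add: surj_f_inv_f[OF bij_is_surj[OF Gtt_bij]])
      have "\<mu> * norm r \<le> norm (?H r)" by (rule Gtt_lower)
      also have "?H r = - snd (dG ?w - dG ?z - ddG ?z (?w - ?z))"
        unfolding Hr snd_diff s by (simp add: dG_def Gt_tst)
      also have "norm (- snd (dG ?w - dG ?z - ddG ?z (?w - ?z))) \<le> norm (dG ?w - dG ?z - ddG ?z (?w - ?z))"
        by (metis norm_minus_cancel norm_snd_le prod.collapse)
      also have "\<dots> \<le> e' * norm (?w - ?z)" by (rule d(2)[OF small])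
      also have "\<dots> \<le> e' * ((1 + q) * norm (y - x))" using nw e' by (intro mult_left_mono) auto
      also have "\<dots> = \<mu> * (e * norm (y - x))" using q_ge1 by (simp add: e'_def)
      finally have "norm r \<le> e * norm (y - x)" using mu by simp
      then show "norm (tst y - tst x - - inv ?H (Gtx x (tst x) (y - x))) \<le> e * norm (y - x)"
        by (simp add: r_def)
    qed
  qed
  with bl show ?thesis unfolding has_derivative_at_alt by blast
qed

text \<open>The chain rule gives \<open>inner (tst' h) (grad_t F)\<close> with \<open>tst'\<close> the derivative of \<open>tst\<close>; symmetry of the
  Hessian moves its inverse onto \<open>grad_t F\<close>, which yields \<open>vst\<close>.\<close>

lemma value_GDERIV: "GDERIV (\<lambda>x. F x (tst x)) x :> hgrad x"
proof -
  let ?H = "blinfun_apply (hess_tt G x (tst x))"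
  let ?D = "\<lambda>h. - inv ?H (Gtx x (tst x) h)"
  have "((\<lambda>x. (x, tst x)) has_derivative (\<lambda>h. (h, ?D h))) (at x)"
    by (rule has_derivative_Pair[OF has_derivative_ident tst_derivative])
  from has_derivative_compose[OF this F_GDERIV[unfolded gderiv_def]]
  have "((\<lambda>x. F x (tst x)) has_derivative (\<lambda>h. inner (h, ?D h) (grad_x F x (tst x), grad_t F x (tst x)))) (at x)"
    by simp
  moreover have "inner (h, ?D h) (grad_x F x (tst x), grad_t F x (tst x)) = inner h (hgrad x)" for h
  proof -
    have "inner (inv ?H (Gtx x (tst x) h)) (grad_t F x (tst x)) = inner (vst x) (?H (inv ?H (Gtx x (tst x) h)))"
      by (metis Gtt_vst Gtt_symmetric)
    also have "\<dots> = inner (Gtx x (tst x) h) (vst x)"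
      by (simp add: surj_f_inv_f[OF bij_is_surj[OF Gtt_bij]] inner_commute)
    also have "\<dots> = inner h (blinfun_apply (hess_xt G x (tst x)) (vst x))" by (rule Gtx_adjoint)
    finally show ?thesis by (simp add: inner_prod_def hgrad_def inner_diff_right)
  qed
  ultimately show ?thesis by (simp add: gderiv_def)
qed

end

section \<open>One step of the noiseless iteration\<close>

text \<open>Young's inequality, written such that weights \<open>t\<close> and \<open>1 - t\<close> make it an instance of convexity.\<close>

lemma norm_sq_split:
  fixes a b :: "'a::real_inner"
  assumes "0 < t" "t < 1"
  shows "(norm (a + b))\<^sup>2 \<le> (norm a)\<^sup>2 / t + (norm b)\<^sup>2 / (1 - t)"
proof -
  have "0 \<le> (norm ((1 - t) *\<^sub>R a - t *\<^sub>R b))\<^sup>2" by simp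
  also have "\<dots> = (1 - t)\<^sup>2 * (norm a)\<^sup>2 + t\<^sup>2 * (norm b)\<^sup>2 - 2 * t * (1 - t) * inner a b"
    unfolding power2_norm_eq_inner
    by (simp add: inner_diff_left inner_diff_right inner_commute power2_eq_square algebra_simps)
  finally have "2 * t * (1 - t) * inner a b \<le> (1 - t)\<^sup>2 * (norm a)\<^sup>2 + t\<^sup>2 * (norm b)\<^sup>2"
    by simp
  then have "t * (1 - t) * ((norm a)\<^sup>2 + (norm b)\<^sup>2 + 2 * inner a b) \<le> (1 - t) * (norm a)\<^sup>2 + t * (norm b)\<^sup>2"
    by (simp add: algebra_simps power2_eq_square)
  moreover have "(norm (a + b))\<^sup>2 = (norm a)\<^sup>2 + (norm b)\<^sup>2 + 2 * inner a b"
    by (simp add: power2_norm_eq_inner inner_add_left inner_add_right inner_commute)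
  ultimately have "t * (1 - t) * (norm (a + b))\<^sup>2 \<le> (1 - t) * (norm a)\<^sup>2 + t * (norm b)\<^sup>2"
    by simp
  then show ?thesis using assms by (simp add: field_simps)
qed

lemma norm_sq_add_le:
  fixes a b :: "'a::real_inner"
  shows "(norm (a + b))\<^sup>2 \<le> 2 * (norm a)\<^sup>2 + 2 * (norm b)\<^sup>2"
  using norm_sq_split[of "1/2" a b] by simp

lemma norm_sq_diff_le:
  fixes a b :: "'a::real_inner"
  shows "(norm (a - b))\<^sup>2 \<le> 2 * (norm a)\<^sup>2 + 2 * (norm b)\<^sup>2"
  using norm_sq_add_le[of a "- b"] by simp

lemma norm_sq_convex:
  fixes a b :: "'a::real_inner"
  assumes "0 < t" "t < 1"
  shows "(norm ((1 - t) *\<^sub>R a + t *\<^sub>R b))\<^sup>2 \<le> (1 - t) * (norm a)\<^sup>2 + t * (norm b)\<^sup>2"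
  using norm_sq_split[of "1 - t" "(1 - t) *\<^sub>R a" "t *\<^sub>R b"] assms
  by (simp add: power_mult_distrib power2_eq_square mult_ac)

lemma sq_sum3_le: "(a + b + c)\<^sup>2 \<le> 3 * (a\<^sup>2 + b\<^sup>2 + (c::real)\<^sup>2)"
proof -
  have "3 * (a\<^sup>2 + b\<^sup>2 + c\<^sup>2) - (a + b + c)\<^sup>2 = (a - b)\<^sup>2 + (b - c)\<^sup>2 + (a - c)\<^sup>2"
    by (simp add: power2_eq_square algebra_simps)
  then show ?thesis by (smt (verit) zero_le_power2)
qed

text \<open>One gradient step with a perturbation \<open>w\<close>. The unperturbed step contracts the square by \<open>1 - a * \<mu>\<close>; half of this is given up to
  pay for \<open>w\<close>. Used for \<open>\<theta>\<close> with \<open>d\<close> a difference of gradients, and for \<open>v\<close> with \<open>d\<close> the Hessian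
  applied to the error.\<close>

lemma contractive_step:
  fixes e d w :: "'a::real_inner"
  assumes mono: "\<mu> * (norm e)\<^sup>2 \<le> inner d e" and lip: "norm d \<le> A * norm e"
    and mu: "0 < \<mu>" "\<mu> \<le> A" and a: "0 < a" "a * A\<^sup>2 \<le> \<mu>"
  shows "(norm (e - a *\<^sub>R d + w))\<^sup>2 \<le> (1 - a * \<mu> / 2) * (norm e)\<^sup>2 + 2 / (a * \<mu>) * (norm w)\<^sup>2"
proof -
  have am: "0 < a * \<mu>" using mu a by simp
  have "a * \<mu>\<^sup>2 \<le> a * A\<^sup>2" using mu a by (simp add: power_mono)
  with a(2) have "a * \<mu>\<^sup>2 \<le> \<mu>" by linarith
  then have "\<mu> * (a * \<mu>) \<le> \<mu> * 1" by (simp add: power2_eq_square mult_ac)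
  then have am1: "a * \<mu> \<le> 1" using mu by simp
  have "(norm (e - a *\<^sub>R d))\<^sup>2 = (norm e)\<^sup>2 - 2 * a * inner d e + a\<^sup>2 * (norm d)\<^sup>2"
    unfolding power2_norm_eq_inner
    by (simp add: inner_diff_left inner_diff_right inner_commute power2_eq_square algebra_simps)
  also have "\<dots> \<le> (norm e)\<^sup>2 - 2 * a * (\<mu> * (norm e)\<^sup>2) + a\<^sup>2 * (A * norm e)\<^sup>2"
    using mono lip a by (intro add_mono diff_mono mult_left_mono power_mono) auto
  also have "\<dots> = (norm e)\<^sup>2 - 2 * a * (\<mu> * (norm e)\<^sup>2) + a * (a * A\<^sup>2) * (norm e)\<^sup>2"
    by (simp add: power_mult_distrib power2_eq_square)
  also have "\<dots> \<le> (norm e)\<^sup>2 - 2 * a * (\<mu> * (norm e)\<^sup>2) + a * \<mu> * (norm e)\<^sup>2"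
    using a by (intro add_left_mono mult_right_mono mult_left_mono) auto
  finally have 1: "(norm (e - a *\<^sub>R d))\<^sup>2 \<le> (1 - a * \<mu>) * (norm e)\<^sup>2"
    by (simp add: algebra_simps)
  let ?t = "1 - a * \<mu> / 2"
  have t: "0 < ?t" "?t < 1" using am am1 by auto
  have "?t * ?t = 1 - a * \<mu> + (a * \<mu> / 2)\<^sup>2"
    by (simp add: algebra_simps power2_eq_square)
  then have "1 - a * \<mu> \<le> ?t * ?t" by simp
  then have 2: "(1 - a * \<mu>) / ?t \<le> ?t" using t by (simp add: pos_divide_le_eq)
  have "(norm (e - a *\<^sub>R d + w))\<^sup>2 \<le> (norm (e - a *\<^sub>R d))\<^sup>2 / ?t + (norm w)\<^sup>2 / (1 - ?t)"
    using t by (rule norm_sq_split)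
  also have "(norm (e - a *\<^sub>R d))\<^sup>2 / ?t \<le> (1 - a * \<mu>) * (norm e)\<^sup>2 / ?t"
    using 1 t by (simp add: divide_right_mono)
  also have "(1 - a * \<mu>) * (norm e)\<^sup>2 / ?t = (1 - a * \<mu>) / ?t * (norm e)\<^sup>2" by simp
  also have "\<dots> \<le> ?t * (norm e)\<^sup>2" using 2 by (rule mult_right_mono) simp
  also have "(norm w)\<^sup>2 / (1 - ?t) = 2 / (a * \<mu>) * (norm w)\<^sup>2" by simp
  finally show ?thesis by simp
qed

lemma power2_norm_le:
  assumes "norm a \<le> b" shows "(norm a)\<^sup>2 \<le> b\<^sup>2"
  using assms by (simp add: power_mono)

context bilevel_node
begin

text \<open>In the following two lemmas \<open>y\<close> is the old and \<open>y'\<close> the new average, while the gradients are evaluated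
  at the local \<open>x\<close>.\<close>

lemma theta_step:
  assumes a: "0 < a" "a * A\<^sup>2 \<le> \<mu>"
  shows "(norm (\<theta> - a *\<^sub>R grad_t G x \<theta> - tst y'))\<^sup>2 \<le> (1 - a * \<mu> / 2) * (norm (\<theta> - tst y))\<^sup>2
      + 4 * a / \<mu> * A\<^sup>2 * (norm (x - y))\<^sup>2 + 4 / (a * \<mu>) * q\<^sup>2 * (norm (y' - y))\<^sup>2"
proof -
  let ?e = "\<theta> - tst y" and ?d = "grad_t G y \<theta> - grad_t G y (tst y)"
  let ?w1 = "a *\<^sub>R (grad_t G y \<theta> - grad_t G x \<theta>)" and ?w2 = "tst y - tst y'"
  have eq: "\<theta> - a *\<^sub>R grad_t G x \<theta> - tst y' = ?e - a *\<^sub>R ?d + (?w1 + ?w2)"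
    by (simp add: Gt_tst algebra_simps)
  have "(norm (\<theta> - a *\<^sub>R grad_t G x \<theta> - tst y'))\<^sup>2
      \<le> (1 - a * \<mu> / 2) * (norm ?e)\<^sup>2 + 2 / (a * \<mu>) * (norm (?w1 + ?w2))\<^sup>2"
    unfolding eq by (rule contractive_step[OF Gt_monotone Gt_lip mu(1,2) a])
  also have "2 / (a * \<mu>) * (norm (?w1 + ?w2))\<^sup>2 \<le> 2 / (a * \<mu>) * (2 * (a * (A * norm (x - y)))\<^sup>2 + 2 * (q * norm (y' - y))\<^sup>2)"
  proof (rule mult_left_mono)
    have "norm ?w1 \<le> a * (A * norm (x - y))"
      using Gt_lip_x[of y \<theta> x] a by (simp add: norm_minus_commute)
    moreover have "norm ?w2 \<le> q * norm (y' - y)"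
      using tst_lip[of y y'] by (simp add: norm_minus_commute)
    ultimately show "(norm (?w1 + ?w2))\<^sup>2 \<le> 2 * (a * (A * norm (x - y)))\<^sup>2 + 2 * (q * norm (y' - y))\<^sup>2"
      using norm_sq_add_le[of ?w1 ?w2] by (smt (verit) power2_norm_le)
  qed (use a mu in simp)
  also have "2 / (a * \<mu>) * (2 * (a * (A * norm (x - y)))\<^sup>2 + 2 * (q * norm (y' - y))\<^sup>2)
      = 4 * a / \<mu> * A\<^sup>2 * (norm (x - y))\<^sup>2 + 4 / (a * \<mu>) * q\<^sup>2 * (norm (y' - y))\<^sup>2"
    using a mu by (simp add: power_mult_distrib power2_eq_square field_simps)
  finally show ?thesis by simp
qed

lemma v_step:
  assumes a: "0 < a" "a * A\<^sup>2 \<le> \<mu>"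
  shows "(norm (v - a *\<^sub>R (blinfun_apply (hess_tt G x \<theta>) v - grad_t F x \<theta>) - vst y'))\<^sup>2
    \<le> (1 - a * \<mu> / 2) * (norm (v - vst y))\<^sup>2
      + 32 * a * A\<^sup>2 * q\<^sup>2 / \<mu> * ((norm (x - y))\<^sup>2 + (norm (\<theta> - tst y))\<^sup>2)
      + 64 * q ^ 6 / (a * \<mu>) * (norm (y' - y))\<^sup>2"
proof -
  let ?H = "blinfun_apply (hess_tt G x \<theta>)"
  let ?e = "v - vst y" and ?r = "?H (vst y) - grad_t F x \<theta>"
  let ?w1 = "a *\<^sub>R (- ?r)" and ?w2 = "vst y - vst y'"
  let ?X = "norm (x - y)" and ?T = "norm (\<theta> - tst y)" and ?Y = "norm (y' - y)"
  have eq: "v - a *\<^sub>R (?H v - grad_t F x \<theta>) - vst y' = ?e - a *\<^sub>R ?H ?e + (?w1 + ?w2)"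
    by (simp add: blinfun.diff_right algebra_simps)
  have "(norm (v - a *\<^sub>R (?H v - grad_t F x \<theta>) - vst y'))\<^sup>2
      \<le> (1 - a * \<mu> / 2) * (norm ?e)\<^sup>2 + 2 / (a * \<mu>) * (norm (?w1 + ?w2))\<^sup>2"
    unfolding eq by (rule contractive_step[OF Gtt_coercive Gtt_bound mu(1,2) a])
  also have "2 / (a * \<mu>) * (norm (?w1 + ?w2))\<^sup>2
      \<le> 2 / (a * \<mu>) * (16 * a\<^sup>2 * A\<^sup>2 * q\<^sup>2 * (?X\<^sup>2 + ?T\<^sup>2) + 32 * q ^ 6 * ?Y\<^sup>2)"
  proof (rule mult_left_mono)
    have "norm ?w1 \<le> a * (2 * A * q * (?X + ?T))"
      using residual_bound[of x \<theta> y] a by (simp add: norm_minus_commute)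
    from power2_norm_le[OF this] have "(norm ?w1)\<^sup>2 \<le> 4 * a\<^sup>2 * A\<^sup>2 * q\<^sup>2 * (?X + ?T)\<^sup>2"
      by (simp add: power_mult_distrib)
    also have "\<dots> \<le> 4 * a\<^sup>2 * A\<^sup>2 * q\<^sup>2 * (2 * (?X\<^sup>2 + ?T\<^sup>2))"
      using sum_squares_bound[of ?X ?T] by (intro mult_left_mono) (auto simp: power2_sum)
    also have "\<dots> = 8 * a\<^sup>2 * A\<^sup>2 * q\<^sup>2 * (?X\<^sup>2 + ?T\<^sup>2)" by (simp add: algebra_simps)
    finally have 1: "(norm ?w1)\<^sup>2 \<le> 8 * a\<^sup>2 * A\<^sup>2 * q\<^sup>2 * (?X\<^sup>2 + ?T\<^sup>2)" .
    have "norm ?w2 \<le> 4 * q ^ 3 * ?Y"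
      using vst_lip[of y y'] by (simp add: norm_minus_commute)
    from power2_norm_le[OF this] have "(norm ?w2)\<^sup>2 \<le> 16 * q ^ 6 * ?Y\<^sup>2"
      by (simp add: power_mult_distrib power_mult[symmetric])
    with 1 show "(norm (?w1 + ?w2))\<^sup>2 \<le> 16 * a\<^sup>2 * A\<^sup>2 * q\<^sup>2 * (?X\<^sup>2 + ?T\<^sup>2) + 32 * q ^ 6 * ?Y\<^sup>2"
      using norm_sq_add_le[of ?w1 ?w2] by linarith
  qed (use a mu in simp)
  also have "2 / (a * \<mu>) * (16 * a\<^sup>2 * A\<^sup>2 * q\<^sup>2 * (?X\<^sup>2 + ?T\<^sup>2) + 32 * q ^ 6 * ?Y\<^sup>2)
      = 32 * a * A\<^sup>2 * q\<^sup>2 / \<mu> * (?X\<^sup>2 + ?T\<^sup>2) + 64 * q ^ 6 / (a * \<mu>) * ?Y\<^sup>2"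
    using a mu by (simp add: power2_eq_square field_simps)
  finally show ?thesis by simp
qed

lemma bias_sq_bound:
  "(norm (hgrad y - (grad_x F x \<theta> - blinfun_apply (hess_xt G x \<theta>) v)))\<^sup>2
     \<le> 12 * A\<^sup>2 * q\<^sup>2 * ((norm (x - y))\<^sup>2 + (norm (\<theta> - tst y))\<^sup>2) + 3 * A\<^sup>2 * (norm (v - vst y))\<^sup>2"
proof -
  have "norm (hgrad y - (grad_x F x \<theta> - blinfun_apply (hess_xt G x \<theta>) v))
    \<le> 2 * A * q * norm (x - y) + 2 * A * q * norm (\<theta> - tst y) + A * norm (v - vst y)"
    using bias_bound[of x \<theta> v y] by (simp add: norm_minus_commute algebra_simps)
  from power2_norm_le[OF this]
  show ?thesis
    by (rule order_trans) (rule order_trans[OF sq_sum3_le], simp add: power_mult_distrib algebra_simps)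
qed

end

section \<open>Gossip averaging\<close>

lemma node_avg_const: "m \<ge> 1 \<Longrightarrow> node_avg m (\<lambda>_. a) = a"
  by (simp add: node_avg_def sum_constant_scaleR)

lemma node_avg_inner: "inner a (node_avg m h) = node_avg m (\<lambda>i. inner a (h i))"
  by (simp add: node_avg_def inner_sum_right)

lemma node_avg_diff: "node_avg m (\<lambda>i. a i - b i) = node_avg m a - node_avg m b"
  by (simp add: node_avg_def sum_subtractf scaleR_diff_right)

lemma node_avg_add: "node_avg m (\<lambda>i. a i + b i) = node_avg m a + node_avg m b"
  by (simp add: node_avg_def sum.distrib scaleR_add_right)

lemma node_avg_scaleR: "node_avg m (\<lambda>i. r *\<^sub>R a i) = r *\<^sub>R node_avg m a"
  by (simp add: node_avg_def scaleR_sum_right[symmetric])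

lemma node_avg_mult: "node_avg m (\<lambda>i. r * (a i::real)) = r * node_avg m a"
  using node_avg_scaleR[of m r a] by simp

lemma node_avg_mono: "(\<And>i. i \<in> {1..m} \<Longrightarrow> a i \<le> (b i::real)) \<Longrightarrow> node_avg m a \<le> node_avg m b"
  unfolding node_avg_def by (auto intro!: scaleR_left_mono sum_mono divide_right_mono)

lemma node_avg_cong: "(\<And>i. i \<in> {1..m} \<Longrightarrow> a i = b i) \<Longrightarrow> node_avg m a = node_avg m b"
  unfolding node_avg_def by (metis (no_types, lifting) sum.cong)

lemma node_avg_nonneg: "(\<And>i. i \<in> {1..m} \<Longrightarrow> 0 \<le> (a i::real)) \<Longrightarrow> 0 \<le> node_avg m a"
  unfolding node_avg_def by (auto intro!: sum_nonneg divide_nonneg_nonneg)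

lemma sum_norm_sq_diff_avg:
  fixes a :: "nat \<Rightarrow> 'a::real_inner"
  assumes "m \<ge> 1"
  shows "(\<Sum>i=1..m. (norm (a i - c))\<^sup>2) = (\<Sum>i=1..m. (norm (a i - node_avg m a))\<^sup>2) + real m * (norm (node_avg m a - c))\<^sup>2"
proof -
  let ?b = "node_avg m a"
  have s: "(\<Sum>i=1..m. a i) = real m *\<^sub>R ?b" using assms by (simp add: node_avg_def)
  have "(norm (a i - c))\<^sup>2 = (norm (a i - ?b))\<^sup>2 + (norm (?b - c))\<^sup>2 + 2 * inner (a i - ?b) (?b - c)" for i
    by (simp add: power2_norm_eq_inner inner_diff_left inner_diff_right inner_commute)
  then have "(\<Sum>i=1..m. (norm (a i - c))\<^sup>2) = (\<Sum>i=1..m. (norm (a i - ?b))\<^sup>2) + real m * (norm (?b - c))\<^sup>2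
      + 2 * inner (\<Sum>i=1..m. a i - ?b) (?b - c)"
    by (simp add: sum.distrib sum_distrib_left inner_sum_left)
  moreover have "(\<Sum>i=1..m. a i - ?b) = 0"
    unfolding sum_subtractf s by (simp add: sum_constant_scaleR)
  ultimately show ?thesis by simp
qed

lemma sum_norm_sq_diff_avg_le:
  fixes a :: "nat \<Rightarrow> 'a::real_inner"
  assumes "m \<ge> 1"
  shows "(\<Sum>i=1..m. (norm (a i - node_avg m a))\<^sup>2) \<le> (\<Sum>i=1..m. (norm (a i - c))\<^sup>2)"
  using sum_norm_sq_diff_avg[OF assms, of a c] by simp

lemma norm_node_avg_sq_le:
  fixes a :: "nat \<Rightarrow> 'a::real_inner"
  assumes "m \<ge> 1"
  shows "(norm (node_avg m a))\<^sup>2 \<le> node_avg m (\<lambda>i. (norm (a i))\<^sup>2)"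
proof -
  have "real m * (norm (node_avg m a))\<^sup>2 \<le> (\<Sum>i=1..m. (norm (a i))\<^sup>2)"
    using sum_norm_sq_diff_avg[OF assms, of a 0] sum_nonneg[of "{1..m}" "\<lambda>i. (norm (a i - node_avg m a))\<^sup>2"]
    by simp
  then show ?thesis using assms by (simp add: node_avg_def field_simps)
qed

lemma spectral_norm_bound:
  "L2_set (\<lambda>i. \<Sum>j=1..m. D i j * u j) {1..m} \<le> spectral_norm m D * L2_set u {1..m}"
proof -
  let ?S = "{u. L2_set u {1..m} \<le> 1}" and ?T = "\<lambda>u i. \<Sum>j=1..m. D i j * u j"
  have bdd: "bdd_above ((\<lambda>u. L2_set (?T u) {1..m}) ` ?S)"
  proof (rule bdd_aboveI2)
    fix u :: "nat \<Rightarrow> real" assume u: "u \<in> ?S"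
    have "L2_set (?T u) {1..m} \<le> (\<Sum>i=1..m. \<bar>?T u i\<bar>)" by (rule L2_set_le_sum_abs)
    also have "\<dots> \<le> (\<Sum>i=1..m. \<Sum>j=1..m. \<bar>D i j\<bar>)"
    proof (rule sum_mono, rule order_trans[OF sum_abs], rule sum_mono)
      fix i j assume j: "j \<in> {1..m}"
      have "\<bar>u j\<bar> \<le> L2_set (\<lambda>i. \<bar>u i\<bar>) {1..m}" using j by (intro member_le_L2_set) auto
      also have "\<dots> \<le> 1" using u by (simp add: L2_set_def)
      finally show "\<bar>D i j * u j\<bar> \<le> \<bar>D i j\<bar>" by (simp add: abs_mult mult_left_le)
    qed
    finally show "L2_set (?T u) {1..m} \<le> (\<Sum>i=1..m. \<Sum>j=1..m. \<bar>D i j\<bar>)" .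
  qed
  show ?thesis
  proof (cases "L2_set u {1..m} = 0")
    case True
    then have "\<forall>j\<in>{1..m}. u j = 0" by (simp add: L2_set_eq_0_iff)
    then have "L2_set (?T u) {1..m} = L2_set (\<lambda>_. 0) {1..m}" by (intro L2_set_cong) auto
    with True show ?thesis by (simp add: L2_set_def)
  next
    case False
    define l where "l = L2_set u {1..m}"
    have l: "l > 0" using False by (simp add: l_def less_le)
    have "L2_set (\<lambda>j. u j / l) {1..m} = 1"
      using L2_set_right_distrib[of "1 / l" u "{1..m}"] l by (simp add: l_def)
    then have "L2_set (?T (\<lambda>j. u j / l)) {1..m} \<le> spectral_norm m D"
      unfolding spectral_norm_def by (intro cSUP_upper2[OF _ _ order_refl] bdd) simp
    moreover have "L2_set (?T (\<lambda>j. u j / l)) {1..m} = L2_set (?T u) {1..m} / l"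
      using L2_set_right_distrib[of "1 / l" "?T u" "{1..m}"] l by (simp add: sum_divide_distrib)
    ultimately have "L2_set (?T u) {1..m} / l \<le> spectral_norm m D" by (simp only:)
    then show ?thesis unfolding l_def[symmetric] by (simp only: pos_divide_le_eq[OF l])
  qed
qed

text \<open>The spectral norm bounds \<open>W - 1/m\<close> on scalar vectors; it acts on each coordinate separately.\<close>

lemma gossip_contraction:
  fixes x :: "nat \<Rightarrow> 'a::euclidean_space"
  shows "(\<Sum>i=1..m. (norm (\<Sum>j=1..m. (W i j - 1 / real m) *\<^sub>R x j))\<^sup>2) \<le> rho m W * (\<Sum>i=1..m. (norm (x i))\<^sup>2)"
proof -
  let ?D = "\<lambda>i j. W i j - 1 / real m"
  have b: "(\<Sum>i=1..m. (\<Sum>j=1..m. ?D i j * u j)\<^sup>2) \<le> rho m W * (\<Sum>i=1..m. (u i)\<^sup>2)" for u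
  proof -
    have "(L2_set (\<lambda>i. \<Sum>j=1..m. ?D i j * u j) {1..m})\<^sup>2 \<le> (spectral_norm m ?D * L2_set u {1..m})\<^sup>2"
      by (rule power_mono[OF spectral_norm_bound]) simp
    then show ?thesis by (simp add: power_mult_distrib rho_def L2_set_def sum_nonneg)
  qed
  have n: "(norm z)\<^sup>2 = (\<Sum>b\<in>Basis. (inner z b)\<^sup>2)" for z :: 'a
    unfolding power2_norm_eq_inner by (subst euclidean_inner) (simp add: power2_eq_square)
  have "(\<Sum>i=1..m. (norm (\<Sum>j=1..m. ?D i j *\<^sub>R x j))\<^sup>2)
      = (\<Sum>b\<in>Basis. \<Sum>i=1..m. (\<Sum>j=1..m. ?D i j * inner (x j) b)\<^sup>2)"
    unfolding n by (subst sum.swap) (simp add: inner_sum_left)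
  also have "\<dots> \<le> (\<Sum>b\<in>Basis. rho m W * (\<Sum>i=1..m. (inner (x i) b)\<^sup>2))"
    by (rule sum_mono) (rule b)
  also have "\<dots> = rho m W * (\<Sum>i=1..m. (norm (x i))\<^sup>2)"
    unfolding n by (simp add: sum_distrib_left[symmetric]) (subst sum.swap, simp)
  finally show ?thesis .
qed

lemma network_neighbour_sum:
  fixes x :: "nat \<Rightarrow> 'a::real_vector"
  assumes "network m E W" "i \<in> {1..m}"
  shows "(\<Sum>j | (i, j) \<in> E. W i j *\<^sub>R x j) = (\<Sum>j=1..m. W i j *\<^sub>R x j)"
proof -
  have E: "{j. (i, j) \<in> E} \<subseteq> {1..m}" using assms unfolding network_def by auto
  have "W i j = 0" if "j \<in> {1..m} - {j. (i, j) \<in> E}" for j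
    using assms that unfolding network_def by blast
  then show ?thesis
    by (intro sum.mono_neutral_left E) auto
qed

text \<open>On deviations from the average \<open>W\<close> acts as \<open>W - 1/m\<close>, which contracts squared norms by \<open>r\<close>. Splitting with weights
  \<open>(1 + r) / 2\<close> and \<open>(1 - r) / 2\<close> uses \<open>r / ((1 + r) / 2) \<le> (1 + r) / 2\<close>, and leaves half of the gap
  \<open>1 - r\<close>.\<close>

lemma consensus_step:
  fixes x z :: "nat \<Rightarrow> 'a::euclidean_space"
  assumes net: "network m E W" and m: "m \<ge> 1" and rho: "rho m W \<le> r" "0 \<le> r" "r < 1"
    and t: "0 < t" "t < 1"
    and x': "\<And>i. i \<in> {1..m} \<Longrightarrow> x' i = (1 - t) *\<^sub>R x i + t *\<^sub>R ((\<Sum>j | (i, j) \<in> E. W i j *\<^sub>R x j) - a *\<^sub>R z i)"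
  shows "node_avg m x' = node_avg m x - (t * a) *\<^sub>R node_avg m z"
    and "(\<Sum>i=1..m. (norm (x' i - node_avg m x'))\<^sup>2)
      \<le> (1 - t * (1 - r) / 2) * (\<Sum>i=1..m. (norm (x i - node_avg m x))\<^sup>2)
        + 2 * t * a\<^sup>2 / (1 - r) * (\<Sum>i=1..m. (norm (z i - node_avg m z))\<^sup>2)"
proof -
  let ?b = "node_avg m x" and ?zb = "node_avg m z"
  have x'': "x' i = (1 - t) *\<^sub>R x i + t *\<^sub>R ((\<Sum>j=1..m. W i j *\<^sub>R x j) - a *\<^sub>R z i)" if "i \<in> {1..m}" for i
    using x'[OF that] unfolding network_neighbour_sum[OF net that] .
  have row: "(\<Sum>j=1..m. W i j) = 1" and col: "(\<Sum>j=1..m. W j i) = 1" if "i \<in> {1..m}" for i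
    using net that unfolding network_def by auto
  have "(\<Sum>i=1..m. \<Sum>j=1..m. W i j *\<^sub>R x j) = (\<Sum>j=1..m. (\<Sum>i=1..m. W i j) *\<^sub>R x j)"
    by (subst sum.swap) (simp add: scaleR_sum_left)
  also have "\<dots> = (\<Sum>j=1..m. x j)" using col by (intro sum.cong) auto
  finally have wsum: "node_avg m (\<lambda>i. \<Sum>j=1..m. W i j *\<^sub>R x j) = ?b" by (simp add: node_avg_def)
  have "node_avg m x' = node_avg m (\<lambda>i. (1 - t) *\<^sub>R x i + t *\<^sub>R ((\<Sum>j=1..m. W i j *\<^sub>R x j) - a *\<^sub>R z i))"
    by (rule node_avg_cong[OF x''])
  also have "\<dots> = (1 - t) *\<^sub>R ?b + t *\<^sub>R (?b - a *\<^sub>R ?zb)"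
    by (simp only: node_avg_add node_avg_scaleR node_avg_diff wsum)
  finally show avg: "node_avg m x' = node_avg m x - (t * a) *\<^sub>R node_avg m z"
    by (simp add: algebra_simps)
  define e where "e i = x i - ?b" for i
  define w where "w i = (\<Sum>j=1..m. (W i j - 1 / real m) *\<^sub>R e j)" for i
  define zc where "zc i = z i - ?zb" for i
  have esum: "(\<Sum>j=1..m. e j) = 0"
    using m by (simp add: e_def sum_subtractf node_avg_def sum_constant_scaleR)
  have weq: "w i = (\<Sum>j=1..m. W i j *\<^sub>R x j) - ?b" if "i \<in> {1..m}" for i
  proof -
    have "w i = (\<Sum>j=1..m. W i j *\<^sub>R e j) - (1 / real m) *\<^sub>R (\<Sum>j=1..m. e j)"
      by (simp add: w_def scaleR_diff_left sum_subtractf scaleR_sum_right)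
    also have "\<dots> = (\<Sum>j=1..m. W i j *\<^sub>R x j) - (\<Sum>j=1..m. W i j) *\<^sub>R ?b"
      unfolding esum by (simp add: e_def scaleR_diff_right sum_subtractf scaleR_sum_left)
    finally show ?thesis using row[OF that] by simp
  qed
  have step: "(norm (x' i - node_avg m x'))\<^sup>2 \<le> (1 - t) * (norm (e i))\<^sup>2
      + t * ((norm (w i))\<^sup>2 / ((1 + r) / 2) + a\<^sup>2 * (norm (zc i))\<^sup>2 / ((1 - r) / 2))" if i: "i \<in> {1..m}" for i
  proof -
    have "x' i - node_avg m x' = (1 - t) *\<^sub>R e i + t *\<^sub>R (w i + (- a) *\<^sub>R zc i)"
      unfolding avg x''[OF i] weq[OF i] e_def zc_def by (simp add: algebra_simps)
    then have "(norm (x' i - node_avg m x'))\<^sup>2 \<le> (1 - t) * (norm (e i))\<^sup>2 + t * (norm (w i + (- a) *\<^sub>R zc i))\<^sup>2"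
      using norm_sq_convex[OF t, of "e i" "w i + (- a) *\<^sub>R zc i"] by simp
    also have "(norm (w i + (- a) *\<^sub>R zc i))\<^sup>2 \<le> (norm (w i))\<^sup>2 / ((1 + r) / 2) + (norm ((- a) *\<^sub>R zc i))\<^sup>2 / (1 - (1 + r) / 2)"
      using rho by (intro norm_sq_split) auto
    also have "(norm ((- a) *\<^sub>R zc i))\<^sup>2 / (1 - (1 + r) / 2) = a\<^sup>2 * (norm (zc i))\<^sup>2 / ((1 - r) / 2)"
    proof -
      have eq: "1 - (1 + r) / 2 = (1 - r) / 2" by (simp add: field_simps)
      show ?thesis unfolding eq by (simp add: power_mult_distrib)
    qed
    finally show ?thesis using t by simp
  qed
  let ?E = "\<Sum>i=1..m. (norm (e i))\<^sup>2" and ?Z = "\<Sum>i=1..m. (norm (zc i))\<^sup>2" and ?Wn = "\<Sum>i=1..m. (norm (w i))\<^sup>2"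
  have "?Wn \<le> rho m W * ?E" unfolding w_def by (rule gossip_contraction)
  also have "\<dots> \<le> r * ?E" using rho by (intro mult_right_mono sum_nonneg) auto
  finally have wb: "?Wn \<le> r * ?E" .
  have "(\<Sum>i=1..m. (norm (x' i - node_avg m x'))\<^sup>2) \<le> (\<Sum>i=1..m. (1 - t) * (norm (e i))\<^sup>2
      + t * ((norm (w i))\<^sup>2 / ((1 + r) / 2) + a\<^sup>2 * (norm (zc i))\<^sup>2 / ((1 - r) / 2)))"
    by (rule sum_mono) (rule step)
  also have "\<dots> = (1 - t) * ?E + t * (?Wn / ((1 + r) / 2) + a\<^sup>2 * ?Z / ((1 - r) / 2))"
    by (simp add: sum.distrib sum_distrib_left sum_divide_distrib distrib_left mult_ac)
  also have "\<dots> \<le> (1 - t) * ?E + t * ((1 - (1 - r) / 2) * ?E + a\<^sup>2 * ?Z / ((1 - r) / 2))"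
  proof -
    have "((1 + r) / 2) * ((1 + r) / 2) - r = ((1 - r) / 2)\<^sup>2"
      by (simp add: power2_eq_square field_simps)
    then have "r \<le> ((1 + r) / 2) * ((1 + r) / 2)"
      by (metis diff_ge_0_iff_ge zero_le_power2)
    then have "r / ((1 + r) / 2) \<le> (1 + r) / 2"
      using rho(2) by (subst pos_divide_le_eq) auto
    also have "(1 + r) / 2 = 1 - (1 - r) / 2" by (simp add: field_simps)
    finally have "r / ((1 + r) / 2) \<le> 1 - (1 - r) / 2" .
    then have "r / ((1 + r) / 2) * ?E \<le> (1 - (1 - r) / 2) * ?E" by (intro mult_right_mono sum_nonneg) auto
    moreover have "?Wn / ((1 + r) / 2) \<le> r / ((1 + r) / 2) * ?E"
      using divide_right_mono[OF wb, of "(1 + r) / 2"] rho(2) by (simp add: mult_ac)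
    ultimately show ?thesis using t by (intro add_left_mono mult_left_mono add_right_mono) auto
  qed
  also have "\<dots> = (1 - t * (1 - r) / 2) * ?E + 2 * t * a\<^sup>2 / (1 - r) * ?Z"
    by (simp add: algebra_simps)
  finally show "(\<Sum>i=1..m. (norm (x' i - node_avg m x'))\<^sup>2)
      \<le> (1 - t * (1 - r) / 2) * (\<Sum>i=1..m. (norm (x i - node_avg m x))\<^sup>2)
        + 2 * t * a\<^sup>2 / (1 - r) * (\<Sum>i=1..m. (norm (z i - node_avg m z))\<^sup>2)"
    unfolding e_def zc_def .
qed

section \<open>The distributed problem\<close>

lemma sq_sum5_le: "(a + b + c + d + e)\<^sup>2 \<le> 5 * (a\<^sup>2 + b\<^sup>2 + c\<^sup>2 + d\<^sup>2 + (e::real)\<^sup>2)"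
proof -
  have "5 * (a\<^sup>2 + b\<^sup>2 + c\<^sup>2 + d\<^sup>2 + e\<^sup>2) - (a + b + c + d + e)\<^sup>2 =
    (a - b)\<^sup>2 + (a - c)\<^sup>2 + (a - d)\<^sup>2 + (a - e)\<^sup>2 + (b - c)\<^sup>2 + (b - d)\<^sup>2 + (b - e)\<^sup>2
    + (c - d)\<^sup>2 + (c - e)\<^sup>2 + (d - e)\<^sup>2"
    by (simp add: power2_eq_square algebra_simps)
  also have "\<dots> \<ge> 0" by (intro add_nonneg_nonneg zero_le_power2)
  finally show ?thesis by simp
qed

definition const_sum :: "fun_consts \<Rightarrow> real \<Rightarrow> real" where
  "const_sum c Lc = 1 + L_fx c + L_ft c + C_ft c + L_gt c + L_gxt c + L_gtt c + C_gxt c + Lc"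

lemma norm_diff_via: "norm (a - c) \<le> norm (a - b) + norm (b - c)"
  using dist_triangle[of a c b] by (simp add: dist_norm)

lemma lipschitz_on_UNIV_norm:
  "L-lipschitz_on UNIV h \<Longrightarrow> norm (h a - h b) \<le> L * norm (a - b)"
  using lipschitz_onD[of L UNIV h a b] by (simp add: dist_norm)

text \<open>Strong monotonicity and the Lipschitz bound along one basis vector. A larger \<open>\<mu>\<close> is thus
  impossible, and \<open>q \<ge> 1\<close> for every problem.\<close>

lemma inner_assumption_mu_le:
  fixes P :: "('x::euclidean_space, 'y::euclidean_space, 's) bilevel"
  assumes inner: "inner_assumption P c \<mu>" and "nodes P \<ge> 1"
  shows "\<mu> \<le> L_gt c"
proof -
  have "1 \<in> V P" using assms(2) by simp
  then have cvx: "strongly_convex \<mu> (g P 1 x)" and C2: "C2 (\<lambda>(x, \<theta>). g P 1 x \<theta>)"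
    and lip: "(L_gt c)-lipschitz_on UNIV (\<lambda>\<theta>. grad_t (g P 1) x \<theta>)" for x
    using inner unfolding inner_assumption_def by blast+
  have gd: "GDERIV (g P 1 0) \<theta> :> grad_t (g P 1) 0 \<theta>" for \<theta>
  proof -
    obtain N where N: "\<And>z. GDERIV (\<lambda>(x, \<theta>). g P 1 x \<theta>) z :> N z"
      using C2_gradient[OF C2] by metis
    from GDERIV_partial(2)[OF N, of 0 \<theta>] show ?thesis
      unfolding grad_t_def using grad_eqI by metis
  qed
  obtain b :: 'y where b: "b \<in> Basis" using nonempty_Basis by blast
  have "\<mu> \<le> inner (grad_t (g P 1) 0 b - grad_t (g P 1) 0 0) b"
    using strongly_convex_gradient_inequality[OF cvx[of 0] gd[of 0], of b]
      strongly_convex_gradient_inequality[OF cvx[of 0] gd[of b], of 0] b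
    by (simp add: inner_diff_left inner_diff_right inner_commute)
  also have "\<dots> \<le> norm (grad_t (g P 1) 0 b - grad_t (g P 1) 0 0) * norm b" by (rule norm_cauchy_schwarz)
  also have "\<dots> \<le> L_gt c" using lipschitz_on_UNIV_norm[OF lip, of 0 b 0] b by simp
  finally show ?thesis .
qed

locale bilevel_problem =
  fixes P :: "('x::euclidean_space, 'y::euclidean_space, 's) bilevel"
    and c :: fun_consts and Lc \<mu> bf bg :: real
  assumes pos_c: "positive_consts c" and Lc: "Lc > 0" and mu0: "\<mu> > 0"
    and nodes1: "nodes P \<ge> 1"
    and outer: "outer_assumption P c" and cross: "cross_lipschitz P Lc"
    and inner: "inner_assumption P c \<mu>" and het: "heterogeneity P bf bg"
begin

definition "A = const_sum c Lc"
definition "m = nodes P"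
definition "q = A / \<mu>"
definition "gP i = grad (Phi_i P i)"
definition "gPhi = grad (Phi P)"

lemma m1: "1 \<le> m" using nodes1 by (simp add: m_def)

lemma A_ge: "L_fx c \<le> A" "L_ft c \<le> A" "C_ft c \<le> A" "L_gt c \<le> A" "L_gxt c \<le> A" "L_gtt c \<le> A" "C_gxt c \<le> A" "Lc \<le> A" "1 \<le> A"
  using pos_c Lc by (simp_all add: A_def const_sum_def positive_consts_def)

lemma mu_le: "\<mu> \<le> L_gt c" "\<mu> \<le> A"
  using inner_assumption_mu_le[OF inner nodes1] A_ge(4) by auto

lemma q1: "1 \<le> q" using mu_le mu0 by (simp add: q_def)

lemma two_block_lipschitz:
  fixes h :: "'x \<Rightarrow> 'y \<Rightarrow> 'z::real_normed_vector"
  assumes "\<And>\<theta>. L1-lipschitz_on UNIV (\<lambda>x. h x \<theta>)" "\<And>x. L2-lipschitz_on UNIV (\<lambda>\<theta>. h x \<theta>)" "L1 \<le> L" "L2 \<le> L"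
  shows "norm (h x \<theta> - h x' \<theta>') \<le> L * (norm (x - x') + norm (\<theta> - \<theta>'))"
proof -
  have "norm (h x \<theta> - h x' \<theta>') \<le> norm (h x \<theta> - h x' \<theta>) + norm (h x' \<theta> - h x' \<theta>')"
    by (rule norm_diff_via)
  also have "\<dots> \<le> L1 * norm (x - x') + L2 * norm (\<theta> - \<theta>')"
    by (intro add_mono lipschitz_on_UNIV_norm[OF assms(1)] lipschitz_on_UNIV_norm[OF assms(2)])
  also have "\<dots> \<le> L * norm (x - x') + L * norm (\<theta> - \<theta>')"
    using assms(3,4) by (intro add_mono mult_right_mono) auto
  finally show ?thesis by (simp add: distrib_left)
qed

lemma joint_lipschitz:
  fixes h :: "'x \<Rightarrow> 'y \<Rightarrow> 'z::real_normed_vector"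
  assumes "L1-lipschitz_on UNIV (\<lambda>(x, \<theta>). h x \<theta>)" "L1 \<le> L"
  shows "norm (h x \<theta> - h x' \<theta>') \<le> L * (norm (x - x') + norm (\<theta> - \<theta>'))"
proof -
  have L1: "0 \<le> L1" using assms(1) by (rule lipschitz_on_nonneg)
  have "norm (h x \<theta> - h x' \<theta>') \<le> L1 * norm ((x, \<theta>) - (x', \<theta>'))"
    using lipschitz_on_UNIV_norm[OF assms(1), of "(x, \<theta>)" "(x', \<theta>')"] by simp
  also have "\<dots> \<le> L * (norm (x - x') + norm (\<theta> - \<theta>'))"
    using assms(2) L1 norm_Pair_le[of "x - x'" "\<theta> - \<theta>'"] by (intro mult_mono) auto
  finally show ?thesis .
qed

lemma node:
  assumes i: "i \<in> V P"
  shows "bilevel_node (f P i) (g P i) \<mu> A (MM c \<mu>)"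
proof
  show "0 < \<mu>" "\<mu> \<le> A" "1 \<le> A" using mu0 mu_le A_ge by auto
  note o = bspec[OF outer[unfolded outer_assumption_def] i]
  note n = bspec[OF inner[unfolded inner_assumption_def] i]
  note x = bspec[OF cross[unfolded cross_lipschitz_def] i]
  show "C1 (\<lambda>(x, \<theta>). f P i x \<theta>)" "C2 (\<lambda>(x, \<theta>). g P i x \<theta>)" using o n by auto
  show "strongly_convex \<mu> (g P i x)" for x using n by auto
  show "norm (grad_x (f P i) x \<theta> - grad_x (f P i) x' \<theta>') \<le> A * (norm (x - x') + norm (\<theta> - \<theta>'))" for x \<theta> x' \<theta>'
    by (rule two_block_lipschitz[where ?L1.0 = "L_fx c" and ?L2.0 = Lc]) (use o x A_ge in auto)
  show "norm (grad_t (f P i) x \<theta> - grad_t (f P i) x' \<theta>') \<le> A * (norm (x - x') + norm (\<theta> - \<theta>'))" for x \<theta> x' \<theta>'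
    by (rule two_block_lipschitz[where ?L1.0 = Lc and ?L2.0 = "L_ft c"]) (use o x A_ge in auto)
  show "norm (grad_t (g P i) x \<theta> - grad_t (g P i) x \<theta>') \<le> A * norm (\<theta> - \<theta>')" for x \<theta> \<theta>'
    using lipschitz_on_UNIV_norm[of "L_gt c" "\<lambda>\<theta>. grad_t (g P i) x \<theta>" \<theta> \<theta>'] n A_ge(4)
      mult_right_mono[OF A_ge(4), of "norm (\<theta> - \<theta>')"] by (meson norm_ge_zero order_trans)
  show "norm (hess_xt (g P i) x \<theta> - hess_xt (g P i) x' \<theta>') \<le> A * (norm (x - x') + norm (\<theta> - \<theta>'))" for x \<theta> x' \<theta>'
    by (rule joint_lipschitz[where ?L1.0 = "L_gxt c"]) (use n A_ge in auto)
  show "norm (hess_tt (g P i) x \<theta> - hess_tt (g P i) x' \<theta>') \<le> A * (norm (x - x') + norm (\<theta> - \<theta>'))" for x \<theta> x' \<theta>'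
    by (rule joint_lipschitz[where ?L1.0 = "L_gtt c"]) (use n A_ge in auto)
  show "norm (hess_xt (g P i) x \<theta>) \<le> A" for x \<theta>
    using n A_ge(7) order_trans by blast
  show "norm (grad_t (f P i) x (arg_min (g P i x) (\<lambda>_. True))) \<le> \<mu> * MM c \<mu>" for x
    using o mu0 by (simp add: MM_def theta_star_def)
  show "\<mu> * MM c \<mu> \<le> A" using mu0 A_ge(3) by (simp add: MM_def)
qed

lemma node_eqs:
  assumes i: "i \<in> V P"
  shows "bilevel_node.tst (g P i) = theta_star P i" "bilevel_node.vst (f P i) (g P i) = v_star P i"
    "bilevel_node.hgrad (f P i) (g P i) = gP i" "bilevel_node.q \<mu> A = q"
proof -
  interpret N: bilevel_node "f P i" "g P i" \<mu> A "MM c \<mu>" using node[OF i] .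
  show t: "N.tst = theta_star P i" by (rule ext) (simp add: N.tst_def theta_star_def)
  show "N.vst = v_star P i" by (rule ext) (simp add: N.vst_def v_star_def t)
  show "N.q = q" by (simp add: q_def N.q_def)
  have "Phi_i P i = (\<lambda>x. f P i x (N.tst x))" by (rule ext) (simp add: Phi_i_def t)
  then have "gP i x = N.hgrad x" for x
    unfolding gP_def using grad_eqI[OF N.value_GDERIV] by simp
  then show "N.hgrad = gP i" by auto
qed

lemma gP_GDERIV: "i \<in> V P \<Longrightarrow> GDERIV (Phi_i P i) x :> gP i x"
  using bilevel_node.value_GDERIV[OF node, of i x]
  by (simp add: node_eqs Phi_i_def[abs_def])

lemma gP_formula: "i \<in> V P \<Longrightarrow> gP i x = grad_x (f P i) x (theta_star P i x)
    - blinfun_apply (hess_xt (g P i) x (theta_star P i x)) (v_star P i x)"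
  using bilevel_node.hgrad_def[OF node, of i x] by (simp add: node_eqs)

lemma gP_lip: "i \<in> V P \<Longrightarrow> norm (gP i x - gP i x') \<le> 8 * A * q ^ 3 * norm (x - x')"
  using bilevel_node.hgrad_lip[OF node, of i x x'] by (simp add: node_eqs)

lemma v_star_bound: "i \<in> V P \<Longrightarrow> norm (v_star P i x) \<le> MM c \<mu>"
  using bilevel_node.vst_bound[OF node, of i x] by (simp add: node_eqs)

lemma theta_star_lip: "i \<in> V P \<Longrightarrow> norm (theta_star P i x - theta_star P i x') \<le> q * norm (x - x')"
  using bilevel_node.tst_lip[OF node, of i x x'] by (simp add: node_eqs)

lemma v_star_lip: "i \<in> V P \<Longrightarrow> norm (v_star P i x - v_star P i x') \<le> 4 * q ^ 3 * norm (x - x')"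
  using bilevel_node.vst_lip[OF node, of i x x'] by (simp add: node_eqs)

lemma Phi_GDERIV: "GDERIV (Phi P) x :> node_avg m (\<lambda>i. gP i x)"
proof -
  have "((\<lambda>x. \<Sum>i=1..m. Phi_i P i x) has_derivative (\<lambda>h. \<Sum>i=1..m. inner h (gP i x))) (at x)"
    by (rule has_derivative_sum) (use gP_GDERIV in \<open>auto simp: gderiv_def m_def\<close>)
  then have "((\<lambda>x. (1 / real m) *\<^sub>R (\<Sum>i=1..m. Phi_i P i x)) has_derivative (\<lambda>h. (1 / real m) *\<^sub>R (\<Sum>i=1..m. inner h (gP i x)))) (at x)"
    by (rule has_derivative_scaleR_right)
  then show ?thesis
    unfolding gderiv_def Phi_def[abs_def] node_avg_def m_def by (simp add: inner_sum_right)
qed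

lemma gPhi_eq: "gPhi x = node_avg m (\<lambda>i. gP i x)"
  unfolding gPhi_def using Phi_GDERIV by (rule grad_eqI)

lemma gPhi_lip: "norm (gPhi x - gPhi x') \<le> 8 * A * q ^ 3 * norm (x - x')"
proof -
  have "gPhi x - gPhi x' = (1 / real m) *\<^sub>R (\<Sum>i=1..m. gP i x - gP i x')"
    by (simp add: gPhi_eq node_avg_def sum_subtractf scaleR_diff_right)
  then have "norm (gPhi x - gPhi x') = norm (\<Sum>i=1..m. gP i x - gP i x') / real m" by simp
  also have "norm (\<Sum>i=1..m. gP i x - gP i x') \<le> (\<Sum>i=1..m. 8 * A * q ^ 3 * norm (x - x'))"
    by (rule order_trans[OF norm_sum sum_mono]) (use gP_lip in \<open>auto simp: m_def\<close>)
  also have "\<dots> = real m * (8 * A * q ^ 3 * norm (x - x'))" by simp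
  finally show ?thesis using m1 by (simp add: divide_right_mono field_simps)
qed

text \<open>The mean value theorem, used in place of integration, puts the full Lipschitz constant of the gradient in front
  of the last term.\<close>

lemma Phi_descent: "Phi P y \<le> Phi P x + inner (y - x) (gPhi x) + 8 * A * q ^ 3 * (norm (y - x))\<^sup>2"
proof -
  have d: "((\<lambda>s. Phi P (x + s *\<^sub>R (y - x))) has_real_derivative inner (y - x) (gPhi (x + s *\<^sub>R (y - x)))) (at s)" for s
    using GDERIV_line[OF Phi_GDERIV] by (simp add: gPhi_eq)
  obtain s where s: "0 < s" "s < 1" "Phi P (x + 1 *\<^sub>R (y - x)) - Phi P (x + 0 *\<^sub>R (y - x))
      = (1 - 0) * inner (y - x) (gPhi (x + s *\<^sub>R (y - x)))"
    using MVT2[of 0 1 "\<lambda>s. Phi P (x + s *\<^sub>R (y - x))" "\<lambda>s. inner (y - x) (gPhi (x + s *\<^sub>R (y - x)))"] d by auto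
  have "inner (y - x) (gPhi (x + s *\<^sub>R (y - x)) - gPhi x) \<le> norm (y - x) * norm (gPhi (x + s *\<^sub>R (y - x)) - gPhi x)"
    by (rule norm_cauchy_schwarz)
  also have "\<dots> \<le> norm (y - x) * (8 * A * q ^ 3 * norm (y - x))"
  proof (rule mult_left_mono)
    have "norm (gPhi (x + s *\<^sub>R (y - x)) - gPhi x) \<le> 8 * A * q ^ 3 * norm (s *\<^sub>R (y - x))"
      using gPhi_lip[of "x + s *\<^sub>R (y - x)" x] by simp
    also have "\<dots> \<le> 8 * A * q ^ 3 * norm (y - x)"
      using s q1 A_ge(9) by (intro mult_left_mono) (auto simp: mult_left_le_one_le)
    finally show "norm (gPhi (x + s *\<^sub>R (y - x)) - gPhi x) \<le> 8 * A * q ^ 3 * norm (y - x)" .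
  qed simp
  finally show ?thesis using s(3) by (simp add: inner_diff_right power2_eq_square algebra_simps)
qed

section \<open>Heterogeneity of the hypergradients\<close>

text \<open>Five differences are squared, hence the factor \<open>5\<close>; \<open>90\<close> is \<open>5 * (16 + 1 + 1)\<close>, the squared coefficients
  of the three differences of \<open>g\<close> in \<open>hypergradient_node_gap\<close>, with \<open>q\<^sup>2\<close> and \<open>q ^ 4\<close> raised to \<open>q ^ 6\<close>.\<close>

definition "het_bound = 5 * (1 + q\<^sup>2) * bf\<^sup>2 + 90 * q ^ 6 * bg\<^sup>2"

text \<open>Replaces the functions of node \<open>i\<close> by those of node \<open>j\<close> at the minimizer \<open>t\<close> of node \<open>j\<close>, where heterogeneity is
  measured. The two minimizers differ by at most \<open>1 / \<mu>\<close> times the difference of the gradients of \<open>g\<close> at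
  \<open>t\<close>. The comparison vector does not involve \<open>i\<close>; \<open>X\<close> and \<open>Q\<close> will be the averaged
  gradients of \<open>f\<close> at that point.\<close>

lemma hypergradient_node_gap:
  fixes x
  assumes i: "i \<in> V P" and j: "j \<in> V P"
  defines "t \<equiv> theta_star P j x"
  shows "norm (gP i x - (X - blinfun_apply (hess_xt (g P j) x t) (inv (blinfun_apply (hess_tt (g P j) x t)) Q)))
    \<le> 4 * q ^ 3 * norm (grad_t (g P i) x t - grad_t (g P j) x t) + norm (grad_x (f P i) x t - X)
      + q * norm (hess_xt (g P i) x t - hess_xt (g P j) x t) + q\<^sup>2 * norm (hess_tt (g P i) x t - hess_tt (g P j) x t)
      + q * norm (grad_t (f P i) x t - Q)"
proof -
  interpret I: bilevel_node "f P i" "g P i" \<mu> A "MM c \<mu>" using node[OF i] .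
  interpret J: bilevel_node "f P j" "g P j" \<mu> A "MM c \<mu>" using node[OF j] .
  let ?ti = "theta_star P i x" and ?vi = "v_star P i x"
  let ?Hj = "hess_tt (g P j) x t" and ?Gj = "hess_xt (g P j) x t"
  define w where "w = inv (blinfun_apply ?Hj) Q"
  define \<delta> where "\<delta> = norm (?ti - t)"
  define \<gamma> where "\<gamma> = norm (grad_t (g P i) x t - grad_t (g P j) x t)"
  define p where "p = norm (grad_x (f P i) x t - X)"
  define \<eta> where "\<eta> = norm (hess_xt (g P i) x t - ?Gj)"
  define \<psi> where "\<psi> = norm (hess_tt (g P i) x t - ?Hj)"
  define r where "r = norm (grad_t (f P i) x t - Q)"
  note qI = node_eqs(4)[OF i]
  have A0: "0 < A" using A_ge(9) by linarith
  have \<delta>0: "0 \<le> \<delta>" by (simp add: \<delta>_def)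
  have muq: "\<mu> * q = A" using mu0 by (simp add: q_def)
  have vi: "norm ?vi \<le> q"
    using I.vst_bound[of x] I.Mv_q by (simp add: node_eqs[OF i])
  have Hw: "blinfun_apply ?Hj w = Q"
    unfolding w_def by (rule surj_f_inv_f[OF bij_is_surj[OF J.Gtt_bij]])
  have \<delta>\<gamma>: "\<mu> * \<delta> \<le> \<gamma>"
  proof -
    have "grad_t (g P i) x ?ti = 0" using I.Gt_tst[of x] by (simp add: node_eqs[OF i])
    moreover have "grad_t (g P j) x t = 0" using J.Gt_tst[of x] by (simp add: node_eqs[OF j] t_def)
    ultimately show ?thesis
      using I.Gt_inverse_lip[of ?ti t x] by (simp add: \<delta>_def \<gamma>_def)
  qed
  have H: "norm (?Hj - hess_tt (g P i) x ?ti) \<le> \<psi> + A * \<delta>"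
  proof -
    have "norm (?Hj - hess_tt (g P i) x ?ti) \<le> norm (?Hj - hess_tt (g P i) x t) + norm (hess_tt (g P i) x t - hess_tt (g P i) x ?ti)"
      by (rule norm_diff_via)
    then show ?thesis using I.Gtt_lip[of x t x ?ti] by (simp add: \<psi>_def \<delta>_def norm_minus_commute)
  qed
  have G: "norm (hess_xt (g P i) x ?ti - ?Gj) \<le> \<eta> + A * \<delta>"
  proof -
    have "norm (hess_xt (g P i) x ?ti - ?Gj) \<le> norm (hess_xt (g P i) x ?ti - hess_xt (g P i) x t) + norm (hess_xt (g P i) x t - ?Gj)"
      by (rule norm_diff_via)
    then show ?thesis using I.Gxt_lip[of x ?ti x t] by (simp add: \<eta>_def \<delta>_def)
  qed
  have Xd: "norm (grad_x (f P i) x ?ti - X) \<le> A * \<delta> + p"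
  proof -
    have "norm (grad_x (f P i) x ?ti - X) \<le> norm (grad_x (f P i) x ?ti - grad_x (f P i) x t) + norm (grad_x (f P i) x t - X)"
      by (rule norm_diff_via)
    then show ?thesis using I.Fx_lip[of x ?ti x t] by (simp add: p_def \<delta>_def)
  qed
  have Qd: "norm (grad_t (f P i) x ?ti - Q) \<le> A * \<delta> + r"
  proof -
    have "norm (grad_t (f P i) x ?ti - Q) \<le> norm (grad_t (f P i) x ?ti - grad_t (f P i) x t) + norm (grad_t (f P i) x t - Q)"
      by (rule norm_diff_via)
    then show ?thesis using I.Ft_lip[of x ?ti x t] by (simp add: r_def \<delta>_def)
  qed
  have vw: "\<mu> * norm (?vi - w) \<le> (\<psi> + A * \<delta>) * q + (A * \<delta> + r)"
  proof -
    have Hv: "blinfun_apply (hess_tt (g P i) x ?ti) ?vi = grad_t (f P i) x ?ti"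
      using I.Gtt_vst[of x] by (simp add: node_eqs[OF i])
    have "\<mu> * norm (?vi - w) \<le> norm (blinfun_apply ?Hj (?vi - w))" by (rule J.Gtt_lower)
    also have "blinfun_apply ?Hj (?vi - w) = blinfun_apply (?Hj - hess_tt (g P i) x ?ti) ?vi + (grad_t (f P i) x ?ti - Q)"
      by (simp add: blinfun.diff_left blinfun.diff_right Hw Hv)
    also have "norm \<dots> \<le> norm (?Hj - hess_tt (g P i) x ?ti) * norm ?vi + norm (grad_t (f P i) x ?ti - Q)"
      by (intro order_trans[OF norm_triangle_ineq] add_right_mono norm_blinfun)
    also have "\<dots> \<le> (\<psi> + A * \<delta>) * q + (A * \<delta> + r)"
      using H Qd vi q1 order_trans[OF norm_ge_zero H] by (intro add_mono mult_mono) auto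
    finally show ?thesis .
  qed
  have Aw: "A * norm (?vi - w) \<le> q * ((\<psi> + A * \<delta>) * q + (A * \<delta> + r))"
  proof -
    have "A * norm (?vi - w) = q * (\<mu> * norm (?vi - w))" by (simp add: muq[symmetric])
    also have "\<dots> \<le> q * ((\<psi> + A * \<delta>) * q + (A * \<delta> + r))" using vw q1 by (intro mult_left_mono) auto
    finally show ?thesis .
  qed
  have "gP i x - (X - blinfun_apply ?Gj w) = (grad_x (f P i) x ?ti - X)
      - (blinfun_apply (hess_xt (g P i) x ?ti - ?Gj) ?vi + blinfun_apply ?Gj (?vi - w))"
    by (simp add: gP_formula[OF i] blinfun.diff_left blinfun.diff_right)
  also have "norm \<dots> \<le> norm (grad_x (f P i) x ?ti - X) + (norm (hess_xt (g P i) x ?ti - ?Gj) * norm ?vi + norm ?Gj * norm (?vi - w))"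
    by (intro order_trans[OF norm_triangle_ineq4] add_left_mono order_trans[OF norm_triangle_ineq] add_mono norm_blinfun)
  also have "\<dots> \<le> (A * \<delta> + p) + ((\<eta> + A * \<delta>) * q + A * norm (?vi - w))"
    using Xd G vi q1 J.Gxt_bound[of x t] order_trans[OF norm_ge_zero G] A0 by (intro add_mono mult_mono) auto
  also have "\<dots> \<le> (A * \<delta> + p) + ((\<eta> + A * \<delta>) * q + q * ((\<psi> + A * \<delta>) * q + (A * \<delta> + r)))"
    using Aw by linarith
  also have "\<dots> = A * \<delta> * (1 + 2 * q + q\<^sup>2) + p + q * \<eta> + q\<^sup>2 * \<psi> + q * r"
    by (simp add: power2_eq_square algebra_simps)
  also have "A * \<delta> * (1 + 2 * q + q\<^sup>2) \<le> A * \<delta> * (4 * q\<^sup>2)"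
  proof (rule mult_left_mono)
    have "1 \<le> q\<^sup>2" using q1 by (simp add: one_le_power)
    moreover have "q \<le> q\<^sup>2" using q1 by (simp add: power2_eq_square)
    ultimately show "1 + 2 * q + q\<^sup>2 \<le> 4 * q\<^sup>2" by linarith
  qed (use A0 \<delta>0 in simp)
  also have "A * \<delta> * (4 * q\<^sup>2) = 4 * q ^ 3 * (\<mu> * \<delta>)"
    by (simp add: muq[symmetric] power2_eq_square power3_eq_cube)
  also have "\<dots> \<le> 4 * q ^ 3 * \<gamma>" using \<delta>\<gamma> q1 by (intro mult_left_mono) auto
  finally show ?thesis by (simp add: w_def \<gamma>_def p_def \<eta>_def \<psi>_def r_def)
qed

text \<open>For each \<open>j\<close>, the comparison vector of \<open>hypergradient_node_gap\<close> is the same for all \<open>i\<close>, so the spread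
  around the mean is at most the distance to it. Averaging over \<open>j\<close> turns the sums into
  those of the heterogeneity assumption.\<close>

lemma hypergradient_heterogeneity:
  "(\<Sum>i=1..m. (norm (gP i x - gPhi x))\<^sup>2) \<le> het_bound"
proof -
  let ?S = "\<Sum>i=1..m. (norm (gP i x - gPhi x))\<^sup>2"
  let ?t = "\<lambda>j. theta_star P j x"
  define X where "X j = node_avg m (\<lambda>k. grad_x (f P k) x (?t j))" for j
  define Q where "Q j = node_avg m (\<lambda>k. grad_t (f P k) x (?t j))" for j
  define \<gamma> where "\<gamma> i j = (norm (grad_t (g P i) x (?t j) - grad_t (g P j) x (?t j)))\<^sup>2" for i j
  define p where "p i j = (norm (grad_x (f P i) x (?t j) - X j))\<^sup>2" for i j
  define \<eta> where "\<eta> i j = (norm (hess_xt (g P i) x (?t j) - hess_xt (g P j) x (?t j)))\<^sup>2" for i j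
  define \<psi> where "\<psi> i j = (norm (hess_tt (g P i) x (?t j) - hess_tt (g P j) x (?t j)))\<^sup>2" for i j
  define r where "r i j = (norm (grad_t (f P i) x (?t j) - Q j))\<^sup>2" for i j
  let ?SS = "\<lambda>h. \<Sum>j=1..m. \<Sum>i=1..m. h i j"
  have m0: "real m > 0" using m1 by simp
  have b1: "(\<Sum>i=1..m. p i j) \<le> bf\<^sup>2" "(\<Sum>i=1..m. r i j) \<le> bf\<^sup>2" for j
    using het unfolding heterogeneity_def p_def r_def X_def Q_def m_def by auto
  have b2: "?SS \<gamma> \<le> real m * bg\<^sup>2" "?SS \<eta> \<le> real m * bg\<^sup>2" "?SS \<psi> \<le> real m * bg\<^sup>2"
  proof -
    have h: "1 / real m * (\<Sum>i=1..m. \<Sum>j=1..m. \<gamma> i j) \<le> bg\<^sup>2"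
      "1 / real m * (\<Sum>i=1..m. \<Sum>j=1..m. \<eta> i j) \<le> bg\<^sup>2"
      "1 / real m * (\<Sum>i=1..m. \<Sum>j=1..m. \<psi> i j) \<le> bg\<^sup>2"
      using het unfolding heterogeneity_def \<gamma>_def \<eta>_def \<psi>_def m_def by auto
    show "?SS \<gamma> \<le> real m * bg\<^sup>2" "?SS \<eta> \<le> real m * bg\<^sup>2" "?SS \<psi> \<le> real m * bg\<^sup>2"
      using h m0 by (subst sum.swap, simp add: field_simps)+
  qed
  have "?S \<le> (\<Sum>i=1..m. 5 * (16 * q ^ 6 * \<gamma> i j + p i j + q\<^sup>2 * \<eta> i j + q ^ 4 * \<psi> i j + q\<^sup>2 * r i j))"
    if j: "j \<in> {1..m}" for j
  proof -
    let ?c = "X j - blinfun_apply (hess_xt (g P j) x (?t j)) (inv (blinfun_apply (hess_tt (g P j) x (?t j))) (Q j))"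
    have "?S \<le> (\<Sum>i=1..m. (norm (gP i x - ?c))\<^sup>2)"
      unfolding gPhi_eq by (rule sum_norm_sq_diff_avg_le[OF m1])
    also have "\<dots> \<le> (\<Sum>i=1..m. 5 * (16 * q ^ 6 * \<gamma> i j + p i j + q\<^sup>2 * \<eta> i j + q ^ 4 * \<psi> i j + q\<^sup>2 * r i j))"
    proof (rule sum_mono)
      fix i assume i: "i \<in> {1..m}"
      have q6: "(q ^ 3)\<^sup>2 = q ^ 6" "(q\<^sup>2)\<^sup>2 = q ^ 4" by (simp_all add: power_mult[symmetric])
      have "(norm (gP i x - ?c))\<^sup>2 \<le> (4 * q ^ 3 * norm (grad_t (g P i) x (?t j) - grad_t (g P j) x (?t j)) + norm (grad_x (f P i) x (?t j) - X j)
      + q * norm (hess_xt (g P i) x (?t j) - hess_xt (g P j) x (?t j)) + q\<^sup>2 * norm (hess_tt (g P i) x (?t j) - hess_tt (g P j) x (?t j))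
      + q * norm (grad_t (f P i) x (?t j) - Q j))\<^sup>2"
        using i j by (intro power2_norm_le hypergradient_node_gap) (auto simp: m_def)
      also have "\<dots> \<le> 5 * (16 * q ^ 6 * \<gamma> i j + p i j + q\<^sup>2 * \<eta> i j + q ^ 4 * \<psi> i j + q\<^sup>2 * r i j)"
        by (rule order_trans[OF sq_sum5_le])
          (simp add: power_mult_distrib q6 \<gamma>_def p_def \<eta>_def \<psi>_def r_def)
      finally show "(norm (gP i x - ?c))\<^sup>2 \<le> 5 * (16 * q ^ 6 * \<gamma> i j + p i j + q\<^sup>2 * \<eta> i j + q ^ 4 * \<psi> i j + q\<^sup>2 * r i j)" .
    qed
    finally show ?thesis .
  qed
  then have "(\<Sum>j=1..m. ?S) \<le> (\<Sum>j=1..m. \<Sum>i=1..m. 5 * (16 * q ^ 6 * \<gamma> i j + p i j + q\<^sup>2 * \<eta> i j + q ^ 4 * \<psi> i j + q\<^sup>2 * r i j))"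
    by (rule sum_mono)
  also have "\<dots> = 5 * (16 * q ^ 6 * ?SS \<gamma> + ?SS p + q\<^sup>2 * ?SS \<eta> + q ^ 4 * ?SS \<psi> + q\<^sup>2 * ?SS r)"
    by (simp add: sum.distrib sum_distrib_left)
  also have "\<dots> \<le> 5 * (16 * q ^ 6 * (real m * bg\<^sup>2) + real m * bf\<^sup>2 + q\<^sup>2 * (real m * bg\<^sup>2) + q ^ 4 * (real m * bg\<^sup>2) + q\<^sup>2 * (real m * bf\<^sup>2))"
  proof -
    have "?SS p \<le> real m * bf\<^sup>2" "?SS r \<le> real m * bf\<^sup>2"
      using sum_mono[of "{1..m}" "\<lambda>j. \<Sum>i=1..m. p i j" "\<lambda>_. bf\<^sup>2"] sum_mono[of "{1..m}" "\<lambda>j. \<Sum>i=1..m. r i j" "\<lambda>_. bf\<^sup>2"] b1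
      by simp_all
    then show ?thesis using b2 q1 by (intro mult_left_mono add_mono) auto
  qed
  also have "\<dots> \<le> real m * het_bound"
  proof -
    have "q\<^sup>2 \<le> q ^ 6" "q ^ 4 \<le> q ^ 6" using q1 by (auto intro: power_increasing)
    then have "q\<^sup>2 * (real m * bg\<^sup>2) \<le> q ^ 6 * (real m * bg\<^sup>2)" "q ^ 4 * (real m * bg\<^sup>2) \<le> q ^ 6 * (real m * bg\<^sup>2)"
      by (auto intro: mult_right_mono)
    then show ?thesis by (simp add: het_bound_def algebra_simps)
  qed
  finally show ?thesis using m0 by simp
qed

end

section \<open>Fresh samples\<close>

context prob_space
begin

text \<open>The sigma-algebra on the sample space generated by the samples with index in \<open>J\<close>.\<close>

definition hist :: "('j \<Rightarrow> 's measure) \<Rightarrow> ('j \<Rightarrow> 'a \<Rightarrow> 's) \<Rightarrow> 'j set \<Rightarrow> 'a measure" where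
  "hist N Z J = vimage_algebra (space M) (\<lambda>\<omega>. \<lambda>j\<in>J. Z j \<omega>) (PiM J N)"

lemma space_hist [simp]: "space (hist N Z J) = space M"
  by (simp add: hist_def)

lemma hist_sample:
  assumes Z: "\<And>j. j \<in> J \<Longrightarrow> Z j \<in> measurable M (N j)" and j: "j \<in> J"
  shows "Z j \<in> measurable (hist N Z J) (N j)"
proof -
  have "(\<lambda>\<omega>. \<lambda>j\<in>J. Z j \<omega>) \<in> measurable (hist N Z J) (PiM J N)"
    unfolding hist_def
    by (rule measurable_vimage_algebra1) (auto simp: space_PiM intro!: measurable_space[OF Z])
  from measurable_compose[OF this measurable_component_singleton[OF j]]
  show ?thesis using j by simp
qed

lemma hist_subset:
  assumes Z: "\<And>j. j \<in> J \<Longrightarrow> Z j \<in> measurable B (N j)" and sp: "space B = space M"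
  shows "sets (hist N Z J) \<subseteq> sets B"
  unfolding hist_def sp[symmetric]
  by (rule sets_image_in_sets) (auto intro: measurable_restrict Z)

lemma measurable_coarser:
  assumes "sets B \<subseteq> sets B'" "space B = space B'" "X \<in> measurable B S"
  shows "X \<in> measurable B' S"
  using assms unfolding measurable_def by auto

lemma hist_mono:
  assumes Z: "\<And>j. j \<in> J' \<Longrightarrow> Z j \<in> measurable M (N j)" and J: "J \<subseteq> J'"
    and X: "X \<in> measurable (hist N Z J) S"
  shows "X \<in> measurable (hist N Z J') S"
proof (rule measurable_coarser[OF hist_subset _ X])
  show "Z j \<in> measurable (hist N Z J') (N j)" if "j \<in> J" for j
    by (rule hist_sample[where J = J']) (use Z J that in auto)
qed auto

lemma hist_measurable:
  assumes Z: "\<And>j. j \<in> J \<Longrightarrow> Z j \<in> measurable M (N j)" and X: "X \<in> measurable (hist N Z J) S"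
  shows "X \<in> measurable M S"
  by (rule measurable_coarser[OF hist_subset _ X]) (use Z in auto)

text \<open>\<open>Z\<close> has law \<open>N\<close> and is independent of \<open>X\<close>.\<close>

definition fresh :: "'b measure \<Rightarrow> ('a \<Rightarrow> 'b) \<Rightarrow> 'c measure \<Rightarrow> ('a \<Rightarrow> 'c) \<Rightarrow> bool" where
  "fresh S X N Z \<longleftrightarrow> X \<in> measurable M S \<and> Z \<in> measurable M N \<and> distr M N Z = N \<and>
     (\<forall>A\<in>sets S. \<forall>B\<in>sets N. prob ((X -` A \<inter> space M) \<inter> (Z -` B \<inter> space M))
        = prob (X -` A \<inter> space M) * prob (Z -` B \<inter> space M))"

lemma fresh_hist:
  assumes ind: "indep_vars N Z I" and J: "J \<subseteq> I" "j \<in> I" "j \<notin> J"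
    and X: "X \<in> measurable (hist N Z J) S" and dist: "distr M (N j) (Z j) = N j"
  shows "fresh S X (N j) (Z j)"
proof -
  have Z: "Z j \<in> measurable M (N j)" if "j \<in> I" for j
    using ind that by (rule indep_vars_def[THEN iffD1, THEN conjunct1, THEN bspec])
  have XM: "X \<in> measurable M S" using X by (rule hist_measurable[rotated]) (use Z J in auto)
  have "indep_var (PiM J N) (\<lambda>\<omega>. \<lambda>j\<in>J. Z j \<omega>) (PiM {j} N) (\<lambda>\<omega>. \<lambda>j\<in>{j}. Z j \<omega>)"
    by (rule indep_var_restrict[OF ind]) (use J in auto)
  then have ids: "indep_set (sets (hist N Z J)) (sets (hist N Z {j}))"
    unfolding indep_var_eq hist_def sets_vimage_algebra by simp
  have "prob ((X -` A \<inter> space M) \<inter> (Z j -` B \<inter> space M)) = prob (X -` A \<inter> space M) * prob (Z j -` B \<inter> space M)"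
    if "A \<in> sets S" "B \<in> sets (N j)" for A B
  proof (rule indep_setD[OF ids])
    show "X -` A \<inter> space M \<in> sets (hist N Z J)" using measurable_sets[OF X that(1)] by simp
    show "Z j -` B \<inter> space M \<in> sets (hist N Z {j})"
      using measurable_sets[OF hist_sample[of "{j}" Z N j] that(2)] Z J by simp
  qed
  then show ?thesis using XM Z J dist by (auto simp: fresh_def)
qed

text \<open>The joint law is a product measure, so that expectations of \<open>h (X, Z)\<close> can be computed by
  integrating over \<open>Z\<close> first, with \<open>X\<close> frozen.\<close>

lemma fresh_distr:
  assumes "fresh S X N Z"
  shows "distr M (S \<Otimes>\<^sub>M N) (\<lambda>\<omega>. (X \<omega>, Z \<omega>)) = distr M S X \<Otimes>\<^sub>M N"
proof -
  have X: "X \<in> measurable M S" and Z: "Z \<in> measurable M N" and d: "distr M N Z = N"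
    using assms by (auto simp: fresh_def)
  interpret N: prob_space N using prob_space_distr[OF Z] d by simp
  interpret D: prob_space "distr M S X" using prob_space_distr[OF X] .
  have XZ: "(\<lambda>\<omega>. (X \<omega>, Z \<omega>)) \<in> measurable M (S \<Otimes>\<^sub>M N)" using X Z by simp
  show ?thesis
  proof (rule pair_measure_eqI[symmetric])
    show "sigma_finite_measure (distr M S X)" "sigma_finite_measure N" ..
    show "sets (distr M S X \<Otimes>\<^sub>M N) = sets (distr M (S \<Otimes>\<^sub>M N) (\<lambda>\<omega>. (X \<omega>, Z \<omega>)))"
      by (simp cong: sets_pair_measure_cong)
    fix A B assume "A \<in> sets (distr M S X)" and B: "B \<in> sets N"
    then have A: "A \<in> sets S" by simp
    have "emeasure (distr M (S \<Otimes>\<^sub>M N) (\<lambda>\<omega>. (X \<omega>, Z \<omega>))) (A \<times> B) = prob ((X -` A \<inter> space M) \<inter> (Z -` B \<inter> space M))"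
      using A B XZ by (subst emeasure_distr) (auto simp: emeasure_eq_measure intro!: arg_cong[where f = prob])
    also have "\<dots> = prob (X -` A \<inter> space M) * prob (Z -` B \<inter> space M)"
      using assms A B by (simp add: fresh_def)
    also have "\<dots> = emeasure (distr M S X) A * emeasure (distr M N Z) B"
      using A B X Z by (simp add: emeasure_distr emeasure_eq_measure ennreal_mult)
    finally show "emeasure (distr M S X) A * emeasure N B = emeasure (distr M (S \<Otimes>\<^sub>M N) (\<lambda>\<omega>. (X \<omega>, Z \<omega>))) (A \<times> B)"
      using d by simp
  qed
qed

lemma fresh_nn_integral:
  assumes ind: "fresh S X N Z" and h: "h \<in> borel_measurable (S \<Otimes>\<^sub>M N)"
  shows "(\<integral>\<^sup>+\<omega>. h (X \<omega>, Z \<omega>) \<partial>M) = (\<integral>\<^sup>+\<omega>. \<integral>\<^sup>+s. h (X \<omega>, s) \<partial>N \<partial>M)"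
proof -
  have X: "X \<in> measurable M S" and Z: "Z \<in> measurable M N"
    using ind by (auto simp: fresh_def)
  interpret N: prob_space N using prob_space_distr[OF Z] ind by (simp add: fresh_def)
  have "(\<integral>\<^sup>+\<omega>. h (X \<omega>, Z \<omega>) \<partial>M) = (\<integral>\<^sup>+p. h p \<partial>distr M (S \<Otimes>\<^sub>M N) (\<lambda>\<omega>. (X \<omega>, Z \<omega>)))"
    using X Z h by (subst nn_integral_distr) auto
  also have "\<dots> = (\<integral>\<^sup>+p. h p \<partial>(distr M S X \<Otimes>\<^sub>M N))" by (simp only: fresh_distr[OF ind])
  also have "\<dots> = (\<integral>\<^sup>+x. \<integral>\<^sup>+s. h (x, s) \<partial>N \<partial>distr M S X)"
    by (rule N.nn_integral_fst[symmetric]) (use h in \<open>simp cong: measurable_cong_sets\<close>)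
  also have "\<dots> = (\<integral>\<^sup>+\<omega>. \<integral>\<^sup>+s. h (X \<omega>, s) \<partial>N \<partial>M)"
    using X h by (subst nn_integral_distr) auto
  finally show ?thesis .
qed

lemma fresh_integral_zero:
  fixes h :: "_ \<Rightarrow> real"
  assumes ind: "fresh S X N Z" and h: "h \<in> borel_measurable (S \<Otimes>\<^sub>M N)"
    and int: "integrable M (\<lambda>\<omega>. h (X \<omega>, Z \<omega>))" and zero: "\<And>x. x \<in> space S \<Longrightarrow> (\<integral>s. h (x, s) \<partial>N) = 0"
  shows "(\<integral>\<omega>. h (X \<omega>, Z \<omega>) \<partial>M) = 0"
proof -
  have X: "X \<in> measurable M S" and Z: "Z \<in> measurable M N"
    using ind by (auto simp: fresh_def)
  interpret N: prob_space N using prob_space_distr[OF Z] ind by (simp add: fresh_def)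
  interpret D: prob_space "distr M S X" using prob_space_distr[OF X] .
  interpret DN: pair_sigma_finite "distr M S X" N ..
  have XZ: "(\<lambda>\<omega>. (X \<omega>, Z \<omega>)) \<in> measurable M (S \<Otimes>\<^sub>M N)" using X Z by simp
  have "integrable (distr M (S \<Otimes>\<^sub>M N) (\<lambda>\<omega>. (X \<omega>, Z \<omega>))) h"
    using int XZ h by (simp add: integrable_distr_eq)
  then have i: "integrable (distr M S X \<Otimes>\<^sub>M N) h" by (simp only: fresh_distr[OF ind])
  have "(\<integral>\<omega>. h (X \<omega>, Z \<omega>) \<partial>M) = (\<integral>p. h p \<partial>distr M (S \<Otimes>\<^sub>M N) (\<lambda>\<omega>. (X \<omega>, Z \<omega>)))"
    using XZ h by (simp add: integral_distr)
  also have "\<dots> = (\<integral>p. h p \<partial>(distr M S X \<Otimes>\<^sub>M N))" by (simp only: fresh_distr[OF ind])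
  also have "\<dots> = (\<integral>x. \<integral>s. h (x, s) \<partial>N \<partial>distr M S X)"
    by (rule DN.integral_fst'[symmetric, OF i])
  also have "\<dots> = (\<integral>x. 0 \<partial>distr M S X)"
    by (rule Bochner_Integration.integral_cong) (auto simp: zero)
  finally show ?thesis by simp
qed

section \<open>Square-integrable vectors\<close>

definition sqi :: "('a \<Rightarrow> 'b::euclidean_space) \<Rightarrow> bool" where
  "sqi X \<longleftrightarrow> X \<in> borel_measurable M \<and> integrable M (\<lambda>\<omega>. (norm (X \<omega>))\<^sup>2)"

lemma sqi_measurable: "sqi X \<Longrightarrow> X \<in> borel_measurable M"
  and sqi_integrable: "sqi X \<Longrightarrow> integrable M (\<lambda>\<omega>. (norm (X \<omega>))\<^sup>2)"
  by (auto simp: sqi_def)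

lemma sqi_bound:
  assumes "X \<in> borel_measurable M" "integrable M h" "\<And>\<omega>. \<omega> \<in> space M \<Longrightarrow> (norm (X \<omega>))\<^sup>2 \<le> h \<omega>"
  shows "sqi X"
  unfolding sqi_def
proof (intro conjI assms(1) Bochner_Integration.integrable_bound[OF assms(2)])
  show "AE \<omega> in M. norm ((norm (X \<omega>))\<^sup>2) \<le> norm (h \<omega>)"
    using assms(3) by (intro AE_I2) (smt (verit) norm_ge_zero real_norm_def zero_le_power2)
qed (use assms(1) in measurable)

lemma sqi_const: "sqi (\<lambda>_. a)"
  by (simp add: sqi_def)

lemma sqi_add:
  assumes "sqi X" "sqi Y" shows "sqi (\<lambda>\<omega>. X \<omega> + Y \<omega>)"
  by (rule sqi_bound[where h = "\<lambda>\<omega>. 2 * (norm (X \<omega>))\<^sup>2 + 2 * (norm (Y \<omega>))\<^sup>2"])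
    (use assms norm_sq_add_le in \<open>auto simp: sqi_def\<close>)

lemma sqi_scaleR: "sqi X \<Longrightarrow> sqi (\<lambda>\<omega>. r *\<^sub>R X \<omega>)"
  by (auto simp: sqi_def power_mult_distrib)

lemma sqi_diff:
  assumes "sqi X" "sqi Y" shows "sqi (\<lambda>\<omega>. X \<omega> - Y \<omega>)"
  using sqi_add[OF assms(1) sqi_scaleR[OF assms(2), of "- 1"]] by simp

lemma sqi_sum: "(\<And>i. i \<in> S \<Longrightarrow> sqi (X i)) \<Longrightarrow> sqi (\<lambda>\<omega>. \<Sum>i\<in>S. X i \<omega>)"
  by (induction S rule: infinite_finite_induct) (auto intro: sqi_add sqi_const)

lemma sqi_node_avg: "(\<And>i. i \<in> {1..k} \<Longrightarrow> sqi (X i)) \<Longrightarrow> sqi (\<lambda>\<omega>. node_avg k (\<lambda>i. X i \<omega>))"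
  unfolding node_avg_def by (intro sqi_scaleR sqi_sum)

lemma sqi_dominated:
  assumes "X \<in> borel_measurable M" "sqi (Y :: 'a \<Rightarrow> 'c::euclidean_space)"
    "\<And>\<omega>. \<omega> \<in> space M \<Longrightarrow> norm (X \<omega>) \<le> r * norm (Y \<omega>)"
  shows "sqi X"
proof (rule sqi_bound[OF assms(1)])
  show "integrable M (\<lambda>\<omega>. r\<^sup>2 * (norm (Y \<omega>))\<^sup>2)" using assms(2) by (simp add: sqi_def)
  show "(norm (X \<omega>))\<^sup>2 \<le> r\<^sup>2 * (norm (Y \<omega>))\<^sup>2" if "\<omega> \<in> space M" for \<omega>
    using power2_norm_le[OF assms(3)[OF that]] by (simp add: power_mult_distrib)
qed

lemma sqi_lipschitz:
  assumes "sqi X" and h: "\<And>a b. norm (h a - h b) \<le> L * norm (a - b)"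
  shows "sqi (\<lambda>\<omega>. h (X \<omega>))"
proof -
  have "continuous_on UNIV h"
  proof (rule continuous_onI)
    fix a :: 'b and e :: real assume e: "e > 0"
    have "dist (h b) (h a) \<le> e" if b: "dist b a < e / (\<bar>L\<bar> + 1)" for b
    proof -
      have "norm (h b - h a) \<le> L * norm (b - a)" by (rule h)
      also have "\<dots> \<le> (\<bar>L\<bar> + 1) * norm (b - a)" by (intro mult_right_mono) auto
      also have "\<dots> \<le> e" using b by (simp add: dist_norm field_simps)
      finally show ?thesis by (simp add: dist_norm)
    qed
    then show "\<exists>d>0. \<forall>b\<in>UNIV. dist b a < d \<longrightarrow> dist (h b) (h a) \<le> e"
      using e by (intro exI[of _ "e / (\<bar>L\<bar> + 1)"]) auto
  qed
  then have hm: "h \<in> borel_measurable borel" by (rule borel_measurable_continuous_onI)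
  have 1: "sqi (\<lambda>\<omega>. h (X \<omega>) - h 0)"
    by (rule sqi_dominated[OF _ assms(1), where r = L])
      (use hm assms(1) h[of _ 0] in \<open>auto simp: sqi_def intro: measurable_compose\<close>)
  from sqi_add[OF 1 sqi_const[of "h 0"]] show ?thesis by simp
qed

lemma sqi_inner:
  assumes "sqi X" "sqi Y" shows "integrable M (\<lambda>\<omega>. inner (X \<omega>) (Y \<omega>))"
proof (rule Bochner_Integration.integrable_bound)
  show "integrable M (\<lambda>\<omega>. (norm (X \<omega>))\<^sup>2 + (norm (Y \<omega>))\<^sup>2)" using assms by (simp add: sqi_def)
  show "(\<lambda>\<omega>. inner (X \<omega>) (Y \<omega>)) \<in> borel_measurable M"
    by (intro borel_measurable_inner sqi_measurable assms)
  have "\<bar>inner a b\<bar> \<le> (norm a)\<^sup>2 + (norm b)\<^sup>2" for a b :: 'b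
  proof -
    have "\<bar>inner a b\<bar> \<le> norm a * norm b" by (rule Cauchy_Schwarz_ineq2)
    moreover have "2 * (norm a * norm b) \<le> (norm a)\<^sup>2 + (norm b)\<^sup>2"
      using sum_squares_bound[of "norm a" "norm b"] by simp
    moreover have "0 \<le> norm a * norm b" by simp
    ultimately show ?thesis by linarith
  qed
  then show "AE \<omega> in M. norm (inner (X \<omega>) (Y \<omega>)) \<le> norm ((norm (X \<omega>))\<^sup>2 + (norm (Y \<omega>))\<^sup>2)" by simp
qed

lemma integral_norm_sq_add_orthogonal:
  assumes "sqi X" "sqi Y" "(\<integral>\<omega>. inner (X \<omega>) (Y \<omega>) \<partial>M) = 0"
  shows "(\<integral>\<omega>. (norm (X \<omega> + Y \<omega>))\<^sup>2 \<partial>M) = (\<integral>\<omega>. (norm (X \<omega>))\<^sup>2 \<partial>M) + (\<integral>\<omega>. (norm (Y \<omega>))\<^sup>2 \<partial>M)"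
proof -
  have "(norm (X \<omega> + Y \<omega>))\<^sup>2 = (norm (X \<omega>))\<^sup>2 + (norm (Y \<omega>))\<^sup>2 + 2 * inner (X \<omega>) (Y \<omega>)" for \<omega>
    by (simp add: power2_norm_eq_inner inner_add_left inner_add_right inner_commute)
  then show ?thesis using assms sqi_inner[OF assms(1,2)] by (simp add: sqi_def)
qed

text \<open>Pythagoras. It gives the factor \<open>1 / m\<close> in the variance of an average over nodes.\<close>

lemma integral_norm_sq_sum_orthogonal:
  assumes "finite S" "\<And>i. i \<in> S \<Longrightarrow> sqi (X i)"
    and "\<And>i j. i \<in> S \<Longrightarrow> j \<in> S \<Longrightarrow> i \<noteq> j \<Longrightarrow> (\<integral>\<omega>. inner (X i \<omega>) (X j \<omega>) \<partial>M) = 0"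
  shows "(\<integral>\<omega>. (norm (\<Sum>i\<in>S. X i \<omega>))\<^sup>2 \<partial>M) = (\<Sum>i\<in>S. \<integral>\<omega>. (norm (X i \<omega>))\<^sup>2 \<partial>M)"
  using assms
proof (induction S rule: finite_induct)
  case (insert i S)
  have "(\<integral>\<omega>. inner (X i \<omega>) (\<Sum>j\<in>S. X j \<omega>) \<partial>M) = (\<Sum>j\<in>S. \<integral>\<omega>. inner (X i \<omega>) (X j \<omega>) \<partial>M)"
    unfolding inner_sum_right by (rule Bochner_Integration.integral_sum) (use insert in \<open>auto intro: sqi_inner\<close>)
  also have "\<dots> = 0" using insert by (intro sum.neutral) auto
  finally have "(\<integral>\<omega>. (norm (X i \<omega> + (\<Sum>j\<in>S. X j \<omega>)))\<^sup>2 \<partial>M)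
     = (\<integral>\<omega>. (norm (X i \<omega>))\<^sup>2 \<partial>M) + (\<integral>\<omega>. (norm (\<Sum>j\<in>S. X j \<omega>))\<^sup>2 \<partial>M)"
    using insert by (intro integral_norm_sq_add_orthogonal sqi_sum) auto
  then show ?case using insert by simp
qed simp

text \<open>\<open>h (X, Z j)\<close> is centered given \<open>X\<close>, with conditional variance at most \<open>V X\<close>. It is orthogonal to
  all vectors determined by the samples in \<open>J\<close>: such an \<open>a\<close> may be adjoined to \<open>X\<close> without losing
  independence of \<open>Z j\<close>.\<close>

lemma fresh_noise:
  fixes h :: "'z \<times> 's \<Rightarrow> 'b::euclidean_space" and V :: "'z \<Rightarrow> real"
  assumes ind: "indep_vars N Z I" and J: "J \<subseteq> I" "j \<in> I" "j \<notin> J"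
    and dist: "distr M (N j) (Z j) = N j"
    and X: "X \<in> measurable (hist N Z J) S" and h: "h \<in> borel_measurable (S \<Otimes>\<^sub>M N j)"
    and V: "\<And>x. x \<in> space S \<Longrightarrow> (\<integral>\<^sup>+s. ennreal ((norm (h (x, s)))\<^sup>2) \<partial>N j) \<le> ennreal (V x)"
    and V0: "\<And>x. x \<in> space S \<Longrightarrow> 0 \<le> V x" and VX: "integrable M (\<lambda>\<omega>. V (X \<omega>))"
    and mean: "\<And>x. x \<in> space S \<Longrightarrow> integrable (N j) (\<lambda>s. h (x, s)) \<and> (\<integral>s. h (x, s) \<partial>N j) = 0"
  shows "sqi (\<lambda>\<omega>. h (X \<omega>, Z j \<omega>))"
    and "(\<integral>\<omega>. (norm (h (X \<omega>, Z j \<omega>)))\<^sup>2 \<partial>M) \<le> (\<integral>\<omega>. V (X \<omega>) \<partial>M)"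
    and "\<And>a. a \<in> borel_measurable (hist N Z J) \<Longrightarrow> sqi a \<Longrightarrow>
           (\<integral>\<omega>. inner (a \<omega>) (h (X \<omega>, Z j \<omega>)) \<partial>M) = 0"
proof -
  have Z: "Z j \<in> measurable M (N j)" if "j \<in> I" for j
    using ind that by (rule indep_vars_def[THEN iffD1, THEN conjunct1, THEN bspec])
  have XM: "X \<in> measurable M S" using X by (rule hist_measurable[rotated]) (use Z J in auto)
  have Zj: "Z j \<in> measurable M (N j)" using Z J by auto
  have Xsp: "X \<omega> \<in> space S" if "\<omega> \<in> space M" for \<omega> using XM that by (rule measurable_space)
  have hm: "(\<lambda>\<omega>. h (X \<omega>, Z j \<omega>)) \<in> borel_measurable M"
    using XM Zj h by (intro measurable_compose[OF measurable_Pair h]) auto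
  have le: "(\<integral>\<^sup>+\<omega>. ennreal ((norm (h (X \<omega>, Z j \<omega>)))\<^sup>2) \<partial>M) \<le> ennreal (\<integral>\<omega>. V (X \<omega>) \<partial>M)"
  proof -
    have "(\<integral>\<^sup>+\<omega>. ennreal ((norm (h (X \<omega>, Z j \<omega>)))\<^sup>2) \<partial>M)
        = (\<integral>\<^sup>+\<omega>. \<integral>\<^sup>+s. ennreal ((norm (h (X \<omega>, s)))\<^sup>2) \<partial>N j \<partial>M)"
      by (rule fresh_nn_integral[OF fresh_hist[OF ind J X dist], of "\<lambda>p. ennreal ((norm (h p))\<^sup>2)"])
        (use h in measurable)
    also have "\<dots> \<le> (\<integral>\<^sup>+\<omega>. ennreal (V (X \<omega>)) \<partial>M)"
      by (rule nn_integral_mono) (use V Xsp in auto)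
    also have "\<dots> = ennreal (\<integral>\<omega>. V (X \<omega>) \<partial>M)"
      by (rule nn_integral_eq_integral[OF VX]) (use V0 Xsp in auto)
    finally show ?thesis .
  qed
  have int: "integrable M (\<lambda>\<omega>. (norm (h (X \<omega>, Z j \<omega>)))\<^sup>2)"
  proof (rule integrableI_bounded)
    show "(\<lambda>\<omega>. (norm (h (X \<omega>, Z j \<omega>)))\<^sup>2) \<in> borel_measurable M" using hm by measurable
    show "(\<integral>\<^sup>+\<omega>. ennreal (norm ((norm (h (X \<omega>, Z j \<omega>)))\<^sup>2)) \<partial>M) < \<infinity>"
      using le by (simp add: order_le_less_trans[OF le])
  qed
  show sq: "sqi (\<lambda>\<omega>. h (X \<omega>, Z j \<omega>))" using hm int by (simp add: sqi_def)
  show "(\<integral>\<omega>. (norm (h (X \<omega>, Z j \<omega>)))\<^sup>2 \<partial>M) \<le> (\<integral>\<omega>. V (X \<omega>) \<partial>M)"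
  proof -
    have "ennreal (\<integral>\<omega>. (norm (h (X \<omega>, Z j \<omega>)))\<^sup>2 \<partial>M) \<le> ennreal (\<integral>\<omega>. V (X \<omega>) \<partial>M)"
      using le nn_integral_eq_integral[OF int] by simp
    moreover have "0 \<le> (\<integral>\<omega>. V (X \<omega>) \<partial>M)"
      by (rule Bochner_Integration.integral_nonneg_AE) (use V0 Xsp in auto)
    ultimately show ?thesis by (simp add: ennreal_le_iff)
  qed
  show "(\<integral>\<omega>. inner (a \<omega>) (h (X \<omega>, Z j \<omega>)) \<partial>M) = 0" if a: "a \<in> borel_measurable (hist N Z J)" "sqi a" for a
  proof -
    have Xa: "(\<lambda>\<omega>. (X \<omega>, a \<omega>)) \<in> measurable (hist N Z J) (S \<Otimes>\<^sub>M borel)"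
      using X a(1) by (rule measurable_Pair)
    let ?h = "\<lambda>p. inner (snd (fst p)) (h (fst (fst p), snd p))"
    have h1: "(\<lambda>p. h (fst (fst p), snd p)) \<in> borel_measurable ((S \<Otimes>\<^sub>M borel) \<Otimes>\<^sub>M N j)"
      by (intro measurable_compose[OF _ h] measurable_Pair) measurable
    have "(\<integral>\<omega>. ?h ((X \<omega>, a \<omega>), Z j \<omega>) \<partial>M) = 0"
    proof (rule fresh_integral_zero[OF fresh_hist[OF ind J Xa dist]])
      show "?h \<in> borel_measurable ((S \<Otimes>\<^sub>M borel) \<Otimes>\<^sub>M N j)"
        by (intro borel_measurable_inner h1) measurable
      show "integrable M (\<lambda>\<omega>. ?h ((X \<omega>, a \<omega>), Z j \<omega>))"
        using sqi_inner[OF a(2) sq] by simp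
      show "(\<integral>s. ?h (p, s) \<partial>N j) = 0" if p: "p \<in> space (S \<Otimes>\<^sub>M (borel :: 'b measure))" for p
      proof -
        have "fst p \<in> space S" using p by (auto simp: space_pair_measure)
        from mean[OF this] show ?thesis by simp
      qed
    qed
    then show ?thesis by simp
  qed
qed

end

section \<open>The stochastic iteration\<close>

lemma (in prob_space) sqi_Pair:
  assumes "sqi X" "sqi Y" shows "sqi (\<lambda>\<omega>. (X \<omega>, Y \<omega>))"
proof -
  have "(norm (a, b))\<^sup>2 = (norm a)\<^sup>2 + (norm b)\<^sup>2" for a :: 'b and b :: 'c
    by (simp add: norm_Pair)
  then show ?thesis
    unfolding sqi_def using sqi_measurable[OF assms(1)] sqi_measurable[OF assms(2)]
      sqi_integrable[OF assms(1)] sqi_integrable[OF assms(2)]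
    by (auto intro: borel_measurable_Pair)
qed

lemma (in prob_space) sqi_cong:
  assumes "sqi X" "\<And>\<omega>. \<omega> \<in> space M \<Longrightarrow> Y \<omega> = X \<omega>" shows "sqi Y"
proof -
  have "Y \<in> borel_measurable M \<longleftrightarrow> X \<in> borel_measurable M"
    by (rule measurable_cong) (rule assms(2))
  moreover have "integrable M (\<lambda>\<omega>. (norm (Y \<omega>))\<^sup>2) \<longleftrightarrow> integrable M (\<lambda>\<omega>. (norm (X \<omega>))\<^sup>2)"
    by (rule Bochner_Integration.integrable_cong) (auto simp: assms(2))
  ultimately show ?thesis using assms(1) by (simp add: sqi_def)
qed

lemma measurable_blinfun_apply:
  fixes B :: "'a \<Rightarrow> 'b::euclidean_space \<Rightarrow>\<^sub>L 'c::euclidean_space"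
  assumes "B \<in> borel_measurable N" "v \<in> borel_measurable N"
  shows "(\<lambda>\<omega>. blinfun_apply (B \<omega>) (v \<omega>)) \<in> borel_measurable N"
  by (rule borel_measurable_continuous_Pair[OF assms]) (intro continuous_intros)

lemma two_block_measurable:
  fixes h :: "'x::euclidean_space \<Rightarrow> 'y::euclidean_space \<Rightarrow> 'z::real_normed_vector"
  assumes "\<And>a b a' b'. norm (h a b - h a' b') \<le> L * (norm (a - a') + norm (b - b'))" "L \<ge> 0"
  shows "(\<lambda>p. h (fst p) (snd p)) \<in> borel_measurable (borel \<Otimes>\<^sub>M borel)"
proof -
  have "(2 * L)-lipschitz_on UNIV (\<lambda>p. h (fst p) (snd p))"
  proof (rule lipschitz_onI)
    fix p p' :: "'x \<times> 'y"
    have "norm (h (fst p) (snd p) - h (fst p') (snd p')) \<le> L * (norm (fst (p - p')) + norm (snd (p - p')))"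
      using assms(1) by simp
    also have "\<dots> \<le> L * (norm (p - p') + norm (p - p'))"
    proof -
      have nz: "norm (fst z) \<le> norm z" "norm (snd z) \<le> norm z" for z :: "'x \<times> 'y"
        using norm_fst_le[of "fst z" "snd z"] norm_snd_le[of "snd z" "fst z"] by simp_all
      show ?thesis using assms(2) by (intro mult_left_mono add_mono nz) auto
    qed
    finally show "dist (h (fst p) (snd p)) (h (fst p') (snd p')) \<le> 2 * L * dist p p'"
      by (simp add: dist_norm)
  qed (use assms(2) in simp)
  then have "(\<lambda>p. h (fst p) (snd p)) \<in> borel_measurable borel"
    by (intro borel_measurable_continuous_onI lipschitz_on_continuous_on)
  then show ?thesis by (simp add: borel_prod)
qed

text \<open>The moving average \<open>z\<close> forgets its error at rate \<open>a\<close>; \<open>d\<close> is the displacement of its target and \<open>b\<close> the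
  bias of the new estimate, which enters with weight \<open>a\<close> only.\<close>

lemma tracking_step:
  fixes e d b :: "'a::real_inner"
  assumes a: "0 < a" "a < 1"
  shows "(norm ((1 - a) *\<^sub>R e + (d + a *\<^sub>R b)))\<^sup>2 \<le> (1 - a) * (norm e)\<^sup>2 + 2 / a * (norm d)\<^sup>2 + 2 * a * (norm b)\<^sup>2"
proof -
  have "(1 - a) *\<^sub>R e + (d + a *\<^sub>R b) = (1 - a) *\<^sub>R e + a *\<^sub>R ((1 / a) *\<^sub>R d + b)"
    using a by (simp add: scaleR_add_right)
  then have "(norm ((1 - a) *\<^sub>R e + (d + a *\<^sub>R b)))\<^sup>2 \<le> (1 - a) * (norm e)\<^sup>2 + a * (norm ((1 / a) *\<^sub>R d + b))\<^sup>2"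
    using norm_sq_convex[OF a, of e "(1 / a) *\<^sub>R d + b"] by simp
  also have "a * (norm ((1 / a) *\<^sub>R d + b))\<^sup>2 \<le> a * (2 * (norm ((1 / a) *\<^sub>R d))\<^sup>2 + 2 * (norm b)\<^sup>2)"
    by (rule mult_left_mono[OF norm_sq_add_le]) (use a in simp)
  also have "\<dots> = 2 / a * (norm d)\<^sup>2 + 2 * a * (norm b)\<^sup>2"
    using a by (simp add: power_mult_distrib power_divide power2_eq_square field_simps)
  finally show ?thesis by simp
qed

text \<open>A run with \<open>c_gamma = c_lambda = c_beta = 1\<close>, hence a common step \<open>\<alpha>\<close> for \<open>\<theta>\<close>, \<open>v\<close> and \<open>z\<close>. A positive
  \<open>\<alpha>\<close> is required since the error recursions divide by it.\<close>

locale lopa_run = bilevel_problem P c Lc \<mu> bf bg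
  for P :: "('x::euclidean_space, 'y::euclidean_space, 's) bilevel" and c Lc \<mu> bf bg +
  fixes E :: "(nat \<times> nat) set" and W :: "nat \<Rightarrow> nat \<Rightarrow> real" and r :: real
    and M :: "'w measure" and \<zeta> :: "nat \<Rightarrow> draw \<Rightarrow> nat \<Rightarrow> 'w \<Rightarrow> 's" and n :: noise
    and st :: steps and \<alpha> :: real
    and x0 :: "nat \<Rightarrow> 'x" and \<theta>0 v0 :: "nat \<Rightarrow> 'y" and z0 :: "nat \<Rightarrow> 'x"
    and x :: "nat \<Rightarrow> nat \<Rightarrow> 'w \<Rightarrow> 'x" and \<theta> v :: "nat \<Rightarrow> nat \<Rightarrow> 'w \<Rightarrow> 'y"
    and y z :: "nat \<Rightarrow> nat \<Rightarrow> 'w \<Rightarrow> 'x"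
  assumes net: "network (nodes P) E W" and rho_r: "rho (nodes P) W = r" "0 \<le> r" "r < 1"
    and samp: "sampling P n M \<zeta>"
    and run: "lopa_lg P E W M \<zeta> st \<alpha> x0 \<theta>0 v0 z0 x \<theta> v y z"
    and steps1: "c_gamma st = 1" "c_lambda st = 1" "c_beta st = 1" and tau: "0 < tau st" "tau st < 1"
    and alpha: "0 < \<alpha>" "\<alpha> < 1" "\<alpha> * (const_sum c Lc)\<^sup>2 \<le> \<mu>"
begin

lemma prob_space_M: "prob_space M" using samp by (simp add: sampling_def)

sublocale prob_space M by (rule prob_space_M)

text \<open>The samples as one family, indexed by node, kind of draw and iteration; \<open>H k\<close> is the information
  available before iteration \<open>k\<close>.\<close>

definition "smp = (\<lambda>(i, d, k). \<zeta> i d k)"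
definition "lw = (\<lambda>(i, d, k :: nat). law P i d)"
definition "Ix = V P \<times> (UNIV :: draw set) \<times> (UNIV :: nat set)"
definition "past (k :: nat) = V P \<times> (UNIV :: draw set) \<times> {..<k}"
definition "H k = hist lw smp (past k)"

lemma indep_smp: "indep_vars lw smp Ix"
  using samp by (simp add: sampling_def lw_def smp_def Ix_def)

lemma past_Ix: "past k \<subseteq> Ix" by (auto simp: past_def Ix_def)

lemma smp_measurable: "j \<in> Ix \<Longrightarrow> smp j \<in> measurable M (lw j)"
  using indep_smp unfolding indep_vars_def by blast

lemma smp_distr: "j \<in> Ix \<Longrightarrow> distr M (lw j) (smp j) = lw j"
  using samp unfolding sampling_def by (auto simp: lw_def smp_def Ix_def)

lemma hist_up: "J \<subseteq> J' \<Longrightarrow> J' \<subseteq> Ix \<Longrightarrow> X \<in> measurable (hist lw smp J) S \<Longrightarrow> X \<in> measurable (hist lw smp J') S"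
  by (rule hist_mono) (auto intro: smp_measurable)

lemma H_up: "k \<le> k' \<Longrightarrow> X \<in> measurable (H k) S \<Longrightarrow> X \<in> measurable (H k') S"
  unfolding H_def by (rule hist_up) (auto simp: past_def Ix_def)

lemma space_H [simp]: "space (H k) = space M" by (simp add: H_def)

lemma sample_H: "i \<in> V P \<Longrightarrow> \<zeta> i d k \<in> measurable (H (Suc k)) (law P i d)"
proof -
  assume i: "i \<in> V P"
  have "smp (i, d, k) \<in> measurable (H (Suc k)) (lw (i, d, k))"
    unfolding H_def 
    by (rule hist_sample, rule smp_measurable, erule subsetD[OF past_Ix]) (use i in \<open>simp add: past_def\<close>)
  then show ?thesis by (simp add: smp_def lw_def)
qed

lemma law_cases: "law P i Xi1 = law_g P i" "law P i Xi2 = law_g P i" "law P i Xi3 = law_g P i"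
  "law P i Sig1 = law_f P i" "law P i Sig2 = law_f P i"
  by (simp_all add: law_def)

lemma init: "i \<in> V P \<Longrightarrow> \<omega> \<in> space M \<Longrightarrow>
    x i 0 \<omega> = x0 i \<and> \<theta> i 0 \<omega> = \<theta>0 i \<and> v i 0 \<omega> = v0 i \<and> z i 0 \<omega> = z0 i"
  using run unfolding lopa_lg_def by blast

lemma y_eq: "i \<in> V P \<Longrightarrow> \<omega> \<in> space M \<Longrightarrow> y i k \<omega> = z i k \<omega>"
  using run unfolding lopa_lg_def Let_def by (cases k) blast+

lemma step:
  assumes "i \<in> V P" "\<omega> \<in> space M"
  shows "\<theta> i (Suc k) \<omega> = \<theta> i k \<omega> - \<alpha> *\<^sub>R grad_t (gsample P i (\<zeta> i Xi1 k \<omega>)) (x i k \<omega>) (\<theta> i k \<omega>)"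
    and "v i (Suc k) \<omega> = v i k \<omega> - \<alpha> *\<^sub>R (blinfun_apply (hess_tt (gsample P i (\<zeta> i Xi2 k \<omega>)) (x i k \<omega>) (\<theta> i k \<omega>)) (v i k \<omega>)
        - grad_t (fsample P i (\<zeta> i Sig1 k \<omega>)) (x i k \<omega>) (\<theta> i k \<omega>))"
    and "x i (Suc k) \<omega> = (1 - tau st) *\<^sub>R x i k \<omega> + tau st *\<^sub>R ((\<Sum>j | (i, j) \<in> E. W i j *\<^sub>R x j k \<omega>) - \<alpha> *\<^sub>R z i k \<omega>)"
    and "z i (Suc k) \<omega> = (1 - \<alpha>) *\<^sub>R z i k \<omega> + \<alpha> *\<^sub>R (grad_x (fsample P i (\<zeta> i Sig2 k \<omega>)) (x i k \<omega>) (\<theta> i k \<omega>)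
        - blinfun_apply (hess_xt (gsample P i (\<zeta> i Xi3 k \<omega>)) (x i k \<omega>) (\<theta> i k \<omega>)) (v i k \<omega>))"
proof -
  have s: "s + (1 - \<alpha>) *\<^sub>R (w - s) = (1 - \<alpha>) *\<^sub>R w + \<alpha> *\<^sub>R s" for s w :: 'x
    by (simp add: algebra_simps)
  note R = run[unfolded lopa_lg_def Let_def steps1 mult_1, rule_format, OF assms]
  note Rk = R[THEN conjunct2, THEN conjunct2, THEN conjunct2, THEN conjunct2, THEN conjunct2, THEN spec[of _ k]]
  show "\<theta> i (Suc k) \<omega> = \<theta> i k \<omega> - \<alpha> *\<^sub>R grad_t (gsample P i (\<zeta> i Xi1 k \<omega>)) (x i k \<omega>) (\<theta> i k \<omega>)"
    by (rule Rk[THEN conjunct1])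
  show "v i (Suc k) \<omega> = v i k \<omega> - \<alpha> *\<^sub>R (blinfun_apply (hess_tt (gsample P i (\<zeta> i Xi2 k \<omega>)) (x i k \<omega>) (\<theta> i k \<omega>)) (v i k \<omega>)
        - grad_t (fsample P i (\<zeta> i Sig1 k \<omega>)) (x i k \<omega>) (\<theta> i k \<omega>))"
    by (rule Rk[THEN conjunct2, THEN conjunct1])
  show "x i (Suc k) \<omega> = (1 - tau st) *\<^sub>R x i k \<omega> + tau st *\<^sub>R ((\<Sum>j | (i, j) \<in> E. W i j *\<^sub>R x j k \<omega>) - \<alpha> *\<^sub>R z i k \<omega>)"
    unfolding y_eq[OF assms, symmetric] by (rule Rk[THEN conjunct2, THEN conjunct2, THEN conjunct1])
  show "z i (Suc k) \<omega> = (1 - \<alpha>) *\<^sub>R z i k \<omega> + \<alpha> *\<^sub>R (grad_x (fsample P i (\<zeta> i Sig2 k \<omega>)) (x i k \<omega>) (\<theta> i k \<omega>)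
        - blinfun_apply (hess_xt (gsample P i (\<zeta> i Xi3 k \<omega>)) (x i k \<omega>) (\<theta> i k \<omega>)) (v i k \<omega>))"
    by (rule trans[OF Rk[THEN conjunct2, THEN conjunct2, THEN conjunct2, THEN conjunct1] s])
qed

lemma measurable_ests:
  assumes "i \<in> V P"
  shows "(\<lambda>(x, \<theta>, s). grad_t (gsample P i s) x \<theta>) \<in> borel_measurable (borel \<Otimes>\<^sub>M borel \<Otimes>\<^sub>M law P i Xi1)"
    "(\<lambda>(x, \<theta>, s). hess_tt (gsample P i s) x \<theta>) \<in> borel_measurable (borel \<Otimes>\<^sub>M borel \<Otimes>\<^sub>M law P i Xi2)"
    "(\<lambda>(x, \<theta>, s). hess_xt (gsample P i s) x \<theta>) \<in> borel_measurable (borel \<Otimes>\<^sub>M borel \<Otimes>\<^sub>M law P i Xi3)"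
    "(\<lambda>(x, \<theta>, s). grad_t (fsample P i s) x \<theta>) \<in> borel_measurable (borel \<Otimes>\<^sub>M borel \<Otimes>\<^sub>M law P i Sig1)"
    "(\<lambda>(x, \<theta>, s). grad_x (fsample P i s) x \<theta>) \<in> borel_measurable (borel \<Otimes>\<^sub>M borel \<Otimes>\<^sub>M law P i Sig2)"
  using samp assms unfolding sampling_def measurable_estimators_def law_cases by blast+

lemma measurable_est_compose:
  assumes "(\<lambda>(x, \<theta>, s). h x \<theta> s) \<in> measurable (borel \<Otimes>\<^sub>M borel \<Otimes>\<^sub>M L) S"
    "a \<in> borel_measurable N" "b \<in> borel_measurable N" "s \<in> measurable N L"
  shows "(\<lambda>\<omega>. h (a \<omega>) (b \<omega>) (s \<omega>)) \<in> measurable N S"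
proof -
  have "(\<lambda>\<omega>. (a \<omega>, b \<omega>, s \<omega>)) \<in> measurable N (borel \<Otimes>\<^sub>M borel \<Otimes>\<^sub>M L)"
    using assms(2-) by (intro measurable_Pair)
  from measurable_compose[OF this assms(1)] show ?thesis by simp
qed

text \<open>The iterates with index \<open>k\<close> are functions of the samples drawn before iteration \<open>k\<close>.\<close>

lemma state_measurable:
  "\<forall>i\<in>V P. x i k \<in> borel_measurable (H k) \<and> \<theta> i k \<in> borel_measurable (H k)
     \<and> v i k \<in> borel_measurable (H k) \<and> z i k \<in> borel_measurable (H k)"
proof (induction k)
  case 0
  show ?case
  proof (intro ballI conjI)
    fix i assume i: "i \<in> V P"
    show "x i 0 \<in> borel_measurable (H 0)"
      by (rule measurable_cong[THEN iffD2, of _ _ "\<lambda>_. x0 i"]) (use init[OF i] in auto)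
    show "\<theta> i 0 \<in> borel_measurable (H 0)"
      by (rule measurable_cong[THEN iffD2, of _ _ "\<lambda>_. \<theta>0 i"]) (use init[OF i] in auto)
    show "v i 0 \<in> borel_measurable (H 0)"
      by (rule measurable_cong[THEN iffD2, of _ _ "\<lambda>_. v0 i"]) (use init[OF i] in auto)
    show "z i 0 \<in> borel_measurable (H 0)"
      by (rule measurable_cong[THEN iffD2, of _ _ "\<lambda>_. z0 i"]) (use init[OF i] in auto)
  qed
next
  case (Suc k)
  show ?case
  proof (intro ballI conjI)
    fix i assume i: "i \<in> V P"
    have xs: "x j k \<in> borel_measurable (H (Suc k))" if "j \<in> V P" for j
      using bspec[OF Suc that] H_up[OF le_SucI[OF order_refl]] by blast
    have m: "x i k \<in> borel_measurable (H (Suc k))" "\<theta> i k \<in> borel_measurable (H (Suc k))"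
      "v i k \<in> borel_measurable (H (Suc k))" "z i k \<in> borel_measurable (H (Suc k))"
      using bspec[OF Suc i] H_up[OF le_SucI[OF order_refl]] by blast+
    note e = measurable_est_compose[OF _ m(1,2) sample_H[OF i]]
    show "\<theta> i (Suc k) \<in> borel_measurable (H (Suc k))"
      by (rule measurable_cong[THEN iffD2, OF step(1)[OF i]], simp,
        intro borel_measurable_diff borel_measurable_scaleR borel_measurable_const m e[OF measurable_ests(1)[OF i]])
    show "v i (Suc k) \<in> borel_measurable (H (Suc k))"
      by (rule measurable_cong[THEN iffD2, OF step(2)[OF i]], simp,
        intro borel_measurable_diff borel_measurable_scaleR borel_measurable_const m measurable_blinfun_apply
          e[OF measurable_ests(2)[OF i]] e[OF measurable_ests(4)[OF i]])
    show "z i (Suc k) \<in> borel_measurable (H (Suc k))"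
      by (rule measurable_cong[THEN iffD2, OF step(4)[OF i]], simp,
        intro borel_measurable_diff borel_measurable_add borel_measurable_scaleR borel_measurable_const m measurable_blinfun_apply
          e[OF measurable_ests(3)[OF i]] e[OF measurable_ests(5)[OF i]])
    have nb: "j \<in> V P" if "(i, j) \<in> E" for j using net that unfolding network_def by auto
    show "x i (Suc k) \<in> borel_measurable (H (Suc k))"
      by (rule measurable_cong[THEN iffD2, OF step(3)[OF i]], simp,
        intro borel_measurable_diff borel_measurable_add borel_measurable_scaleR borel_measurable_const m
          borel_measurable_sum xs nb) simp
  qed
qed

lemma node_measurable:
  assumes i: "i \<in> V P"
  shows "(\<lambda>p. grad_x (f P i) (fst p) (snd p)) \<in> borel_measurable (borel \<Otimes>\<^sub>M borel)"
    "(\<lambda>p. grad_t (f P i) (fst p) (snd p)) \<in> borel_measurable (borel \<Otimes>\<^sub>M borel)"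
    "(\<lambda>p. grad_t (g P i) (fst p) (snd p)) \<in> borel_measurable (borel \<Otimes>\<^sub>M borel)"
    "(\<lambda>p. hess_xt (g P i) (fst p) (snd p)) \<in> borel_measurable (borel \<Otimes>\<^sub>M borel)"
    "(\<lambda>p. hess_tt (g P i) (fst p) (snd p)) \<in> borel_measurable (borel \<Otimes>\<^sub>M borel)"
proof -
  interpret N: bilevel_node "f P i" "g P i" \<mu> A "MM c \<mu>" using node[OF i] .
  have A0: "0 \<le> A" using N.A_pos by simp
  have gl: "norm (grad_t (g P i) a b - grad_t (g P i) a' b') \<le> A * (norm (a - a') + norm (b - b'))" for a b a' b'
    using norm_diff_via[of "grad_t (g P i) a b" "grad_t (g P i) a' b'" "grad_t (g P i) a' b"]
      N.Gt_lip_x[of a b a'] N.Gt_lip[of a' b b'] by (simp add: distrib_left)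
  show "(\<lambda>p. grad_x (f P i) (fst p) (snd p)) \<in> borel_measurable (borel \<Otimes>\<^sub>M borel)"
    by (rule two_block_measurable[OF N.Fx_lip A0])
  show "(\<lambda>p. grad_t (f P i) (fst p) (snd p)) \<in> borel_measurable (borel \<Otimes>\<^sub>M borel)"
    by (rule two_block_measurable[OF N.Ft_lip A0])
  show "(\<lambda>p. grad_t (g P i) (fst p) (snd p)) \<in> borel_measurable (borel \<Otimes>\<^sub>M borel)"
    by (rule two_block_measurable[OF gl A0])
  show "(\<lambda>p. hess_xt (g P i) (fst p) (snd p)) \<in> borel_measurable (borel \<Otimes>\<^sub>M borel)"
    by (rule two_block_measurable[OF N.Gxt_lip A0])
  show "(\<lambda>p. hess_tt (g P i) (fst p) (snd p)) \<in> borel_measurable (borel \<Otimes>\<^sub>M borel)"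
    by (rule two_block_measurable[OF N.Gtt_lip A0])
qed

lemma measurable_mean_compose:
  assumes "(\<lambda>p. h (fst p) (snd p)) \<in> measurable (borel \<Otimes>\<^sub>M borel) S" "a \<in> borel_measurable N" "b \<in> borel_measurable N"
  shows "(\<lambda>\<omega>. h (a \<omega>) (b \<omega>)) \<in> measurable N S"
  using measurable_compose[OF measurable_Pair[OF assms(2,3)] assms(1)] by simp

lemma estimator_law:
  assumes i: "i \<in> V P" and est: "estimator M (\<lambda>\<omega>. X (\<zeta> i d k \<omega>)) a \<sigma>"
    and X: "X \<in> borel_measurable (law P i d)"
  shows "integrable (law P i d) X" "(\<integral>s. X s \<partial>law P i d) = a"
    "(\<integral>\<^sup>+s. ennreal ((norm (X s - a))\<^sup>2) \<partial>law P i d) \<le> ennreal (\<sigma>\<^sup>2)"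
proof -
  have j: "(i, d, k) \<in> Ix" using i by (simp add: Ix_def)
  have Z: "\<zeta> i d k \<in> measurable M (law P i d)" using smp_measurable[OF j] by (simp add: smp_def lw_def)
  have d: "distr M (law P i d) (\<zeta> i d k) = law P i d" using smp_distr[OF j] by (simp add: smp_def lw_def)
  show "integrable (law P i d) X"
    using est integrable_distr_eq[OF Z X] by (simp add: estimator_def d)
  show "(\<integral>s. X s \<partial>law P i d) = a"
    using est integral_distr[OF Z X] by (simp add: estimator_def d)
  show "(\<integral>\<^sup>+s. ennreal ((norm (X s - a))\<^sup>2) \<partial>law P i d) \<le> ennreal (\<sigma>\<^sup>2)"
    using est nn_integral_distr[OF Z, of "\<lambda>s. ennreal ((norm (X s - a))\<^sup>2)"] X by (simp add: estimator_def d)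
qed

lemma law_prob_space: "i \<in> V P \<Longrightarrow> prob_space (law P i d)"
  using prob_space_distr[OF smp_measurable[of "(i, d, 0)"]] smp_distr[of "(i, d, 0)"]
  by (simp add: Ix_def lw_def smp_def)

text \<open>The third part is stated for every history \<open>K\<close> that misses the sample in question, not only for the past: for
  orthogonality of the noise at two nodes, \<open>K\<close> also contains samples of the other node in the same
  iteration.\<close>

lemma vector_noise:
  fixes h :: "'x \<Rightarrow> 'y \<Rightarrow> 's \<Rightarrow> 'b::euclidean_space"
  assumes i: "i \<in> V P"
    and h: "(\<lambda>(x, \<theta>, s). h x \<theta> s) \<in> borel_measurable (borel \<Otimes>\<^sub>M borel \<Otimes>\<^sub>M law P i d)"
    and hm: "(\<lambda>p. hm (fst p) (snd p)) \<in> borel_measurable (borel \<Otimes>\<^sub>M borel)"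
    and est: "\<And>a b. estimator M (\<lambda>\<omega>. h a b (\<zeta> i d k \<omega>)) (hm a b) \<sigma>"
  defines "N \<equiv> \<lambda>\<omega>. h (x i k \<omega>) (\<theta> i k \<omega>) (\<zeta> i d k \<omega>) - hm (x i k \<omega>) (\<theta> i k \<omega>)"
  shows "sqi N" "(\<integral>\<omega>. (norm (N \<omega>))\<^sup>2 \<partial>M) \<le> \<sigma>\<^sup>2"
    "\<And>K a. past k \<subseteq> K \<Longrightarrow> K \<subseteq> Ix \<Longrightarrow> (i, d, k) \<notin> K \<Longrightarrow> a \<in> borel_measurable (hist lw smp K) \<Longrightarrow> sqi a
       \<Longrightarrow> (\<integral>\<omega>. inner (a \<omega>) (N \<omega>) \<partial>M) = 0"
proof -
  have j: "(i, d, k) \<in> Ix" using i by (simp add: Ix_def)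
  have lwj: "lw (i, d, k) = law P i d" "smp (i, d, k) = \<zeta> i d k" by (simp_all add: lw_def smp_def)
  interpret L: prob_space "law P i d" by (rule law_prob_space[OF i])
  let ?X = "\<lambda>\<omega>. (x i k \<omega>, \<theta> i k \<omega>)"
  let ?h = "\<lambda>p. h (fst (fst p)) (snd (fst p)) (snd p) - hm (fst (fst p)) (snd (fst p))"
  have hs: "(\<lambda>s. h a b s) \<in> borel_measurable (law P i d)" for a b
    by (rule measurable_est_compose[OF h]) auto
  have XK: "?X \<in> measurable (hist lw smp K) (borel \<Otimes>\<^sub>M borel)" if "past k \<subseteq> K" "K \<subseteq> Ix" for K
    by (rule hist_up[OF that]) (use state_measurable[of k] i in \<open>auto simp: H_def intro: measurable_Pair\<close>)
  have hM: "?h \<in> borel_measurable ((borel \<Otimes>\<^sub>M borel) \<Otimes>\<^sub>M law P i d)"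
    by (intro borel_measurable_diff measurable_est_compose[OF h] measurable_mean_compose[OF hm]) measurable
  have V: "(\<integral>\<^sup>+s. ennreal ((norm (?h (p, s)))\<^sup>2) \<partial>law P i d) \<le> ennreal (\<sigma>\<^sup>2)" for p
    using estimator_law(3)[OF i est hs] by simp
  have mean: "integrable (law P i d) (\<lambda>s. ?h (p, s)) \<and> (\<integral>s. ?h (p, s) \<partial>law P i d) = 0" for p
    using estimator_law(1,2)[OF i est hs] by (simp add: L.prob_space)
  have F: "sqi (\<lambda>\<omega>. ?h (?X \<omega>, smp (i, d, k) \<omega>))"
    "(\<integral>\<omega>. (norm (?h (?X \<omega>, smp (i, d, k) \<omega>)))\<^sup>2 \<partial>M) \<le> (\<integral>\<omega>. \<sigma>\<^sup>2 \<partial>M)"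
    "\<And>a. a \<in> borel_measurable (hist lw smp K) \<Longrightarrow> sqi a \<Longrightarrow> (\<integral>\<omega>. inner (a \<omega>) (?h (?X \<omega>, smp (i, d, k) \<omega>)) \<partial>M) = 0"
    if K: "past k \<subseteq> K" "K \<subseteq> Ix" "(i, d, k) \<notin> K" for K
    by (rule fresh_noise[OF indep_smp K(2) j K(3) smp_distr[OF j] XK[OF K(1,2)], where h = ?h and V = "\<lambda>_. \<sigma>\<^sup>2"];
        use hM V mean in \<open>simp add: lwj\<close>)+
  have Neq: "N = (\<lambda>\<omega>. ?h (?X \<omega>, smp (i, d, k) \<omega>))" by (simp add: N_def lwj)
  have K0: "past k \<subseteq> past k" "past k \<subseteq> Ix" "(i, d, k) \<notin> past k" using past_Ix by (auto simp: past_def)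
  show "sqi N" unfolding Neq by (rule F(1)[OF K0])
  show "(\<integral>\<omega>. (norm (N \<omega>))\<^sup>2 \<partial>M) \<le> \<sigma>\<^sup>2" using F(2)[OF K0] unfolding Neq by (simp add: prob_space)
  show "(\<integral>\<omega>. inner (a \<omega>) (N \<omega>) \<partial>M) = 0"
    if "past k \<subseteq> K" "K \<subseteq> Ix" "(i, d, k) \<notin> K" "a \<in> borel_measurable (hist lw smp K)" "sqi a" for K a
    unfolding Neq by (rule F(3)[OF that])
qed

text \<open>The matrix estimators multiply \<open>v\<close>, so that their noise is proportional to the size of \<open>v\<close>.\<close>

lemma matrix_noise:
  fixes h :: "'x \<Rightarrow> 'y \<Rightarrow> 's \<Rightarrow> 'y \<Rightarrow>\<^sub>L 'b::euclidean_space"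
  assumes i: "i \<in> V P"
    and h: "(\<lambda>(x, \<theta>, s). h x \<theta> s) \<in> borel_measurable (borel \<Otimes>\<^sub>M borel \<Otimes>\<^sub>M law P i d)"
    and hm: "(\<lambda>p. hm (fst p) (snd p)) \<in> borel_measurable (borel \<Otimes>\<^sub>M borel)"
    and est: "\<And>a b. estimator M (\<lambda>\<omega>. h a b (\<zeta> i d k \<omega>)) (hm a b) \<sigma>"
    and sv: "sqi (v i k)"
  defines "N \<equiv> \<lambda>\<omega>. blinfun_apply (h (x i k \<omega>) (\<theta> i k \<omega>) (\<zeta> i d k \<omega>) - hm (x i k \<omega>) (\<theta> i k \<omega>)) (v i k \<omega>)"
  shows "sqi N" "(\<integral>\<omega>. (norm (N \<omega>))\<^sup>2 \<partial>M) \<le> \<sigma>\<^sup>2 * (\<integral>\<omega>. (norm (v i k \<omega>))\<^sup>2 \<partial>M)"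
    "\<And>K a. past k \<subseteq> K \<Longrightarrow> K \<subseteq> Ix \<Longrightarrow> (i, d, k) \<notin> K \<Longrightarrow> a \<in> borel_measurable (hist lw smp K) \<Longrightarrow> sqi a
       \<Longrightarrow> (\<integral>\<omega>. inner (a \<omega>) (N \<omega>) \<partial>M) = 0"
proof -
  have j: "(i, d, k) \<in> Ix" using i by (simp add: Ix_def)
  have lwj: "lw (i, d, k) = law P i d" "smp (i, d, k) = \<zeta> i d k" by (simp_all add: lw_def smp_def)
  interpret L: prob_space "law P i d" by (rule law_prob_space[OF i])
  let ?X = "\<lambda>\<omega>. ((x i k \<omega>, \<theta> i k \<omega>), v i k \<omega>)"
  let ?D = "\<lambda>p s. h (fst (fst p)) (snd (fst p)) s - hm (fst (fst p)) (snd (fst p))"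
  let ?h = "\<lambda>p. blinfun_apply (?D (fst p) (snd p)) (snd (fst p))"
  let ?V = "\<lambda>p. \<sigma>\<^sup>2 * (norm (snd p))\<^sup>2"
  have hs: "(\<lambda>s. h a b s) \<in> borel_measurable (law P i d)" for a b
    by (rule measurable_est_compose[OF h]) auto
  have XK: "?X \<in> measurable (hist lw smp K) ((borel \<Otimes>\<^sub>M borel) \<Otimes>\<^sub>M borel)" if "past k \<subseteq> K" "K \<subseteq> Ix" for K
    by (rule hist_up[OF that]) (use state_measurable[of k] i in \<open>auto simp: H_def intro!: measurable_Pair\<close>)
  have hM: "?h \<in> borel_measurable (((borel \<Otimes>\<^sub>M borel) \<Otimes>\<^sub>M borel) \<Otimes>\<^sub>M law P i d)"
    by (intro measurable_blinfun_apply borel_measurable_diff measurable_est_compose[OF h] measurable_mean_compose[OF hm]) measurable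
  have V: "(\<integral>\<^sup>+s. ennreal ((norm (?h (p, s)))\<^sup>2) \<partial>law P i d) \<le> ennreal (?V p)" for p
  proof -
    have Dm: "(\<lambda>s. ennreal ((norm (?D p s))\<^sup>2)) \<in> borel_measurable (law P i d)"
      using hs by measurable
    have "(\<integral>\<^sup>+s. ennreal ((norm (?h (p, s)))\<^sup>2) \<partial>law P i d)
        \<le> (\<integral>\<^sup>+s. ennreal ((norm (snd p))\<^sup>2) * ennreal ((norm (?D p s))\<^sup>2) \<partial>law P i d)"
    proof (rule nn_integral_mono)
      fix s
      have "(norm (?h (p, s)))\<^sup>2 \<le> (norm (?D p s) * norm (snd p))\<^sup>2"
        by (intro power2_norm_le) (simp add: norm_blinfun)
      then show "ennreal ((norm (?h (p, s)))\<^sup>2) \<le> ennreal ((norm (snd p))\<^sup>2) * ennreal ((norm (?D p s))\<^sup>2)"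
        by (simp add: ennreal_mult[symmetric] power_mult_distrib mult.commute ennreal_leI)
    qed
    also have "\<dots> = ennreal ((norm (snd p))\<^sup>2) * (\<integral>\<^sup>+s. ennreal ((norm (?D p s))\<^sup>2) \<partial>law P i d)"
      by (rule nn_integral_cmult[OF Dm])
    also have "\<dots> \<le> ennreal ((norm (snd p))\<^sup>2) * ennreal (\<sigma>\<^sup>2)"
      using estimator_law(3)[OF i est hs] by (intro mult_left_mono) auto
    finally show ?thesis by (simp add: ennreal_mult[symmetric] mult.commute)
  qed
  have mean: "integrable (law P i d) (\<lambda>s. ?h (p, s)) \<and> (\<integral>s. ?h (p, s) \<partial>law P i d) = 0" for p
  proof -
    have i1: "integrable (law P i d) (?D p)" and i2: "(\<integral>s. ?D p s \<partial>law P i d) = 0"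
      using estimator_law(1,2)[OF i est hs] by (simp_all add: L.prob_space)
    have bl: "bounded_linear (\<lambda>B :: 'y \<Rightarrow>\<^sub>L 'b. blinfun_apply B (snd p))" by (rule blinfun.bounded_linear_left)
    show ?thesis
      using integrable_bounded_linear[OF bl i1] integral_bounded_linear[OF bl i1] i2 by simp
  qed
  have VX: "integrable M (\<lambda>\<omega>. ?V (?X \<omega>))" using sqi_integrable[OF sv] by simp
  have F: "sqi (\<lambda>\<omega>. ?h (?X \<omega>, smp (i, d, k) \<omega>))"
    "(\<integral>\<omega>. (norm (?h (?X \<omega>, smp (i, d, k) \<omega>)))\<^sup>2 \<partial>M) \<le> (\<integral>\<omega>. ?V (?X \<omega>) \<partial>M)"
    "\<And>a. a \<in> borel_measurable (hist lw smp K) \<Longrightarrow> sqi a \<Longrightarrow> (\<integral>\<omega>. inner (a \<omega>) (?h (?X \<omega>, smp (i, d, k) \<omega>)) \<partial>M) = 0"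
    if K: "past k \<subseteq> K" "K \<subseteq> Ix" "(i, d, k) \<notin> K" for K
    by (rule fresh_noise[OF indep_smp K(2) j K(3) smp_distr[OF j] XK[OF K(1,2)], where h = ?h and V = ?V];
        (use hM in \<open>simp add: lwj; fail\<close> | rule V[folded lwj(1)] | rule VX | rule mean[folded lwj(1)] | simp))+
  have Neq: "N = (\<lambda>\<omega>. ?h (?X \<omega>, smp (i, d, k) \<omega>))" by (simp add: N_def lwj)
  have K0: "past k \<subseteq> past k" "past k \<subseteq> Ix" "(i, d, k) \<notin> past k" using past_Ix by (auto simp: past_def)
  show "sqi N" unfolding Neq by (rule F(1)[OF K0])
  show "(\<integral>\<omega>. (norm (N \<omega>))\<^sup>2 \<partial>M) \<le> \<sigma>\<^sup>2 * (\<integral>\<omega>. (norm (v i k \<omega>))\<^sup>2 \<partial>M)"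
    using F(2)[OF K0] unfolding Neq by simp
  show "(\<integral>\<omega>. inner (a \<omega>) (N \<omega>) \<partial>M) = 0"
    if "past k \<subseteq> K" "K \<subseteq> Ix" "(i, d, k) \<notin> K" "a \<in> borel_measurable (hist lw smp K)" "sqi a" for K a
    unfolding Neq by (rule F(3)[OF that])
qed

end

section \<open>Expected one-step recursions\<close>

lemma (in prob_space) lipschitz_measurable:
  fixes h :: "'b::euclidean_space \<Rightarrow> 'c::euclidean_space"
  assumes "\<And>a b. norm (h a - h b) \<le> L * norm (a - b)"
  shows "h \<in> borel_measurable borel"
proof -
  have "\<bar>L\<bar>-lipschitz_on UNIV h"
  proof (rule lipschitz_onI)
    fix a b
    have "norm (h a - h b) \<le> L * norm (a - b)" by (rule assms)
    also have "\<dots> \<le> \<bar>L\<bar> * norm (a - b)" by (rule mult_right_mono) auto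
    finally show "dist (h a) (h b) \<le> \<bar>L\<bar> * dist a b" by (simp add: dist_norm)
  qed simp
  then show ?thesis by (intro borel_measurable_continuous_onI lipschitz_on_continuous_on)
qed

lemma (in prob_space) sqi_two_block:
  fixes h :: "'b::euclidean_space \<Rightarrow> 'c::euclidean_space \<Rightarrow> 'd::euclidean_space"
  assumes "sqi X" "sqi Y" "\<And>a b a' b'. norm (h a b - h a' b') \<le> L * (norm (a - a') + norm (b - b'))" "L \<ge> 0"
  shows "sqi (\<lambda>\<omega>. h (X \<omega>) (Y \<omega>))"
proof -
  have "norm (h (fst p) (snd p) - h (fst p') (snd p')) \<le> (2 * L) * norm (p - p')" for p p'
  proof -
    have nz: "norm (fst z) \<le> norm z" "norm (snd z) \<le> norm z" for z :: "'b \<times> 'c"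
      using norm_fst_le[of "fst z" "snd z"] norm_snd_le[of "snd z" "fst z"] by simp_all
    have "norm (h (fst p) (snd p) - h (fst p') (snd p')) \<le> L * (norm (fst (p - p')) + norm (snd (p - p')))"
      using assms(3) by simp
    also have "\<dots> \<le> L * (norm (p - p') + norm (p - p'))"
      using assms(4) by (intro mult_left_mono add_mono nz) auto
    finally show ?thesis by simp
  qed
  from sqi_lipschitz[OF sqi_Pair[OF assms(1,2)], of "\<lambda>p. h (fst p) (snd p)" "2 * L", OF this]
  show ?thesis by simp
qed

lemma (in prob_space) integral_le_combination:
  assumes "integrable M F" "integrable M F1" "integrable M F2" "integrable M F3" "integrable M F4"
    and "\<And>\<omega>. \<omega> \<in> space M \<Longrightarrow> F \<omega> \<le> a1 * F1 \<omega> + a2 * F2 \<omega> + a3 * F3 \<omega> + a4 * (F4 \<omega> :: real)"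
  shows "(\<integral>\<omega>. F \<omega> \<partial>M) \<le> a1 * (\<integral>\<omega>. F1 \<omega> \<partial>M) + a2 * (\<integral>\<omega>. F2 \<omega> \<partial>M) + a3 * (\<integral>\<omega>. F3 \<omega> \<partial>M) + a4 * (\<integral>\<omega>. F4 \<omega> \<partial>M)"
proof -
  have "(\<integral>\<omega>. F \<omega> \<partial>M) \<le> (\<integral>\<omega>. a1 * F1 \<omega> + a2 * F2 \<omega> + a3 * F3 \<omega> + a4 * F4 \<omega> \<partial>M)"
    by (rule integral_mono) (use assms in auto)
  also have "\<dots> = a1 * (\<integral>\<omega>. F1 \<omega> \<partial>M) + a2 * (\<integral>\<omega>. F2 \<omega> \<partial>M) + a3 * (\<integral>\<omega>. F3 \<omega> \<partial>M) + a4 * (\<integral>\<omega>. F4 \<omega> \<partial>M)"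
    using assms(1-5) by simp
  finally show ?thesis .
qed

context lopa_run
begin

lemma A_pos: "0 < A" using A_ge(9) by linarith

lemma alpha_A: "\<alpha> * A\<^sup>2 \<le> \<mu>" using alpha(3) by (simp add: A_def)

lemma ests:
  assumes "i \<in> V P"
  shows "estimator M (\<lambda>\<omega>. grad_t (gsample P i (\<zeta> i Xi1 k \<omega>)) a b) (grad_t (g P i) a b) (s_gt n)"
    "estimator M (\<lambda>\<omega>. hess_tt (gsample P i (\<zeta> i Xi2 k \<omega>)) a b) (hess_tt (g P i) a b) (s_gtt n)"
    "estimator M (\<lambda>\<omega>. hess_xt (gsample P i (\<zeta> i Xi3 k \<omega>)) a b) (hess_xt (g P i) a b) (s_gxt n)"
    "estimator M (\<lambda>\<omega>. grad_t (fsample P i (\<zeta> i Sig1 k \<omega>)) a b) (grad_t (f P i) a b) (s_ft n)"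
    "estimator M (\<lambda>\<omega>. grad_x (fsample P i (\<zeta> i Sig2 k \<omega>)) a b) (grad_x (f P i) a b) (s_fx n)"
  using samp assms unfolding sampling_def by blast+

text \<open>Sampling errors \<open>n\<close> and exact values \<open>m\<close> of the update directions of \<open>\<theta>\<close> (\<open>T\<close>), \<open>v\<close> (\<open>V\<close>) and \<open>z\<close> (\<open>S\<close>). The
  direction of \<open>v\<close> combines a Hessian (\<open>H\<close>) and a gradient sample (\<open>F\<close>), that of \<open>z\<close> a gradient
  (\<open>X\<close>) and a Jacobian sample (\<open>J\<close>).\<close>

definition "nT i k \<omega> = grad_t (gsample P i (\<zeta> i Xi1 k \<omega>)) (x i k \<omega>) (\<theta> i k \<omega>) - grad_t (g P i) (x i k \<omega>) (\<theta> i k \<omega>)"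
definition "nH i k \<omega> = blinfun_apply (hess_tt (gsample P i (\<zeta> i Xi2 k \<omega>)) (x i k \<omega>) (\<theta> i k \<omega>) - hess_tt (g P i) (x i k \<omega>) (\<theta> i k \<omega>)) (v i k \<omega>)"
definition "nF i k \<omega> = grad_t (fsample P i (\<zeta> i Sig1 k \<omega>)) (x i k \<omega>) (\<theta> i k \<omega>) - grad_t (f P i) (x i k \<omega>) (\<theta> i k \<omega>)"
definition "nX i k \<omega> = grad_x (fsample P i (\<zeta> i Sig2 k \<omega>)) (x i k \<omega>) (\<theta> i k \<omega>) - grad_x (f P i) (x i k \<omega>) (\<theta> i k \<omega>)"
definition "nJ i k \<omega> = blinfun_apply (hess_xt (gsample P i (\<zeta> i Xi3 k \<omega>)) (x i k \<omega>) (\<theta> i k \<omega>) - hess_xt (g P i) (x i k \<omega>) (\<theta> i k \<omega>)) (v i k \<omega>)"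
definition "nV i k \<omega> = nH i k \<omega> - nF i k \<omega>"
definition "nS i k \<omega> = nX i k \<omega> - nJ i k \<omega>"
definition "mT i k \<omega> = grad_t (g P i) (x i k \<omega>) (\<theta> i k \<omega>)"
definition "mV i k \<omega> = blinfun_apply (hess_tt (g P i) (x i k \<omega>) (\<theta> i k \<omega>)) (v i k \<omega>) - grad_t (f P i) (x i k \<omega>) (\<theta> i k \<omega>)"
definition "mS i k \<omega> = grad_x (f P i) (x i k \<omega>) (\<theta> i k \<omega>) - blinfun_apply (hess_xt (g P i) (x i k \<omega>) (\<theta> i k \<omega>)) (v i k \<omega>)"

lemma noisy_step:
  assumes "i \<in> V P" "\<omega> \<in> space M"
  shows "\<theta> i (Suc k) \<omega> = \<theta> i k \<omega> - \<alpha> *\<^sub>R mT i k \<omega> - \<alpha> *\<^sub>R nT i k \<omega>"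
    "v i (Suc k) \<omega> = v i k \<omega> - \<alpha> *\<^sub>R mV i k \<omega> - \<alpha> *\<^sub>R nV i k \<omega>"
    "z i (Suc k) \<omega> = (1 - \<alpha>) *\<^sub>R z i k \<omega> + \<alpha> *\<^sub>R mS i k \<omega> + \<alpha> *\<^sub>R nS i k \<omega>"
  unfolding step[OF assms] mT_def mV_def mS_def nT_def nV_def nS_def nH_def nF_def nX_def nJ_def
  by (simp_all add: blinfun.diff_left algebra_simps)

text \<open>A noise vector with zero conditional mean given the samples in \<open>K\<close>, expressed by integrals only.\<close>

definition orth :: "(nat \<times> draw \<times> nat) set \<Rightarrow> ('w \<Rightarrow> 'b::euclidean_space) \<Rightarrow> bool" where
  "orth K N \<longleftrightarrow> (\<forall>a. a \<in> borel_measurable (hist lw smp K) \<longrightarrow> sqi a \<longrightarrow> (\<integral>\<omega>. inner (a \<omega>) (N \<omega>) \<partial>M) = 0)"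

lemma orth_diff:
  fixes N N' :: "'w \<Rightarrow> 'b::euclidean_space"
  assumes "orth K N" "orth K N'" "sqi N" "sqi N'" shows "orth K (\<lambda>\<omega>. N \<omega> - N' \<omega>)"
  unfolding orth_def
proof (intro allI impI)
  fix a :: "'w \<Rightarrow> 'b" assume a: "a \<in> borel_measurable (hist lw smp K)" "sqi a"
  have "(\<integral>\<omega>. inner (a \<omega>) (N \<omega> - N' \<omega>) \<partial>M) = (\<integral>\<omega>. inner (a \<omega>) (N \<omega>) \<partial>M) - (\<integral>\<omega>. inner (a \<omega>) (N' \<omega>) \<partial>M)"
    unfolding inner_diff_right
    by (rule Bochner_Integration.integral_diff[OF sqi_inner[OF a(2) assms(3)] sqi_inner[OF a(2) assms(4)]])
  then show "(\<integral>\<omega>. inner (a \<omega>) (N \<omega> - N' \<omega>) \<partial>M) = 0"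
    using a assms(1,2) by (simp add: orth_def)
qed

lemma past_new: "(i, d, k) \<notin> past k" by (simp add: past_def)

lemma noise_T:
  assumes i: "i \<in> V P"
  shows "sqi (nT i k)" "(\<integral>\<omega>. (norm (nT i k \<omega>))\<^sup>2 \<partial>M) \<le> (s_gt n)\<^sup>2" "orth (past k) (nT i k)"
proof -
  note N = vector_noise[OF i measurable_ests(1)[OF i] node_measurable(3)[OF i] ests(1)[OF i]]
  show "sqi (nT i k)" unfolding nT_def[abs_def] by (rule N(1))
  show "orth (past k) (nT i k)"
    unfolding orth_def nT_def[abs_def] by (intro allI impI) (rule N(3)[OF order_refl past_Ix past_new])
  show "(\<integral>\<omega>. (norm (nT i k \<omega>))\<^sup>2 \<partial>M) \<le> (s_gt n)\<^sup>2"
    unfolding nT_def[abs_def] by (rule N(2))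
qed

lemma noise_F:
  assumes i: "i \<in> V P"
  shows "sqi (nF i k)" "(\<integral>\<omega>. (norm (nF i k \<omega>))\<^sup>2 \<partial>M) \<le> (s_ft n)\<^sup>2" "orth (past k) (nF i k)"
proof -
  note N = vector_noise[OF i measurable_ests(4)[OF i] node_measurable(2)[OF i] ests(4)[OF i]]
  show "sqi (nF i k)" unfolding nF_def[abs_def] by (rule N(1))
  show "orth (past k) (nF i k)"
    unfolding orth_def nF_def[abs_def] by (intro allI impI) (rule N(3)[OF order_refl past_Ix past_new])
  show "(\<integral>\<omega>. (norm (nF i k \<omega>))\<^sup>2 \<partial>M) \<le> (s_ft n)\<^sup>2"
    unfolding nF_def[abs_def] by (rule N(2))
qed

lemma noise_X:
  assumes i: "i \<in> V P"
  shows "sqi (nX i k)" "(\<integral>\<omega>. (norm (nX i k \<omega>))\<^sup>2 \<partial>M) \<le> (s_fx n)\<^sup>2"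
    "past k \<subseteq> K \<Longrightarrow> K \<subseteq> Ix \<Longrightarrow> (i, Sig2, k) \<notin> K \<Longrightarrow> orth K (nX i k)"
proof -
  note N = vector_noise[OF i measurable_ests(5)[OF i] node_measurable(1)[OF i] ests(5)[OF i]]
  show "sqi (nX i k)" unfolding nX_def[abs_def] by (rule N(1))
  show "orth K (nX i k)" if "past k \<subseteq> K" "K \<subseteq> Ix" "(i, Sig2, k) \<notin> K"
    unfolding orth_def nX_def[abs_def] by (intro allI impI) (rule N(3)[OF that])
  show "(\<integral>\<omega>. (norm (nX i k \<omega>))\<^sup>2 \<partial>M) \<le> (s_fx n)\<^sup>2"
    unfolding nX_def[abs_def] by (rule N(2))
qed

lemma noise_H:
  assumes i: "i \<in> V P" and sv: "sqi (v i k)"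
  shows "sqi (nH i k)" "(\<integral>\<omega>. (norm (nH i k \<omega>))\<^sup>2 \<partial>M) \<le> (s_gtt n)\<^sup>2 * (\<integral>\<omega>. (norm (v i k \<omega>))\<^sup>2 \<partial>M)" "orth (past k) (nH i k)"
proof -
  note N = matrix_noise[OF i measurable_ests(2)[OF i] node_measurable(5)[OF i] ests(2)[OF i] sv]
  show "sqi (nH i k)" unfolding nH_def[abs_def] by (rule N(1))
  show "orth (past k) (nH i k)"
    unfolding orth_def nH_def[abs_def] by (intro allI impI) (rule N(3)[OF order_refl past_Ix past_new])
  show "(\<integral>\<omega>. (norm (nH i k \<omega>))\<^sup>2 \<partial>M) \<le> (s_gtt n)\<^sup>2 * (\<integral>\<omega>. (norm (v i k \<omega>))\<^sup>2 \<partial>M)"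
    unfolding nH_def[abs_def] by (rule N(2))
qed

lemma noise_J:
  assumes i: "i \<in> V P" and sv: "sqi (v i k)"
  shows "sqi (nJ i k)" "(\<integral>\<omega>. (norm (nJ i k \<omega>))\<^sup>2 \<partial>M) \<le> (s_gxt n)\<^sup>2 * (\<integral>\<omega>. (norm (v i k \<omega>))\<^sup>2 \<partial>M)"
    "past k \<subseteq> K \<Longrightarrow> K \<subseteq> Ix \<Longrightarrow> (i, Xi3, k) \<notin> K \<Longrightarrow> orth K (nJ i k)"
proof -
  note N = matrix_noise[OF i measurable_ests(3)[OF i] node_measurable(4)[OF i] ests(3)[OF i] sv]
  show "sqi (nJ i k)" unfolding nJ_def[abs_def] by (rule N(1))
  show "orth K (nJ i k)" if "past k \<subseteq> K" "K \<subseteq> Ix" "(i, Xi3, k) \<notin> K"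
    unfolding orth_def nJ_def[abs_def] by (intro allI impI) (rule N(3)[OF that])
  show "(\<integral>\<omega>. (norm (nJ i k \<omega>))\<^sup>2 \<partial>M) \<le> (s_gxt n)\<^sup>2 * (\<integral>\<omega>. (norm (v i k \<omega>))\<^sup>2 \<partial>M)"
    unfolding nJ_def[abs_def] by (rule N(2))
qed

lemma mean_measurable:
  assumes i: "i \<in> V P" and m: "x i k \<in> borel_measurable N" "\<theta> i k \<in> borel_measurable N" "v i k \<in> borel_measurable N"
  shows "mT i k \<in> borel_measurable N" "mV i k \<in> borel_measurable N" "mS i k \<in> borel_measurable N"
    "(\<lambda>\<omega>. blinfun_apply (hess_tt (g P i) (x i k \<omega>) (\<theta> i k \<omega>)) (v i k \<omega>)) \<in> borel_measurable N"
    "(\<lambda>\<omega>. blinfun_apply (hess_xt (g P i) (x i k \<omega>) (\<theta> i k \<omega>)) (v i k \<omega>)) \<in> borel_measurable N"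
  unfolding mT_def[abs_def] mV_def[abs_def] mS_def[abs_def]
  by (intro borel_measurable_diff measurable_blinfun_apply m
      measurable_mean_compose[OF node_measurable(1)[OF i] m(1,2)]
      measurable_mean_compose[OF node_measurable(2)[OF i] m(1,2)]
      measurable_mean_compose[OF node_measurable(3)[OF i] m(1,2)]
      measurable_mean_compose[OF node_measurable(4)[OF i] m(1,2)]
      measurable_mean_compose[OF node_measurable(5)[OF i] m(1,2)])+

lemma mean_sqi:
  assumes i: "i \<in> V P" and s: "sqi (x i k)" "sqi (\<theta> i k)" "sqi (v i k)"
  shows "sqi (mT i k)" "sqi (mV i k)" "sqi (mS i k)"
proof -
  interpret N: bilevel_node "f P i" "g P i" \<mu> A "MM c \<mu>" using node[OF i] .
  note m = mean_measurable[OF i sqi_measurable[OF s(1)] sqi_measurable[OF s(2)] sqi_measurable[OF s(3)]]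
  have gl: "norm (grad_t (g P i) a b - grad_t (g P i) a' b') \<le> A * (norm (a - a') + norm (b - b'))" for a b a' b'
    using norm_diff_via[of "grad_t (g P i) a b" "grad_t (g P i) a' b'" "grad_t (g P i) a' b"]
      N.Gt_lip_x[of a b a'] N.Gt_lip[of a' b b'] by (simp add: distrib_left)
  have A0: "0 \<le> A" using A_pos by simp
  show "sqi (mT i k)" unfolding mT_def[abs_def] by (rule sqi_two_block[OF s(1,2) gl A0])
  have 1: "sqi (\<lambda>\<omega>. blinfun_apply (hess_tt (g P i) (x i k \<omega>) (\<theta> i k \<omega>)) (v i k \<omega>))"
    by (rule sqi_dominated[OF m(4) s(3)]) (rule N.Gtt_bound)
  have 2: "sqi (\<lambda>\<omega>. blinfun_apply (hess_xt (g P i) (x i k \<omega>) (\<theta> i k \<omega>)) (v i k \<omega>))"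
    by (rule sqi_dominated[OF m(5) s(3), where r = A]) (rule order_trans[OF norm_blinfun], intro mult_right_mono N.Gxt_bound norm_ge_zero)
  show "sqi (mV i k)" unfolding mV_def[abs_def]
    by (rule sqi_diff[OF 1 sqi_two_block[OF s(1,2) N.Ft_lip A0]])
  show "sqi (mS i k)" unfolding mS_def[abs_def]
    by (rule sqi_diff[OF sqi_two_block[OF s(1,2) N.Fx_lip A0] 2])
qed

text \<open>Square integrability must go along with the induction on \<open>k\<close>: the noise of the matrix estimators has
  a finite second moment only if \<open>v\<close> has one.\<close>

lemma state_sqi: "\<forall>i\<in>V P. sqi (x i k) \<and> sqi (\<theta> i k) \<and> sqi (v i k) \<and> sqi (z i k)"
proof (induction k)
  case 0
  show ?case
    by (intro ballI conjI; rule sqi_cong[OF sqi_const]; use init in blast)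
next
  case (Suc k)
  show ?case
  proof (intro ballI)
    fix i assume i: "i \<in> V P"
    have s: "sqi (x i k)" "sqi (\<theta> i k)" "sqi (v i k)" "sqi (z i k)" using bspec[OF Suc i] by blast+
    note ms = mean_sqi[OF i s(1-3)]
    have 1: "sqi (\<theta> i (Suc k))"
      by (rule sqi_cong[OF _ noisy_step(1)[OF i]]) (intro sqi_diff sqi_scaleR s ms noise_T(1)[OF i])
    have nv: "sqi (nV i k)" unfolding nV_def[abs_def] by (intro sqi_diff noise_H(1)[OF i s(3)] noise_F(1)[OF i])
    have ns: "sqi (nS i k)" unfolding nS_def[abs_def] by (intro sqi_diff noise_X(1)[OF i] noise_J(1)[OF i s(3)])
    have 2: "sqi (v i (Suc k))"
      by (rule sqi_cong[OF _ noisy_step(2)[OF i]]) (intro sqi_diff sqi_scaleR s ms nv)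
    have 3: "sqi (z i (Suc k))"
      by (rule sqi_cong[OF _ noisy_step(3)[OF i]]) (intro sqi_add sqi_scaleR s ms ns)
    have nb: "j \<in> V P" if "(i, j) \<in> E" for j using net that unfolding network_def by auto
    have 4: "sqi (x i (Suc k))"
    proof (rule sqi_cong[OF _ step(3)[OF i]])
      have "sqi (x j k)" if "j \<in> {j. (i, j) \<in> E}" for j
        using bspec[OF Suc nb[of j]] that by blast
      then show "sqi (\<lambda>\<omega>. (1 - tau st) *\<^sub>R x i k \<omega> + tau st *\<^sub>R ((\<Sum>j | (i, j) \<in> E. W i j *\<^sub>R x j k \<omega>) - \<alpha> *\<^sub>R z i k \<omega>))"
        by (intro sqi_add sqi_diff sqi_scaleR s sqi_sum)
    qed
    show "sqi (x i (Suc k)) \<and> sqi (\<theta> i (Suc k)) \<and> sqi (v i (Suc k)) \<and> sqi (z i (Suc k))"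
      using 1 2 3 4 by blast
  qed
qed

lemma ssq: "i \<in> V P \<Longrightarrow> sqi (x i k)" "i \<in> V P \<Longrightarrow> sqi (\<theta> i k)" "i \<in> V P \<Longrightarrow> sqi (v i k)" "i \<in> V P \<Longrightarrow> sqi (z i k)"
  using state_sqi by blast+

lemma smeas: "i \<in> V P \<Longrightarrow> x i k \<in> borel_measurable (H k)" "i \<in> V P \<Longrightarrow> \<theta> i k \<in> borel_measurable (H k)"
  "i \<in> V P \<Longrightarrow> v i k \<in> borel_measurable (H k)" "i \<in> V P \<Longrightarrow> z i k \<in> borel_measurable (H k)"
  using state_measurable by blast+

lemma noise_V:
  assumes i: "i \<in> V P"
  shows "sqi (nV i k)"
    "(\<integral>\<omega>. (norm (nV i k \<omega>))\<^sup>2 \<partial>M) \<le> 2 * (s_ft n)\<^sup>2 + 2 * (s_gtt n)\<^sup>2 * (\<integral>\<omega>. (norm (v i k \<omega>))\<^sup>2 \<partial>M)"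
    "orth (past k) (nV i k)"
proof -
  note h = noise_H[OF i ssq(3)[OF i]] and fn = noise_F[OF i]
  show "sqi (nV i k)" unfolding nV_def[abs_def] by (intro sqi_diff h fn)
  show "orth (past k) (nV i k)" unfolding nV_def[abs_def] by (intro orth_diff h fn)
  have "(\<integral>\<omega>. (norm (nV i k \<omega>))\<^sup>2 \<partial>M) \<le> 2 * (\<integral>\<omega>. (norm (nH i k \<omega>))\<^sup>2 \<partial>M) + 2 * (\<integral>\<omega>. (norm (nF i k \<omega>))\<^sup>2 \<partial>M)
      + 0 * (\<integral>\<omega>. 0 \<partial>M) + 0 * (\<integral>\<omega>. 0 \<partial>M)"
  proof (rule integral_le_combination)
    show "(norm (nV i k \<omega>))\<^sup>2 \<le> 2 * (norm (nH i k \<omega>))\<^sup>2 + 2 * (norm (nF i k \<omega>))\<^sup>2 + 0 * 0 + 0 * 0" for \<omega>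
      using norm_sq_diff_le[of "nH i k \<omega>" "nF i k \<omega>"] by (simp add: nV_def)
  qed (rule sqi_integrable[OF \<open>sqi (nV i k)\<close>] sqi_integrable[OF h(1)] sqi_integrable[OF fn(1)] integrable_zero)+
  then show "(\<integral>\<omega>. (norm (nV i k \<omega>))\<^sup>2 \<partial>M) \<le> 2 * (s_ft n)\<^sup>2 + 2 * (s_gtt n)\<^sup>2 * (\<integral>\<omega>. (norm (v i k \<omega>))\<^sup>2 \<partial>M)"
    using h(2)[of k] fn(2)[of k] by simp
qed

lemma noise_S:
  assumes i: "i \<in> V P"
  shows "sqi (nS i k)"
    "(\<integral>\<omega>. (norm (nS i k \<omega>))\<^sup>2 \<partial>M) \<le> 2 * (s_fx n)\<^sup>2 + 2 * (s_gxt n)\<^sup>2 * (\<integral>\<omega>. (norm (v i k \<omega>))\<^sup>2 \<partial>M)"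
    "past k \<subseteq> K \<Longrightarrow> K \<subseteq> Ix \<Longrightarrow> (i, Sig2, k) \<notin> K \<Longrightarrow> (i, Xi3, k) \<notin> K \<Longrightarrow> orth K (nS i k)"
proof -
  note h = noise_J[OF i ssq(3)[OF i]] and fn = noise_X[OF i]
  show "sqi (nS i k)" unfolding nS_def[abs_def] by (intro sqi_diff h fn)
  show "orth K (nS i k)" if "past k \<subseteq> K" "K \<subseteq> Ix" "(i, Sig2, k) \<notin> K" "(i, Xi3, k) \<notin> K"
    unfolding nS_def[abs_def] by (intro orth_diff h fn that)
  have "(\<integral>\<omega>. (norm (nS i k \<omega>))\<^sup>2 \<partial>M) \<le> 2 * (\<integral>\<omega>. (norm (nX i k \<omega>))\<^sup>2 \<partial>M) + 2 * (\<integral>\<omega>. (norm (nJ i k \<omega>))\<^sup>2 \<partial>M)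
      + 0 * (\<integral>\<omega>. 0 \<partial>M) + 0 * (\<integral>\<omega>. 0 \<partial>M)"
  proof (rule integral_le_combination)
    show "(norm (nS i k \<omega>))\<^sup>2 \<le> 2 * (norm (nX i k \<omega>))\<^sup>2 + 2 * (norm (nJ i k \<omega>))\<^sup>2 + 0 * 0 + 0 * 0" for \<omega>
      using norm_sq_diff_le[of "nX i k \<omega>" "nJ i k \<omega>"] by (simp add: nS_def)
  qed (rule sqi_integrable[OF \<open>sqi (nS i k)\<close>] sqi_integrable[OF h(1)] sqi_integrable[OF fn(1)] integrable_zero)+
  then show "(\<integral>\<omega>. (norm (nS i k \<omega>))\<^sup>2 \<partial>M) \<le> 2 * (s_fx n)\<^sup>2 + 2 * (s_gxt n)\<^sup>2 * (\<integral>\<omega>. (norm (v i k \<omega>))\<^sup>2 \<partial>M)"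
    using h(2)[of k] fn(2)[of k] by simp
qed

text \<open>The noise of node \<open>i\<close> is a function of the past and of two samples of node \<open>i\<close>, while that of node \<open>j\<close>
  is centered given all of these.\<close>

lemma noise_S_pair:
  assumes i: "i \<in> V P" and j: "j \<in> V P" and ij: "i \<noteq> j"
  shows "(\<integral>\<omega>. inner (nS i k \<omega>) (nS j k \<omega>) \<partial>M) = 0"
proof -
  define K where "K = past k \<union> {(i, Sig2, k), (i, Xi3, k)}"
  have K: "past k \<subseteq> K" "K \<subseteq> Ix" using past_Ix i by (auto simp: K_def Ix_def)
  have up: "X \<in> measurable (hist lw smp K) S" if "X \<in> measurable (H k) S" for X and S :: "'q measure"
    using that unfolding H_def by (rule hist_up[OF K])
  have sm: "\<zeta> i d k \<in> measurable (hist lw smp K) (law P i d)" if "d = Sig2 \<or> d = Xi3" for d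
  proof -
    have "smp (i, d, k) \<in> measurable (hist lw smp K) (lw (i, d, k))"
      by (rule hist_sample, rule smp_measurable, erule subsetD[OF K(2)]) (use that in \<open>auto simp: K_def\<close>)
    then show ?thesis by (simp add: smp_def lw_def)
  qed
  have upb: "X \<in> borel_measurable (hist lw smp K)" if "X \<in> borel_measurable (H k)" for X :: "'w \<Rightarrow> 'q::topological_space"
    using that unfolding H_def by (rule hist_up[OF K])
  note m = upb[OF smeas(1)[OF i]] upb[OF smeas(2)[OF i]] upb[OF smeas(3)[OF i]]
  have "nS i k \<in> borel_measurable (hist lw smp K)"
    unfolding nS_def[abs_def] nX_def[abs_def] nJ_def[abs_def]
    by (intro borel_measurable_diff measurable_blinfun_apply m
        measurable_est_compose[OF measurable_ests(5)[OF i] m(1,2) sm]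
        measurable_est_compose[OF measurable_ests(3)[OF i] m(1,2) sm]
        measurable_mean_compose[OF node_measurable(1)[OF i] m(1,2)]
        measurable_mean_compose[OF node_measurable(4)[OF i] m(1,2)]) auto
  moreover have "orth K (nS j k)"
    by (rule noise_S(3)[OF j K]) (use ij in \<open>auto simp: K_def past_def\<close>)
  ultimately show ?thesis using noise_S(1)[OF i] by (simp add: orth_def)
qed

text \<open>\<open>xn k\<close> is the next average \<open>xb (Suc k)\<close> expressed through iteration \<open>k\<close>, which makes it measurable
  with respect to \<open>H k\<close>: gossip preserves the average, and the current samples do not enter
  the update of \<open>x\<close>.\<close>

definition "xb k \<omega> = node_avg m (\<lambda>i. x i k \<omega>)"
definition "zb k \<omega> = node_avg m (\<lambda>i. z i k \<omega>)"
definition "xn k \<omega> = xb k \<omega> - (tau st * \<alpha>) *\<^sub>R zb k \<omega>"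

lemma xb_sqi: "sqi (xb k)" and zb_sqi: "sqi (zb k)"
  unfolding xb_def[abs_def] zb_def[abs_def] by (rule sqi_node_avg, simp add: ssq m_def)+

lemma xb_H: "xb k \<in> borel_measurable (H k)" and zb_H: "zb k \<in> borel_measurable (H k)"
  unfolding xb_def[abs_def] zb_def[abs_def] node_avg_def
  by (intro borel_measurable_scaleR borel_measurable_const borel_measurable_sum smeas, simp add: m_def)+

lemma xn_H: "xn k \<in> borel_measurable (H k)"
  unfolding xn_def[abs_def] by (intro borel_measurable_diff borel_measurable_scaleR borel_measurable_const xb_H zb_H)

lemma xn_sqi: "sqi (xn k)"
  unfolding xn_def[abs_def] by (intro sqi_diff sqi_scaleR xb_sqi zb_sqi)

lemma gossip_step:
  assumes "\<omega> \<in> space M"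
  shows "xb (Suc k) \<omega> = xn k \<omega>"
    and "(\<Sum>i=1..m. (norm (x i (Suc k) \<omega> - xb (Suc k) \<omega>))\<^sup>2)
      \<le> (1 - tau st * (1 - r) / 2) * (\<Sum>i=1..m. (norm (x i k \<omega> - xb k \<omega>))\<^sup>2)
        + 2 * tau st * \<alpha>\<^sup>2 / (1 - r) * (\<Sum>i=1..m. (norm (z i k \<omega> - zb k \<omega>))\<^sup>2)"
proof -
  have s: "x i (Suc k) \<omega> = (1 - tau st) *\<^sub>R x i k \<omega> + tau st *\<^sub>R ((\<Sum>j | (i, j) \<in> E. W i j *\<^sub>R x j k \<omega>) - \<alpha> *\<^sub>R z i k \<omega>)"
    if "i \<in> {1..m}" for i
    by (rule step(3)) (use that assms in \<open>auto simp: m_def\<close>)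
  have rr: "rho m W \<le> r" using rho_r(1) by (simp add: m_def)
  note C = consensus_step[OF net[folded m_def] m1 rr rho_r(2,3) tau,
      of "\<lambda>i. x i (Suc k) \<omega>" "\<lambda>i. x i k \<omega>" \<alpha> "\<lambda>i. z i k \<omega>", OF s]
  show "xb (Suc k) \<omega> = xn k \<omega>" using C(1) by (simp add: xb_def xn_def zb_def)
  show "(\<Sum>i=1..m. (norm (x i (Suc k) \<omega> - xb (Suc k) \<omega>))\<^sup>2)
      \<le> (1 - tau st * (1 - r) / 2) * (\<Sum>i=1..m. (norm (x i k \<omega> - xb k \<omega>))\<^sup>2)
        + 2 * tau st * \<alpha>\<^sup>2 / (1 - r) * (\<Sum>i=1..m. (norm (z i k \<omega> - zb k \<omega>))\<^sup>2)"
    using C(2) by (simp add: xb_def zb_def)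
qed

lemma xn_diff: "(norm (xn k \<omega> - xb k \<omega>))\<^sup>2 = (tau st)\<^sup>2 * \<alpha>\<^sup>2 * (norm (zb k \<omega>))\<^sup>2"
  by (simp add: xn_def power_mult_distrib)

lemma star_sqi:
  assumes i: "i \<in> V P" and X: "sqi X"
  shows "sqi (\<lambda>\<omega>. theta_star P i (X \<omega>))" "sqi (\<lambda>\<omega>. v_star P i (X \<omega>))" "sqi (\<lambda>\<omega>. gP i (X \<omega>))"
  by (rule sqi_lipschitz[OF X theta_star_lip[OF i]] sqi_lipschitz[OF X v_star_lip[OF i]] sqi_lipschitz[OF X gP_lip[OF i]])+

lemma star_measurable:
  assumes i: "i \<in> V P" and X: "X \<in> borel_measurable N"
  shows "(\<lambda>\<omega>. theta_star P i (X \<omega>)) \<in> borel_measurable N" "(\<lambda>\<omega>. v_star P i (X \<omega>)) \<in> borel_measurable N"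
    "(\<lambda>\<omega>. gP i (X \<omega>)) \<in> borel_measurable N"
  by (rule measurable_compose[OF X lipschitz_measurable[OF theta_star_lip[OF i]]]
      measurable_compose[OF X lipschitz_measurable[OF v_star_lip[OF i]]]
      measurable_compose[OF X lipschitz_measurable[OF gP_lip[OF i]]])+

lemma gPhi_sqi: "sqi X \<Longrightarrow> sqi (\<lambda>\<omega>. gPhi (X \<omega>))"
  by (rule sqi_lipschitz[OF _ gPhi_lip])

text \<open>\<open>Dc\<close> and \<open>Dz\<close> both measure tracking, per node and on average. The averaged error drives the
  objective and has the small variance; the error per node is what the consensus error depends on.\<close>

definition "Dx i k = (\<integral>\<omega>. (norm (x i k \<omega> - xb k \<omega>))\<^sup>2 \<partial>M)"
definition "Dt i k = (\<integral>\<omega>. (norm (\<theta> i k \<omega> - theta_star P i (xb k \<omega>)))\<^sup>2 \<partial>M)"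
definition "Dv i k = (\<integral>\<omega>. (norm (v i k \<omega> - v_star P i (xb k \<omega>)))\<^sup>2 \<partial>M)"
definition "Dc i k = (\<integral>\<omega>. (norm (gP i (xb k \<omega>) - z i k \<omega>))\<^sup>2 \<partial>M)"
definition "Dz k = (\<integral>\<omega>. (norm (gPhi (xb k \<omega>) - zb k \<omega>))\<^sup>2 \<partial>M)"
definition "EZ k = (\<integral>\<omega>. (norm (zb k \<omega>))\<^sup>2 \<partial>M)"
definition "EG k = (\<integral>\<omega>. (norm (gPhi (xb k \<omega>)))\<^sup>2 \<partial>M)"
definition "EP k = (\<integral>\<omega>. Phi P (xb k \<omega>) \<partial>M)"

lemma err_sqi:
  assumes i: "i \<in> V P"
  shows "sqi (\<lambda>\<omega>. x i k \<omega> - xb k \<omega>)" "sqi (\<lambda>\<omega>. \<theta> i k \<omega> - theta_star P i (xb k \<omega>))"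
    "sqi (\<lambda>\<omega>. v i k \<omega> - v_star P i (xb k \<omega>))" "sqi (\<lambda>\<omega>. gP i (xb k \<omega>) - z i k \<omega>)"
    "sqi (\<lambda>\<omega>. gPhi (xb k \<omega>) - zb k \<omega>)"
  by (intro sqi_diff ssq[OF i] xb_sqi zb_sqi star_sqi[OF i] gPhi_sqi)+

lemmas err_int = err_sqi[THEN sqi_integrable]
lemmas zb_int = zb_sqi[THEN sqi_integrable]

text \<open>Each update is a vector determined by the past plus centered noise, so the noise adds just its second moment.\<close>

lemma expectation_noisy:
  assumes "sqi a" "a \<in> borel_measurable (H k)" "sqi N" "orth (past k) N"
    and "\<And>\<omega>. \<omega> \<in> space M \<Longrightarrow> X \<omega> = a \<omega> + s *\<^sub>R N \<omega>"
  shows "(\<integral>\<omega>. (norm (X \<omega>))\<^sup>2 \<partial>M) = (\<integral>\<omega>. (norm (a \<omega>))\<^sup>2 \<partial>M) + s\<^sup>2 * (\<integral>\<omega>. (norm (N \<omega>))\<^sup>2 \<partial>M)"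
proof -
  have "(\<integral>\<omega>. (norm (X \<omega>))\<^sup>2 \<partial>M) = (\<integral>\<omega>. (norm (a \<omega> + s *\<^sub>R N \<omega>))\<^sup>2 \<partial>M)"
    by (rule Bochner_Integration.integral_cong) (auto simp: assms(5))
  also have "\<dots> = (\<integral>\<omega>. (norm (a \<omega>))\<^sup>2 \<partial>M) + (\<integral>\<omega>. (norm (s *\<^sub>R N \<omega>))\<^sup>2 \<partial>M)"
    by (rule integral_norm_sq_add_orthogonal[OF assms(1) sqi_scaleR[OF assms(3)]])
      (use assms(1,2,4) in \<open>simp add: orth_def H_def\<close>)
  finally show ?thesis by (simp add: power_mult_distrib)
qed

text \<open>Each recursion is the deterministic step for the exact directions, integrated, plus the variance. The
  displacement of \<open>xb\<close> contributes a multiple of \<open>1 / (\<alpha> * \<mu>) * \<tau>\<^sup>2 * \<alpha>\<^sup>2\<close> times the square of \<open>zb\<close>, which is linear in \<open>\<alpha>\<close>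
  and thus comparable with the descent of the objective.\<close>

lemma recursion_theta:
  assumes i: "i \<in> V P"
  shows "Dt i (Suc k) \<le> (1 - \<alpha> * \<mu> / 2) * Dt i k + 4 * \<alpha> / \<mu> * A\<^sup>2 * Dx i k
    + 4 * \<alpha> * q\<^sup>2 * (tau st)\<^sup>2 / \<mu> * EZ k + \<alpha>\<^sup>2 * (s_gt n)\<^sup>2"
proof -
  let ?a = "\<lambda>\<omega>. \<theta> i k \<omega> - \<alpha> *\<^sub>R mT i k \<omega> - theta_star P i (xn k \<omega>)"
  have sa: "sqi ?a" by (intro sqi_diff sqi_scaleR ssq[OF i] mean_sqi[OF i] star_sqi[OF i] xn_sqi)
  have ma: "?a \<in> borel_measurable (H k)"
    by (intro borel_measurable_diff borel_measurable_scaleR borel_measurable_const smeas[OF i] mean_measurable[OF i] star_measurable[OF i] xn_H)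
  have e: "Dt i (Suc k) = (\<integral>\<omega>. (norm (?a \<omega>))\<^sup>2 \<partial>M) + (- \<alpha>)\<^sup>2 * (\<integral>\<omega>. (norm (nT i k \<omega>))\<^sup>2 \<partial>M)"
    unfolding Dt_def
    by (rule expectation_noisy[OF sa ma noise_T(1)[OF i] noise_T(3)[OF i]]) (simp add: noisy_step[OF i] gossip_step(1))
  have X: "(\<integral>\<omega>. (norm (?a \<omega>))\<^sup>2 \<partial>M) \<le> (1 - \<alpha> * \<mu> / 2) * Dt i k + 4 * \<alpha> / \<mu> * A\<^sup>2 * Dx i k
    + 4 * \<alpha> * q\<^sup>2 * (tau st)\<^sup>2 / \<mu> * EZ k + 0 * (\<integral>\<omega>. 0 \<partial>M)"
    unfolding Dt_def Dx_def EZ_def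
  proof (rule integral_le_combination)
    fix \<omega>
    have "(norm (?a \<omega>))\<^sup>2 \<le> (1 - \<alpha> * \<mu> / 2) * (norm (\<theta> i k \<omega> - theta_star P i (xb k \<omega>)))\<^sup>2
        + 4 * \<alpha> / \<mu> * A\<^sup>2 * (norm (x i k \<omega> - xb k \<omega>))\<^sup>2 + 4 / (\<alpha> * \<mu>) * q\<^sup>2 * (norm (xn k \<omega> - xb k \<omega>))\<^sup>2"
      unfolding mT_def
      using bilevel_node.theta_step[OF node[OF i] alpha(1) alpha_A, of "\<theta> i k \<omega>" "x i k \<omega>" "xn k \<omega>" "xb k \<omega>"]
      by (simp only: node_eqs[OF i])
    also have "4 / (\<alpha> * \<mu>) * q\<^sup>2 * (norm (xn k \<omega> - xb k \<omega>))\<^sup>2 = 4 * \<alpha> * q\<^sup>2 * (tau st)\<^sup>2 / \<mu> * (norm (zb k \<omega>))\<^sup>2"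
      unfolding xn_diff using alpha mu0 by (simp add: power2_eq_square field_simps)
    finally show "(norm (?a \<omega>))\<^sup>2 \<le> (1 - \<alpha> * \<mu> / 2) * (norm (\<theta> i k \<omega> - theta_star P i (xb k \<omega>)))\<^sup>2
        + 4 * \<alpha> / \<mu> * A\<^sup>2 * (norm (x i k \<omega> - xb k \<omega>))\<^sup>2 + 4 * \<alpha> * q\<^sup>2 * (tau st)\<^sup>2 / \<mu> * (norm (zb k \<omega>))\<^sup>2 + 0 * 0"
      by simp
  qed (rule sqi_integrable[OF sa] err_int[OF i] zb_int integrable_zero)+
  have Y: "(- \<alpha>)\<^sup>2 * (\<integral>\<omega>. (norm (nT i k \<omega>))\<^sup>2 \<partial>M) \<le> \<alpha>\<^sup>2 * (s_gt n)\<^sup>2"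
    using noise_T(2)[OF i] by (simp add: mult_left_mono)
  show ?thesis using e X Y by simp
qed

text \<open>Makes the variance in the recursions for \<open>v\<close> and \<open>z\<close> explicit: a constant part and a part proportional to
  \<open>Dv\<close>, to be absorbed by the contraction of \<open>v\<close> for small \<open>\<alpha>\<close>.\<close>

lemma v_second_moment:
  assumes i: "i \<in> V P"
  shows "(\<integral>\<omega>. (norm (v i k \<omega>))\<^sup>2 \<partial>M) \<le> 2 * (MM c \<mu>)\<^sup>2 + 2 * Dv i k"
proof -
  have "(\<integral>\<omega>. (norm (v i k \<omega>))\<^sup>2 \<partial>M) \<le> 2 * Dv i k + 2 * (\<integral>\<omega>. (MM c \<mu>)\<^sup>2 \<partial>M)
      + 0 * (\<integral>\<omega>. 0 \<partial>M) + 0 * (\<integral>\<omega>. 0 \<partial>M)"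
    unfolding Dv_def
  proof (rule integral_le_combination)
    fix \<omega>
    have "(norm (v_star P i (xb k \<omega>)))\<^sup>2 \<le> (MM c \<mu>)\<^sup>2" by (rule power2_norm_le[OF v_star_bound[OF i]])
    then show "(norm (v i k \<omega>))\<^sup>2 \<le> 2 * (norm (v i k \<omega> - v_star P i (xb k \<omega>)))\<^sup>2 + 2 * (MM c \<mu>)\<^sup>2 + 0 * 0 + 0 * 0"
      using norm_sq_add_le[of "v i k \<omega> - v_star P i (xb k \<omega>)" "v_star P i (xb k \<omega>)"] by simp
  qed (rule sqi_integrable[OF ssq(3)[OF i]] err_int[OF i] integrable_zero integrable_const)+
  then show ?thesis by (simp add: prob_space)
qed

lemma recursion_v:
  assumes i: "i \<in> V P"
  shows "Dv i (Suc k) \<le> (1 - \<alpha> * \<mu> / 2) * Dv i k + 32 * \<alpha> * A\<^sup>2 * q\<^sup>2 / \<mu> * (Dx i k + Dt i k)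
    + 64 * \<alpha> * q ^ 6 * (tau st)\<^sup>2 / \<mu> * EZ k + \<alpha>\<^sup>2 * (2 * (s_ft n)\<^sup>2 + 2 * (s_gtt n)\<^sup>2 * (2 * (MM c \<mu>)\<^sup>2 + 2 * Dv i k))"
proof -
  let ?a = "\<lambda>\<omega>. v i k \<omega> - \<alpha> *\<^sub>R mV i k \<omega> - v_star P i (xn k \<omega>)"
  let ?D = "32 * \<alpha> * A\<^sup>2 * q\<^sup>2 / \<mu>"
  have sa: "sqi ?a" by (intro sqi_diff sqi_scaleR ssq[OF i] mean_sqi[OF i] star_sqi[OF i] xn_sqi)
  have ma: "?a \<in> borel_measurable (H k)"
    by (intro borel_measurable_diff borel_measurable_scaleR borel_measurable_const smeas[OF i] mean_measurable[OF i] star_measurable[OF i] xn_H)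
  have e: "Dv i (Suc k) = (\<integral>\<omega>. (norm (?a \<omega>))\<^sup>2 \<partial>M) + (- \<alpha>)\<^sup>2 * (\<integral>\<omega>. (norm (nV i k \<omega>))\<^sup>2 \<partial>M)"
    unfolding Dv_def
    by (rule expectation_noisy[OF sa ma noise_V(1)[OF i] noise_V(3)[OF i]]) (simp add: noisy_step[OF i] gossip_step(1))
  have X: "(\<integral>\<omega>. (norm (?a \<omega>))\<^sup>2 \<partial>M) \<le> (1 - \<alpha> * \<mu> / 2) * Dv i k + ?D * Dx i k + ?D * Dt i k
    + 64 * \<alpha> * q ^ 6 * (tau st)\<^sup>2 / \<mu> * EZ k"
    unfolding Dv_def Dt_def Dx_def EZ_def
  proof (rule integral_le_combination)
    fix \<omega>
    have "(norm (?a \<omega>))\<^sup>2 \<le> (1 - \<alpha> * \<mu> / 2) * (norm (v i k \<omega> - v_star P i (xb k \<omega>)))\<^sup>2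
        + ?D * ((norm (x i k \<omega> - xb k \<omega>))\<^sup>2 + (norm (\<theta> i k \<omega> - theta_star P i (xb k \<omega>)))\<^sup>2)
        + 64 * q ^ 6 / (\<alpha> * \<mu>) * (norm (xn k \<omega> - xb k \<omega>))\<^sup>2"
      unfolding mV_def
      using bilevel_node.v_step[OF node[OF i] alpha(1) alpha_A, of "v i k \<omega>" "x i k \<omega>" "\<theta> i k \<omega>" "xn k \<omega>" "xb k \<omega>"]
      by (simp only: node_eqs[OF i])
    also have "64 * q ^ 6 / (\<alpha> * \<mu>) * (norm (xn k \<omega> - xb k \<omega>))\<^sup>2 = 64 * \<alpha> * q ^ 6 * (tau st)\<^sup>2 / \<mu> * (norm (zb k \<omega>))\<^sup>2"
      unfolding xn_diff using alpha mu0 by (simp add: power2_eq_square field_simps)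
    finally show "(norm (?a \<omega>))\<^sup>2 \<le> (1 - \<alpha> * \<mu> / 2) * (norm (v i k \<omega> - v_star P i (xb k \<omega>)))\<^sup>2
        + ?D * (norm (x i k \<omega> - xb k \<omega>))\<^sup>2 + ?D * (norm (\<theta> i k \<omega> - theta_star P i (xb k \<omega>)))\<^sup>2
        + 64 * \<alpha> * q ^ 6 * (tau st)\<^sup>2 / \<mu> * (norm (zb k \<omega>))\<^sup>2"
      by (simp only: distrib_left add.assoc)
  qed (rule sqi_integrable[OF sa] err_int[OF i] zb_int integrable_zero)+
  have Y: "(- \<alpha>)\<^sup>2 * (\<integral>\<omega>. (norm (nV i k \<omega>))\<^sup>2 \<partial>M)
      \<le> \<alpha>\<^sup>2 * (2 * (s_ft n)\<^sup>2 + 2 * (s_gtt n)\<^sup>2 * (2 * (MM c \<mu>)\<^sup>2 + 2 * Dv i k))"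
  proof -
    have "(\<integral>\<omega>. (norm (nV i k \<omega>))\<^sup>2 \<partial>M) \<le> 2 * (s_ft n)\<^sup>2 + 2 * (s_gtt n)\<^sup>2 * (\<integral>\<omega>. (norm (v i k \<omega>))\<^sup>2 \<partial>M)"
      by (rule noise_V(2)[OF i])
    also have "\<dots> \<le> 2 * (s_ft n)\<^sup>2 + 2 * (s_gtt n)\<^sup>2 * (2 * (MM c \<mu>)\<^sup>2 + 2 * Dv i k)"
      by (intro add_left_mono mult_left_mono v_second_moment[OF i]) simp
    finally show ?thesis by (simp add: mult_left_mono)
  qed
  show ?thesis using e X Y by (simp add: distrib_left)
qed

end

lemma (in prob_space)
  fixes h :: "nat \<Rightarrow> 'a \<Rightarrow> real"
  assumes "\<And>i. i \<in> {1..k} \<Longrightarrow> integrable M (h i)"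
  shows integrable_node_avg: "integrable M (\<lambda>\<omega>. node_avg k (\<lambda>i. h i \<omega>))"
    and integral_node_avg: "(\<integral>\<omega>. node_avg k (\<lambda>i. h i \<omega>) \<partial>M) = node_avg k (\<lambda>i. \<integral>\<omega>. h i \<omega> \<partial>M)"
proof -
  have s: "integrable M (\<lambda>\<omega>. \<Sum>i=1..k. h i \<omega>)"
    by (rule Bochner_Integration.integrable_sum) (rule assms)
  then show "integrable M (\<lambda>\<omega>. node_avg k (\<lambda>i. h i \<omega>))"
    unfolding node_avg_def by (rule integrable_scaleR_right)
  have "(\<integral>\<omega>. (\<Sum>i=1..k. h i \<omega>) \<partial>M) = (\<Sum>i=1..k. \<integral>\<omega>. h i \<omega> \<partial>M)"
    by (rule Bochner_Integration.integral_sum) (rule assms)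
  then show "(\<integral>\<omega>. node_avg k (\<lambda>i. h i \<omega>) \<partial>M) = node_avg k (\<lambda>i. \<integral>\<omega>. h i \<omega> \<partial>M)"
    unfolding node_avg_def by simp
qed

context lopa_run
begin

lemma VP: "i \<in> {1..m} \<Longrightarrow> i \<in> V P" by (simp add: m_def)

definition "bias_sq i k \<omega> = 12 * A\<^sup>2 * q\<^sup>2 * ((norm (x i k \<omega> - xb k \<omega>))\<^sup>2 + (norm (\<theta> i k \<omega> - theta_star P i (xb k \<omega>)))\<^sup>2)
   + 3 * A\<^sup>2 * (norm (v i k \<omega> - v_star P i (xb k \<omega>)))\<^sup>2"

lemma bias_sq_le: "i \<in> V P \<Longrightarrow> (norm (gP i (xb k \<omega>) - mS i k \<omega>))\<^sup>2 \<le> bias_sq i k \<omega>"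
  using bilevel_node.bias_sq_bound[OF node, of i "xb k \<omega>" "x i k \<omega>" "\<theta> i k \<omega>" "v i k \<omega>"]
  unfolding bias_sq_def mS_def by (simp only: node_eqs)

definition "Db i k = 12 * A\<^sup>2 * q\<^sup>2 * (Dx i k + Dt i k) + 3 * A\<^sup>2 * Dv i k"

lemma bias_sq_integral:
  assumes i: "i \<in> V P"
  shows "integrable M (bias_sq i k)" "(\<integral>\<omega>. bias_sq i k \<omega> \<partial>M) = Db i k"
  unfolding bias_sq_def[abs_def] Db_def Dx_def Dt_def Dv_def
  using err_int(1,2,3)[OF i] by simp_all

lemma gradient_drift_sq:
  assumes "norm (h (xn k \<omega>) - h (xb k \<omega>)) \<le> 8 * A * q ^ 3 * norm (xn k \<omega> - xb k \<omega>)"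
  shows "2 / \<alpha> * (norm (h (xn k \<omega>) - h (xb k \<omega>)))\<^sup>2 \<le> 128 * A\<^sup>2 * q ^ 6 * (tau st)\<^sup>2 * \<alpha> * (norm (zb k \<omega>))\<^sup>2"
proof -
  have "(norm (h (xn k \<omega>) - h (xb k \<omega>)))\<^sup>2 \<le> (8 * A * q ^ 3 * norm (xn k \<omega> - xb k \<omega>))\<^sup>2"
    by (rule power2_norm_le[OF assms])
  also have "\<dots> = 64 * A\<^sup>2 * q ^ 6 * ((tau st)\<^sup>2 * \<alpha>\<^sup>2 * (norm (zb k \<omega>))\<^sup>2)"
    by (simp add: power_mult_distrib xn_diff power_mult[symmetric])
  finally have "2 / \<alpha> * (norm (h (xn k \<omega>) - h (xb k \<omega>)))\<^sup>2 \<le> 2 / \<alpha> * (64 * A\<^sup>2 * q ^ 6 * ((tau st)\<^sup>2 * \<alpha>\<^sup>2 * (norm (zb k \<omega>))\<^sup>2))"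
    by (rule mult_left_mono) (use alpha in simp)
  also have "\<dots> = 128 * A\<^sup>2 * q ^ 6 * (tau st)\<^sup>2 * \<alpha> * (norm (zb k \<omega>))\<^sup>2"
    using alpha(1) by (simp add: power2_eq_square)
  finally show ?thesis .
qed

definition "sS i k = 2 * (s_fx n)\<^sup>2 + 2 * (s_gxt n)\<^sup>2 * (2 * (MM c \<mu>)\<^sup>2 + 2 * Dv i k)"

lemma noise_S_bound:
  assumes i: "i \<in> V P"
  shows "(\<integral>\<omega>. (norm (nS i k \<omega>))\<^sup>2 \<partial>M) \<le> sS i k"
proof -
  have "(\<integral>\<omega>. (norm (nS i k \<omega>))\<^sup>2 \<partial>M) \<le> 2 * (s_fx n)\<^sup>2 + 2 * (s_gxt n)\<^sup>2 * (\<integral>\<omega>. (norm (v i k \<omega>))\<^sup>2 \<partial>M)"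
    by (rule noise_S(2)[OF i])
  also have "\<dots> \<le> sS i k"
    unfolding sS_def by (intro add_left_mono mult_left_mono v_second_moment[OF i]) simp
  finally show ?thesis .
qed

lemma recursion_c:
  assumes i: "i \<in> V P"
  shows "Dc i (Suc k) \<le> (1 - \<alpha>) * Dc i k + 2 * \<alpha> * Db i k
    + 128 * A\<^sup>2 * q ^ 6 * (tau st)\<^sup>2 * \<alpha> * EZ k + \<alpha>\<^sup>2 * sS i k"
proof -
  let ?a = "\<lambda>\<omega>. (1 - \<alpha>) *\<^sub>R (gP i (xb k \<omega>) - z i k \<omega>) + ((gP i (xn k \<omega>) - gP i (xb k \<omega>)) + \<alpha> *\<^sub>R (gP i (xb k \<omega>) - mS i k \<omega>))"
  have sa: "sqi ?a" by (intro sqi_diff sqi_add sqi_scaleR ssq[OF i] mean_sqi[OF i] star_sqi[OF i] xn_sqi xb_sqi)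
  have ma: "?a \<in> borel_measurable (H k)"
    by (intro borel_measurable_diff borel_measurable_add borel_measurable_scaleR borel_measurable_const smeas[OF i]
        mean_measurable[OF i] star_measurable[OF i] xn_H xb_H)
  have o: "orth (past k) (nS i k)" by (rule noise_S(3)[OF i order_refl past_Ix past_new past_new])
  have e: "Dc i (Suc k) = (\<integral>\<omega>. (norm (?a \<omega>))\<^sup>2 \<partial>M) + (- \<alpha>)\<^sup>2 * (\<integral>\<omega>. (norm (nS i k \<omega>))\<^sup>2 \<partial>M)"
    unfolding Dc_def
    by (rule expectation_noisy[OF sa ma noise_S(1)[OF i] o]) (simp add: noisy_step[OF i] gossip_step(1) algebra_simps)
  have X: "(\<integral>\<omega>. (norm (?a \<omega>))\<^sup>2 \<partial>M) \<le> (1 - \<alpha>) * Dc i k + 128 * A\<^sup>2 * q ^ 6 * (tau st)\<^sup>2 * \<alpha> * EZ k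
      + 2 * \<alpha> * (\<integral>\<omega>. bias_sq i k \<omega> \<partial>M) + 0 * (\<integral>\<omega>. 0 \<partial>M)"
    unfolding Dc_def EZ_def
  proof (rule integral_le_combination)
    fix \<omega>
    have "(norm (?a \<omega>))\<^sup>2 \<le> (1 - \<alpha>) * (norm (gP i (xb k \<omega>) - z i k \<omega>))\<^sup>2
        + 2 / \<alpha> * (norm (gP i (xn k \<omega>) - gP i (xb k \<omega>)))\<^sup>2 + 2 * \<alpha> * (norm (gP i (xb k \<omega>) - mS i k \<omega>))\<^sup>2"
      by (rule tracking_step[OF alpha(1,2)])
    moreover have "2 * \<alpha> * (norm (gP i (xb k \<omega>) - mS i k \<omega>))\<^sup>2 \<le> 2 * \<alpha> * bias_sq i k \<omega>"
      using bias_sq_le[OF i] alpha by (intro mult_left_mono) auto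
    moreover note gradient_drift_sq[of "gP i" k \<omega>, OF gP_lip[OF i]]
    ultimately show "(norm (?a \<omega>))\<^sup>2 \<le> (1 - \<alpha>) * (norm (gP i (xb k \<omega>) - z i k \<omega>))\<^sup>2
        + 128 * A\<^sup>2 * q ^ 6 * (tau st)\<^sup>2 * \<alpha> * (norm (zb k \<omega>))\<^sup>2 + 2 * \<alpha> * bias_sq i k \<omega> + 0 * 0"
      by linarith
  qed (rule sqi_integrable[OF sa] err_int[OF i] zb_int integrable_zero bias_sq_integral[OF i])+
  have Y: "(- \<alpha>)\<^sup>2 * (\<integral>\<omega>. (norm (nS i k \<omega>))\<^sup>2 \<partial>M) \<le> \<alpha>\<^sup>2 * sS i k"
    using noise_S_bound[OF i] by (simp add: mult_left_mono)
  show ?thesis using e X Y by (simp add: bias_sq_integral[OF i])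
qed

text \<open>The nodes draw independent samples, so their errors are pairwise orthogonal and the average gains a
  factor \<open>1 / m\<close>.\<close>

lemma noise_S_avg:
  shows "sqi (\<lambda>\<omega>. node_avg m (\<lambda>i. nS i k \<omega>))" "orth (past k) (\<lambda>\<omega>. node_avg m (\<lambda>i. nS i k \<omega>))"
    "(\<integral>\<omega>. (norm (node_avg m (\<lambda>i. nS i k \<omega>)))\<^sup>2 \<partial>M) \<le> node_avg m (\<lambda>i. sS i k) / real m"
proof -
  show "sqi (\<lambda>\<omega>. node_avg m (\<lambda>i. nS i k \<omega>))" by (rule sqi_node_avg) (rule noise_S(1)[OF VP])
  show "orth (past k) (\<lambda>\<omega>. node_avg m (\<lambda>i. nS i k \<omega>))"
    unfolding orth_def
  proof (intro allI impI)
    fix a :: "'w \<Rightarrow> 'x" assume a: "a \<in> borel_measurable (hist lw smp (past k))" "sqi a"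
    have "(\<integral>\<omega>. inner (a \<omega>) (nS i k \<omega>) \<partial>M) = 0" if "i \<in> {1..m}" for i
      using noise_S(3)[OF VP[OF that] order_refl past_Ix past_new past_new] a by (simp add: orth_def)
    then have "node_avg m (\<lambda>i. \<integral>\<omega>. inner (a \<omega>) (nS i k \<omega>) \<partial>M) = 0"
      by (simp add: node_avg_def)
    moreover have "integrable M (\<lambda>\<omega>. inner (a \<omega>) (nS i k \<omega>))" if "i \<in> {1..m}" for i
      by (rule sqi_inner[OF a(2) noise_S(1)[OF VP[OF that]]])
    ultimately show "(\<integral>\<omega>. inner (a \<omega>) (node_avg m (\<lambda>i. nS i k \<omega>)) \<partial>M) = 0"
      unfolding node_avg_inner by (subst integral_node_avg) auto
  qed
  have "(\<integral>\<omega>. (norm (\<Sum>i=1..m. nS i k \<omega>))\<^sup>2 \<partial>M) = (\<Sum>i=1..m. \<integral>\<omega>. (norm (nS i k \<omega>))\<^sup>2 \<partial>M)"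
    by (rule integral_norm_sq_sum_orthogonal) (auto intro!: noise_S(1)[OF VP] noise_S_pair[OF VP VP])
  also have "\<dots> \<le> (\<Sum>i=1..m. sS i k)" by (rule sum_mono) (rule noise_S_bound[OF VP])
  finally have 1: "(\<integral>\<omega>. (norm (\<Sum>i=1..m. nS i k \<omega>))\<^sup>2 \<partial>M) \<le> (\<Sum>i=1..m. sS i k)" .
  have "(\<integral>\<omega>. (norm (node_avg m (\<lambda>i. nS i k \<omega>)))\<^sup>2 \<partial>M) = (1 / real m)\<^sup>2 * (\<integral>\<omega>. (norm (\<Sum>i=1..m. nS i k \<omega>))\<^sup>2 \<partial>M)"
    by (simp add: node_avg_def power_divide)
  also have "\<dots> \<le> (1 / real m)\<^sup>2 * (\<Sum>i=1..m. sS i k)" by (rule mult_left_mono[OF 1]) simp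
  also have "\<dots> = node_avg m (\<lambda>i. sS i k) / real m" by (simp add: node_avg_def power2_eq_square)
  finally show "(\<integral>\<omega>. (norm (node_avg m (\<lambda>i. nS i k \<omega>)))\<^sup>2 \<partial>M) \<le> node_avg m (\<lambda>i. sS i k) / real m" .
qed

lemma recursion_z:
  "Dz (Suc k) \<le> (1 - \<alpha>) * Dz k + 2 * \<alpha> * node_avg m (\<lambda>i. Db i k)
    + 128 * A\<^sup>2 * q ^ 6 * (tau st)\<^sup>2 * \<alpha> * EZ k + \<alpha>\<^sup>2 * (node_avg m (\<lambda>i. sS i k) / real m)"
proof -
  let ?s = "\<lambda>\<omega>. node_avg m (\<lambda>i. mS i k \<omega>)" and ?n = "\<lambda>\<omega>. node_avg m (\<lambda>i. nS i k \<omega>)"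
  let ?a = "\<lambda>\<omega>. (1 - \<alpha>) *\<^sub>R (gPhi (xb k \<omega>) - zb k \<omega>) + ((gPhi (xn k \<omega>) - gPhi (xb k \<omega>)) + \<alpha> *\<^sub>R (gPhi (xb k \<omega>) - ?s \<omega>))"
  have ss: "sqi ?s" by (rule sqi_node_avg) (rule mean_sqi(3)[OF VP ssq(1-3)[OF VP]])
  have sm: "?s \<in> borel_measurable (H k)"
    unfolding node_avg_def
    by (intro borel_measurable_scaleR borel_measurable_const borel_measurable_sum mean_measurable(3)[OF VP smeas(1-3)[OF VP]])
  have gm: "gPhi \<in> borel_measurable borel" by (rule lipschitz_measurable[OF gPhi_lip])
  have sa: "sqi ?a" by (intro sqi_diff sqi_add sqi_scaleR ss gPhi_sqi xn_sqi xb_sqi zb_sqi)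
  have ma: "?a \<in> borel_measurable (H k)"
    by (intro borel_measurable_diff borel_measurable_add borel_measurable_scaleR borel_measurable_const sm zb_H
        measurable_compose[OF xn_H gm] measurable_compose[OF xb_H gm])
  have st: "gPhi (xb (Suc k) \<omega>) - zb (Suc k) \<omega> = ?a \<omega> + (- \<alpha>) *\<^sub>R ?n \<omega>" if w: "\<omega> \<in> space M" for \<omega>
  proof -
    have "zb (Suc k) \<omega> = node_avg m (\<lambda>i. (1 - \<alpha>) *\<^sub>R z i k \<omega> + \<alpha> *\<^sub>R mS i k \<omega> + \<alpha> *\<^sub>R nS i k \<omega>)"
      unfolding zb_def by (rule node_avg_cong) (rule noisy_step(3)[OF VP w])
    also have "\<dots> = (1 - \<alpha>) *\<^sub>R zb k \<omega> + \<alpha> *\<^sub>R ?s \<omega> + \<alpha> *\<^sub>R ?n \<omega>"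
      by (simp only: node_avg_add node_avg_scaleR zb_def)
    finally show ?thesis by (simp add: gossip_step(1)[OF w] algebra_simps)
  qed
  have e: "Dz (Suc k) = (\<integral>\<omega>. (norm (?a \<omega>))\<^sup>2 \<partial>M) + (- \<alpha>)\<^sup>2 * (\<integral>\<omega>. (norm (?n \<omega>))\<^sup>2 \<partial>M)"
    unfolding Dz_def by (rule expectation_noisy[OF sa ma noise_S_avg(1,2) st])
  have bi: "integrable M (\<lambda>\<omega>. node_avg m (\<lambda>i. bias_sq i k \<omega>))"
    by (rule integrable_node_avg) (rule bias_sq_integral(1)[OF VP])
  have b: "(\<integral>\<omega>. node_avg m (\<lambda>i. bias_sq i k \<omega>) \<partial>M) = node_avg m (\<lambda>i. Db i k)"
    by (subst integral_node_avg) (auto intro!: node_avg_cong bias_sq_integral[OF VP])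
  have X: "(\<integral>\<omega>. (norm (?a \<omega>))\<^sup>2 \<partial>M) \<le> (1 - \<alpha>) * Dz k + 128 * A\<^sup>2 * q ^ 6 * (tau st)\<^sup>2 * \<alpha> * EZ k
      + 2 * \<alpha> * (\<integral>\<omega>. node_avg m (\<lambda>i. bias_sq i k \<omega>) \<partial>M) + 0 * (\<integral>\<omega>. 0 \<partial>M)"
    unfolding Dz_def EZ_def
  proof (rule integral_le_combination)
    fix \<omega>
    have "(norm (?a \<omega>))\<^sup>2 \<le> (1 - \<alpha>) * (norm (gPhi (xb k \<omega>) - zb k \<omega>))\<^sup>2
        + 2 / \<alpha> * (norm (gPhi (xn k \<omega>) - gPhi (xb k \<omega>)))\<^sup>2 + 2 * \<alpha> * (norm (gPhi (xb k \<omega>) - ?s \<omega>))\<^sup>2"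
      by (rule tracking_step[OF alpha(1,2)])
    moreover have "2 * \<alpha> * (norm (gPhi (xb k \<omega>) - ?s \<omega>))\<^sup>2 \<le> 2 * \<alpha> * node_avg m (\<lambda>i. bias_sq i k \<omega>)"
    proof (rule mult_left_mono)
      have "(norm (gPhi (xb k \<omega>) - ?s \<omega>))\<^sup>2 \<le> node_avg m (\<lambda>i. (norm (gP i (xb k \<omega>) - mS i k \<omega>))\<^sup>2)"
        unfolding gPhi_eq node_avg_diff[symmetric] by (rule norm_node_avg_sq_le[OF m1])
      also have "\<dots> \<le> node_avg m (\<lambda>i. bias_sq i k \<omega>)" by (rule node_avg_mono) (rule bias_sq_le[OF VP])
      finally show "(norm (gPhi (xb k \<omega>) - ?s \<omega>))\<^sup>2 \<le> node_avg m (\<lambda>i. bias_sq i k \<omega>)" .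
    qed (use alpha in simp)
    moreover note gradient_drift_sq[of gPhi k \<omega>, OF gPhi_lip]
    ultimately show "(norm (?a \<omega>))\<^sup>2 \<le> (1 - \<alpha>) * (norm (gPhi (xb k \<omega>) - zb k \<omega>))\<^sup>2
        + 128 * A\<^sup>2 * q ^ 6 * (tau st)\<^sup>2 * \<alpha> * (norm (zb k \<omega>))\<^sup>2 + 2 * \<alpha> * node_avg m (\<lambda>i. bias_sq i k \<omega>) + 0 * 0"
      by linarith
  qed (rule sqi_integrable[OF sa] sqi_integrable[OF sqi_diff[OF gPhi_sqi[OF xb_sqi] zb_sqi]] zb_int integrable_zero bi)+
  have Y: "(- \<alpha>)\<^sup>2 * (\<integral>\<omega>. (norm (?n \<omega>))\<^sup>2 \<partial>M) \<le> \<alpha>\<^sup>2 * (node_avg m (\<lambda>i. sS i k) / real m)"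
    using mult_left_mono[OF noise_S_avg(3), of "\<alpha>\<^sup>2"] by simp
  show ?thesis using e X Y unfolding b by simp
qed

text \<open>Consensus is disturbed by the spread of the \<open>z\<close>, which is at most twice the tracking error per node plus
  twice the heterogeneity of the local gradients.\<close>

lemma recursion_x:
  "node_avg m (\<lambda>i. Dx i (Suc k)) \<le> (1 - tau st * (1 - r) / 2) * node_avg m (\<lambda>i. Dx i k)
     + 2 * tau st * \<alpha>\<^sup>2 / (1 - r) * (2 * node_avg m (\<lambda>i. Dc i k) + 2 * het_bound / real m)"
proof -
  let ?cx = "1 - tau st * (1 - r) / 2" and ?cz = "2 * tau st * \<alpha>\<^sup>2 / (1 - r)"
  have cz: "0 \<le> ?cz" using tau rho_r by simp
  have xi: "integrable M (\<lambda>\<omega>. node_avg m (\<lambda>i. (norm (x i k \<omega> - xb k \<omega>))\<^sup>2))" for k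
    by (rule integrable_node_avg) (rule err_int(1)[OF VP])
  have ci: "integrable M (\<lambda>\<omega>. node_avg m (\<lambda>i. (norm (gP i (xb k \<omega>) - z i k \<omega>))\<^sup>2))"
    by (rule integrable_node_avg) (rule err_int(4)[OF VP])
  have xe: "(\<integral>\<omega>. node_avg m (\<lambda>i. (norm (x i k \<omega> - xb k \<omega>))\<^sup>2) \<partial>M) = node_avg m (\<lambda>i. Dx i k)" for k
    unfolding Dx_def by (rule integral_node_avg) (rule err_int(1)[OF VP])
  have ce: "(\<integral>\<omega>. node_avg m (\<lambda>i. (norm (gP i (xb k \<omega>) - z i k \<omega>))\<^sup>2) \<partial>M) = node_avg m (\<lambda>i. Dc i k)"
    unfolding Dc_def by (rule integral_node_avg) (rule err_int(4)[OF VP])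
  have "(\<integral>\<omega>. node_avg m (\<lambda>i. (norm (x i (Suc k) \<omega> - xb (Suc k) \<omega>))\<^sup>2) \<partial>M)
     \<le> ?cx * (\<integral>\<omega>. node_avg m (\<lambda>i. (norm (x i k \<omega> - xb k \<omega>))\<^sup>2) \<partial>M)
      + ?cz * 2 * (\<integral>\<omega>. node_avg m (\<lambda>i. (norm (gP i (xb k \<omega>) - z i k \<omega>))\<^sup>2) \<partial>M)
      + ?cz * (\<integral>\<omega>. 2 * het_bound / real m \<partial>M) + 0 * (\<integral>\<omega>. 0 \<partial>M)"
  proof (rule integral_le_combination)
    fix \<omega> assume w: "\<omega> \<in> space M"
    have "(\<Sum>i=1..m. (norm (z i k \<omega> - zb k \<omega>))\<^sup>2) \<le> (\<Sum>i=1..m. (norm (z i k \<omega> - gPhi (xb k \<omega>)))\<^sup>2)"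
      unfolding zb_def by (rule sum_norm_sq_diff_avg_le[OF m1])
    also have "\<dots> \<le> (\<Sum>i=1..m. 2 * (norm (gP i (xb k \<omega>) - z i k \<omega>))\<^sup>2 + 2 * (norm (gP i (xb k \<omega>) - gPhi (xb k \<omega>)))\<^sup>2)"
    proof (rule sum_mono)
      fix i
      show "(norm (z i k \<omega> - gPhi (xb k \<omega>)))\<^sup>2 \<le> 2 * (norm (gP i (xb k \<omega>) - z i k \<omega>))\<^sup>2 + 2 * (norm (gP i (xb k \<omega>) - gPhi (xb k \<omega>)))\<^sup>2"
        using norm_sq_add_le[of "z i k \<omega> - gP i (xb k \<omega>)" "gP i (xb k \<omega>) - gPhi (xb k \<omega>)"]
        by (simp add: norm_minus_commute)
    qed
    also have "\<dots> \<le> 2 * (\<Sum>i=1..m. (norm (gP i (xb k \<omega>) - z i k \<omega>))\<^sup>2) + 2 * het_bound"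
      using hypergradient_heterogeneity[of "xb k \<omega>"] by (simp add: sum.distrib sum_distrib_left[symmetric])
    finally have zs: "(\<Sum>i=1..m. (norm (z i k \<omega> - zb k \<omega>))\<^sup>2) \<le> 2 * (\<Sum>i=1..m. (norm (gP i (xb k \<omega>) - z i k \<omega>))\<^sup>2) + 2 * het_bound" .
    have "(\<Sum>i=1..m. (norm (x i (Suc k) \<omega> - xb (Suc k) \<omega>))\<^sup>2)
      \<le> ?cx * (\<Sum>i=1..m. (norm (x i k \<omega> - xb k \<omega>))\<^sup>2) + ?cz * (2 * (\<Sum>i=1..m. (norm (gP i (xb k \<omega>) - z i k \<omega>))\<^sup>2) + 2 * het_bound)"
      using gossip_step(2)[OF w, of k] mult_left_mono[OF zs cz] by linarith
    from mult_left_mono[OF this, of "1 / real m"]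
    show "node_avg m (\<lambda>i. (norm (x i (Suc k) \<omega> - xb (Suc k) \<omega>))\<^sup>2)
       \<le> ?cx * node_avg m (\<lambda>i. (norm (x i k \<omega> - xb k \<omega>))\<^sup>2)
        + ?cz * 2 * node_avg m (\<lambda>i. (norm (gP i (xb k \<omega>) - z i k \<omega>))\<^sup>2) + ?cz * (2 * het_bound / real m) + 0 * 0"
      unfolding node_avg_def real_scaleR_def by (simp add: distrib_left mult_ac)
  qed (rule xi ci integrable_const integrable_zero)+
  then show ?thesis unfolding xe ce by (simp add: prob_space distrib_left)
qed

lemma Phi_measurable: "Phi P \<in> borel_measurable borel"
proof (rule borel_measurable_continuous_onI)
  show "continuous_on UNIV (Phi P)"
    using Phi_GDERIV has_derivative_continuous unfolding gderiv_def
    by (blast intro: continuous_at_imp_continuous_on)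
qed

lemma Phi_integrable:
  assumes pos: "\<forall>x. 0 \<le> Phi P x" and X: "sqi X"
  shows "integrable M (\<lambda>\<omega>. Phi P (X \<omega>))"
proof (rule Bochner_Integration.integrable_bound)
  show "integrable M (\<lambda>\<omega>. Phi P 0 + inner (X \<omega>) (gPhi 0) + 8 * A * q ^ 3 * (norm (X \<omega>))\<^sup>2)"
    using sqi_inner[OF X sqi_const] sqi_integrable[OF X] by simp
  show "(\<lambda>\<omega>. Phi P (X \<omega>)) \<in> borel_measurable M"
    by (rule measurable_compose[OF sqi_measurable[OF X] Phi_measurable])
  have "norm (Phi P y) \<le> norm (Phi P 0 + inner y (gPhi 0) + 8 * A * q ^ 3 * (norm y)\<^sup>2)" for y
    using Phi_descent[of y 0] pos[rule_format, of y] by simp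
  then show "AE \<omega> in M. norm (Phi P (X \<omega>)) \<le> norm (Phi P 0 + inner (X \<omega>) (gPhi 0) + 8 * A * q ^ 3 * (norm (X \<omega>))\<^sup>2)"
    by simp
qed

text \<open>The inner product of \<open>zb\<close> and the gradient is split by polarization, which produces \<open>- EZ\<close>; the condition on
  \<open>\<tau> * \<alpha>\<close> leaves half of it after the second order term.\<close>

lemma recursion_Phi:
  assumes pos: "\<forall>x. 0 \<le> Phi P x" and t: "32 * A * q ^ 3 * tau st * \<alpha> \<le> 1"
  shows "EP (Suc k) \<le> EP k - tau st * \<alpha> / 2 * EG k - tau st * \<alpha> / 4 * EZ k + tau st * \<alpha> / 2 * Dz k"
proof -
  let ?s = "tau st * \<alpha>"
  have s0: "0 \<le> ?s" using tau alpha by simp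
  have "EP (Suc k) \<le> 1 * EP k + (- ?s / 2) * EG k + (- ?s / 4) * EZ k + (?s / 2) * Dz k"
    unfolding EP_def EG_def EZ_def Dz_def
  proof (rule integral_le_combination)
    fix \<omega> assume w: "\<omega> \<in> space M"
    let ?G = "gPhi (xb k \<omega>)" and ?Z = "zb k \<omega>"
    have "Phi P (xb (Suc k) \<omega>) \<le> Phi P (xb k \<omega>) + inner (xb (Suc k) \<omega> - xb k \<omega>) ?G + 8 * A * q ^ 3 * (norm (xb (Suc k) \<omega> - xb k \<omega>))\<^sup>2"
      by (rule Phi_descent)
    also have "\<dots> = Phi P (xb k \<omega>) - ?s * inner ?Z ?G + 8 * A * q ^ 3 * (?s * ?s) * (norm ?Z)\<^sup>2"
      unfolding gossip_step(1)[OF w] xn_diff by (simp add: xn_def power2_eq_square)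
    also have "8 * A * q ^ 3 * (?s * ?s) * (norm ?Z)\<^sup>2 = (32 * A * q ^ 3 * tau st * \<alpha>) * (?s / 4 * (norm ?Z)\<^sup>2)" by simp
    also have "\<dots> \<le> 1 * (?s / 4 * (norm ?Z)\<^sup>2)" using s0 by (intro mult_right_mono t) simp
    also have "inner ?Z ?G = ((norm ?G)\<^sup>2 + (norm ?Z)\<^sup>2 - (norm (?G - ?Z))\<^sup>2) / 2"
      by (simp add: power2_norm_eq_inner inner_diff_left inner_diff_right inner_commute)
    finally show "Phi P (xb (Suc k) \<omega>) \<le> 1 * Phi P (xb k \<omega>) + - ?s / 2 * (norm ?G)\<^sup>2 + - ?s / 4 * (norm ?Z)\<^sup>2 + ?s / 2 * (norm (?G - ?Z))\<^sup>2"
      by (simp add: field_simps)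
  qed (rule Phi_integrable[OF pos xb_sqi] sqi_integrable[OF gPhi_sqi[OF xb_sqi]] zb_int
      sqi_integrable[OF sqi_diff[OF gPhi_sqi[OF xb_sqi] zb_sqi]])+
  then show ?thesis by simp
qed

end

section \<open>The Lyapunov function\<close>

text \<open>The weights are found backwards. The weight of \<open>ez\<close> is \<open>1\<close>: it decays by \<open>\<alpha> * ez\<close>, and the objective needs half
  of that. The tracking errors \<open>ez\<close> and \<open>ec\<close> load \<open>12 * A\<^sup>2 * \<alpha>\<close> on \<open>ev\<close>, and the noise proportional
  to \<open>ev\<close> as much again by \<open>small\<close>; \<open>w1 * \<mu> / 2 = 24 * A\<^sup>2\<close> covers both. Then \<open>et\<close> is loaded with
  \<open>48\<close> from tracking and \<open>32 * 48 = 1536\<close> from \<open>ev\<close>, in units of \<open>A\<^sup>2 * q ^ 4 * \<alpha>\<close>, so \<open>w2 * \<mu> / 2\<close> is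
  \<open>1584\<close> of these. Finally \<open>ex\<close> is loaded with the same \<open>1584\<close> and with \<open>4 * 3168 = 12672\<close> from \<open>et\<close>, now in units
  of \<open>A\<^sup>2 * q ^ 6 * \<alpha>\<close>, so \<open>R / 2 = 14256\<close>. The weight \<open>w4\<close> is such that the decay of \<open>ec\<close> exactly pays for its effect on \<open>ex\<close>. It is of order
  \<open>\<alpha>\<^sup>2\<close>, hence at most \<open>1 / m\<close>, so that the noise per node counts no more than that of the average.
  The squares of \<open>zb\<close> collect a coefficient of at most \<open>16000 * A\<^sup>2 * q ^ 8 * \<tau>\<^sup>2\<close>, against \<open>1 / 4\<close> from
  the objective.\<close>

lemma lyapunov_step:
  fixes A q \<mu> \<alpha> \<tau> r m ev et ez ec ex Z Ph G ev' et' ez' ec' ex' Ph' sgt sft sgtt sfx sgxt Mv hb :: real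
  assumes A: "1 \<le> A" and q: "1 \<le> q" and mu: "0 < \<mu>" "A = \<mu> * q" and a: "0 < \<alpha>"
    and tau: "0 < \<tau>" "64000 * A\<^sup>2 * q ^ 8 * \<tau>\<^sup>2 \<le> 1" and r: "r < 1" and m: "1 \<le> m"
    and nonneg: "0 \<le> ev" "0 \<le> et" "0 \<le> ez" "0 \<le> ec" "0 \<le> ex" "0 \<le> Z"
    and rP: "Ph' \<le> Ph - \<tau> * \<alpha> / 2 * G - \<tau> * \<alpha> / 4 * Z + \<tau> * \<alpha> / 2 * ez"
    and rt: "et' \<le> (1 - \<alpha> * \<mu> / 2) * et + 4 * \<alpha> / \<mu> * A\<^sup>2 * ex + 4 * \<alpha> * q\<^sup>2 * \<tau>\<^sup>2 / \<mu> * Z + \<alpha>\<^sup>2 * sgt\<^sup>2"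
    and rv: "ev' \<le> (1 - \<alpha> * \<mu> / 2) * ev + 32 * \<alpha> * A\<^sup>2 * q\<^sup>2 / \<mu> * (ex + et) + 64 * \<alpha> * q ^ 6 * \<tau>\<^sup>2 / \<mu> * Z
        + \<alpha>\<^sup>2 * (2 * sft\<^sup>2 + 2 * sgtt\<^sup>2 * (2 * Mv\<^sup>2 + 2 * ev))"
    and rz: "ez' \<le> (1 - \<alpha>) * ez + 2 * \<alpha> * (12 * A\<^sup>2 * q\<^sup>2 * (ex + et) + 3 * A\<^sup>2 * ev) + 128 * A\<^sup>2 * q ^ 6 * \<tau>\<^sup>2 * \<alpha> * Z
        + \<alpha>\<^sup>2 * ((2 * sfx\<^sup>2 + 2 * sgxt\<^sup>2 * (2 * Mv\<^sup>2 + 2 * ev)) / m)"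
    and rc: "ec' \<le> (1 - \<alpha>) * ec + 2 * \<alpha> * (12 * A\<^sup>2 * q\<^sup>2 * (ex + et) + 3 * A\<^sup>2 * ev) + 128 * A\<^sup>2 * q ^ 6 * \<tau>\<^sup>2 * \<alpha> * Z
        + \<alpha>\<^sup>2 * (2 * sfx\<^sup>2 + 2 * sgxt\<^sup>2 * (2 * Mv\<^sup>2 + 2 * ev))"
    and rx: "ex' \<le> (1 - \<tau> * (1 - r) / 2) * ex + 2 * \<tau> * \<alpha>\<^sup>2 / (1 - r) * (2 * ec + 2 * hb / m)"
  defines "w1 \<equiv> 48 * A\<^sup>2 / \<mu>" and "w2 \<equiv> 3168 * A\<^sup>2 * q ^ 4 / \<mu>" and "R \<equiv> 28512 * A\<^sup>2 * q ^ 6"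
  defines "w4 \<equiv> 4 * R * \<alpha>\<^sup>2 / (1 - r)\<^sup>2" and "w5 \<equiv> R * \<alpha> / (\<tau> * (1 - r))"
  assumes w4m: "w4 \<le> 1 / m" and small: "\<alpha> * (4 * w1 * sgtt\<^sup>2 + 8 * sgxt\<^sup>2) \<le> 12 * A\<^sup>2"
  shows "Ph' / \<tau> + w1 * ev' + w2 * et' + ez' + w4 * ec' + w5 * ex'
    \<le> Ph / \<tau> + w1 * ev + w2 * et + ez + w4 * ec + w5 * ex - \<alpha> / 2 * G
      + \<alpha>\<^sup>2 * (w1 * (2 * sft\<^sup>2 + 4 * Mv\<^sup>2 * sgtt\<^sup>2) + w2 * sgt\<^sup>2 + 2 / m * (2 * sfx\<^sup>2 + 4 * Mv\<^sup>2 * sgxt\<^sup>2))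
      + 4 * R * \<alpha> ^ 3 * hb / (m * (1 - r)\<^sup>2)"
proof -
  define b where "b = 12 * A\<^sup>2 * q\<^sup>2 * (ex + et) + 3 * A\<^sup>2 * ev"
  define N where "N = 2 * sfx\<^sup>2 + 2 * sgxt\<^sup>2 * (2 * Mv\<^sup>2 + 2 * ev)"
  have A0: "0 < A" using A by simp
  have qm: "A / \<mu> = q" using mu by simp
  have R0: "0 \<le> R" by (simp add: R_def q)
  have w0: "0 \<le> w1" "0 \<le> w2" "0 \<le> w4" "0 \<le> w5"
    using mu a tau r q R0 by (simp_all add: w1_def w2_def w4_def w5_def)
  have b0: "0 \<le> b" using nonneg by (simp add: b_def)
  have N0: "0 \<le> N" using nonneg by (simp add: N_def)
  have w41: "w4 \<le> 1" using w4m m by (meson divide_le_eq_1 order_trans zero_less_one less_le_trans)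
  have w1m: "w1 * \<mu> = 48 * A\<^sup>2" using mu by (simp add: w1_def)
  have w2m: "w2 * \<mu> = 3168 * A\<^sup>2 * q ^ 4" using mu by (simp add: w2_def)
  have w1d: "w1 / \<mu> = 48 * q\<^sup>2" using mu by (simp add: w1_def power2_eq_square)
  have w2d: "w2 / \<mu> = 3168 * q ^ 6" using mu by (simp add: w2_def power2_eq_square eval_nat_numeral)
  have P: "Ph' / \<tau> \<le> Ph / \<tau> - \<alpha> / 2 * G - \<alpha> / 4 * Z + \<alpha> / 2 * ez"
    using divide_right_mono[OF rP, of \<tau>] tau by (simp add: add_divide_distrib diff_divide_distrib)
  have Vv: "w1 * ev' \<le> w1 * ev - 24 * A\<^sup>2 * \<alpha> * ev + 1536 * A\<^sup>2 * q ^ 4 * \<alpha> * (ex + et) + 3072 * q ^ 8 * \<tau>\<^sup>2 * \<alpha> * Z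
      + \<alpha>\<^sup>2 * (w1 * (2 * sft\<^sup>2 + 4 * Mv\<^sup>2 * sgtt\<^sup>2)) + \<alpha>\<^sup>2 * (4 * w1 * sgtt\<^sup>2) * ev"
  proof -
    have "w1 * ev' \<le> w1 * ((1 - \<alpha> * \<mu> / 2) * ev + 32 * \<alpha> * A\<^sup>2 * q\<^sup>2 / \<mu> * (ex + et) + 64 * \<alpha> * q ^ 6 * \<tau>\<^sup>2 / \<mu> * Z
        + \<alpha>\<^sup>2 * (2 * sft\<^sup>2 + 2 * sgtt\<^sup>2 * (2 * Mv\<^sup>2 + 2 * ev)))"
      using rv w0(1) by (rule mult_left_mono)
    also have "\<dots> = w1 * ev - (w1 * \<mu>) * \<alpha> / 2 * ev + (w1 / \<mu>) * (32 * \<alpha> * A\<^sup>2 * q\<^sup>2 * (ex + et)) + (w1 / \<mu>) * (64 * \<alpha> * q ^ 6 * \<tau>\<^sup>2 * Z)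
      + \<alpha>\<^sup>2 * (w1 * (2 * sft\<^sup>2 + 4 * Mv\<^sup>2 * sgtt\<^sup>2)) + \<alpha>\<^sup>2 * (4 * w1 * sgtt\<^sup>2) * ev"
      by (simp add: algebra_simps add_divide_distrib)
    finally show ?thesis unfolding w1m w1d by (simp add: algebra_simps eval_nat_numeral)
  qed
  have Tt: "w2 * et' \<le> w2 * et - 1584 * A\<^sup>2 * q ^ 4 * \<alpha> * et + 12672 * A\<^sup>2 * q ^ 6 * \<alpha> * ex + 12672 * q ^ 8 * \<tau>\<^sup>2 * \<alpha> * Z + \<alpha>\<^sup>2 * (w2 * sgt\<^sup>2)"
  proof -
    have "w2 * et' \<le> w2 * ((1 - \<alpha> * \<mu> / 2) * et + 4 * \<alpha> / \<mu> * A\<^sup>2 * ex + 4 * \<alpha> * q\<^sup>2 * \<tau>\<^sup>2 / \<mu> * Z + \<alpha>\<^sup>2 * sgt\<^sup>2)"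
      using rt w0(2) by (rule mult_left_mono)
    also have "\<dots> = w2 * et - (w2 * \<mu>) * \<alpha> / 2 * et + (w2 / \<mu>) * (4 * \<alpha> * A\<^sup>2 * ex) + (w2 / \<mu>) * (4 * \<alpha> * q\<^sup>2 * \<tau>\<^sup>2 * Z) + \<alpha>\<^sup>2 * (w2 * sgt\<^sup>2)"
      by (simp add: algebra_simps)
    finally show ?thesis unfolding w2m w2d by (simp add: algebra_simps eval_nat_numeral)
  qed
  have Cc: "w4 * ec' \<le> w4 * ec - w4 * \<alpha> * ec + 2 * \<alpha> * b + 128 * A\<^sup>2 * q ^ 6 * \<tau>\<^sup>2 * \<alpha> * Z + \<alpha>\<^sup>2 * (N / m)"
  proof -
    have "w4 * ec' \<le> w4 * ((1 - \<alpha>) * ec + 2 * \<alpha> * b + 128 * A\<^sup>2 * q ^ 6 * \<tau>\<^sup>2 * \<alpha> * Z + \<alpha>\<^sup>2 * N)"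
      using rc w0(3) unfolding b_def N_def by (rule mult_left_mono)
    also have "\<dots> = w4 * ec - w4 * \<alpha> * ec + w4 * (2 * \<alpha> * b + 128 * A\<^sup>2 * q ^ 6 * \<tau>\<^sup>2 * \<alpha> * Z) + w4 * (\<alpha>\<^sup>2 * N)"
      by (simp add: algebra_simps)
    also have "w4 * (2 * \<alpha> * b + 128 * A\<^sup>2 * q ^ 6 * \<tau>\<^sup>2 * \<alpha> * Z) \<le> 1 * (2 * \<alpha> * b + 128 * A\<^sup>2 * q ^ 6 * \<tau>\<^sup>2 * \<alpha> * Z)"
      using w41 b0 a q nonneg by (intro mult_right_mono) auto
    also have "w4 * (\<alpha>\<^sup>2 * N) \<le> 1 / m * (\<alpha>\<^sup>2 * N)" using w4m N0 by (intro mult_right_mono) auto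
    finally show ?thesis by simp
  qed
  have Xx: "w5 * ex' \<le> w5 * ex - 14256 * A\<^sup>2 * q ^ 6 * \<alpha> * ex + w4 * \<alpha> * ec + 4 * R * \<alpha> ^ 3 * hb / (m * (1 - r)\<^sup>2)"
  proof -
    have "w5 * ex' \<le> w5 * ((1 - \<tau> * (1 - r) / 2) * ex + 2 * \<tau> * \<alpha>\<^sup>2 / (1 - r) * (2 * ec + 2 * hb / m))"
      using rx w0(4) by (rule mult_left_mono)
    also have "\<dots> = w5 * ex - (w5 * (\<tau> * (1 - r))) / 2 * ex + (w5 * \<tau> / (1 - r)) * (2 * \<alpha>\<^sup>2) * (2 * ec + 2 * hb / m)"
      by (simp add: algebra_simps)
    also have "w5 * (\<tau> * (1 - r)) = R * \<alpha>" using tau r by (simp add: w5_def)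
    also have "w5 * \<tau> / (1 - r) = R * \<alpha> / (1 - r)\<^sup>2" using tau r by (simp add: w5_def power2_eq_square)
    also have "w5 * ex - R * \<alpha> / 2 * ex + R * \<alpha> / (1 - r)\<^sup>2 * (2 * \<alpha>\<^sup>2) * (2 * ec + 2 * hb / m)
       = w5 * ex - R / 2 * \<alpha> * ex + w4 * \<alpha> * ec + 4 * R * \<alpha> ^ 3 * hb / (m * (1 - r)\<^sup>2)"
      by (simp add: w4_def distrib_left power2_eq_square power3_eq_cube add_divide_distrib mult_ac)
    finally show ?thesis by (simp add: R_def)
  qed
  have cZ: "(3072 * q ^ 8 + 12672 * q ^ 8 + 256 * A\<^sup>2 * q ^ 6) * \<tau>\<^sup>2 * \<alpha> * Z \<le> \<alpha> / 4 * Z"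
  proof -
    have "1 \<le> A\<^sup>2" using A by simp
    then have 1: "q ^ 8 \<le> A\<^sup>2 * q ^ 8" using q by (simp add: mult_left_le_one_le mult_le_cancel_right1)
    have "A\<^sup>2 * q ^ 6 \<le> A\<^sup>2 * q ^ 8" using q by (intro mult_left_mono power_increasing) auto
    with 1 have "3072 * q ^ 8 + 12672 * q ^ 8 + 256 * A\<^sup>2 * q ^ 6 \<le> 16000 * A\<^sup>2 * q ^ 8" by linarith
    then have "(3072 * q ^ 8 + 12672 * q ^ 8 + 256 * A\<^sup>2 * q ^ 6) * \<tau>\<^sup>2 \<le> 16000 * A\<^sup>2 * q ^ 8 * \<tau>\<^sup>2"
      by (rule mult_right_mono) simp
    also have "\<dots> \<le> 1 / 4" using tau(2) by simp
    finally have "(3072 * q ^ 8 + 12672 * q ^ 8 + 256 * A\<^sup>2 * q ^ 6) * \<tau>\<^sup>2 * (\<alpha> * Z) \<le> 1 / 4 * (\<alpha> * Z)"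
      using a nonneg by (intro mult_right_mono) auto
    then show ?thesis by simp
  qed
  have cv: "\<alpha>\<^sup>2 * (4 * w1 * sgtt\<^sup>2) * ev + \<alpha>\<^sup>2 * (8 * sgxt\<^sup>2) * ev \<le> 12 * A\<^sup>2 * \<alpha> * ev"
  proof -
    have "(\<alpha> * (4 * w1 * sgtt\<^sup>2 + 8 * sgxt\<^sup>2)) * (\<alpha> * ev) \<le> 12 * A\<^sup>2 * (\<alpha> * ev)"
      using small a nonneg by (intro mult_right_mono) auto
    then show ?thesis by (simp add: algebra_simps power2_eq_square)
  qed
  have cNv: "2 * (\<alpha>\<^sup>2 * (N / m)) \<le> \<alpha>\<^sup>2 * (2 / m * (2 * sfx\<^sup>2 + 4 * Mv\<^sup>2 * sgxt\<^sup>2)) + \<alpha>\<^sup>2 * (8 * sgxt\<^sup>2) * ev"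
  proof -
    have "2 * (N / m) = 2 / m * (2 * sfx\<^sup>2 + 4 * Mv\<^sup>2 * sgxt\<^sup>2) + (8 * sgxt\<^sup>2 * ev) / m"
      by (simp add: N_def algebra_simps add_divide_distrib)
    moreover have "(8 * sgxt\<^sup>2 * ev) / m \<le> 8 * sgxt\<^sup>2 * ev"
    proof -
      have "(8 * sgxt\<^sup>2 * ev) / m \<le> (8 * sgxt\<^sup>2 * ev) / 1"
        using m nonneg by (intro divide_left_mono) auto
      then show ?thesis by simp
    qed
    ultimately have "2 * (N / m) \<le> 2 / m * (2 * sfx\<^sup>2 + 4 * Mv\<^sup>2 * sgxt\<^sup>2) + 8 * sgxt\<^sup>2 * ev" by linarith
    from mult_left_mono[OF this, of "\<alpha>\<^sup>2"] show ?thesis by (simp add: algebra_simps)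
  qed
  have q24: "A\<^sup>2 * q\<^sup>2 * \<alpha> * (ex + et) \<le> A\<^sup>2 * q ^ 4 * \<alpha> * (ex + et)"
    using a nonneg q by (intro mult_right_mono mult_left_mono power_increasing) auto
  have q46: "A\<^sup>2 * q ^ 4 * \<alpha> * ex \<le> A\<^sup>2 * q ^ 6 * \<alpha> * ex"
    using a nonneg q by (intro mult_right_mono mult_left_mono power_increasing) auto
  have Zz: "ez' \<le> ez - \<alpha> * ez + 2 * \<alpha> * b + 128 * A\<^sup>2 * q ^ 6 * \<tau>\<^sup>2 * \<alpha> * Z + \<alpha>\<^sup>2 * (N / m)"
    using rz unfolding b_def N_def by (simp add: algebra_simps)
  have bb: "2 * \<alpha> * b + 2 * \<alpha> * b = 48 * (A\<^sup>2 * q\<^sup>2 * \<alpha> * (ex + et)) + 12 * A\<^sup>2 * \<alpha> * ev"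
    unfolding b_def by (simp add: algebra_simps)
  have ezz: "\<alpha> / 2 * ez \<le> \<alpha> * ez" using a nonneg by simp
  define X1 where "X1 = A\<^sup>2 * q ^ 4 * \<alpha> * ex"
  define X2 where "X2 = A\<^sup>2 * q ^ 4 * \<alpha> * et"
  define X3 where "X3 = A\<^sup>2 * q ^ 6 * \<alpha> * ex"
  define Y1 where "Y1 = q ^ 8 * \<tau>\<^sup>2 * \<alpha> * Z"
  define Y2 where "Y2 = A\<^sup>2 * q ^ 6 * \<tau>\<^sup>2 * \<alpha> * Z"
  define U where "U = A\<^sup>2 * \<alpha> * ev"
  define V1 where "V1 = \<alpha>\<^sup>2 * (4 * w1 * sgtt\<^sup>2) * ev"
  define V2 where "V2 = \<alpha>\<^sup>2 * (8 * sgxt\<^sup>2) * ev"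
  define Nn where "Nn = \<alpha>\<^sup>2 * (N / m)"
  define ab where "ab = 2 * \<alpha> * b"
  have P': "Ph' / \<tau> \<le> Ph / \<tau> - \<alpha> / 2 * G - \<alpha> / 4 * Z + \<alpha> / 2 * ez" by (rule P)
  have Vv': "w1 * ev' \<le> w1 * ev - 24 * U + 1536 * (X1 + X2) + 3072 * Y1 + \<alpha>\<^sup>2 * (w1 * (2 * sft\<^sup>2 + 4 * Mv\<^sup>2 * sgtt\<^sup>2)) + V1"
    using Vv unfolding U_def X1_def X2_def Y1_def V1_def by (simp add: algebra_simps)
  have Tt': "w2 * et' \<le> w2 * et - 1584 * X2 + 12672 * X3 + 12672 * Y1 + \<alpha>\<^sup>2 * (w2 * sgt\<^sup>2)"
    using Tt unfolding X2_def X3_def Y1_def by (simp add: algebra_simps)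
  have Zz': "ez' \<le> ez - \<alpha> * ez + ab + 128 * Y2 + Nn"
    using Zz unfolding Y2_def ab_def Nn_def by (simp add: algebra_simps)
  have Cc': "w4 * ec' \<le> w4 * ec - w4 * \<alpha> * ec + ab + 128 * Y2 + Nn"
    using Cc unfolding Y2_def ab_def Nn_def by (simp add: algebra_simps)
  have Xx': "w5 * ex' \<le> w5 * ex - 14256 * X3 + w4 * \<alpha> * ec + 4 * R * \<alpha> ^ 3 * hb / (m * (1 - r)\<^sup>2)"
    using Xx unfolding X3_def by (simp add: algebra_simps)
  have cZ': "3072 * Y1 + 12672 * Y1 + 256 * Y2 \<le> \<alpha> / 4 * Z"
    using cZ unfolding Y1_def Y2_def by (simp add: algebra_simps)
  have cv': "V1 + V2 \<le> 12 * U" using cv unfolding V1_def V2_def U_def by (simp add: algebra_simps)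
  have cN': "2 * Nn \<le> \<alpha>\<^sup>2 * (2 / m * (2 * sfx\<^sup>2 + 4 * Mv\<^sup>2 * sgxt\<^sup>2)) + V2"
    using cNv unfolding Nn_def V2_def .
  have bb': "2 * ab \<le> 48 * (X1 + X2) + 12 * U"
    using bb q24 unfolding ab_def X1_def X2_def U_def by (simp add: algebra_simps)
  have q46': "X1 \<le> X3" using q46 unfolding X1_def X3_def .
  have S: "\<alpha>\<^sup>2 * (w1 * (2 * sft\<^sup>2 + 4 * Mv\<^sup>2 * sgtt\<^sup>2) + w2 * sgt\<^sup>2 + 2 / m * (2 * sfx\<^sup>2 + 4 * Mv\<^sup>2 * sgxt\<^sup>2))
    = \<alpha>\<^sup>2 * (w1 * (2 * sft\<^sup>2 + 4 * Mv\<^sup>2 * sgtt\<^sup>2)) + \<alpha>\<^sup>2 * (w2 * sgt\<^sup>2) + \<alpha>\<^sup>2 * (2 / m * (2 * sfx\<^sup>2 + 4 * Mv\<^sup>2 * sgxt\<^sup>2))"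
    by (simp only: distrib_left)
  \<comment> \<open>The monomials are abstracted into variables, so that only linear arithmetic is left.\<close>
  have lin: "p' + v' + t' + z' + c' + x' \<le> p + v + t + z + c + x - g + (s1 + s2 + s3) + h"
    if "p' \<le> p - g - aZ + e2" "v' \<le> v - 24 * u + 1536 * (a1 + a2) + 3072 * b1 + s1 + k1"
      "t' \<le> t - 1584 * a2 + 12672 * a3 + 12672 * b1 + s2" "z' \<le> z - e1 + d + 128 * b2 + nn"
      "c' \<le> c - wc + d + 128 * b2 + nn" "x' \<le> x - 14256 * a3 + wc + h"
      "3072 * b1 + 12672 * b1 + 256 * b2 \<le> aZ" "k1 + k2 \<le> 12 * u" "2 * nn \<le> s3 + k2"
      "2 * d \<le> 48 * (a1 + a2) + 12 * u" "a1 \<le> a3" "e2 \<le> e1"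
    for p' v' t' z' c' x' p v t z c x g s1 s2 s3 h aZ e1 e2 u a1 a2 a3 b1 b2 k1 k2 d nn wc :: real
  proof -
    have "p' + v' + t' + z' + c' + x' \<le> p + v + t + z + c + x - g + s1 + s2 + h
        + (3072 * b1 + 12672 * b1 + 256 * b2 - aZ) + (e2 - e1) + (2 * d - 48 * (a1 + a2) - 12 * u)
        + 1584 * (a1 - a3) + 2 * nn + k1 - 12 * u"
      using that(1-6) by (simp add: algebra_simps)
    moreover have "2 * nn + k1 - 12 * u \<le> s3" using that(8,9) by linarith
    moreover have "3072 * b1 + 12672 * b1 + 256 * b2 - aZ \<le> 0" using that(7) by simp
    moreover have "2 * d - 48 * (a1 + a2) - 12 * u \<le> 0" using that(10) by simp
    moreover have "1584 * (a1 - a3) \<le> 0" using that(11) by simp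
    ultimately show ?thesis using that(12) by linarith
  qed
  show ?thesis
    unfolding S by (rule lin[OF P' Vv' Tt' Zz' Cc' Xx' cZ' cv' cN' bb' q46' ezz])
qed

context lopa_run
begin

definition "w1 = 48 * A\<^sup>2 / \<mu>"
definition "w2 = 3168 * A\<^sup>2 * q ^ 4 / \<mu>"
definition "R = 28512 * A\<^sup>2 * q ^ 6"
definition "w4 = 4 * R * \<alpha>\<^sup>2 / (1 - r)\<^sup>2"
definition "w5 = R * \<alpha> / (tau st * (1 - r))"
definition "lyap k = EP k / tau st + w1 * node_avg m (\<lambda>i. Dv i k) + w2 * node_avg m (\<lambda>i. Dt i k) + Dz k
   + w4 * node_avg m (\<lambda>i. Dc i k) + w5 * node_avg m (\<lambda>i. Dx i k)"
definition "noise_floor = w1 * (2 * (s_ft n)\<^sup>2 + 4 * (MM c \<mu>)\<^sup>2 * (s_gtt n)\<^sup>2) + w2 * (s_gt n)\<^sup>2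
   + 2 / real m * (2 * (s_fx n)\<^sup>2 + 4 * (MM c \<mu>)\<^sup>2 * (s_gxt n)\<^sup>2)"
definition "drift = \<alpha>\<^sup>2 * noise_floor + 4 * R * \<alpha> ^ 3 * het_bound / (real m * (1 - r)\<^sup>2)"

lemma weights_nonneg: "0 \<le> w1" "0 \<le> w2" "0 \<le> R" "0 \<le> w4" "0 \<le> w5"
  using mu0 A_pos q1 alpha tau rho_r by (simp_all add: w1_def w2_def R_def w4_def w5_def)

lemma D_nonneg: "0 \<le> Dx i k" "0 \<le> Dt i k" "0 \<le> Dv i k" "0 \<le> Dc i k" "0 \<le> Dz k" "0 \<le> EZ k" "0 \<le> EG k"
  by (simp_all add: Dx_def Dt_def Dv_def Dc_def Dz_def EZ_def EG_def)

lemma avg_nonneg: "0 \<le> node_avg m (\<lambda>i. Dx i k)" "0 \<le> node_avg m (\<lambda>i. Dt i k)" "0 \<le> node_avg m (\<lambda>i. Dv i k)"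
  "0 \<le> node_avg m (\<lambda>i. Dc i k)"
  by (rule node_avg_nonneg, rule D_nonneg)+

lemma lyap_step:
  assumes pos: "\<forall>x. 0 \<le> Phi P x" and t1: "32 * A * q ^ 3 * tau st * \<alpha> \<le> 1" and t2: "64000 * A\<^sup>2 * q ^ 8 * (tau st)\<^sup>2 \<le> 1"
    and w4m: "w4 \<le> 1 / real m" and small: "\<alpha> * (4 * w1 * (s_gtt n)\<^sup>2 + 8 * (s_gxt n)\<^sup>2) \<le> 12 * A\<^sup>2"
  shows "lyap (Suc k) \<le> lyap k - \<alpha> / 2 * EG k + drift"
proof -
  let ?x = "node_avg m (\<lambda>i. Dx i k)" and ?t = "node_avg m (\<lambda>i. Dt i k)"
    and ?v = "node_avg m (\<lambda>i. Dv i k)" and ?c = "node_avg m (\<lambda>i. Dc i k)"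
  note lin = node_avg_add node_avg_mult node_avg_const[OF m1]
  have "node_avg m (\<lambda>i. Dt i (Suc k)) \<le> node_avg m (\<lambda>i. (1 - \<alpha> * \<mu> / 2) * Dt i k + 4 * \<alpha> / \<mu> * A\<^sup>2 * Dx i k
    + 4 * \<alpha> * q\<^sup>2 * (tau st)\<^sup>2 / \<mu> * EZ k + \<alpha>\<^sup>2 * (s_gt n)\<^sup>2)"
    by (rule node_avg_mono) (rule recursion_theta[OF VP])
  then have rt: "node_avg m (\<lambda>i. Dt i (Suc k)) \<le> (1 - \<alpha> * \<mu> / 2) * ?t + 4 * \<alpha> / \<mu> * A\<^sup>2 * ?x
    + 4 * \<alpha> * q\<^sup>2 * (tau st)\<^sup>2 / \<mu> * EZ k + \<alpha>\<^sup>2 * (s_gt n)\<^sup>2"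
    by (simp only: lin)
  have "node_avg m (\<lambda>i. Dv i (Suc k)) \<le> node_avg m (\<lambda>i. (1 - \<alpha> * \<mu> / 2) * Dv i k + 32 * \<alpha> * A\<^sup>2 * q\<^sup>2 / \<mu> * (Dx i k + Dt i k)
    + 64 * \<alpha> * q ^ 6 * (tau st)\<^sup>2 / \<mu> * EZ k + \<alpha>\<^sup>2 * (2 * (s_ft n)\<^sup>2 + 2 * (s_gtt n)\<^sup>2 * (2 * (MM c \<mu>)\<^sup>2 + 2 * Dv i k)))"
    by (rule node_avg_mono) (rule recursion_v[OF VP])
  then have rv: "node_avg m (\<lambda>i. Dv i (Suc k)) \<le> (1 - \<alpha> * \<mu> / 2) * ?v + 32 * \<alpha> * A\<^sup>2 * q\<^sup>2 / \<mu> * (?x + ?t)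
    + 64 * \<alpha> * q ^ 6 * (tau st)\<^sup>2 / \<mu> * EZ k + \<alpha>\<^sup>2 * (2 * (s_ft n)\<^sup>2 + 2 * (s_gtt n)\<^sup>2 * (2 * (MM c \<mu>)\<^sup>2 + 2 * ?v))"
    by (simp only: lin)
  have "node_avg m (\<lambda>i. Dc i (Suc k)) \<le> node_avg m (\<lambda>i. (1 - \<alpha>) * Dc i k + 2 * \<alpha> * Db i k
    + 128 * A\<^sup>2 * q ^ 6 * (tau st)\<^sup>2 * \<alpha> * EZ k + \<alpha>\<^sup>2 * sS i k)"
    by (rule node_avg_mono) (rule recursion_c[OF VP])
  then have rc: "node_avg m (\<lambda>i. Dc i (Suc k)) \<le> (1 - \<alpha>) * ?c + 2 * \<alpha> * (12 * A\<^sup>2 * q\<^sup>2 * (?x + ?t) + 3 * A\<^sup>2 * ?v)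
    + 128 * A\<^sup>2 * q ^ 6 * (tau st)\<^sup>2 * \<alpha> * EZ k
    + \<alpha>\<^sup>2 * (2 * (s_fx n)\<^sup>2 + 2 * (s_gxt n)\<^sup>2 * (2 * (MM c \<mu>)\<^sup>2 + 2 * ?v))"
    unfolding Db_def sS_def by (simp only: lin)
  have rz: "Dz (Suc k) \<le> (1 - \<alpha>) * Dz k + 2 * \<alpha> * (12 * A\<^sup>2 * q\<^sup>2 * (?x + ?t) + 3 * A\<^sup>2 * ?v)
    + 128 * A\<^sup>2 * q ^ 6 * (tau st)\<^sup>2 * \<alpha> * EZ k
    + \<alpha>\<^sup>2 * ((2 * (s_fx n)\<^sup>2 + 2 * (s_gxt n)\<^sup>2 * (2 * (MM c \<mu>)\<^sup>2 + 2 * ?v)) / real m)"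
    using recursion_z[of k] unfolding Db_def sS_def by (simp only: lin)
  have mq: "A = \<mu> * q" using mu0 by (simp add: q_def)
  have mm: "1 \<le> real m" using m1 by simp
  show ?thesis
    unfolding lyap_def drift_def noise_floor_def
    using lyapunov_step[OF A_ge(9) q1 mu0 mq alpha(1) tau(1) t2 rho_r(3) mm avg_nonneg(3) avg_nonneg(2) D_nonneg(5)
        avg_nonneg(4) avg_nonneg(1) D_nonneg(6) recursion_Phi[OF pos t1] rt rv rz rc recursion_x
        w4m[unfolded w4_def R_def] small[unfolded w1_def]]
    unfolding w1_def w2_def w4_def w5_def R_def by (simp only: add.assoc)
qed

lemma lyap_nonneg: "\<forall>x. 0 \<le> Phi P x \<Longrightarrow> 0 \<le> lyap k"
  unfolding lyap_def EP_def using tau weights_nonneg avg_nonneg D_nonneg(5)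
  by (intro add_nonneg_nonneg mult_nonneg_nonneg divide_nonneg_nonneg Bochner_Integration.integral_nonneg) auto

lemma lyap_telescope:
  assumes pos: "\<forall>x. 0 \<le> Phi P x" and t1: "32 * A * q ^ 3 * tau st * \<alpha> \<le> 1" and t2: "64000 * A\<^sup>2 * q ^ 8 * (tau st)\<^sup>2 \<le> 1"
    and w4m: "w4 \<le> 1 / real m" and small: "\<alpha> * (4 * w1 * (s_gtt n)\<^sup>2 + 8 * (s_gxt n)\<^sup>2) \<le> 12 * A\<^sup>2"
  shows "1 / (real K + 1) * (\<Sum>k=0..K. EG k) \<le> 2 * lyap 0 / (\<alpha> * (real K + 1)) + 2 * \<alpha> * noise_floor
     + 8 * R * \<alpha>\<^sup>2 * het_bound / (real m * (1 - r)\<^sup>2)"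
proof -
  have "\<alpha> / 2 * (\<Sum>k=0..K. EG k) + lyap (Suc K) \<le> lyap 0 + (real K + 1) * drift"
  proof (induction K)
    case 0
    then show ?case using lyap_step[OF assms, of 0] by simp
  next
    case (Suc K)
    then show ?case using lyap_step[OF assms, of "Suc K"] by (simp add: algebra_simps)
  qed
  then have "\<alpha> / 2 * (\<Sum>k=0..K. EG k) \<le> lyap 0 + (real K + 1) * drift"
    using lyap_nonneg[OF pos, of "Suc K"] by linarith
  then have "2 / (\<alpha> * (real K + 1)) * (\<alpha> / 2 * (\<Sum>k=0..K. EG k)) \<le> 2 / (\<alpha> * (real K + 1)) * (lyap 0 + (real K + 1) * drift)"
    by (rule mult_left_mono) (use alpha in simp)
  moreover have "2 / (\<alpha> * (real K + 1)) * (\<alpha> / 2 * (\<Sum>k=0..K. EG k)) = 1 / (real K + 1) * (\<Sum>k=0..K. EG k)"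
  proof -
    have "2 / (\<alpha> * b) * (\<alpha> / 2 * s) = 1 / b * s" for b s :: real using alpha(1) by simp
    then show ?thesis .
  qed
  moreover have "2 / (\<alpha> * (real K + 1)) * (lyap 0 + (real K + 1) * drift) = 2 * lyap 0 / (\<alpha> * (real K + 1)) + 2 * (drift / \<alpha>)"
  proof -
    have "2 / (\<alpha> * (real K + 1)) * ((real K + 1) * drift) = 2 * (drift / \<alpha>)" by simp
    then show ?thesis by (simp only: distrib_left) simp
  qed
  ultimately have "1 / (real K + 1) * (\<Sum>k=0..K. EG k) \<le> 2 * lyap 0 / (\<alpha> * (real K + 1)) + 2 * (drift / \<alpha>)"
    by (simp only:)
  also have "drift / \<alpha> = \<alpha> * noise_floor + 4 * R * \<alpha>\<^sup>2 * het_bound / (real m * (1 - r)\<^sup>2)"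
    using alpha(1) by (simp add: drift_def add_divide_distrib power2_eq_square power3_eq_cube)
  finally show ?thesis by (simp add: distrib_left add.assoc)
qed

lemma lyap_0:
  defines "xi \<equiv> node_avg m x0"
  shows "lyap 0 = Phi P xi / tau st + w1 * node_avg m (\<lambda>i. (norm (v0 i - v_star P i xi))\<^sup>2)
    + w2 * node_avg m (\<lambda>i. (norm (\<theta>0 i - theta_star P i xi))\<^sup>2) + (norm (gPhi xi - node_avg m z0))\<^sup>2
    + w4 * node_avg m (\<lambda>i. (norm (gP i xi - z0 i))\<^sup>2) + w5 * node_avg m (\<lambda>i. (norm (x0 i - xi))\<^sup>2)"
proof -
  have x: "xb 0 \<omega> = xi" and z: "zb 0 \<omega> = node_avg m z0" if "\<omega> \<in> space M" for \<omega>
    unfolding xb_def zb_def xi_def using init[OF VP that] by (auto intro!: node_avg_cong)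
  have const: "(\<integral>\<omega>. h \<omega> \<partial>M) = a" if "\<And>\<omega>. \<omega> \<in> space M \<Longrightarrow> h \<omega> = a" for h :: "'w \<Rightarrow> real" and a
  proof -
    have "(\<integral>\<omega>. h \<omega> \<partial>M) = (\<integral>\<omega>. a \<partial>M)" by (rule Bochner_Integration.integral_cong) (auto simp: that)
    then show ?thesis by (simp add: prob_space)
  qed
  have "EP 0 = Phi P xi" "Dz 0 = (norm (gPhi xi - node_avg m z0))\<^sup>2"
    unfolding EP_def Dz_def by (rule const, simp add: x z)+
  moreover have "node_avg m (\<lambda>i. Dv i 0) = node_avg m (\<lambda>i. (norm (v0 i - v_star P i xi))\<^sup>2)"
    "node_avg m (\<lambda>i. Dt i 0) = node_avg m (\<lambda>i. (norm (\<theta>0 i - theta_star P i xi))\<^sup>2)"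
    "node_avg m (\<lambda>i. Dc i 0) = node_avg m (\<lambda>i. (norm (gP i xi - z0 i))\<^sup>2)"
    "node_avg m (\<lambda>i. Dx i 0) = node_avg m (\<lambda>i. (norm (x0 i - xi))\<^sup>2)"
    unfolding Dv_def Dt_def Dc_def Dx_def by (rule node_avg_cong, rule const, simp add: x init[OF VP])+
  ultimately show ?thesis by (simp add: lyap_def)
qed

end

section \<open>Sizes of the constants\<close>

text \<open>The parameters of the step-size rule as functions of the constants alone, without a problem.\<close>

locale step_constants =
  fixes c :: fun_consts and Lc \<mu> :: real
  assumes pos_c: "positive_consts c" and Lc: "Lc > 0" and mu0: "\<mu> > 0"
begin

definition "A = const_sum c Lc"
text \<open>\<open>A\<close> and \<open>lo\<close> do not involve \<open>\<mu>\<close>, and so neither does \<open>D\<close>. Both \<open>kappa\<close> and \<open>MM\<close> lie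
  between \<open>lo / \<mu>\<close> and \<open>q = D * (lo / \<mu>)\<close>.\<close>

definition "lo = Min {L_fx c, L_ft c, C_ft c, L_gt c, L_gxt c, L_gtt c, C_gxt c}"
definition "D = A / lo"
definition "q = A / \<mu>"

lemma c_pos: "0 < L_fx c" "0 < L_ft c" "0 < C_ft c" "0 < L_gt c" "0 < L_gxt c" "0 < L_gtt c" "0 < C_gxt c"
  using pos_c by (auto simp: positive_consts_def)

lemma c_le_A: "L_fx c \<le> A" "L_ft c \<le> A" "C_ft c \<le> A" "L_gt c \<le> A" "L_gxt c \<le> A" "L_gtt c \<le> A" "C_gxt c \<le> A" "1 \<le> A"
  using c_pos Lc by (simp_all add: A_def const_sum_def)

lemma lo_le: "lo \<le> L_fx c" "lo \<le> L_ft c" "lo \<le> C_ft c" "lo \<le> L_gt c" "lo \<le> L_gxt c" "lo \<le> L_gtt c" "lo \<le> C_gxt c"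
  unfolding lo_def by (rule Min_le; simp)+

lemma lo_pos: "0 < lo" using c_pos by (simp add: lo_def)

lemma A_pos: "0 < A" using c_le_A by linarith

lemma D_ge1: "1 \<le> D" using lo_pos lo_le(1) c_le_A(1) by (simp add: D_def)

lemma A_D: "A = D * lo" using lo_pos by (simp add: D_def)

lemma q_pos: "0 < q" using A_pos mu0 by (simp add: q_def)

lemma kappa_bounds: "lo / \<mu> \<le> kappa c \<mu>" "kappa c \<mu> \<le> q" "q \<le> D * kappa c \<mu>" "0 < kappa c \<mu>"
proof -
  let ?L = "Max {L_fx c, L_ft c, L_gt c, L_gxt c, L_gtt c}"
  have "lo \<le> ?L" using lo_le(1) by (simp add: le_max_iff_disj)
  then show 1: "lo / \<mu> \<le> kappa c \<mu>" using mu0 by (simp add: kappa_def divide_right_mono)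
  have "?L \<le> A" using c_le_A by simp
  then show "kappa c \<mu> \<le> q" using mu0 unfolding kappa_def q_def by (intro divide_right_mono) auto
  have "q = D * (lo / \<mu>)" by (simp add: q_def A_D)
  also have "\<dots> \<le> D * kappa c \<mu>" using 1 D_ge1 by (intro mult_left_mono) auto
  finally show "q \<le> D * kappa c \<mu>" .
  show "0 < kappa c \<mu>" using 1 lo_pos mu0 by (meson divide_pos_pos less_le_trans)
qed

lemma MM_bounds: "lo / \<mu> \<le> MM c \<mu>" "MM c \<mu> \<le> q" "0 < MM c \<mu>"
  using lo_le(3) c_le_A(3) c_pos(3) mu0 by (auto simp: MM_def q_def divide_right_mono)

lemma L_fg_pos: "0 < L_fgx c \<mu>" "0 < L_fgt c \<mu>"
  using c_pos by (auto simp: L_fgx_def L_fgt_def intro!: add_pos_nonneg)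

lemma PP_pos: "0 < PP c \<mu>"
  unfolding PP_def using L_fg_pos mu0 by (intro add_pos_nonneg) auto

lemma omega_pos: "0 < omega_t c \<mu>"
  using c_pos mu0 by (simp add: omega_t_def)

lemma omega_le: "omega_t c \<mu> \<le> \<mu> / 2"
  using c_pos mu0 by (simp add: omega_t_def field_simps)

text \<open>The last summand of \<open>PP\<close> with the last one of \<open>L_fgt\<close> is the one with the highest power of \<open>1 / \<mu>\<close>; lower bounds of this kind are
  what the weights \<open>w2\<close> and \<open>R\<close> are compared with.\<close>

lemma PP_lower: "128 * lo ^ 6 / \<mu> ^ 4 \<le> PP c \<mu>"
proof -
  have "4 * (lo / \<mu>)\<^sup>2 * lo\<^sup>2 \<le> L_fgt c \<mu>"
    using MM_bounds(1) lo_le(6) lo_pos mu0 unfolding L_fgt_def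
    by (intro add_increasing mult_mono power_mono) auto
  then have "32 * lo\<^sup>2 * (4 * (lo / \<mu>)\<^sup>2 * lo\<^sup>2) / \<mu>\<^sup>2 \<le> 32 * (C_gxt c)\<^sup>2 * L_fgt c \<mu> / \<mu>\<^sup>2"
    using lo_le(7) lo_pos mu0 by (intro divide_right_mono mult_mono power_mono) auto
  also have "\<dots> \<le> PP c \<mu>" using L_fg_pos by (simp add: PP_def)
  finally show ?thesis by (simp add: eval_nat_numeral power_divide)
qed

lemma phi_lower: "2048 * lo ^ 8 / \<mu> ^ 6 \<le> phi c \<mu>"
proof -
  have "16 * lo\<^sup>2 / \<mu>\<^sup>2 = 4 * lo\<^sup>2 / (\<mu> / 2)\<^sup>2" by (simp add: power_divide)
  also have "\<dots> \<le> 4 * (L_gt c)\<^sup>2 / (omega_t c \<mu>)\<^sup>2"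
    using lo_le(4) lo_pos omega_le omega_pos by (intro frac_le mult_left_mono power_mono) auto
  finally have 1: "16 * lo\<^sup>2 / \<mu>\<^sup>2 \<le> 1 + 4 * (L_gt c)\<^sup>2 / (omega_t c \<mu>)\<^sup>2" by simp
  have "128 * lo ^ 6 / \<mu> ^ 4 * (16 * lo\<^sup>2 / \<mu>\<^sup>2) \<le> phi c \<mu>"
    unfolding phi_def using lo_pos mu0 PP_pos by (intro mult_mono PP_lower 1) auto
  then show ?thesis by (simp add: eval_nat_numeral)
qed

lemma phi_pos: "0 < phi c \<mu>"
  using phi_lower lo_pos mu0 by (meson divide_pos_pos less_le_trans mult_pos_pos zero_less_numeral zero_less_power)

lemma LL_pos: "0 < LL c \<mu>"
proof -
  have "0 < L_v c \<mu>" "0 < L_tstar c \<mu>" using c_pos mu0 by (auto simp: L_v_def L_tstar_def intro!: add_pos_pos)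
  then show ?thesis using c_pos mu0 unfolding LL_def by (intro mult_pos_pos add_pos_pos) auto
qed

lemma L_vstar_pos: "0 < L_vstar c \<mu>"
proof -
  have "0 < L_v c \<mu>" "0 < L_tstar c \<mu>" using c_pos mu0 by (auto simp: L_v_def L_tstar_def intro!: add_pos_pos)
  then show ?thesis unfolding L_vstar_def by (intro mult_pos_pos add_pos_pos) auto
qed

lemma uu_props:
  assumes n: "noise_levels n" and t: "0 < tau st" and r: "\<rho> < 1"
  shows "0 < uu c \<mu> n st \<rho>" "uu c \<mu> n st \<rho> \<le> (1 - \<rho>) / (12 * phi c \<mu> powr (1/2))"
    "uu c \<mu> n st \<rho> \<le> (1 - \<rho>) powr (2/3) / (4 * phi c \<mu> powr (1/3))"
proof -
  have s: "0 < s_gxt n" using n by (simp add: noise_levels_def)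
  have "0 < u1 c \<mu> st" using LL_pos t by (simp add: u1_def)
  moreover have "0 < u2 c \<mu> n \<rho>"
    using phi_pos PP_pos L_fg_pos c_pos s r unfolding u2_def by (simp add: less_imp_neq[symmetric])
  moreover have "0 < u3 c \<mu> n st"
    using LL_pos L_vstar_pos PP_pos c_pos s t omega_pos mu0 unfolding u3_def L_tstar_def
    by (auto simp: min_def intro!: divide_pos_pos mult_pos_pos add_pos_pos)
  ultimately show "0 < uu c \<mu> n st \<rho>" by (simp add: uu_def)
  have "uu c \<mu> n st \<rho> \<le> u2 c \<mu> n \<rho>" by (simp add: uu_def)
  then show "uu c \<mu> n st \<rho> \<le> (1 - \<rho>) / (12 * phi c \<mu> powr (1/2))"
    "uu c \<mu> n st \<rho> \<le> (1 - \<rho>) powr (2/3) / (4 * phi c \<mu> powr (1/3))"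
    by (auto simp: u2_def intro: order_trans)
qed

text \<open>The summand of highest order in \<open>1 / \<mu>\<close> suffices for the comparison with \<open>het_bound\<close>.\<close>

lemma b2_lower: "4 * (1 + lo\<^sup>2 / \<mu>\<^sup>2) * bf\<^sup>2 + 16 * lo ^ 6 / \<mu> ^ 6 * bg\<^sup>2 \<le> b2 c \<mu> bf bg"
proof -
  have 1: "4 * (1 + lo\<^sup>2 / \<mu>\<^sup>2) * bf\<^sup>2 \<le> 4 * (1 + (C_gxt c)\<^sup>2 / \<mu>\<^sup>2) * bf\<^sup>2"
    using lo_le(7) lo_pos by (intro mult_right_mono mult_left_mono add_left_mono divide_right_mono power_mono) auto
  have "lo ^ 6 / \<mu> ^ 6 = lo\<^sup>2 * lo\<^sup>2 * lo\<^sup>2 / \<mu> ^ 6" by (simp add: eval_nat_numeral)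
  also have "\<dots> \<le> (C_ft c)\<^sup>2 * (C_gxt c)\<^sup>2 * (L_gtt c)\<^sup>2 / \<mu> ^ 6"
    using lo_le(3,6,7) lo_pos mu0 by (intro divide_right_mono mult_mono power_mono) auto
  finally have 2: "16 * lo ^ 6 / \<mu> ^ 6 * bg\<^sup>2 \<le> 4 * (4 * (C_ft c)\<^sup>2 * (C_gxt c)\<^sup>2 * (L_gtt c)\<^sup>2 / \<mu> ^ 6) * bg\<^sup>2"
    by (intro mult_right_mono) auto
  have 3: "4 * (4 * (C_ft c)\<^sup>2 * (C_gxt c)\<^sup>2 * (L_gtt c)\<^sup>2 / \<mu> ^ 6) * bg\<^sup>2 \<le>
     4 * (4 * (C_ft c)\<^sup>2 * (C_gxt c)\<^sup>2 / \<mu> ^ 4 + 4 * (C_ft c)\<^sup>2 / \<mu>\<^sup>2 + (L_fx c)\<^sup>2 / \<mu>\<^sup>2 +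
          (L_ft c)\<^sup>2 * (C_gxt c)\<^sup>2 / \<mu> ^ 4 +
          4 * (C_ft c)\<^sup>2 * (C_gxt c)\<^sup>2 * (L_gtt c)\<^sup>2 / \<mu> ^ 6 +
          4 * (C_ft c)\<^sup>2 * (L_gxt c)\<^sup>2 / \<mu> ^ 4) * bg\<^sup>2"
    by (intro mult_right_mono mult_left_mono) auto
  show ?thesis unfolding b2_def using 1 2 3 by linarith
qed

lemma b2_pos: "bf > 0 \<Longrightarrow> 0 < b2 c \<mu> bf bg"
proof -
  assume "bf > 0"
  then have "0 < 4 * (1 + lo\<^sup>2 / \<mu>\<^sup>2) * bf\<^sup>2 + 16 * lo ^ 6 / \<mu> ^ 6 * bg\<^sup>2"
    using lo_pos mu0 by (intro add_pos_nonneg mult_pos_pos) (auto intro!: add_pos_nonneg)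
  then show ?thesis using b2_lower by (rule less_le_trans)
qed

lemma het_bound_le: "5 * (1 + q\<^sup>2) * bf\<^sup>2 + 90 * q ^ 6 * bg\<^sup>2 \<le> 7 * D ^ 6 * b2 c \<mu> bf bg"
proof -
  have D2: "1 \<le> D\<^sup>2" "D\<^sup>2 \<le> D ^ 6" using D_ge1 by (auto simp: one_le_power intro: power_increasing)
  have q2: "q\<^sup>2 = D\<^sup>2 * (lo\<^sup>2 / \<mu>\<^sup>2)" by (simp add: q_def A_D power_mult_distrib power_divide)
  have q6: "q ^ 6 = D ^ 6 * (lo ^ 6 / \<mu> ^ 6)" by (simp add: q_def A_D power_mult_distrib power_divide)
  have "1 + q\<^sup>2 \<le> D\<^sup>2 * (1 + lo\<^sup>2 / \<mu>\<^sup>2)" unfolding q2 using D2 by (simp add: distrib_left)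
  also have "\<dots> \<le> D ^ 6 * (1 + lo\<^sup>2 / \<mu>\<^sup>2)" using D2 by (intro mult_right_mono) auto
  finally have "5 * (1 + q\<^sup>2) * bf\<^sup>2 \<le> 5 * (D ^ 6 * (1 + lo\<^sup>2 / \<mu>\<^sup>2)) * bf\<^sup>2"
    by (intro mult_right_mono mult_left_mono) auto
  then have "5 * (1 + q\<^sup>2) * bf\<^sup>2 + 90 * q ^ 6 * bg\<^sup>2 \<le> D ^ 6 * (5 * (1 + lo\<^sup>2 / \<mu>\<^sup>2) * bf\<^sup>2 + 90 * (lo ^ 6 / \<mu> ^ 6) * bg\<^sup>2)"
    unfolding q6 by (simp add: algebra_simps)
  also have "\<dots> \<le> D ^ 6 * (7 * (4 * (1 + lo\<^sup>2 / \<mu>\<^sup>2) * bf\<^sup>2 + 16 * lo ^ 6 / \<mu> ^ 6 * bg\<^sup>2))"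
  proof (rule mult_left_mono)
    have lin: "5 * p + 90 * s \<le> 7 * (4 * p + 16 * s)" if "0 \<le> p" "0 \<le> s" for p s :: real
      using that by simp
    have e: "16 * lo ^ 6 / \<mu> ^ 6 * bg\<^sup>2 = 16 * ((lo ^ 6 / \<mu> ^ 6) * bg\<^sup>2)" by simp
    have "0 \<le> (1 + lo\<^sup>2 / \<mu>\<^sup>2) * bf\<^sup>2" by (intro mult_nonneg_nonneg) auto
    moreover have "0 \<le> (lo ^ 6 / \<mu> ^ 6) * bg\<^sup>2" using lo_pos mu0 by (intro mult_nonneg_nonneg) auto
    ultimately show "5 * (1 + lo\<^sup>2 / \<mu>\<^sup>2) * bf\<^sup>2 + 90 * (lo ^ 6 / \<mu> ^ 6) * bg\<^sup>2 \<le> 7 * (4 * (1 + lo\<^sup>2 / \<mu>\<^sup>2) * bf\<^sup>2 + 16 * lo ^ 6 / \<mu> ^ 6 * bg\<^sup>2)"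
      unfolding e mult.assoc by (rule lin)
  qed (use D_ge1 in simp)
  also have "\<dots> \<le> D ^ 6 * (7 * b2 c \<mu> bf bg)"
    using b2_lower[of bf bg] D_ge1 by (intro mult_left_mono) auto
  finally show ?thesis by (simp add: mult_ac)
qed

end

context step_constants
begin

lemma q_ge1: "\<mu> \<le> L_gt c \<Longrightarrow> 1 \<le> q"
  using c_le_A(4) mu0 by (simp add: q_def)

lemma omega_lower: "\<mu> \<le> L_gt c \<Longrightarrow> \<mu> / 4 \<le> omega_t c \<mu>"
proof -
  assume g: "\<mu> \<le> L_gt c"
  have "1 / 2 \<le> L_gt c / (\<mu> + L_gt c)" using g mu0 by (simp add: field_simps)
  then have "\<mu> / 2 * (1 / 2) \<le> \<mu> / 2 * (L_gt c / (\<mu> + L_gt c))" using mu0 by (intro mult_left_mono) auto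
  then show ?thesis by (simp add: omega_t_def)
qed

lemma L_fg_upper:
  assumes g: "\<mu> \<le> L_gt c"
  shows "L_fgx c \<mu> \<le> 6 * A\<^sup>2 * q\<^sup>2" "L_fgt c \<mu> \<le> 6 * A\<^sup>2 * q\<^sup>2"
proof -
  have q2: "1 \<le> q\<^sup>2" using q_ge1[OF g] by (simp add: one_le_power)
  have b: "2 * l\<^sup>2 + 4 * (MM c \<mu>)\<^sup>2 * l'\<^sup>2 \<le> 6 * A\<^sup>2 * q\<^sup>2" if "0 < l" "l \<le> A" "0 < l'" "l' \<le> A" for l l'
  proof -
    have "2 * l\<^sup>2 + 4 * (MM c \<mu>)\<^sup>2 * l'\<^sup>2 \<le> 2 * A\<^sup>2 + 4 * q\<^sup>2 * A\<^sup>2"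
      using that MM_bounds by (intro add_mono mult_mono power_mono) auto
    also have "\<dots> \<le> 2 * (A\<^sup>2 * q\<^sup>2) + 4 * q\<^sup>2 * A\<^sup>2"
      using mult_left_mono[OF q2, of "A\<^sup>2"] by simp
    finally show ?thesis by simp
  qed
  show "L_fgx c \<mu> \<le> 6 * A\<^sup>2 * q\<^sup>2" unfolding L_fgx_def by (rule b) (use c_pos c_le_A in auto)
  show "L_fgt c \<mu> \<le> 6 * A\<^sup>2 * q\<^sup>2" unfolding L_fgt_def by (rule b) (use c_pos c_le_A in auto)
qed

lemma PP_upper:
  assumes g: "\<mu> \<le> L_gt c"
  shows "PP c \<mu> \<le> 198 * A\<^sup>2 * q ^ 4"
proof -
  have "(C_gxt c)\<^sup>2 * L_fgt c \<mu> \<le> A\<^sup>2 * (6 * A\<^sup>2 * q\<^sup>2)"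
    using L_fg_upper(2)[OF g] L_fg_pos c_pos c_le_A by (intro mult_mono power_mono) auto
  then have "32 * ((C_gxt c)\<^sup>2 * L_fgt c \<mu>) / \<mu>\<^sup>2 \<le> 32 * (A\<^sup>2 * (6 * A\<^sup>2 * q\<^sup>2)) / \<mu>\<^sup>2"
    by (intro divide_right_mono mult_left_mono) auto
  also have "\<dots> = 192 * A\<^sup>2 * q ^ 4"
    by (simp add: q_def power_divide eval_nat_numeral)
  finally have "PP c \<mu> \<le> 6 * A\<^sup>2 * q\<^sup>2 + 192 * A\<^sup>2 * q ^ 4"
    unfolding PP_def using L_fg_upper(1)[OF g] by (simp add: mult.assoc)
  also have "6 * A\<^sup>2 * q\<^sup>2 \<le> 6 * A\<^sup>2 * q ^ 4"
    using q_ge1[OF g] by (intro mult_left_mono power_increasing) auto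
  finally show ?thesis by simp
qed

lemma phi_upper:
  assumes g: "\<mu> \<le> L_gt c"
  shows "phi c \<mu> \<le> 12870 * A\<^sup>2 * q ^ 6"
proof -
  have "4 * (L_gt c)\<^sup>2 / (omega_t c \<mu>)\<^sup>2 \<le> 4 * A\<^sup>2 / (\<mu> / 4)\<^sup>2"
    using c_pos c_le_A omega_lower[OF g] mu0 by (intro frac_le mult_left_mono power_mono) auto
  also have "\<dots> = 64 * q\<^sup>2" by (simp add: q_def power_divide)
  finally have "1 + 4 * (L_gt c)\<^sup>2 / (omega_t c \<mu>)\<^sup>2 \<le> 65 * q\<^sup>2"
    using q_ge1[OF g] one_le_power[of q 2] by linarith
  then have "phi c \<mu> \<le> 198 * A\<^sup>2 * q ^ 4 * (65 * q\<^sup>2)"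
    unfolding phi_def using PP_upper[OF g] PP_pos q_pos by (intro mult_mono) auto
  also have "\<dots> = 12870 * A\<^sup>2 * q ^ 6" by (simp add: eval_nat_numeral)
  finally show ?thesis .
qed

lemma PP_omega_upper:
  assumes g: "\<mu> \<le> L_gt c"
  shows "PP c \<mu> / omega_t c \<mu> \<le> 792 * A * q ^ 5"
proof -
  have "PP c \<mu> / omega_t c \<mu> \<le> 198 * A\<^sup>2 * q ^ 4 / (\<mu> / 4)"
    using PP_upper[OF g] PP_pos omega_lower[OF g] mu0 q_pos by (intro frac_le) auto
  also have "\<dots> = 792 * A * q ^ 5" by (simp add: q_def eval_nat_numeral)
  finally show ?thesis .
qed

lemma C_mu_upper: "8 * (C_gxt c)\<^sup>2 / \<mu> \<le> 8 * A * q"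
proof -
  have "8 * (C_gxt c)\<^sup>2 / \<mu> \<le> 8 * A\<^sup>2 / \<mu>"
    using c_pos c_le_A mu0 by (intro divide_right_mono mult_left_mono power_mono) auto
  then show ?thesis by (simp add: q_def power2_eq_square)
qed

text \<open>The second entry of \<open>u2\<close> bounds the cube of \<open>u\<close> by \<open>(1 - \<rho>)\<^sup>2 / (64 * phi)\<close>, which cancels the prefactor
  of \<open>d4_hat\<close>.\<close>

lemma d4_upper:
  assumes n: "noise_levels n" and st: "0 < tau st" "c_gamma st = 1" and r: "\<rho> < 1"
  shows "d4_hat c \<mu> n st \<rho> / tau st \<le> 1" "0 < d4_hat c \<mu> n st \<rho> / tau st"
proof -
  let ?u = "uu c \<mu> n st \<rho>"
  note u = uu_props[OF n st(1) r]
  have "?u ^ 3 \<le> ((1 - \<rho>) powr (2/3) / (4 * phi c \<mu> powr (1/3))) ^ 3"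
    using u by (intro power_mono) auto
  also have "\<dots> = (1 - \<rho>)\<^sup>2 / (64 * phi c \<mu>)"
  proof -
    have "((1 - \<rho>) powr (2/3)) ^ 3 = (1 - \<rho>)\<^sup>2" "(phi c \<mu> powr (1/3)) ^ 3 = phi c \<mu>"
      using r phi_pos by (simp_all add: powr_power powr_numeral)
    then show ?thesis by (simp add: power_divide power_mult_distrib)
  qed
  finally have u3: "?u ^ 3 \<le> (1 - \<rho>)\<^sup>2 / (64 * phi c \<mu>)" .
  have e: "d4_hat c \<mu> n st \<rho> / tau st = 24 * phi c \<mu> / (1 - \<rho>)\<^sup>2 * ?u ^ 3"
    using st by (simp add: d4_hat_def)
  also have "\<dots> \<le> 24 * phi c \<mu> / (1 - \<rho>)\<^sup>2 * ((1 - \<rho>)\<^sup>2 / (64 * phi c \<mu>))"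
    using u3 phi_pos by (intro mult_left_mono) auto
  also have "\<dots> \<le> 1" using phi_pos r by simp
  finally show "d4_hat c \<mu> n st \<rho> / tau st \<le> 1" .
  show "0 < d4_hat c \<mu> n st \<rho> / tau st" unfolding e using phi_pos r u(1) by simp
qed

text \<open>Here the first entry of \<open>u2\<close> is used. The result is of order \<open>q ^ 7\<close>, two powers more than the other weights, which is why the
  initial consensus error is measured with an extra \<open>\<kappa>\<^sup>2\<close>.\<close>

lemma d5_upper:
  assumes g: "\<mu> \<le> L_gt c" and n: "noise_levels n" and st: "tau st = 1 / (300 * A * q ^ 4)" and r: "\<rho> < 1"
  shows "d5_hat c \<mu> n st \<rho> / tau st \<le> 5700 * A\<^sup>2 * q ^ 7" "0 < d5_hat c \<mu> n st \<rho> / tau st"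
proof -
  let ?u = "uu c \<mu> n st \<rho>"
  have t: "0 < tau st" using st A_pos q_pos by simp
  note u = uu_props[OF n t r]
  have s: "sqrt (phi c \<mu>) \<le> 114 * A * q ^ 3"
  proof (rule real_le_lsqrt)
    have "12870 * A\<^sup>2 * q ^ 6 \<le> 12996 * A\<^sup>2 * q ^ 6" by (intro mult_right_mono) auto
    also have "\<dots> = (114 * A * q ^ 3)\<^sup>2" by (simp add: power_mult_distrib power_mult[symmetric])
    finally show "phi c \<mu> \<le> (114 * A * q ^ 3)\<^sup>2" using phi_upper[OF g] by linarith
  qed (use A_pos q_pos in auto)
  have "d5_hat c \<mu> n st \<rho> = 2 * phi c \<mu> / (1 - \<rho>) * ?u" by (simp add: d5_hat_def)
  also have "\<dots> \<le> 2 * phi c \<mu> / (1 - \<rho>) * ((1 - \<rho>) / (12 * sqrt (phi c \<mu>)))"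
    using u(2) phi_pos r by (intro mult_left_mono) (auto simp: powr_half_sqrt)
  also have "\<dots> = sqrt (phi c \<mu>) / 6"
  proof -
    have "2 * (w * w) / b * (b / (12 * w)) = w / 6" if "0 < w" "0 < b" for w b :: real
      using that by simp
    from this[of "sqrt (phi c \<mu>)" "1 - \<rho>"] show ?thesis
      using phi_pos r real_sqrt_mult_self[of "phi c \<mu>"] by simp
  qed
  also have "\<dots> \<le> 19 * A * q ^ 3" using s by simp
  finally have "d5_hat c \<mu> n st \<rho> / tau st \<le> 19 * A * q ^ 3 / tau st" using t by (simp add: divide_right_mono)
  also have "\<dots> = 5700 * A\<^sup>2 * q ^ 7" using A_pos q_pos by (simp add: st eval_nat_numeral)
  finally show "d5_hat c \<mu> n st \<rho> / tau st \<le> 5700 * A\<^sup>2 * q ^ 7" .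
  show "0 < d5_hat c \<mu> n st \<rho> / tau st" using phi_pos r u(1) t by (simp add: d5_hat_def)
qed

lemma V0_hat_eq:
  fixes P :: "('x::euclidean_space, 'y::euclidean_space, 's) bilevel" and x0 z0 :: "nat \<Rightarrow> 'x" and \<theta>0 v0 :: "nat \<Rightarrow> 'y"
  assumes st: "0 < tau st" "c_gamma st = 1" "c_lambda st = 1" "c_beta st = 1" and m: "nodes P = m"
  defines "xi \<equiv> node_avg m x0"
  shows "V0_hat P c \<mu> n st \<rho> x0 \<theta>0 v0 z0 = Phi P xi / tau st
    + 8 * (C_gxt c)\<^sup>2 / \<mu> * node_avg m (\<lambda>i. (norm (v0 i - v_star P i xi))\<^sup>2)
    + PP c \<mu> / omega_t c \<mu> * node_avg m (\<lambda>i. (norm (\<theta>0 i - theta_star P i xi))\<^sup>2)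
    + 1 / 2 * (norm (grad (Phi P) xi - node_avg m z0))\<^sup>2
    + d4_hat c \<mu> n st \<rho> / tau st * node_avg m (\<lambda>i. (norm (grad (Phi_i P i) xi - z0 i))\<^sup>2)
    + d5_hat c \<mu> n st \<rho> / tau st * node_avg m (\<lambda>i. (norm (x0 i - xi))\<^sup>2)"
proof -
  have avg: "node_avg m h = (\<Sum>i=1..m. h i) / real m" for h :: "nat \<Rightarrow> real"
    by (simp add: node_avg_def)
  show ?thesis
    using st unfolding V0_hat_def Let_def m xi_def[symmetric] d0_def d1_def d2_def d3_def
    by (simp add: avg)
qed

text \<open>The numerical factor collects the bounds of the six weights of \<open>V0_hat\<close> in \<open>V0_hat_upper\<close>.\<close>

definition "V0_const B = 6802 * A\<^sup>2 * D\<^sup>2 * B"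

text \<open>The error of \<open>\<theta>\<close> has a weight of order \<open>q ^ 5\<close> and an initial size of order one. The other terms are of no
  higher order: their weights are smaller, or, for consensus, the initial size makes up for two powers.\<close>

lemma V0_hat_upper:
  fixes P :: "('x::euclidean_space, 'y::euclidean_space, 's) bilevel" and x0 z0 :: "nat \<Rightarrow> 'x" and \<theta>0 v0 :: "nat \<Rightarrow> 'y"
  assumes g: "\<mu> \<le> L_gt c" and n: "noise_levels n" and r: "\<rho> < 1" and B: "0 < B"
    and st: "tau st = 1 / (300 * A * q ^ 4)" "c_gamma st = 1" "c_lambda st = 1" "c_beta st = 1"
    and m: "nodes P = m" "1 \<le> m" and init: "init_bound P (kappa c \<mu>) B x0 \<theta>0 v0 z0"
    and gavg: "grad (Phi P) (node_avg m x0) = node_avg m (\<lambda>i. grad (Phi_i P i) (node_avg m x0))"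
  shows "V0_hat P c \<mu> n st \<rho> x0 \<theta>0 v0 z0 \<le> V0_const B * q ^ 5"
proof -
  let ?xi = "node_avg m x0" and ?k = "kappa c \<mu>"
  have t: "0 < tau st" using st A_pos q_pos by simp
  have q1: "1 \<le> q" by (rule q_ge1[OF g])
  note k = kappa_bounds
  have I: "Phi P ?xi \<le> B" "node_avg m (\<lambda>i. (norm (\<theta>0 i - theta_star P i ?xi))\<^sup>2) \<le> B"
    "node_avg m (\<lambda>i. (norm (v0 i - v_star P i ?xi))\<^sup>2) \<le> B * ?k\<^sup>2"
    "node_avg m (\<lambda>i. (norm (grad (Phi_i P i) ?xi - z0 i))\<^sup>2) \<le> B * ?k\<^sup>2"
    "?k\<^sup>2 * node_avg m (\<lambda>i. (norm (x0 i - ?xi))\<^sup>2) \<le> B"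
    using init unfolding init_bound_def Let_def m by auto
  have kq: "B * ?k\<^sup>2 \<le> B * q\<^sup>2" using k B by (intro mult_left_mono power_mono) auto
  have qp: "q ^ i \<le> q ^ 5" if "i \<le> 5" for i using q1 that by (rule power_increasing[rotated])
  have AB: "0 \<le> A * B" "0 \<le> A\<^sup>2 * B" using A_pos B by auto
  have AA: "A \<le> A\<^sup>2 * D\<^sup>2" "1 \<le> A\<^sup>2 * D\<^sup>2"
  proof -
    have "1 \<le> D\<^sup>2" using D_ge1 by (simp add: one_le_power)
    moreover have "A \<le> A\<^sup>2" "1 \<le> A\<^sup>2" using c_le_A(8) using one_le_power[OF c_le_A(8), of 2] by (auto simp: power2_eq_square)
    moreover have "A\<^sup>2 * 1 \<le> A\<^sup>2 * D\<^sup>2" by (rule mult_left_mono) (use calculation in auto)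
    ultimately show "A \<le> A\<^sup>2 * D\<^sup>2" "1 \<le> A\<^sup>2 * D\<^sup>2" by linarith+
  qed
  define W where "W = B * q ^ 5"
  have W0: "0 \<le> W" using B q_pos by (simp add: W_def)
  have T0: "Phi P ?xi / tau st \<le> 300 * A * W"
  proof -
    have "Phi P ?xi / tau st \<le> B / tau st" using I(1) t by (simp add: divide_right_mono)
    also have "\<dots> = 300 * A * (B * q ^ 4)" by (simp add: st)
    also have "\<dots> \<le> 300 * A * W" unfolding W_def using qp[of 4] A_pos B by (intro mult_left_mono) auto
    finally show ?thesis .
  qed
  have T1: "8 * (C_gxt c)\<^sup>2 / \<mu> * node_avg m (\<lambda>i. (norm (v0 i - v_star P i ?xi))\<^sup>2) \<le> 8 * A * W"
  proof -
    have "8 * (C_gxt c)\<^sup>2 / \<mu> * node_avg m (\<lambda>i. (norm (v0 i - v_star P i ?xi))\<^sup>2) \<le> 8 * A * q * (B * q\<^sup>2)"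
      using C_mu_upper I(3) kq A_pos q_pos by (intro mult_mono node_avg_nonneg) auto
    also have "\<dots> = 8 * A * (B * q ^ 3)" by (simp add: eval_nat_numeral)
    also have "\<dots> \<le> 8 * A * W" unfolding W_def using qp[of 3] A_pos B by (intro mult_left_mono) auto
    finally show ?thesis .
  qed
  have T2: "PP c \<mu> / omega_t c \<mu> * node_avg m (\<lambda>i. (norm (\<theta>0 i - theta_star P i ?xi))\<^sup>2) \<le> 792 * A * W"
  proof -
    have "PP c \<mu> / omega_t c \<mu> * node_avg m (\<lambda>i. (norm (\<theta>0 i - theta_star P i ?xi))\<^sup>2) \<le> 792 * A * q ^ 5 * B"
      using PP_omega_upper[OF g] I(2) A_pos q_pos by (intro mult_mono node_avg_nonneg) auto
    then show ?thesis by (simp add: W_def mult_ac)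
  qed
  have BW: "B * ?k\<^sup>2 \<le> W"
    using kq mult_left_mono[OF qp[of 2], of B] B by (simp add: W_def)
  have T3: "1 / 2 * (norm (grad (Phi P) ?xi - node_avg m z0))\<^sup>2 \<le> W"
  proof -
    have "(norm (grad (Phi P) ?xi - node_avg m z0))\<^sup>2 \<le> node_avg m (\<lambda>i. (norm (grad (Phi_i P i) ?xi - z0 i))\<^sup>2)"
      unfolding gavg node_avg_diff[symmetric] by (rule norm_node_avg_sq_le[OF m(2)])
    then show ?thesis using I(4) BW W0 by linarith
  qed
  have T4: "d4_hat c \<mu> n st \<rho> / tau st * node_avg m (\<lambda>i. (norm (grad (Phi_i P i) ?xi - z0 i))\<^sup>2) \<le> W"
  proof -
    have "d4_hat c \<mu> n st \<rho> / tau st * node_avg m (\<lambda>i. (norm (grad (Phi_i P i) ?xi - z0 i))\<^sup>2) \<le> 1 * W"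
      using d4_upper[OF n t st(2) r] I(4) BW by (intro mult_mono node_avg_nonneg) auto
    then show ?thesis by simp
  qed
  have T5: "d5_hat c \<mu> n st \<rho> / tau st * node_avg m (\<lambda>i. (norm (x0 i - ?xi))\<^sup>2) \<le> 5700 * (A\<^sup>2 * D\<^sup>2) * W"
  proof -
    let ?N = "node_avg m (\<lambda>i. (norm (x0 i - ?xi))\<^sup>2)"
    have N0: "0 \<le> ?N" by (rule node_avg_nonneg) simp
    have "q\<^sup>2 * ?N \<le> (D * ?k)\<^sup>2 * ?N" using k(3) q_pos N0 by (intro mult_right_mono power_mono) auto
    also have "\<dots> = D\<^sup>2 * (?k\<^sup>2 * ?N)" by (simp add: power_mult_distrib)
    also have "\<dots> \<le> D\<^sup>2 * B" using I(5) by (intro mult_left_mono) auto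
    finally have qN: "q\<^sup>2 * ?N \<le> D\<^sup>2 * B" .
    have "d5_hat c \<mu> n st \<rho> / tau st * ?N \<le> 5700 * A\<^sup>2 * q ^ 7 * ?N"
      using d5_upper(1)[OF g n st(1) r] N0 by (rule mult_right_mono)
    also have "\<dots> = 5700 * A\<^sup>2 * q ^ 5 * (q\<^sup>2 * ?N)" by (simp add: eval_nat_numeral)
    also have "\<dots> \<le> 5700 * A\<^sup>2 * q ^ 5 * (D\<^sup>2 * B)" using qN q_pos by (intro mult_left_mono) auto
    finally show ?thesis by (simp add: W_def mult_ac)
  qed
  have "V0_hat P c \<mu> n st \<rho> x0 \<theta>0 v0 z0 \<le> 300 * A * W + 8 * A * W + 792 * A * W + W + W + 5700 * (A\<^sup>2 * D\<^sup>2) * W"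
    unfolding V0_hat_eq[OF t st(2-4) m(1)] using T0 T1 T2 T3 T4 T5 by linarith
  also have "\<dots> = (1100 * A + 2 * 1 + 5700 * (A\<^sup>2 * D\<^sup>2)) * W" by (simp add: algebra_simps)
  also have "\<dots> \<le> (6802 * (A\<^sup>2 * D\<^sup>2)) * W" using AA W0 by (intro mult_right_mono) linarith+
  finally show ?thesis by (simp add: V0_const_def W_def mult_ac)
qed

lemma sigma_c_upper:
  assumes n: "noise_levels n" and st: "0 < tau st" "c_gamma st = 1"
  shows "sigma_c c \<mu> n st \<le> 2 * D * (s_fx n + kappa c \<mu> * s_gxt n)" "0 < sigma_c c \<mu> n st"
    "(s_fx n + 2 * MM c \<mu> * s_gxt n)\<^sup>2 = 2 * (sigma_c c \<mu> n st)\<^sup>2"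
proof -
  have s: "0 \<le> s_fx n" "0 < s_gxt n" using n by (auto simp: noise_levels_def)
  let ?s = "s_fx n + 2 * MM c \<mu> * s_gxt n"
  have sp: "0 < ?s" using s MM_bounds(3) by (intro add_nonneg_pos) auto
  have e: "sigma_c c \<mu> n st = sqrt (1 / 2) * ?s"
    using st by (simp add: sigma_c_def d3_def)
  show "0 < sigma_c c \<mu> n st" unfolding e using sp by simp
  show "?s\<^sup>2 = 2 * (sigma_c c \<mu> n st)\<^sup>2" unfolding e by (simp add: power_mult_distrib)
  have "sigma_c c \<mu> n st \<le> 1 * ?s" unfolding e using sp by (intro mult_right_mono) auto
  also have "\<dots> \<le> 2 * D * s_fx n + 2 * (D * kappa c \<mu>) * s_gxt n"
  proof -
    have "1 * s_fx n \<le> 2 * D * s_fx n" using D_ge1 s by (intro mult_right_mono) auto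
    moreover have "2 * MM c \<mu> * s_gxt n \<le> 2 * (D * kappa c \<mu>) * s_gxt n"
      using MM_bounds(2) kappa_bounds(3) s by (intro mult_right_mono) auto
    ultimately show ?thesis by simp
  qed
  finally show "sigma_c c \<mu> n st \<le> 2 * D * (s_fx n + kappa c \<mu> * s_gxt n)" by (simp add: algebra_simps)
qed

text \<open>The condition on \<open>c_beta\<close> holds for \<open>c_beta = 1\<close> when \<open>\<mu> \<le> L_gt c\<close> by \<open>PP_omega_upper\<close>, and can be arranged by a suitable
  \<open>c_beta\<close> for any \<open>\<mu>\<close>.\<close>

lemma sigma_p_upper:
  assumes n: "noise_levels n" and st: "0 < tau st" "c_lambda st = 1" "0 < c_beta st"
    and cb: "PP c \<mu> / omega_t c \<mu> * c_beta st \<le> 792 * A * q ^ 5"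
  shows "sigma_p c \<mu> n st \<le> 30 * sqrt A * D ^ 3 * (kappa c \<mu> powr (1/2) * s_ft n + kappa c \<mu> powr (3/2) * s_gtt n
      + kappa c \<mu> powr (5/2) * s_gt n)"
proof -
  let ?k = "kappa c \<mu>"
  note k = kappa_bounds
  have s: "0 \<le> s_ft n" "0 \<le> s_gtt n" "0 \<le> s_gt n" using n by (auto simp: noise_levels_def)
  have DD: "sqrt D \<le> D ^ 3" "D * sqrt D \<le> D ^ 3" "D\<^sup>2 * sqrt D \<le> D ^ 3"
  proof -
    have sD: "sqrt D \<le> D" using D_ge1 by (intro real_le_lsqrt) (auto simp: power2_eq_square)
    have "D * 1 \<le> D * D" "1 * D \<le> D\<^sup>2 * D" using D_ge1 by (auto intro!: mult_mono simp: one_le_power)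
    then have "D \<le> D\<^sup>2" "D \<le> D ^ 3" by (auto simp: power2_eq_square power3_eq_cube)
    moreover have "D * sqrt D \<le> D * D" "D\<^sup>2 * sqrt D \<le> D\<^sup>2 * D" using sD D_ge1 by (auto intro!: mult_left_mono)
    moreover have "D\<^sup>2 \<le> D ^ 3" using D_ge1 by (intro power_increasing) auto
    ultimately show "sqrt D \<le> D ^ 3" "D * sqrt D \<le> D ^ 3" "D\<^sup>2 * sqrt D \<le> D ^ 3"
      using sD by (auto simp: power2_eq_square power3_eq_cube)
  qed
  have kp: "?k powr (3/2) = ?k * sqrt ?k" "?k powr (5/2) = ?k\<^sup>2 * sqrt ?k" "?k powr (1/2) = sqrt ?k"
    using k(4) powr_add[of ?k 1 "1/2"] powr_add[of ?k 2 "1/2"] by (simp_all add: powr_half_sqrt)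
  have sq: "sqrt q \<le> sqrt D * sqrt ?k" using k(3) by (simp add: real_sqrt_mult[symmetric])
  have r1: "sqrt (8 * (C_gxt c)\<^sup>2 / \<mu>) \<le> 3 * sqrt A * (sqrt D * sqrt ?k)"
  proof -
    have "sqrt (8 * (C_gxt c)\<^sup>2 / \<mu>) \<le> sqrt (9 * (A * q))" 
    proof (rule real_sqrt_le_mono)
      have "8 * A * q \<le> 9 * (A * q)" using A_pos q_pos by simp
      then show "8 * (C_gxt c)\<^sup>2 / \<mu> \<le> 9 * (A * q)" using C_mu_upper by linarith
    qed
    also have "\<dots> = 3 * sqrt A * sqrt q" by (simp add: real_sqrt_mult)
    also have "\<dots> \<le> 3 * sqrt A * (sqrt D * sqrt ?k)" using sq A_pos by (intro mult_left_mono) auto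
    finally show ?thesis .
  qed
  have r2: "sqrt (PP c \<mu> / omega_t c \<mu> * c_beta st) \<le> 30 * sqrt A * (D\<^sup>2 * sqrt D * (?k\<^sup>2 * sqrt ?k))"
  proof -
    have "sqrt (PP c \<mu> / omega_t c \<mu> * c_beta st) \<le> sqrt (30\<^sup>2 * (A * (q\<^sup>2)\<^sup>2 * q))"
    proof (rule real_sqrt_le_mono)
      have "792 * A * q ^ 5 \<le> 900 * A * q ^ 5" using A_pos q_pos by (intro mult_right_mono) auto
      also have "\<dots> = 30\<^sup>2 * (A * (q\<^sup>2)\<^sup>2 * q)" by (simp add: eval_nat_numeral)
      finally show "PP c \<mu> / omega_t c \<mu> * c_beta st \<le> 30\<^sup>2 * (A * (q\<^sup>2)\<^sup>2 * q)" using cb by linarith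
    qed
    also have "\<dots> = 30 * sqrt A * (q\<^sup>2 * sqrt q)"
      by (simp only: real_sqrt_mult real_sqrt_abs abs_power2 abs_numeral mult.assoc)
    also have "\<dots> \<le> 30 * sqrt A * ((D * ?k)\<^sup>2 * (sqrt D * sqrt ?k))"
      using sq k(3) q_pos A_pos by (intro mult_left_mono mult_mono power_mono) auto
    finally show ?thesis by (simp add: power_mult_distrib mult_ac)
  qed
  have e1: "sqrt (d1 c \<mu> st / tau st) = sqrt (8 * (C_gxt c)\<^sup>2 / \<mu>)" using st by (simp add: d1_def)
  have e2: "sqrt (d2 c \<mu> st / tau st) * c_beta st = sqrt (PP c \<mu> / omega_t c \<mu> * c_beta st)"
  proof -
    have "sqrt (d2 c \<mu> st / tau st) * c_beta st = sqrt (PP c \<mu> / omega_t c \<mu> / c_beta st) * sqrt ((c_beta st)\<^sup>2)"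
      using st by (simp add: d2_def)
    also have "\<dots> = sqrt (PP c \<mu> / omega_t c \<mu> / c_beta st * (c_beta st)\<^sup>2)" by (simp only: real_sqrt_mult)
    also have "PP c \<mu> / omega_t c \<mu> / c_beta st * (c_beta st)\<^sup>2 = PP c \<mu> / omega_t c \<mu> * c_beta st"
      using st by (simp add: power2_eq_square)
    finally show ?thesis .
  qed
  have "sigma_p c \<mu> n st = sqrt (8 * (C_gxt c)\<^sup>2 / \<mu>) * s_ft n + sqrt (8 * (C_gxt c)\<^sup>2 / \<mu>) * (2 * MM c \<mu>) * s_gtt n
      + sqrt (PP c \<mu> / omega_t c \<mu> * c_beta st) * s_gt n"
    unfolding sigma_p_def e1 e2[symmetric] using st by (simp add: algebra_simps)
  also have "\<dots> \<le> 30 * sqrt A * D ^ 3 * sqrt ?k * s_ft n + 30 * sqrt A * D ^ 3 * (?k * sqrt ?k) * s_gtt n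
      + 30 * sqrt A * D ^ 3 * (?k\<^sup>2 * sqrt ?k) * s_gt n"
  proof (intro add_mono mult_right_mono s)
    have "3 * sqrt A * (sqrt D * sqrt ?k) \<le> 30 * sqrt A * (D ^ 3 * sqrt ?k)"
      using DD A_pos k D_ge1 by (intro mult_mono) auto
    from order_trans[OF r1 this] show "sqrt (8 * (C_gxt c)\<^sup>2 / \<mu>) \<le> 30 * sqrt A * D ^ 3 * sqrt ?k"
      by (simp only: mult_ac)
    have "sqrt (8 * (C_gxt c)\<^sup>2 / \<mu>) * (2 * MM c \<mu>) \<le> 3 * sqrt A * (sqrt D * sqrt ?k) * (2 * (D * ?k))"
      using r1 MM_bounds k D_ge1 A_pos by (intro mult_mono) auto
    also have "\<dots> = 6 * sqrt A * ((D * sqrt D) * (?k * sqrt ?k))" by simp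
    also have "\<dots> \<le> 30 * sqrt A * (D ^ 3 * (?k * sqrt ?k))"
      using DD A_pos k D_ge1 by (intro mult_mono) auto
    finally show "sqrt (8 * (C_gxt c)\<^sup>2 / \<mu>) * (2 * MM c \<mu>) \<le> 30 * sqrt A * D ^ 3 * (?k * sqrt ?k)" by simp
    have "30 * sqrt A * (D\<^sup>2 * sqrt D * (?k\<^sup>2 * sqrt ?k)) \<le> 30 * sqrt A * (D ^ 3 * (?k\<^sup>2 * sqrt ?k))"
      using DD A_pos k D_ge1 by (intro mult_left_mono mult_right_mono) auto
    from order_trans[OF r2 this] show "sqrt (PP c \<mu> / omega_t c \<mu> * c_beta st) \<le> 30 * sqrt A * D ^ 3 * (?k\<^sup>2 * sqrt ?k)"
      by (simp only: mult_ac)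
  qed
  finally show ?thesis unfolding kp by (simp add: algebra_simps)
qed

end

section \<open>Balancing the step size\<close>

text \<open>With \<open>a = s\<close> the first two terms are equal, with \<open>a = t\<close> the first and the third. At the minimum, the
  first is at most the sum of its values at \<open>s\<close> and \<open>t\<close>, and the others only decrease.\<close>

lemma step_size_balance:
  fixes a0 a1 a2 k :: real
  assumes pos: "0 < a0" "0 < a1" "0 < a2" "0 < k"
  defines "s \<equiv> (a0 / (a1 * k)) powr (1/2)" and "t \<equiv> (a0 / (a2 * k)) powr (1/3)"
  defines "a \<equiv> min s t"
  shows "0 < a" "a0 / (a * k) + a1 * a + a2 * a\<^sup>2 \<le> 2 * (a1 powr (1/2) * (a0 / k) powr (1/2)) + 2 * (a2 powr (1/3) * (a0 / k) powr (2/3))"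
proof -
  have st: "0 < s" "0 < t" using pos by (simp_all add: s_def t_def)
  then show a: "0 < a" by (simp add: a_def)
  have s2: "s\<^sup>2 = a0 / (a1 * k)" using pos by (simp add: s_def powr_power)
  have t3: "t ^ 3 = a0 / (a2 * k)" using pos by (simp add: t_def powr_power)
  have s1: "a0 / (s * k) = a1 * s"
  proof -
    have "a0 = a1 * k * s\<^sup>2" using s2 pos by (simp add: field_simps)
    then show ?thesis using st pos by (simp add: divide_eq_eq power2_eq_square mult_ac)
  qed
  have t1: "a0 / (t * k) = a2 * t\<^sup>2"
  proof -
    have "a0 = a2 * k * t ^ 3" using t3 pos by (simp add: field_simps)
    then show ?thesis using st pos by (simp add: divide_eq_eq power2_eq_square power3_eq_cube mult_ac)
  qed
  have "a0 / (a * k) \<le> a0 / (s * k) + a0 / (t * k)"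
    using st pos(1,4) by (auto simp: a_def min_def)
  moreover have "a1 * a \<le> a1 * s" using pos(2) by (simp add: a_def)
  moreover have "a2 * a\<^sup>2 \<le> a2 * t\<^sup>2"
    using pos(3) a by (intro mult_left_mono power_mono) (auto simp: a_def)
  ultimately have "a0 / (a * k) + a1 * a + a2 * a\<^sup>2 \<le> 2 * (a1 * s) + 2 * (a2 * t\<^sup>2)"
    using s1 t1 by linarith
  also have "a1 * s = a1 powr (1/2) * (a0 / k) powr (1/2)"
  proof -
    have e: "a0 / (a1 * k) = (a0 / k) / a1" by simp
    have se: "s = (a0 / k) powr (1/2) / a1 powr (1/2)"
      unfolding s_def e by (rule powr_divide)
    have "a1 powr (1/2) * a1 powr (1/2) = a1" using pos by (simp add: powr_add[symmetric])
    then have "a1 * s = (a1 powr (1/2) * a1 powr (1/2)) * s" by simp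
    then show ?thesis unfolding se using pos by simp
  qed
  also have "a2 * t\<^sup>2 = a2 powr (1/3) * (a0 / k) powr (2/3)"
  proof -
    have e: "a0 / (a2 * k) = (a0 / k) / a2" by simp
    have "t\<^sup>2 = (a0 / k / a2) powr (2/3)" unfolding t_def e using pos by (simp add: powr_power)
    also have "\<dots> = (a0 / k) powr (2/3) / a2 powr (2/3)"
      by (rule powr_divide)
    finally have te: "t\<^sup>2 = (a0 / k) powr (2/3) / a2 powr (2/3)" .
    have "a2 powr (1/3) * a2 powr (2/3) = a2" using pos by (simp add: powr_add[symmetric])
    then have "a2 * t\<^sup>2 = (a2 powr (1/3) * a2 powr (2/3)) * t\<^sup>2" by simp
    then show ?thesis unfolding te using pos by simp
  qed
  finally show "a0 / (a * k) + a1 * a + a2 * a\<^sup>2 \<le> 2 * (a1 powr (1/2) * (a0 / k) powr (1/2)) + 2 * (a2 powr (1/3) * (a0 / k) powr (2/3))" .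
qed

text \<open>The initial value of order \<open>q ^ 5\<close> yields \<open>\<kappa> powr (5/2)\<close> under the square root.\<close>

lemma sqrt_term_scale:
  fixes X \<kappa> D q k K \<sigma> :: real
  assumes X: "0 < X" and k: "0 < \<kappa>" "0 < q" "q \<le> D * \<kappa>" "0 < D" and K: "0 < K" "K \<le> k"
    and a0: "0 < a0" "a0 \<le> X * q ^ 5" and s: "0 < \<sigma>"
  shows "(8 * \<sigma>\<^sup>2) powr (1/2) * (a0 / k) powr (1/2) \<le> 3 * X powr (1/2) * D powr (5/2) * (1 / sqrt K * \<kappa> powr (5/2) * \<sigma>)"
proof -
  have "(8 * \<sigma>\<^sup>2) powr (1/2) \<le> (9 * \<sigma>\<^sup>2) powr (1/2)" using s by (intro powr_mono2) auto
  also have "\<dots> = 3 * \<sigma>" using s by (simp add: powr_half_sqrt real_sqrt_mult)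
  finally have 1: "(8 * \<sigma>\<^sup>2) powr (1/2) \<le> 3 * \<sigma>" .
  have "a0 / k \<le> X * q ^ 5 / K" using a0 K X by (intro frac_le) auto
  also have "\<dots> \<le> X * (D * \<kappa>) ^ 5 / K" using k K X by (intro divide_right_mono mult_left_mono power_mono) auto
  finally have "(a0 / k) powr (1/2) \<le> (X * (D * \<kappa>) ^ 5 / K) powr (1/2)"
    using a0 K by (intro powr_mono2) auto
  also have "\<dots> = X powr (1/2) * (D * \<kappa>) powr (5/2) / sqrt K"
  proof -
    have "((D * \<kappa>) ^ 5) powr (1/2) = (D * \<kappa>) powr (5/2)"
      using k powr_realpow[of "D * \<kappa>" 5] by (simp add: powr_powr del: powr_numeral flip: powr_realpow)
    then show ?thesis using X K k by (simp add: powr_mult powr_divide powr_half_sqrt)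
  qed
  finally have 2: "(a0 / k) powr (1/2) \<le> X powr (1/2) * (D powr (5/2) * \<kappa> powr (5/2)) / sqrt K"
    using k by (simp add: powr_mult)
  have "(8 * \<sigma>\<^sup>2) powr (1/2) * (a0 / k) powr (1/2) \<le> 3 * \<sigma> * (X powr (1/2) * (D powr (5/2) * \<kappa> powr (5/2)) / sqrt K)"
    using 1 2 s by (intro mult_mono) auto
  then show ?thesis by (simp add: field_simps)
qed

text \<open>The exponents of \<open>q\<close> add up to \<open>6 / 3 + 5 * 2 / 3 = 16 / 3\<close>.\<close>

lemma cube_root_term_scale:
  fixes X Y \<kappa> D q k K b m \<rho> :: real
  assumes X: "0 < X" and Y: "0 < Y" and k: "0 < \<kappa>" "0 < q" "q \<le> D * \<kappa>" "0 < D" and K: "0 < K" "K \<le> k"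
    and a0: "0 < a0" "a0 \<le> X * q ^ 5" and b: "0 < b" and m: "0 < m" and r: "\<rho> < 1"
    and a2: "0 < a2" "a2 \<le> Y * q ^ 6 * (b / (m * (1 - \<rho>)\<^sup>2))"
  shows "a2 powr (1/3) * (a0 / k) powr (2/3) \<le> Y powr (1/3) * X powr (2/3) * D powr (16/3) *
     (\<kappa> powr (16/3) * (sqrt b / sqrt m) powr (2/3) / ((1 - \<rho>) powr (2/3) * K powr (2/3)))"
proof -
  let ?Q = "D * \<kappa>"
  have Q: "0 < ?Q" using k by simp
  have rp: "(?Q ^ 6) powr (1/3) = ?Q powr 2" "(?Q ^ 5) powr (2/3) = ?Q powr (10/3)"
    using powr_powr[of ?Q 6 "1/3"] powr_powr[of ?Q 5 "2/3"] Q by simp_all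
  have r2: "((1 - \<rho>)\<^sup>2) powr (1/3) = (1 - \<rho>) powr (2/3)"
    using powr_powr[of "1 - \<rho>" 2 "1/3"] r by simp
  have bm: "(b / m) powr (1/3) = (sqrt b / sqrt m) powr (2/3)"
  proof -
    have "(sqrt b / sqrt m) powr (2/3) = ((b / m) powr (1/2)) powr (2/3)"
      using b m by (simp add: powr_half_sqrt real_sqrt_divide)
    then show ?thesis by (simp add: powr_powr)
  qed
  have "a2 \<le> Y * q ^ 6 * (b / (m * (1 - \<rho>)\<^sup>2))" by (rule a2)
  also have "\<dots> \<le> Y * ?Q ^ 6 * (b / (m * (1 - \<rho>)\<^sup>2))"
    using k Y b m by (intro mult_right_mono mult_left_mono power_mono) auto
  also have "\<dots> = Y * ?Q ^ 6 * ((b / m) / (1 - \<rho>)\<^sup>2)" by simp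
  finally have "a2 powr (1/3) \<le> (Y * ?Q ^ 6 * ((b / m) / (1 - \<rho>)\<^sup>2)) powr (1/3)"
    using a2 by (intro powr_mono2) auto
  also have "\<dots> = Y powr (1/3) * ?Q powr 2 * ((sqrt b / sqrt m) powr (2/3) / (1 - \<rho>) powr (2/3))"
  proof -
    have "(Y * ?Q ^ 6 * ((b / m) / (1 - \<rho>)\<^sup>2)) powr (1/3)
        = Y powr (1/3) * (?Q ^ 6) powr (1/3) * ((b / m) powr (1/3) / ((1 - \<rho>)\<^sup>2) powr (1/3))"
      using Y Q b m r by (simp only: powr_mult powr_divide)
    then show ?thesis unfolding rp r2 bm .
  qed
  finally have 1: "a2 powr (1/3) \<le> Y powr (1/3) * ?Q powr 2 * ((sqrt b / sqrt m) powr (2/3) / (1 - \<rho>) powr (2/3))" .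
  have "a0 / k \<le> X * q ^ 5 / K" using a0 K X by (intro frac_le) auto
  also have "\<dots> \<le> X * ?Q ^ 5 / K" using k K X by (intro divide_right_mono mult_left_mono power_mono) auto
  finally have "(a0 / k) powr (2/3) \<le> (X * ?Q ^ 5 / K) powr (2/3)"
    using a0 K by (intro powr_mono2) auto
  also have "\<dots> = X powr (2/3) * ?Q powr (10/3) / K powr (2/3)"
  proof -
    have "(X * ?Q ^ 5 / K) powr (2/3) = X powr (2/3) * (?Q ^ 5) powr (2/3) / K powr (2/3)"
      using X Q K by (simp only: powr_mult powr_divide)
    then show ?thesis unfolding rp .
  qed
  finally have 2: "(a0 / k) powr (2/3) \<le> X powr (2/3) * ?Q powr (10/3) / K powr (2/3)" .
  have "a2 powr (1/3) * (a0 / k) powr (2/3)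
     \<le> (Y powr (1/3) * ?Q powr 2 * ((sqrt b / sqrt m) powr (2/3) / (1 - \<rho>) powr (2/3))) * (X powr (2/3) * ?Q powr (10/3) / K powr (2/3))"
    using 1 2 by (intro mult_mono) auto
  also have "\<dots> = Y powr (1/3) * X powr (2/3) * (?Q powr 2 * ?Q powr (10/3)) * ((sqrt b / sqrt m) powr (2/3) / ((1 - \<rho>) powr (2/3) * K powr (2/3)))"
    by (simp only: times_divide_eq_left times_divide_eq_right divide_divide_eq_left mult_ac)
  also have "?Q powr 2 * ?Q powr (10/3) = D powr (16/3) * \<kappa> powr (16/3)"
    using k powr_add[of ?Q 2 "10/3"] powr_mult[of D \<kappa> "16/3"] by simp
  finally show ?thesis by (simp add: mult_ac)
qed

text \<open>If the initial Lyapunov value is zero, the rule gives \<open>\<alpha> = 0\<close> and only gossip is left, which does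
  not move the average.\<close>

lemma vanishing_step:
  assumes net: "network (nodes P) E W" and m: "nodes P = m" "1 \<le> m" and rho: "rho m W \<le> r" "0 \<le> r" "r < 1"
    and t: "0 < tau st" "tau st < 1" and w: "\<omega> \<in> space M"
    and run: "lopa_lg P E W M \<zeta> st 0 x0 \<theta>0 v0 z0 x \<theta> v y z"
  shows "node_avg m (\<lambda>i. x i k \<omega>) = node_avg m x0"
proof (induction k)
  case 0
  show ?case using run w unfolding lopa_lg_def m by (intro node_avg_cong) blast
next
  case (Suc k)
  have "x i (Suc k) \<omega> = (1 - tau st) *\<^sub>R x i k \<omega> + tau st *\<^sub>R ((\<Sum>j | (i, j) \<in> E. W i j *\<^sub>R x j k \<omega>) - 0 *\<^sub>R y i k \<omega>)"
    if "i \<in> {1..m}" for i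
  proof -
    note R = run[unfolded lopa_lg_def Let_def m, rule_format, OF that w]
    note Rk = R[THEN conjunct2, THEN conjunct2, THEN conjunct2, THEN conjunct2, THEN conjunct2, THEN spec[of _ k]]
    show ?thesis by (rule Rk[THEN conjunct2, THEN conjunct2, THEN conjunct1])
  qed
  from consensus_step(1)[OF net[unfolded m] m(2) rho t, of "\<lambda>i. x i (Suc k) \<omega>" "\<lambda>i. x i k \<omega>" 0 "\<lambda>i. y i k \<omega>", OF this]
  show ?case using Suc by simp
qed

section \<open>Comparison with the constants of the step-size rule\<close>

context lopa_run
begin

text \<open>Weight by weight: \<open>w1\<close> and \<open>w2\<close> exceed those of \<open>V0_hat\<close> by at most powers of \<open>D\<close>, and \<open>w4\<close>, \<open>w5\<close> are
  small for small \<open>\<alpha>\<close>. One numerical factor serves for all weights and for the two comparisons below.\<close>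

lemma lyap_0_le:
  assumes pos: "\<forall>x. 0 \<le> Phi P x" and w4: "w4 \<le> d4_hat c \<mu> n st r / tau st" and w5: "w5 \<le> d5_hat c \<mu> n st r / tau st"
  shows "lyap 0 \<le> 14 * (step_constants.D c Lc) ^ 6 * V0_hat P c \<mu> n st r x0 \<theta>0 v0 z0"
proof -
  interpret S: step_constants c Lc \<mu> by unfold_locales (use pos_c Lc mu0 in auto)
  have AS: "A = S.A" "q = S.q" by (simp_all add: A_def S.A_def q_def S.q_def)
  let ?xi = "node_avg m x0" and ?C = "14 * S.D ^ 6"
  let ?av = "node_avg m (\<lambda>i. (norm (v0 i - v_star P i ?xi))\<^sup>2)" and ?at = "node_avg m (\<lambda>i. (norm (\<theta>0 i - theta_star P i ?xi))\<^sup>2)"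
  let ?ac = "node_avg m (\<lambda>i. (norm (gP i ?xi - z0 i))\<^sup>2)" and ?ax = "node_avg m (\<lambda>i. (norm (x0 i - ?xi))\<^sup>2)"
  let ?G = "(norm (gPhi ?xi - node_avg m z0))\<^sup>2"
  have n0: "0 \<le> ?av" "0 \<le> ?at" "0 \<le> ?ac" "0 \<le> ?ax" by (rule node_avg_nonneg, simp)+
  have D2: "1 \<le> S.D ^ 6" "S.D\<^sup>2 \<le> S.D ^ 6" using S.D_ge1 by (auto simp: one_le_power intro: power_increasing)
  have C1: "1 \<le> ?C" using D2 by linarith
  have k1: "w1 \<le> ?C * (8 * (C_gxt c)\<^sup>2 / \<mu>)"
  proof -
    have "48 * A\<^sup>2 = 48 * (S.D\<^sup>2 * S.lo\<^sup>2)" by (simp add: AS S.A_D power_mult_distrib)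
    also have "\<dots> \<le> 112 * (S.D ^ 6 * (C_gxt c)\<^sup>2)"
      using D2 S.lo_le(7) S.lo_pos by (intro mult_mono power_mono) auto
    finally have "48 * A\<^sup>2 / \<mu> \<le> 112 * (S.D ^ 6 * (C_gxt c)\<^sup>2) / \<mu>" using mu0 by (simp add: divide_right_mono)
    then show ?thesis by (simp add: w1_def)
  qed
  have k2: "w2 \<le> ?C * (PP c \<mu> / omega_t c \<mu>)"
  proof -
    have "w2 = 3168 * (S.D ^ 6 * (S.lo ^ 6 / \<mu> ^ 5))"
      by (simp add: w2_def AS S.q_def S.A_D power_mult_distrib power_divide eval_nat_numeral mult_ac)
    also have "\<dots> \<le> 14 * S.D ^ 6 * (128 * S.lo ^ 6 / \<mu> ^ 4 / (\<mu> / 2))"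
    proof -
      have e: "14 * S.D ^ 6 * (128 * S.lo ^ 6 / \<mu> ^ 4 / (\<mu> / 2)) = 3584 * (S.D ^ 6 * (S.lo ^ 6 / \<mu> ^ 5))"
        by (simp add: eval_nat_numeral mult_ac)
      have p: "0 \<le> S.D ^ 6 * (S.lo ^ 6 / \<mu> ^ 5)" using S.D_ge1 S.lo_pos mu0 by simp
      show ?thesis unfolding e by (rule mult_right_mono[OF _ p]) simp
    qed
    also have "\<dots> \<le> ?C * (PP c \<mu> / omega_t c \<mu>)"
      using S.PP_lower S.omega_le S.omega_pos S.D_ge1 S.PP_pos by (intro mult_left_mono frac_le) auto
    finally show ?thesis .
  qed
  have up: "w * a \<le> ?C * (h * a)" if "w \<le> h" "0 \<le> h" "0 \<le> a" for w h a :: real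
  proof -
    have "w * a \<le> 1 * (h * a)" using that by (simp add: mult_right_mono)
    also have "\<dots> \<le> ?C * (h * a)" using C1 that by (intro mult_right_mono) auto
    finally show ?thesis .
  qed
  have T0: "Phi P ?xi / tau st \<le> ?C * (Phi P ?xi / tau st)"
    using C1 pos tau mult_right_mono[OF C1, of "Phi P ?xi / tau st"] by simp
  have T1: "w1 * ?av \<le> ?C * (8 * (C_gxt c)\<^sup>2 / \<mu> * ?av)"
    using mult_right_mono[OF k1 n0(1)] by (simp only: mult.assoc)
  have T2: "w2 * ?at \<le> ?C * (PP c \<mu> / omega_t c \<mu> * ?at)"
    using mult_right_mono[OF k2 n0(2)] by (simp only: mult.assoc)
  have T3: "?G \<le> ?C * (1 / 2 * ?G)"
  proof -
    have "2 * (1 / 2 * ?G) \<le> ?C * (1 / 2 * ?G)" using D2 by (intro mult_right_mono) auto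
    then show ?thesis by simp
  qed
  have T4: "w4 * ?ac \<le> ?C * (d4_hat c \<mu> n st r / tau st * ?ac)"
    by (rule up[OF w4 order_trans[OF weights_nonneg(4) w4] n0(3)])
  have T5: "w5 * ?ax \<le> ?C * (d5_hat c \<mu> n st r / tau st * ?ax)"
    by (rule up[OF w5 order_trans[OF weights_nonneg(5) w5] n0(4)])
  have V: "V0_hat P c \<mu> n st r x0 \<theta>0 v0 z0 = Phi P ?xi / tau st + 8 * (C_gxt c)\<^sup>2 / \<mu> * ?av + PP c \<mu> / omega_t c \<mu> * ?at
     + 1 / 2 * ?G + d4_hat c \<mu> n st r / tau st * ?ac + d5_hat c \<mu> n st r / tau st * ?ax"
    using S.V0_hat_eq[OF tau(1) steps1 m_def[symmetric]] by (simp only: gPhi_def gP_def)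
  show ?thesis unfolding lyap_0 V distrib_left using T0 T1 T2 T3 T4 T5 by (intro add_mono)
qed

lemma noise_floor_le:
  assumes n: "noise_levels n"
  shows "noise_floor \<le> 14 * (step_constants.D c Lc) ^ 6 * (sigma_LG_hat c \<mu> n st m)\<^sup>2"
proof -
  interpret S: step_constants c Lc \<mu> by unfold_locales (use pos_c Lc mu0 in auto)
  have AS: "A = S.A" "q = S.q" by (simp_all add: A_def S.A_def q_def S.q_def)
  let ?C = "14 * S.D ^ 6" and ?M = "MM c \<mu>"
  let ?d1 = "8 * (C_gxt c)\<^sup>2 / \<mu>" and ?d2 = "PP c \<mu> / omega_t c \<mu>"
  let ?sp = "sigma_p c \<mu> n st" and ?sc = "sigma_c c \<mu> n st"
  have s: "0 \<le> s_ft n" "0 \<le> s_gtt n" "0 \<le> s_gt n" "0 \<le> s_fx n" "0 < s_gxt n" using n by (auto simp: noise_levels_def)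
  have M0: "0 < ?M" by (rule S.MM_bounds(3))
  have D2: "1 \<le> S.D ^ 6" "S.D\<^sup>2 \<le> S.D ^ 6" using S.D_ge1 by (auto simp: one_le_power intro: power_increasing)
  have k1: "w1 \<le> ?C * ?d1"
  proof -
    have "48 * A\<^sup>2 = 48 * (S.D\<^sup>2 * S.lo\<^sup>2)" by (simp add: AS S.A_D power_mult_distrib)
    also have "\<dots> \<le> 112 * (S.D ^ 6 * (C_gxt c)\<^sup>2)"
      using D2 S.lo_le(7) S.lo_pos by (intro mult_mono power_mono) auto
    finally have "48 * A\<^sup>2 / \<mu> \<le> 112 * (S.D ^ 6 * (C_gxt c)\<^sup>2) / \<mu>" using mu0 by (simp add: divide_right_mono)
    then show ?thesis by (simp add: w1_def)
  qed
  have k2: "w2 \<le> ?C * ?d2"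
  proof -
    have "w2 = 3168 * (S.D ^ 6 * (S.lo ^ 6 / \<mu> ^ 5))"
      by (simp add: w2_def AS S.q_def S.A_D power_mult_distrib power_divide eval_nat_numeral mult_ac)
    also have "\<dots> \<le> 14 * S.D ^ 6 * (128 * S.lo ^ 6 / \<mu> ^ 4 / (\<mu> / 2))"
    proof -
      have e: "14 * S.D ^ 6 * (128 * S.lo ^ 6 / \<mu> ^ 4 / (\<mu> / 2)) = 3584 * (S.D ^ 6 * (S.lo ^ 6 / \<mu> ^ 5))"
        by (simp add: eval_nat_numeral mult_ac)
      have p: "0 \<le> S.D ^ 6 * (S.lo ^ 6 / \<mu> ^ 5)" using S.D_ge1 S.lo_pos mu0 by simp
      show ?thesis unfolding e by (rule mult_right_mono[OF _ p]) simp
    qed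
    also have "\<dots> \<le> ?C * ?d2"
      using S.PP_lower S.omega_le S.omega_pos S.D_ge1 S.PP_pos by (intro mult_left_mono frac_le) auto
    finally show ?thesis .
  qed
  have d0: "0 \<le> ?d1" "0 \<le> ?d2" using mu0 S.PP_pos S.omega_pos by auto
  have spe: "?sp = sqrt ?d1 * (s_ft n + 2 * ?M * s_gtt n) + sqrt ?d2 * s_gt n"
    using tau steps1 by (simp add: sigma_p_def d1_def d2_def)
  have sp0: "0 \<le> ?sp" unfolding spe using d0 s M0 by (intro add_nonneg_nonneg mult_nonneg_nonneg) auto
  have sc0: "0 < ?sc" by (rule S.sigma_c_upper(2)[OF n tau(1) steps1(1)])
  have spsq: "?d1 * (s_ft n + 2 * ?M * s_gtt n)\<^sup>2 + ?d2 * (s_gt n)\<^sup>2 \<le> ?sp\<^sup>2"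
  proof -
    have ab: "a\<^sup>2 + b\<^sup>2 \<le> (a + b)\<^sup>2" if "0 \<le> a" "0 \<le> b" for a b :: real
      using that by (simp add: power2_sum)
    have "(sqrt ?d1 * (s_ft n + 2 * ?M * s_gtt n))\<^sup>2 + (sqrt ?d2 * s_gt n)\<^sup>2 \<le> ?sp\<^sup>2"
      unfolding spe using d0 s M0 by (intro ab mult_nonneg_nonneg add_nonneg_nonneg) auto
    then show ?thesis using d0 by (simp only: power_mult_distrib real_sqrt_pow2)
  qed
  have ab2: "2 * a\<^sup>2 + 4 * l\<^sup>2 * b\<^sup>2 \<le> 2 * (a + 2 * l * b)\<^sup>2" if "0 \<le> a" "0 \<le> b" "0 \<le> l" for a b l :: real
    using that by (simp add: power2_sum power_mult_distrib)
  have N1: "w1 * (2 * (s_ft n)\<^sup>2 + 4 * ?M\<^sup>2 * (s_gtt n)\<^sup>2) \<le> ?C * ?d1 * (2 * (s_ft n + 2 * ?M * s_gtt n)\<^sup>2)"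
    using k1 ab2[of "s_ft n" "s_gtt n" ?M] s M0 order_trans[OF weights_nonneg(1) k1] by (intro mult_mono) auto
  have N2: "w2 * (s_gt n)\<^sup>2 \<le> ?C * ?d2 * (s_gt n)\<^sup>2" using k2 by (intro mult_right_mono) auto
  have N3: "2 / real m * (2 * (s_fx n)\<^sup>2 + 4 * ?M\<^sup>2 * (s_gxt n)\<^sup>2) \<le> 2 / real m * (2 * (2 * ?sc\<^sup>2))"
    using ab2[of "s_fx n" "s_gxt n" ?M] s M0 S.sigma_c_upper(3)[OF n tau(1) steps1(1)] by (intro mult_left_mono) auto
  have dbl: "t \<le> 2 * t" if "0 \<le> t" for t :: real using that by simp
  have Q: "?C * ?d2 * (s_gt n)\<^sup>2 \<le> 2 * (?C * ?d2 * (s_gt n)\<^sup>2)"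
    using d0(2) D2 by (intro dbl mult_nonneg_nonneg) auto
  have "noise_floor \<le> ?C * ?d1 * (2 * (s_ft n + 2 * ?M * s_gtt n)\<^sup>2) + 2 * (?C * ?d2 * (s_gt n)\<^sup>2) + 2 / real m * (2 * (2 * ?sc\<^sup>2))"
    unfolding noise_floor_def using N1 N2 N3 Q by linarith
  also have "\<dots> = 2 * ?C * (?d1 * (s_ft n + 2 * ?M * s_gtt n)\<^sup>2 + ?d2 * (s_gt n)\<^sup>2) + 8 * (?sc\<^sup>2 / real m)"
    by (simp add: algebra_simps)
  also have "\<dots> \<le> 2 * ?C * ?sp\<^sup>2 + 2 * ?C * (?sc\<^sup>2 / real m)"
    using spsq D2 by (intro add_mono mult_left_mono mult_right_mono) auto
  also have "\<dots> \<le> ?C * (2 * (?sp + 1 / sqrt (real m) * ?sc)\<^sup>2)"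
  proof -
    have "?sp\<^sup>2 + ?sc\<^sup>2 / real m \<le> (?sp + 1 / sqrt (real m) * ?sc)\<^sup>2"
      using sp0 sc0 by (simp add: power2_sum power_mult_distrib power_divide)
    then have "2 * ?C * (?sp\<^sup>2 + ?sc\<^sup>2 / real m) \<le> 2 * ?C * (?sp + 1 / sqrt (real m) * ?sc)\<^sup>2"
      using D2 by (intro mult_left_mono) auto
    then show ?thesis by (simp only: distrib_left mult_ac)
  qed
  also have "2 * (?sp + 1 / sqrt (real m) * ?sc)\<^sup>2 = (sigma_LG_hat c \<mu> n st m)\<^sup>2"
  proof -
    have "sigma_LG_hat c \<mu> n st m = sqrt 2 * (?sp + 1 / sqrt (real m) * ?sc)"
      by (simp add: sigma_LG_hat_def distrib_left)
    then show ?thesis by (simp add: power_mult_distrib)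
  qed
  finally show ?thesis .
qed

lemma het_term_le:
  "8 * R * het_bound / (real m * (1 - r)\<^sup>2) \<le> 14 * (step_constants.D c Lc) ^ 14 * (4 * vartheta c \<mu> st r / real m * b2 c \<mu> bf bg)"
proof -
  interpret S: step_constants c Lc \<mu> by unfold_locales (use pos_c Lc mu0 in auto)
  have AS: "A = S.A" "q = S.q" by (simp_all add: A_def S.A_def q_def S.q_def)
  let ?b = "b2 c \<mu> bf bg"
  have b0: "0 \<le> ?b"
  proof -
    have "0 \<le> 4 * (1 + S.lo\<^sup>2 / \<mu>\<^sup>2) * bf\<^sup>2 + 16 * S.lo ^ 6 / \<mu> ^ 6 * bg\<^sup>2"
      using S.lo_pos mu0 by (intro add_nonneg_nonneg mult_nonneg_nonneg) auto
    then show ?thesis using S.b2_lower order_trans by blast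
  qed
  have h: "het_bound \<le> 7 * S.D ^ 6 * ?b" unfolding het_bound_def AS by (rule S.het_bound_le)
  have Rb: "R \<le> 14 * S.D ^ 8 * phi c \<mu>"
  proof -
    have "R = 28512 * (S.D ^ 8 * (S.lo ^ 8 / \<mu> ^ 6))"
      by (simp add: R_def AS S.q_def S.A_D power_mult_distrib power_divide eval_nat_numeral mult_ac)
    also have "\<dots> \<le> 14 * S.D ^ 8 * (2048 * S.lo ^ 8 / \<mu> ^ 6)"
    proof -
      have e: "14 * S.D ^ 8 * (2048 * S.lo ^ 8 / \<mu> ^ 6) = 28672 * (S.D ^ 8 * (S.lo ^ 8 / \<mu> ^ 6))" by simp
      have p: "0 \<le> S.D ^ 8 * (S.lo ^ 8 / \<mu> ^ 6)" using S.D_ge1 S.lo_pos mu0 by simp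
      show ?thesis unfolding e by (rule mult_right_mono[OF _ p]) simp
    qed
    also have "\<dots> \<le> 14 * S.D ^ 8 * phi c \<mu>" using S.phi_lower S.D_ge1 by (intro mult_left_mono) auto
    finally show ?thesis .
  qed
  have "R * het_bound \<le> (14 * S.D ^ 8 * phi c \<mu>) * (7 * S.D ^ 6 * ?b)"
    using Rb h S.phi_pos S.D_ge1 weights_nonneg b0 by (intro mult_mono) (auto simp: het_bound_def)
  also have "\<dots> = 98 * (S.D ^ 14 * (phi c \<mu> * ?b))" by (simp add: eval_nat_numeral)
  also have "\<dots> \<le> 168 * (S.D ^ 14 * (phi c \<mu> * ?b))"
    using S.D_ge1 S.phi_pos b0 by (intro mult_right_mono mult_nonneg_nonneg) auto
  finally have 1: "8 * R * het_bound \<le> 1344 * (S.D ^ 14 * (phi c \<mu> * ?b))" by (simp add: mult_ac)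
  have "8 * R * het_bound / (real m * (1 - r)\<^sup>2) \<le> 1344 * (S.D ^ 14 * (phi c \<mu> * ?b)) / (real m * (1 - r)\<^sup>2)"
    by (rule divide_right_mono[OF 1]) simp
  also have "\<dots> = 14 * S.D ^ 14 * (4 * vartheta c \<mu> st r / real m * ?b)"
    using steps1 by (simp add: vartheta_def)
  finally show ?thesis .
qed

end

section \<open>The convergence rate\<close>

text \<open>If the variance argument of the step-size rule is below \<open>u\<close>, then \<open>u\<close> drops out of the minimum.\<close>

lemma Min3_eq_min:
  fixes u s t :: real
  assumes "s \<le> u" shows "Min {u, s, t} = min s t"
  using assms by (simp add: min_def)

context step_constants
begin

text \<open>\<open>\<tau>\<close> meets the condition \<open>64000 * A\<^sup>2 * q ^ 8 * \<tau>\<^sup>2 \<le> 1\<close> of the Lyapunov step, as \<open>300\<^sup>2\<close>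
  exceeds \<open>64000\<close>.\<close>

definition "steps_of = \<lparr>tau = 1 / (300 * A * q ^ 4), c_gamma = 1, c_lambda = 1, c_beta = 1\<rparr>"

text \<open>\<open>14 * D ^ 14\<close> is the loss in comparing the Lyapunov bound with \<open>a0\<close>, \<open>a1\<close>, \<open>a2\<close>; the bracket adds up the
  factors of \<open>sqrt_term_scale\<close> and \<open>cube_root_term_scale\<close>, each doubled by \<open>step_size_balance\<close>.
  It is free of \<open>\<mu>\<close> and of the noise levels.\<close>

definition "rate_const B = 14 * D ^ 14 * (6 * (4 * V0_const B) powr (1/2) * D powr (5/2)
   + 2 * (1235520 * A\<^sup>2) powr (1/3) * (4 * V0_const B) powr (2/3) * D powr (16/3))"

lemma steps_of_simps [simp]:
  "tau steps_of = 1 / (300 * A * q ^ 4)" "c_gamma steps_of = 1" "c_lambda steps_of = 1" "c_beta steps_of = 1"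
  by (simp_all add: steps_of_def)

lemma tau_bounds:
  assumes g: "\<mu> \<le> L_gt c"
  shows "0 < tau steps_of" "tau steps_of < 1" "64000 * A\<^sup>2 * q ^ 8 * (tau steps_of)\<^sup>2 \<le> 1"
proof -
  have "1 * 1 \<le> A * q ^ 4" using c_le_A(8) q_ge1[OF g] by (intro mult_mono one_le_power) auto
  then have "1 < 300 * A * q ^ 4" by simp
  then show "0 < tau steps_of" "tau steps_of < 1" by (simp_all add: divide_less_eq)
  show "64000 * A\<^sup>2 * q ^ 8 * (tau steps_of)\<^sup>2 \<le> 1"
    using A_pos q_pos by (simp add: power_divide power_mult_distrib power_mult[symmetric])
qed

lemma vartheta_upper:
  assumes g: "\<mu> \<le> L_gt c" and r: "\<rho> < 1" and m: "1 \<le> m" and b: "0 \<le> b"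
  shows "4 * vartheta c \<mu> steps_of \<rho> / real m * b \<le> 1235520 * A\<^sup>2 * q ^ 6 * (b / (real m * (1 - \<rho>)\<^sup>2))"
proof -
  have "4 * vartheta c \<mu> steps_of \<rho> / real m * b = 96 * phi c \<mu> * (b / (real m * (1 - \<rho>)\<^sup>2))"
    by (simp add: vartheta_def)
  also have "\<dots> \<le> 96 * (12870 * A\<^sup>2 * q ^ 6) * (b / (real m * (1 - \<rho>)\<^sup>2))"
    using phi_upper[OF g] b by (intro mult_right_mono mult_left_mono) auto
  finally show ?thesis by simp
qed

text \<open>Each requirement on \<open>a\<close> is an upper bound by a positive number that is fixed by the constants, the noise
  levels, \<open>m\<close> and \<open>\<rho>\<close>. For those quadratic in \<open>a\<close>, \<open>a\<^sup>2 \<le> a\<close> is used.\<close>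

lemma small_step_exists:
  assumes g: "\<mu> \<le> L_gt c" and n: "noise_levels n" and m: "1 \<le> (m::nat)" and r: "0 \<le> \<rho>" "\<rho> < 1"
  obtains \<epsilon> where "0 < \<epsilon>" "\<epsilon> \<le> 1 / real m" "\<epsilon> \<le> uu c \<mu> n steps_of \<rho>"
    "\<And>a. 0 < a \<Longrightarrow> a \<le> \<epsilon> \<Longrightarrow> a < 1 \<and> a * A\<^sup>2 \<le> \<mu> \<and> 32 * A * q ^ 3 * tau steps_of * a \<le> 1
        \<and> 4 * (28512 * A\<^sup>2 * q ^ 6) * a\<^sup>2 / (1 - \<rho>)\<^sup>2 \<le> 1 / real m
        \<and> 4 * (28512 * A\<^sup>2 * q ^ 6) * a\<^sup>2 / (1 - \<rho>)\<^sup>2 \<le> d4_hat c \<mu> n steps_of \<rho> / tau steps_of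
        \<and> 28512 * A\<^sup>2 * q ^ 6 * a / (tau steps_of * (1 - \<rho>)) \<le> d5_hat c \<mu> n steps_of \<rho> / tau steps_of
        \<and> a * (4 * (48 * A\<^sup>2 / \<mu>) * (s_gtt n)\<^sup>2 + 8 * (s_gxt n)\<^sup>2) \<le> 12 * A\<^sup>2"
proof -
  note t = tau_bounds[OF g]
  define R where "R = 28512 * A\<^sup>2 * q ^ 6"
  define S where "S = 4 * (48 * A\<^sup>2 / \<mu>) * (s_gtt n)\<^sup>2 + 8 * (s_gxt n)\<^sup>2"
  define d4 where "d4 = d4_hat c \<mu> n steps_of \<rho> / tau steps_of"
  define d5 where "d5 = d5_hat c \<mu> n steps_of \<rho> / tau steps_of"
  have R0: "0 < R" using A_pos q_pos by (simp add: R_def)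
  have S0: "0 < S" using n mu0 A_pos unfolding S_def noise_levels_def by (intro add_nonneg_pos) auto
  have d: "0 < d4" "0 < d5"
    using d4_upper(2)[OF n t(1) steps_of_simps(2) r(2)] d5_upper(2)[OF g n steps_of_simps(1) r(2)] by (simp_all only: d4_def d5_def)
  have r1: "0 < 1 - \<rho>" using r by simp
  define E where "E = {1 / real m, uu c \<mu> n steps_of \<rho>, 1 / 2, \<mu> / A\<^sup>2, 1 / (32 * A * q ^ 3 * tau steps_of),
     (1 / real m) * (1 - \<rho>)\<^sup>2 / (4 * R), d4 * (1 - \<rho>)\<^sup>2 / (4 * R), d5 * (tau steps_of * (1 - \<rho>)) / R, 12 * A\<^sup>2 / S}"
  have fin: "finite E" "E \<noteq> {}" by (auto simp: E_def)
  have Epos: "\<forall>e\<in>E. 0 < e"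
    unfolding E_def using m uu_props(1)[OF n t(1) r(2)] mu0 A_pos q_pos t(1) R0 S0 d r1
    by (simp del: steps_of_simps)
  show thesis
  proof (rule that[of "Min E"])
    show "0 < Min E" using Epos fin by simp
    show "Min E \<le> 1 / real m" "Min E \<le> uu c \<mu> n steps_of \<rho>"
      by (rule Min_le[OF fin(1)], simp add: E_def)+
    fix a assume a: "0 < a" "a \<le> Min E"
    have le: "a \<le> e" if "e \<in> E" for e using a(2) Min_le[OF fin(1) that] by linarith
    have a1: "a < 1" using le[of "1 / 2"] by (simp add: E_def)
    have sq: "4 * R * a\<^sup>2 / (1 - \<rho>)\<^sup>2 \<le> y" if "a \<le> y * (1 - \<rho>)\<^sup>2 / (4 * R)" for y
    proof -
      have "a\<^sup>2 \<le> a" using a a1 by (simp add: power2_eq_square mult_left_le)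
      also have "\<dots> \<le> y * (1 - \<rho>)\<^sup>2 / (4 * R)" by (rule that)
      finally show ?thesis using R0 r1 by (simp add: field_simps)
    qed
    have "a * A\<^sup>2 \<le> \<mu>" using le[of "\<mu> / A\<^sup>2"] A_pos by (simp add: E_def pos_le_divide_eq)
    moreover have "32 * A * q ^ 3 * tau steps_of * a \<le> 1"
    proof -
      have p: "0 < 32 * A * q ^ 3 * tau steps_of" using A_pos q_pos t(1) by (simp del: steps_of_simps)
      have "a \<le> 1 / (32 * A * q ^ 3 * tau steps_of)" by (rule le) (simp add: E_def)
      then show ?thesis using p by (simp only: pos_le_divide_eq mult.commute)
    qed
    moreover have "4 * R * a\<^sup>2 / (1 - \<rho>)\<^sup>2 \<le> 1 / real m" "4 * R * a\<^sup>2 / (1 - \<rho>)\<^sup>2 \<le> d4"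
      by (rule sq, rule le, simp add: E_def)+
    moreover have "R * a / (tau steps_of * (1 - \<rho>)) \<le> d5"
    proof -
      have p: "0 < tau steps_of * (1 - \<rho>)" using t(1) r1 by (intro mult_pos_pos)
      have "a \<le> d5 * (tau steps_of * (1 - \<rho>)) / R" by (rule le) (simp add: E_def)
      then have "R * a \<le> d5 * (tau steps_of * (1 - \<rho>))" using R0 by (simp only: pos_le_divide_eq mult.commute)
      then show ?thesis using p by (simp only: pos_divide_le_eq)
    qed
    moreover have "a * S \<le> 12 * A\<^sup>2"
      using le[of "12 * A\<^sup>2 / S"] S0 by (simp add: E_def pos_le_divide_eq)
    ultimately show "a < 1 \<and> a * A\<^sup>2 \<le> \<mu> \<and> 32 * A * q ^ 3 * tau steps_of * a \<le> 1
        \<and> 4 * (28512 * A\<^sup>2 * q ^ 6) * a\<^sup>2 / (1 - \<rho>)\<^sup>2 \<le> 1 / real m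
        \<and> 4 * (28512 * A\<^sup>2 * q ^ 6) * a\<^sup>2 / (1 - \<rho>)\<^sup>2 \<le> d4_hat c \<mu> n steps_of \<rho> / tau steps_of
        \<and> 28512 * A\<^sup>2 * q ^ 6 * a / (tau steps_of * (1 - \<rho>)) \<le> d5_hat c \<mu> n steps_of \<rho> / tau steps_of
        \<and> a * (4 * (48 * A\<^sup>2 / \<mu>) * (s_gtt n)\<^sup>2 + 8 * (s_gxt n)\<^sup>2) \<le> 12 * A\<^sup>2"
      unfolding R_def S_def d4_def d5_def using a1 by blast
  qed
qed

lemma sigma_LG_pos:
  assumes g: "\<mu> \<le> L_gt c" and n: "noise_levels n" and m: "1 \<le> (m::nat)"
  shows "0 < sigma_p c \<mu> n steps_of + 1 / sqrt (real m) * sigma_c c \<mu> n steps_of"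
    "4 * (sigma_LG_hat c \<mu> n steps_of m)\<^sup>2 = 8 * (sigma_p c \<mu> n steps_of + 1 / sqrt (real m) * sigma_c c \<mu> n steps_of)\<^sup>2"
proof -
  have s: "0 \<le> s_ft n" "0 \<le> s_gtt n" "0 \<le> s_gt n" using n by (auto simp: noise_levels_def)
  have "0 \<le> sigma_p c \<mu> n steps_of"
    using s mu0 PP_pos omega_pos MM_bounds(3) tau_bounds(1)[OF g] unfolding sigma_p_def d1_def d2_def
    by (intro add_nonneg_nonneg mult_nonneg_nonneg real_sqrt_ge_zero divide_nonneg_nonneg) (auto simp del: steps_of_simps(1))
  moreover have "0 < 1 / sqrt (real m) * sigma_c c \<mu> n steps_of"
    using sigma_c_upper(2)[OF n tau_bounds(1)[OF g] steps_of_simps(2)] m by (intro mult_pos_pos) auto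
  ultimately show "0 < sigma_p c \<mu> n steps_of + 1 / sqrt (real m) * sigma_c c \<mu> n steps_of" by linarith
  have "sigma_LG_hat c \<mu> n steps_of m = sqrt 2 * (sigma_p c \<mu> n steps_of + 1 / sqrt (real m) * sigma_c c \<mu> n steps_of)"
    by (simp add: sigma_LG_hat_def distrib_left)
  then show "4 * (sigma_LG_hat c \<mu> n steps_of m)\<^sup>2 = 8 * (sigma_p c \<mu> n steps_of + 1 / sqrt (real m) * sigma_c c \<mu> n steps_of)\<^sup>2"
    by (simp add: power_mult_distrib)
qed

definition "rate n m \<rho> bf bg K = kappa c \<mu> powr (16/3) * (sqrt (b2 c \<mu> bf bg) / sqrt (real m)) powr (2/3) / ((1 - \<rho>) powr (2/3) * real K powr (2/3))
   + 1 / sqrt (real K) * kappa c \<mu> powr (5/2) * (sigma_p c \<mu> n steps_of + 1 / sqrt (real m) * sigma_c c \<mu> n steps_of)"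

lemma V0_const_pos: "0 < B \<Longrightarrow> 0 < V0_const B"
  using A_pos D_ge1 by (simp add: V0_const_def)

lemma rate_const_pos: "0 < B \<Longrightarrow> 0 < rate_const B"
  using V0_const_pos[of B] D_ge1 A_pos unfolding rate_const_def
  by (intro mult_pos_pos add_pos_nonneg) auto

lemma rate_nonneg:
  assumes g: "\<mu> \<le> L_gt c" and n: "noise_levels n" and m: "1 \<le> (m::nat)"
  shows "0 \<le> rate n m \<rho> bf bg K"
proof -
  let ?s = "sigma_p c \<mu> n steps_of + 1 / sqrt (real m) * sigma_c c \<mu> n steps_of"
  have "0 \<le> t * ?s" if "0 \<le> t" for t
    using that sigma_LG_pos(1)[OF g n m] by (intro mult_nonneg_nonneg) auto
  then show ?thesis unfolding rate_def by (intro add_nonneg_nonneg) (auto simp del: times_divide_eq_left)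
qed

lemma balanced_rate:
  fixes bf bg :: real
  assumes g: "\<mu> \<le> L_gt c" and n: "noise_levels n" and m: "1 \<le> (m::nat)" and r: "0 \<le> \<rho>" "\<rho> < 1" and bf: "0 < bf" and B: "0 < B"
    and K: "1 \<le> (K::nat)" and a0: "0 < a0" "a0 \<le> 4 * (V0_const B * q ^ 5)"
  defines "a1 \<equiv> 4 * (sigma_LG_hat c \<mu> n steps_of m)\<^sup>2" and "a2 \<equiv> 4 * vartheta c \<mu> steps_of \<rho> / real m * b2 c \<mu> bf bg"
  defines "a \<equiv> min ((a0 / (a1 * (real K + 1))) powr (1/2)) ((a0 / (a2 * (real K + 1))) powr (1/3))"
  shows "0 < a" "14 * D ^ 14 * (a0 / (a * (real K + 1)) + a1 * a + a2 * a\<^sup>2) \<le> rate_const B * rate n m \<rho> bf bg K"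
proof -
  let ?s = "sigma_p c \<mu> n steps_of + 1 / sqrt (real m) * sigma_c c \<mu> n steps_of"
  let ?X = "4 * V0_const B" and ?Y = "1235520 * A\<^sup>2"
  note sg = sigma_LG_pos[OF g n m]
  have a1: "a1 = 8 * ?s\<^sup>2" "0 < a1" using sg by (simp_all add: a1_def)
  have b: "0 < b2 c \<mu> bf bg" by (rule b2_pos[OF bf])
  have a2: "0 < a2" "a2 \<le> ?Y * q ^ 6 * (b2 c \<mu> bf bg / (real m * (1 - \<rho>)\<^sup>2))"
    using phi_pos r m b vartheta_upper[OF g r(2) m less_imp_le[OF b]] by (simp_all add: a2_def vartheta_def)
  have X: "0 < ?X" using V0_const_pos[OF B] by simp
  have Y: "0 < ?Y" using A_pos by simp
  have a0': "a0 \<le> ?X * q ^ 5" using a0 by simp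
  have kk: "0 < kappa c \<mu>" "0 < q" "q \<le> D * kappa c \<mu>" "0 < D" using kappa_bounds q_pos D_ge1 by auto
  have KK: "0 < real K" "real K \<le> real K + 1" using K by auto
  have mm: "0 < real m" using m by simp
  have K1: "0 < real K + 1" by simp
  note bal = step_size_balance[OF a0(1) a1(2) a2(1) K1]
  show "0 < a" unfolding a_def by (rule bal(1))
  note t1 = sqrt_term_scale[OF X kk KK a0(1) a0' sg(1), folded a1(1)]
  note t2 = cube_root_term_scale[OF X Y kk KK a0(1) a0' b mm r(2) a2]
  let ?T1 = "1 / sqrt (real K) * kappa c \<mu> powr (5/2) * ?s"
  let ?T2 = "kappa c \<mu> powr (16/3) * (sqrt (b2 c \<mu> bf bg) / sqrt (real m)) powr (2/3) / ((1 - \<rho>) powr (2/3) * real K powr (2/3))"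
  let ?c1 = "6 * ?X powr (1/2) * D powr (5/2)" and ?c2 = "2 * ?Y powr (1/3) * ?X powr (2/3) * D powr (16/3)"
  have T: "0 \<le> ?T1" "0 \<le> ?T2" using sg(1) by (auto intro!: mult_nonneg_nonneg divide_nonneg_nonneg)
  have "a0 / (a * (real K + 1)) + a1 * a + a2 * a\<^sup>2 \<le> ?c1 * ?T1 + ?c2 * ?T2"
    using bal(2) t1 t2 unfolding a_def by linarith
  also have "\<dots> \<le> (?c1 + ?c2) * ?T1 + (?c1 + ?c2) * ?T2"
    using T by (intro add_mono mult_right_mono) auto
  also have "\<dots> = (?c1 + ?c2) * rate n m \<rho> bf bg K" by (simp only: rate_def distrib_left add.commute)
  finally have "14 * D ^ 14 * (a0 / (a * (real K + 1)) + a1 * a + a2 * a\<^sup>2) \<le> 14 * D ^ 14 * ((?c1 + ?c2) * rate n m \<rho> bf bg K)"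
    using D_ge1 by (intro mult_left_mono) auto
  then show "14 * D ^ 14 * (a0 / (a * (real K + 1)) + a1 * a + a2 * a\<^sup>2) \<le> rate_const B * rate n m \<rho> bf bg K"
    by (simp only: rate_const_def mult.assoc)
qed

text \<open>\<open>large\<close> says that the variance argument of the step-size rule is at most \<open>\<epsilon>\<close>, since \<open>a0\<close> is at most
  \<open>4 * (V0_const B * q ^ 5)\<close> for all initial data of size \<open>B\<close>.\<close>

lemma run_rate:
  fixes P :: "('x::euclidean_space, 'y::euclidean_space, 's) bilevel"
  assumes g: "\<mu> \<le> L_gt c" and n: "noise_levels n" and B: "0 < B" and r: "0 \<le> \<rho>" "\<rho> < 1"
    and m: "nodes P = m" "1 \<le> m" and net: "network m E W" "rho m W = \<rho>"
    and prob: "bilevel_problem P c Lc \<mu> bf bg" and bf: "0 < bf" and samp: "sampling P n M \<zeta>"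
    and pos: "\<forall>x. 0 \<le> Phi P x" and init: "init_bound P (kappa c \<mu>) B x0 \<theta>0 v0 z0"
    and K: "1 \<le> K"
    and eps: "0 < \<epsilon>" "\<epsilon> \<le> 1 / real m" "\<epsilon> \<le> uu c \<mu> n steps_of \<rho>"
    and small: "\<And>a. 0 < a \<Longrightarrow> a \<le> \<epsilon> \<Longrightarrow> a < 1 \<and> a * A\<^sup>2 \<le> \<mu> \<and> 32 * A * q ^ 3 * tau steps_of * a \<le> 1
        \<and> 4 * (28512 * A\<^sup>2 * q ^ 6) * a\<^sup>2 / (1 - \<rho>)\<^sup>2 \<le> 1 / real m
        \<and> 4 * (28512 * A\<^sup>2 * q ^ 6) * a\<^sup>2 / (1 - \<rho>)\<^sup>2 \<le> d4_hat c \<mu> n steps_of \<rho> / tau steps_of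
        \<and> 28512 * A\<^sup>2 * q ^ 6 * a / (tau steps_of * (1 - \<rho>)) \<le> d5_hat c \<mu> n steps_of \<rho> / tau steps_of
        \<and> a * (4 * (48 * A\<^sup>2 / \<mu>) * (s_gtt n)\<^sup>2 + 8 * (s_gxt n)\<^sup>2) \<le> 12 * A\<^sup>2"
    and large: "4 * (V0_const B * q ^ 5) \<le> \<epsilon>\<^sup>2 * (4 * (sigma_LG_hat c \<mu> n steps_of m)\<^sup>2) * (real K + 1)"
  defines "al \<equiv> alpha P c \<mu> n steps_of \<rho> bf bg x0 \<theta>0 v0 z0 K"
  shows "al \<le> 1 / real m"
    and "lopa_lg P E W M \<zeta> steps_of al x0 \<theta>0 v0 z0 x \<theta> v y z \<Longrightarrow>
      integrable M (\<lambda>\<omega>. (norm (grad (Phi P) (node_avg m (\<lambda>i. x i k \<omega>))))\<^sup>2)"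
    and "lopa_lg P E W M \<zeta> steps_of al x0 \<theta>0 v0 z0 x \<theta> v y z \<Longrightarrow>
      1 / (real K + 1) * (\<Sum>k=0..K. \<integral>\<omega>. (norm (grad (Phi P) (node_avg m (\<lambda>i. x i k \<omega>))))\<^sup>2 \<partial>M)
        \<le> rate_const B * rate n m \<rho> bf bg K"
proof -
  interpret Q: bilevel_problem P c Lc \<mu> bf bg by (rule prob)
  have Qm: "Q.m = m" by (simp add: Q.m_def m)
  have AS: "Q.A = A" "Q.q = q" by (simp_all add: Q.A_def A_def Q.q_def q_def)
  note t = tau_bounds[OF g]
  let ?V = "V0_hat P c \<mu> n steps_of \<rho> x0 \<theta>0 v0 z0"
  define a0 where "a0 = 4 * ?V"
  define a1 where "a1 = 4 * (sigma_LG_hat c \<mu> n steps_of m)\<^sup>2"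
  define a2 where "a2 = 4 * vartheta c \<mu> steps_of \<rho> / real m * b2 c \<mu> bf bg"
  define s where "s = (a0 / (a1 * (real K + 1))) powr (1/2)"
  define w where "w = (a0 / (a2 * (real K + 1))) powr (1/3)"
  have gavg: "grad (Phi P) (node_avg m x0) = node_avg m (\<lambda>i. grad (Phi_i P i) (node_avg m x0))"
    using Q.gPhi_eq[of "node_avg m x0"] by (simp only: Q.gPhi_def Q.gP_def Qm)
  note Veq = V0_hat_eq[OF t(1) steps_of_simps(2-4) m(1), of n \<rho> x0 \<theta>0 v0 z0]
  note du = d4_upper(2)[OF n t(1) steps_of_simps(2) r(2)] d5_upper(2)[OF g n steps_of_simps(1) r(2)]
  have V_ge: "0 \<le> ?V" "Phi P (node_avg m x0) / tau steps_of \<le> ?V"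
  proof -
    have p0: "0 \<le> Phi P (node_avg m x0) / tau steps_of"
      using pos t(1) by (simp del: steps_of_simps(1))
    have "Phi P (node_avg m x0) / tau steps_of + 0 + 0 + 0 + 0 + 0 \<le> ?V"
      unfolding Veq using du mu0 PP_pos omega_pos
      by (intro add_mono order_refl mult_nonneg_nonneg node_avg_nonneg) (auto simp del: steps_of_simps(1) intro: less_imp_le divide_nonneg_nonneg)
    then show "Phi P (node_avg m x0) / tau steps_of \<le> ?V" by simp
    then show "0 \<le> ?V" using p0 by linarith
  qed
  have a0: "0 \<le> a0" "a0 \<le> 4 * (V0_const B * q ^ 5)"
    using V_ge(1) V0_hat_upper[OF g n r(2) B steps_of_simps m init gavg] by (simp_all add: a0_def)
  have a1: "0 < a1" using sigma_LG_pos[OF g n m(2)] by (simp add: a1_def)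
  have se: "s \<le> \<epsilon>"
  proof -
    have "a0 / (a1 * (real K + 1)) \<le> \<epsilon>\<^sup>2"
    proof -
      have "a0 \<le> \<epsilon>\<^sup>2 * (a1 * (real K + 1))" using a0(2) large unfolding a1_def by (simp only: mult.assoc)
      then show ?thesis using a1 by (subst pos_divide_le_eq) (auto intro: mult_pos_pos)
    qed
    then have "s \<le> (\<epsilon>\<^sup>2) powr (1/2)" unfolding s_def using a0(1) a1 by (intro powr_mono2) auto
    also have "\<dots> = \<epsilon>" using eps(1) by (simp add: powr_half_sqrt)
    finally show ?thesis .
  qed
  have al: "al = min s w"
    unfolding al_def alpha_def step_size_def m a0_def[symmetric] a1_def[symmetric] a2_def[symmetric] s_def[symmetric] w_def[symmetric]
    by (rule Min3_eq_min) (use se eps in linarith)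
  have al_eps: "al \<le> \<epsilon>" using se by (simp add: al)
  then show "al \<le> 1 / real m" using eps(2) by linarith
  interpret M: prob_space M using samp by (simp add: sampling_def)
  have pred: "integrable M (\<lambda>\<omega>. (norm (grad (Phi P) (node_avg m (\<lambda>i. x i k \<omega>))))\<^sup>2) \<and>
     1 / (real K + 1) * (\<Sum>k=0..K. \<integral>\<omega>. (norm (grad (Phi P) (node_avg m (\<lambda>i. x i k \<omega>))))\<^sup>2 \<partial>M)
        \<le> rate_const B * rate n m \<rho> bf bg K"
    if run: "lopa_lg P E W M \<zeta> steps_of al x0 \<theta>0 v0 z0 x \<theta> v y z" for k
  proof (cases "a0 = 0")
    case True
    \<comment> \<open>The average rests at its starting point, where the nonnegative objective vanishes, and hence
      so does its gradient.\<close>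
    have al0: "al = 0" using True by (simp add: al s_def w_def)
    have "Phi P (node_avg m x0) / tau steps_of \<le> 0" using V_ge(2) True by (simp add: a0_def)
    then have "Phi P (node_avg m x0) \<le> 0" using t(1) by (simp add: divide_le_0_iff del: steps_of_simps(1))
    then have min: "\<forall>y\<in>UNIV. Phi P (node_avg m x0) \<le> Phi P y" using pos order_trans by blast
    have "(\<lambda>h. inner h (Q.gPhi (node_avg m x0))) = (\<lambda>v. 0)"
      by (rule differential_zero_maxmin[OF UNIV_I open_UNIV Q.Phi_GDERIV[unfolded gderiv_def, folded Q.gPhi_eq]])
        (use min in blast)
    then have g0: "grad (Phi P) (node_avg m x0) = 0" unfolding Q.gPhi_def by (metis inner_eq_zero_iff)
    have z: "(norm (grad (Phi P) (node_avg m (\<lambda>i. x i k \<omega>))))\<^sup>2 = 0" if "\<omega> \<in> space M" for \<omega> k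
    proof -
      have "node_avg m (\<lambda>i. x i k \<omega>) = node_avg m x0"
        by (rule vanishing_step[OF net(1)[folded m(1)] m _ r t(1,2) that run[unfolded al0]]) (simp add: net(2))
      then show ?thesis using g0 by simp
    qed
    have i: "integrable M (\<lambda>\<omega>. (norm (grad (Phi P) (node_avg m (\<lambda>i. x i k \<omega>))))\<^sup>2)"
    proof -
      have "integrable M (\<lambda>\<omega>. (norm (grad (Phi P) (node_avg m (\<lambda>i. x i k \<omega>))))\<^sup>2) \<longleftrightarrow> integrable M (\<lambda>\<omega>. 0 :: real)"
        by (rule Bochner_Integration.integrable_cong[OF refl z])
      then show ?thesis by simp
    qed
    have "(\<integral>\<omega>. (norm (grad (Phi P) (node_avg m (\<lambda>i. x i k \<omega>))))\<^sup>2 \<partial>M) = (\<integral>\<omega>. 0 \<partial>M)" for k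
      by (rule Bochner_Integration.integral_cong[OF refl z])
    moreover have "0 \<le> rate_const B * rate n m \<rho> bf bg K"
      by (intro mult_nonneg_nonneg rate_nonneg[OF g n m(2)] less_imp_le[OF rate_const_pos[OF B]])
    ultimately show ?thesis using i by simp
  next
    case False
    \<comment> \<open>Now \<open>\<alpha> > 0\<close>, and the three terms of the telescoped bound are compared with \<open>a0\<close>, \<open>a1\<close>
      and \<open>a2\<close>.\<close>
    then have a0p: "0 < a0" using a0(1) by simp
    note bal = balanced_rate[OF g n m(2) r bf B K a0p a0(2), where bg = bg, folded a1_def a2_def, folded s_def w_def, folded al]
    have sm: "al < 1" "al * A\<^sup>2 \<le> \<mu>" "32 * A * q ^ 3 * tau steps_of * al \<le> 1"
      "4 * (28512 * A\<^sup>2 * q ^ 6) * al\<^sup>2 / (1 - \<rho>)\<^sup>2 \<le> 1 / real m"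
      "4 * (28512 * A\<^sup>2 * q ^ 6) * al\<^sup>2 / (1 - \<rho>)\<^sup>2 \<le> d4_hat c \<mu> n steps_of \<rho> / tau steps_of"
      "28512 * A\<^sup>2 * q ^ 6 * al / (tau steps_of * (1 - \<rho>)) \<le> d5_hat c \<mu> n steps_of \<rho> / tau steps_of"
      "al * (4 * (48 * A\<^sup>2 / \<mu>) * (s_gtt n)\<^sup>2 + 8 * (s_gxt n)\<^sup>2) \<le> 12 * A\<^sup>2"
      using small[OF bal(1) al_eps] by blast+
    interpret L: lopa_run P c Lc \<mu> bf bg E W \<rho> M \<zeta> n steps_of al x0 \<theta>0 v0 z0 x \<theta> v y z
      by unfold_locales (use net r samp run t bal(1) sm(1,2) in \<open>simp_all add: m A_def del: steps_of_simps(1)\<close>)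
    have W: "L.w4 \<le> 1 / real Q.m" "L.w4 \<le> d4_hat c \<mu> n steps_of \<rho> / tau steps_of"
      "L.w5 \<le> d5_hat c \<mu> n steps_of \<rho> / tau steps_of" "al * (4 * L.w1 * (s_gtt n)\<^sup>2 + 8 * (s_gxt n)\<^sup>2) \<le> 12 * Q.A\<^sup>2"
      unfolding L.w4_def L.w5_def L.w1_def L.R_def AS Qm by (rule sm(4) sm(5) sm(6) sm(7))+
    have T: "32 * Q.A * Q.q ^ 3 * tau steps_of * al \<le> 1" "64000 * Q.A\<^sup>2 * Q.q ^ 8 * (tau steps_of)\<^sup>2 \<le> 1"
      unfolding AS by (rule sm(3) t(3))+
    have xbg: "Q.gPhi (L.xb k \<omega>) = grad (Phi P) (node_avg m (\<lambda>i. x i k \<omega>))" for k \<omega>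
      by (simp add: Q.gPhi_def L.xb_def Qm)
    have i: "integrable M (\<lambda>\<omega>. (norm (grad (Phi P) (node_avg m (\<lambda>i. x i k \<omega>))))\<^sup>2)"
      using M.sqi_integrable[OF L.gPhi_sqi[OF L.xb_sqi]] by (simp only: xbg)
    have "1 / (real K + 1) * (\<Sum>k=0..K. L.EG k) \<le> 2 * L.lyap 0 / (al * (real K + 1)) + 2 * al * L.noise_floor
       + 8 * L.R * al\<^sup>2 * Q.het_bound / (real Q.m * (1 - \<rho>)\<^sup>2)"
      by (rule L.lyap_telescope[OF pos T W(1,4)])
    also have "\<dots> \<le> 14 * D ^ 14 * (a0 / (al * (real K + 1))) + 14 * D ^ 14 * (a1 * al) + 14 * D ^ 14 * (a2 * al\<^sup>2)"
    proof (intro add_mono)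
      have D614: "D ^ 6 \<le> D ^ 14" using D_ge1 by (intro power_increasing) auto
      have "2 * L.lyap 0 \<le> 2 * (14 * D ^ 6 * ?V)" using L.lyap_0_le[OF pos W(2,3)] by simp
      also have "\<dots> = 7 * D ^ 6 * a0" by (simp add: a0_def)
      also have "\<dots> \<le> 14 * D ^ 14 * a0" using D614 a0(1) D_ge1 by (intro mult_right_mono mult_mono) auto
      finally have "2 * L.lyap 0 / (al * (real K + 1)) \<le> 14 * D ^ 14 * a0 / (al * (real K + 1))"
        using bal(1) by (intro divide_right_mono) auto
      then show "2 * L.lyap 0 / (al * (real K + 1)) \<le> 14 * D ^ 14 * (a0 / (al * (real K + 1)))" by simp
      have "2 * L.noise_floor \<le> 2 * (14 * D ^ 6 * (sigma_LG_hat c \<mu> n steps_of m)\<^sup>2)"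
        using L.noise_floor_le[OF n] by (simp add: Qm)
      also have "\<dots> = 7 * D ^ 6 * a1" by (simp add: a1_def)
      also have "\<dots> \<le> 14 * D ^ 14 * a1" using D614 a1 D_ge1 by (intro mult_right_mono mult_mono) auto
      finally have "al * (2 * L.noise_floor) \<le> al * (14 * D ^ 14 * a1)"
        using bal(1) by (intro mult_left_mono) auto
      then show "2 * al * L.noise_floor \<le> 14 * D ^ 14 * (a1 * al)" by (simp only: mult_ac)
      have "8 * L.R * Q.het_bound / (real m * (1 - \<rho>)\<^sup>2) * al\<^sup>2 \<le> 14 * D ^ 14 * a2 * al\<^sup>2"
        using L.het_term_le unfolding a2_def Qm by (intro mult_right_mono) auto
      then show "8 * L.R * al\<^sup>2 * Q.het_bound / (real Q.m * (1 - \<rho>)\<^sup>2) \<le> 14 * D ^ 14 * (a2 * al\<^sup>2)"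
        unfolding Qm by (simp add: mult_ac)
    qed
    also have "\<dots> = 14 * D ^ 14 * (a0 / (al * (real K + 1)) + a1 * al + a2 * al\<^sup>2)" by (simp only: distrib_left)
    also have "\<dots> \<le> rate_const B * rate n m \<rho> bf bg K" by (rule bal(2))
    finally have "1 / (real K + 1) * (\<Sum>k=0..K. L.EG k) \<le> rate_const B * rate n m \<rho> bf bg K" .
    then show ?thesis using i unfolding L.EG_def xbg by blast
  qed
  show "lopa_lg P E W M \<zeta> steps_of al x0 \<theta>0 v0 z0 x \<theta> v y z \<Longrightarrow>
      integrable M (\<lambda>\<omega>. (norm (grad (Phi P) (node_avg m (\<lambda>i. x i k \<omega>))))\<^sup>2)"
    using pred by blast
  show "lopa_lg P E W M \<zeta> steps_of al x0 \<theta>0 v0 z0 x \<theta> v y z \<Longrightarrow>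
      1 / (real K + 1) * (\<Sum>k=0..K. \<integral>\<omega>. (norm (grad (Phi P) (node_avg m (\<lambda>i. x i k \<omega>))))\<^sup>2 \<partial>M)
        \<le> rate_const B * rate n m \<rho> bf bg K"
    using pred by blast
qed

end


theorem corollary7:
  fixes c :: fun_consts and Lc B :: real
  assumes "positive_consts c" and "Lc > 0" and "B > 0"
  shows "\<exists>C>0. \<forall>\<mu> n. \<mu> > 0 \<longrightarrow> noise_levels n \<longrightarrow>
    (\<exists>st. 0 < tau st \<and> tau st < 1 \<and> c_gamma st > 0 \<and> c_lambda st > 0 \<and> c_beta st > 0 \<and>
      sigma_p c \<mu> n st \<le> C * (kappa c \<mu> powr (1/2) * s_ft n + kappa c \<mu> powr (3/2) * s_gtt n +
                             kappa c \<mu> powr (5/2) * s_gt n) \<and>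
      sigma_c c \<mu> n st \<le> C * (s_fx n + kappa c \<mu> * s_gxt n) \<and>
      (\<forall>(m::nat) \<rho>. m \<ge> 1 \<longrightarrow> 0 \<le> \<rho> \<longrightarrow> \<rho> < 1 \<longrightarrow>
        (\<exists>K0\<ge>1.
          \<forall>(P :: (real ^ 'n, real ^ 'p, 's) bilevel) E W bf bg (M :: 'w measure) \<zeta> x0 \<theta>0 v0 z0.
            nodes P = m \<longrightarrow> well_formed P \<longrightarrow>
            network m E W \<longrightarrow> rho m W = \<rho> \<longrightarrow>
            outer_assumption P c \<longrightarrow> cross_lipschitz P Lc \<longrightarrow>
            inner_assumption P c \<mu> \<longrightarrow>
            bf > 0 \<longrightarrow> bg > 0 \<longrightarrow> heterogeneity P bf bg \<longrightarrow>
            sampling P n M \<zeta> \<longrightarrow>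
            (\<forall>x. 0 \<le> Phi P x) \<longrightarrow>
            init_bound P (kappa c \<mu>) B x0 \<theta>0 v0 z0 \<longrightarrow>
            (\<forall>K\<ge>K0.
              alpha P c \<mu> n st \<rho> bf bg x0 \<theta>0 v0 z0 K \<le> 1 / real m \<and>
              (\<forall>x \<theta> v y z.
                lopa_lg P E W M \<zeta> st (alpha P c \<mu> n st \<rho> bf bg x0 \<theta>0 v0 z0 K)
                  x0 \<theta>0 v0 z0 x \<theta> v y z \<longrightarrow>
                (\<forall>k\<le>K. integrable M
                   (\<lambda>\<omega>. (norm (grad (Phi P) (node_avg m (\<lambda>i. x i k \<omega>))))\<^sup>2)) \<and>
                1 / (real K + 1) * (\<Sum>k=0..K.
                   \<integral>\<omega>. (norm (grad (Phi P) (node_avg m (\<lambda>i. x i k \<omega>))))\<^sup>2 \<partial>M)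
                \<le> C * (kappa c \<mu> ^ 8 / ((1 - \<rho>) * real K) +
                        kappa c \<mu> powr (16/3) * (sqrt (b2 c \<mu> bf bg) / sqrt (real m)) powr (2/3) /
                          ((1 - \<rho>) powr (2/3) * real K powr (2/3)) +
                        1 / sqrt (real K) * kappa c \<mu> powr (5/2) *
                          (sigma_p c \<mu> n st + 1 / sqrt (real m) * sigma_c c \<mu> n st)))))))"
proof -
  define D where "D = step_constants.D c Lc"
  define A where "A = step_constants.A c Lc"
  define R where "R = step_constants.rate_const c Lc B"
  define C where "C = R + 2 * D + 30 * sqrt A * D ^ 3"
  have SC: "step_constants c Lc \<mu>" if "\<mu> > 0" for \<mu>
    using assms that by unfold_locales
  \<comment> \<open>\<open>A\<close>, \<open>D\<close> and \<open>rate_const\<close> do not depend on \<open>\<mu>\<close>, so their signs can be read off at \<open>\<mu> = 1\<close>.\<close>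
  interpret one: step_constants c Lc 1 by (rule SC) simp
  have pos: "0 < R" "0 \<le> 2 * D" "0 \<le> 30 * sqrt A * D ^ 3"
    using one.rate_const_pos[OF assms(3)] one.D_ge1 one.A_pos by (simp_all add: R_def D_def A_def)
  then have C: "0 < C" "R \<le> C" "2 * D \<le> C" "30 * sqrt A * D ^ 3 \<le> C" by (simp_all add: C_def)
  show ?thesis
  proof (intro exI[of _ C] conjI C(1) allI impI)
    fix \<mu> :: real and n assume mu: "\<mu> > 0" and n: "noise_levels n"
    interpret S: step_constants c Lc \<mu> by (rule SC) (rule mu)
    have nn: "0 \<le> s_ft n" "0 \<le> s_gtt n" "0 \<le> s_gt n" "0 \<le> s_fx n" "0 \<le> s_gxt n"
      using n by (auto simp: noise_levels_def)
    have sp: "sigma_p c \<mu> n st \<le> C * (kappa c \<mu> powr (1/2) * s_ft n + kappa c \<mu> powr (3/2) * s_gtt n +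
                             kappa c \<mu> powr (5/2) * s_gt n)"
      if "0 < tau st" "c_lambda st = 1" "0 < c_beta st" "PP c \<mu> / omega_t c \<mu> * c_beta st \<le> 792 * S.A * S.q ^ 5" for st
      using S.sigma_p_upper[OF n that, folded A_def D_def]
      by (rule order_trans) (use C(4) nn in \<open>intro mult_right_mono add_nonneg_nonneg mult_nonneg_nonneg; simp\<close>)
    have sc: "sigma_c c \<mu> n st \<le> C * (s_fx n + kappa c \<mu> * s_gxt n)" if "0 < tau st" "c_gamma st = 1" for st
      using S.sigma_c_upper(1)[OF n that, folded D_def]
      by (rule order_trans) (use C(3) nn S.kappa_bounds(4) in \<open>intro mult_right_mono add_nonneg_nonneg mult_nonneg_nonneg; simp\<close>)
    consider (lt) "L_gt c < \<mu>" | (le) "\<mu> \<le> L_gt c" by linarith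
    then show "\<exists>st. 0 < tau st \<and> tau st < 1 \<and> c_gamma st > 0 \<and> c_lambda st > 0 \<and> c_beta st > 0 \<and>
      sigma_p c \<mu> n st \<le> C * (kappa c \<mu> powr (1/2) * s_ft n + kappa c \<mu> powr (3/2) * s_gtt n +
                             kappa c \<mu> powr (5/2) * s_gt n) \<and>
      sigma_c c \<mu> n st \<le> C * (s_fx n + kappa c \<mu> * s_gxt n) \<and>
      (\<forall>(m::nat) \<rho>. m \<ge> 1 \<longrightarrow> 0 \<le> \<rho> \<longrightarrow> \<rho> < 1 \<longrightarrow>
        (\<exists>K0\<ge>1.
          \<forall>(P :: (real ^ 'n, real ^ 'p, 's) bilevel) E W bf bg (M :: 'w measure) \<zeta> x0 \<theta>0 v0 z0.
            nodes P = m \<longrightarrow> well_formed P \<longrightarrow>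
            network m E W \<longrightarrow> rho m W = \<rho> \<longrightarrow>
            outer_assumption P c \<longrightarrow> cross_lipschitz P Lc \<longrightarrow>
            inner_assumption P c \<mu> \<longrightarrow>
            bf > 0 \<longrightarrow> bg > 0 \<longrightarrow> heterogeneity P bf bg \<longrightarrow>
            sampling P n M \<zeta> \<longrightarrow>
            (\<forall>x. 0 \<le> Phi P x) \<longrightarrow>
            init_bound P (kappa c \<mu>) B x0 \<theta>0 v0 z0 \<longrightarrow>
            (\<forall>K\<ge>K0.
              alpha P c \<mu> n st \<rho> bf bg x0 \<theta>0 v0 z0 K \<le> 1 / real m \<and>
              (\<forall>x \<theta> v y z.
                lopa_lg P E W M \<zeta> st (alpha P c \<mu> n st \<rho> bf bg x0 \<theta>0 v0 z0 K)
                  x0 \<theta>0 v0 z0 x \<theta> v y z \<longrightarrow>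
                (\<forall>k\<le>K. integrable M
                   (\<lambda>\<omega>. (norm (grad (Phi P) (node_avg m (\<lambda>i. x i k \<omega>))))\<^sup>2)) \<and>
                1 / (real K + 1) * (\<Sum>k=0..K.
                   \<integral>\<omega>. (norm (grad (Phi P) (node_avg m (\<lambda>i. x i k \<omega>))))\<^sup>2 \<partial>M)
                \<le> C * (kappa c \<mu> ^ 8 / ((1 - \<rho>) * real K) +
                        kappa c \<mu> powr (16/3) * (sqrt (b2 c \<mu> bf bg) / sqrt (real m)) powr (2/3) /
                          ((1 - \<rho>) powr (2/3) * real K powr (2/3)) +
                        1 / sqrt (real K) * kappa c \<mu> powr (5/2) *
                          (sigma_p c \<mu> n st + 1 / sqrt (real m) * sigma_c c \<mu> n st))))))"
    proof cases
      case lt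
      \<comment> \<open>No problem has such a \<open>\<mu>\<close>; only the bounds on the variances have to be met, and a \<open>c_beta\<close> adapted
        to \<open>\<mu>\<close> does this.\<close>
      define st where "st = \<lparr>tau = 1 / 2, c_gamma = 1, c_lambda = 1, c_beta = 792 * S.A * S.q ^ 5 * omega_t c \<mu> / PP c \<mu>\<rparr>"
      have st: "tau st = 1 / 2" "c_gamma st = 1" "c_lambda st = 1" "0 < c_beta st"
        "PP c \<mu> / omega_t c \<mu> * c_beta st \<le> 792 * S.A * S.q ^ 5"
        using S.A_pos S.q_pos S.omega_pos S.PP_pos by (simp_all add: st_def)
      have vac: False if "nodes P = m" "1 \<le> m" "inner_assumption P c \<mu>" for m and P :: "(real ^ 'n, real ^ 'p, 's) bilevel"
        using inner_assumption_mu_le[of P c \<mu>] that lt by simp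
      show ?thesis
        by (rule exI[of _ st], intro conjI sp sc allI impI exI[of _ "1 :: nat"]) (use st vac in \<open>auto\<close>)
    next
      case le
      note t = S.tau_bounds[OF le]
      have cb: "PP c \<mu> / omega_t c \<mu> * c_beta S.steps_of \<le> 792 * S.A * S.q ^ 5"
        using S.PP_omega_upper[OF le] by simp
      have run: "\<exists>K0\<ge>1.
          \<forall>(P :: (real ^ 'n, real ^ 'p, 's) bilevel) E W bf bg (M :: 'w measure) \<zeta> x0 \<theta>0 v0 z0.
            nodes P = m \<longrightarrow> well_formed P \<longrightarrow>
            network m E W \<longrightarrow> rho m W = \<rho> \<longrightarrow>
            outer_assumption P c \<longrightarrow> cross_lipschitz P Lc \<longrightarrow>
            inner_assumption P c \<mu> \<longrightarrow>
            bf > 0 \<longrightarrow> bg > 0 \<longrightarrow> heterogeneity P bf bg \<longrightarrow>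
            sampling P n M \<zeta> \<longrightarrow>
            (\<forall>x. 0 \<le> Phi P x) \<longrightarrow>
            init_bound P (kappa c \<mu>) B x0 \<theta>0 v0 z0 \<longrightarrow>
            (\<forall>K\<ge>K0.
              alpha P c \<mu> n S.steps_of \<rho> bf bg x0 \<theta>0 v0 z0 K \<le> 1 / real m \<and>
              (\<forall>x \<theta> v y z.
                lopa_lg P E W M \<zeta> S.steps_of (alpha P c \<mu> n S.steps_of \<rho> bf bg x0 \<theta>0 v0 z0 K)
                  x0 \<theta>0 v0 z0 x \<theta> v y z \<longrightarrow>
                (\<forall>k\<le>K. integrable M
                   (\<lambda>\<omega>. (norm (grad (Phi P) (node_avg m (\<lambda>i. x i k \<omega>))))\<^sup>2)) \<and>
                1 / (real K + 1) * (\<Sum>k=0..K.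
                   \<integral>\<omega>. (norm (grad (Phi P) (node_avg m (\<lambda>i. x i k \<omega>))))\<^sup>2 \<partial>M)
                \<le> C * (kappa c \<mu> ^ 8 / ((1 - \<rho>) * real K) +
                        kappa c \<mu> powr (16/3) * (sqrt (b2 c \<mu> bf bg) / sqrt (real m)) powr (2/3) /
                          ((1 - \<rho>) powr (2/3) * real K powr (2/3)) +
                        1 / sqrt (real K) * kappa c \<mu> powr (5/2) *
                          (sigma_p c \<mu> n S.steps_of + 1 / sqrt (real m) * sigma_c c \<mu> n S.steps_of))))"
        if m: "m \<ge> 1" and r: "0 \<le> \<rho>" "\<rho> < 1" for m :: nat and \<rho> :: real
      proof -
        obtain \<epsilon> where eps: "0 < \<epsilon>" "\<epsilon> \<le> 1 / real m" "\<epsilon> \<le> uu c \<mu> n S.steps_of \<rho>"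
          and small: "\<And>a. 0 < a \<Longrightarrow> a \<le> \<epsilon> \<Longrightarrow> a < 1 \<and> a * S.A\<^sup>2 \<le> \<mu> \<and> 32 * S.A * S.q ^ 3 * tau S.steps_of * a \<le> 1
            \<and> 4 * (28512 * S.A\<^sup>2 * S.q ^ 6) * a\<^sup>2 / (1 - \<rho>)\<^sup>2 \<le> 1 / real m
            \<and> 4 * (28512 * S.A\<^sup>2 * S.q ^ 6) * a\<^sup>2 / (1 - \<rho>)\<^sup>2 \<le> d4_hat c \<mu> n S.steps_of \<rho> / tau S.steps_of
            \<and> 28512 * S.A\<^sup>2 * S.q ^ 6 * a / (tau S.steps_of * (1 - \<rho>)) \<le> d5_hat c \<mu> n S.steps_of \<rho> / tau S.steps_of
            \<and> a * (4 * (48 * S.A\<^sup>2 / \<mu>) * (s_gtt n)\<^sup>2 + 8 * (s_gxt n)\<^sup>2) \<le> 12 * S.A\<^sup>2"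
          using S.small_step_exists[OF le n m r] by blast
        define e where "e = \<epsilon>\<^sup>2 * (4 * (sigma_LG_hat c \<mu> n S.steps_of m)\<^sup>2)"
        have e: "0 < e" using eps(1) S.sigma_LG_pos[OF le n m] by (simp add: e_def)
        \<comment> \<open>The threshold that brings the variance argument below \<open>\<epsilon>\<close>.\<close>
        obtain K1 :: nat where K1: "4 * (S.V0_const B * S.q ^ 5) / e < real K1" using reals_Archimedean2 by blast
        have large: "4 * (S.V0_const B * S.q ^ 5) \<le> \<epsilon>\<^sup>2 * (4 * (sigma_LG_hat c \<mu> n S.steps_of m)\<^sup>2) * (real K + 1)"
          if "max 1 K1 \<le> K" for K
        proof -
          have "4 * (S.V0_const B * S.q ^ 5) \<le> e * real K1" using K1 e by (simp add: pos_divide_less_eq mult.commute)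
          also have "\<dots> \<le> e * (real K + 1)" using e that by (intro mult_left_mono) auto
          finally show ?thesis by (simp only: e_def)
        qed
        show ?thesis
        proof (rule exI[of _ "max 1 K1"], intro conjI allI impI, goal_cases)
          case 1 show ?case by simp
        next
          case (2 P E W bf bg M \<zeta> x0 \<theta>0 v0 z0 K)
          note a = 2
          have K: "1 \<le> K" using a by simp
          have prob: "bilevel_problem P c Lc \<mu> bf bg" by unfold_locales (use assms mu m a in auto)
          show ?case
            by (rule S.run_rate(1)[OF le n assms(3) r a(1) m a(3,4) prob a(8) a(11-13) K eps small large[OF a(14)]])
        next
          case (3 P E W bf bg M \<zeta> x0 \<theta>0 v0 z0 K x \<theta> v y z k)
          note a = 3
          have K: "1 \<le> K" using a by simp
          have prob: "bilevel_problem P c Lc \<mu> bf bg" by unfold_locales (use assms mu m a in auto)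
          show ?case
            by (rule S.run_rate(2)[OF le n assms(3) r a(1) m a(3,4) prob a(8) a(11-13) K eps small large[OF a(14)] a(15)])
        next
          case (4 P E W bf bg M \<zeta> x0 \<theta>0 v0 z0 K x \<theta> v y z)
          note a = 4
          have K: "1 \<le> K" using a by simp
          have prob: "bilevel_problem P c Lc \<mu> bf bg" by unfold_locales (use assms mu m a in auto)
          let ?rate = "S.rate n m \<rho> bf bg K"
          let ?avg = "1 / (real K + 1) * (\<Sum>k=0..K. \<integral>\<omega>. (norm (grad (Phi P) (node_avg m (\<lambda>i. x i k \<omega>))))\<^sup>2 \<partial>M)"
          have "?avg \<le> R * ?rate"
            unfolding R_def
            by (rule S.run_rate(3)[OF le n assms(3) r a(1) m a(3,4) prob a(8) a(11-13) K eps small large[OF a(14)] a(15)])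
          also have "\<dots> \<le> C * ?rate" using C(2) S.rate_nonneg[OF le n m] by (rule mult_right_mono)
          also have "\<dots> \<le> C * (kappa c \<mu> ^ 8 / ((1 - \<rho>) * real K) + ?rate)"
            using C(1) r S.kappa_bounds(4) by (intro mult_left_mono) auto
          finally show ?case unfolding S.rate_def by (simp only: add.assoc)
        qed
      qed
      show ?thesis
        by (rule exI[of _ S.steps_of], intro conjI sp sc cb t(1,2) allI impI run) simp_all
    qed
  qed
qed

end
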